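(* Let $k$ be a positive integer. Then $\overline{a}(n)$ is almost always divisible by $2^k$, namely, $$\lim_{X\to\infty}\frac{\#\left\{n\le X:\ \overline{a}(n)\equiv 0\pmod{2^k}\right\}}{X}=1,$$ where $\overline{a}(n)$ denotes the number of overcubic partitions of $n$, i.e. the coefficients defined by $\sum_{n=0}^{\infty}\overline{a}(n)q^n=\dfrac{(-q;q)_\infty\,(-q^2;q^2)_\infty}{(q;q)_\infty\,(q^2;q^2)_\infty}$.
   Context: For $|q|<1$, $(a;q)_\infty:=\prod_{n\ge 0}(1-aq^n)$; thus, for a positive integer $j$, $(q^j;q^j)_\infty=\prod_{n\ge 1}(1-q^{jn})$ and $(-q^j;q^j)_\infty=\prod_{n\ge 1}(1+q^{jn})$. The integers $\overline{a}(n)$, $n\ge 0$, are the coefficients of the power series $\sum_{n=0}^{\infty}\overline{a}(n)q^n=\frac{(-q;q)_\infty(-q^2;q^2)_\infty}{(q;q)_\infty(q^2;q^2)_\infty}$. In the counting set, $n$ ranges over non-negative integers. *)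

theory Defs
  imports "HOL-Analysis.Analysis" "HOL-Number_Theory.Cong"
begin

text \<open>
  Stated for any topological commutative ring: it covers both complex numbers and formal power
  series, where \<open>prodinf\<close> is taken in the \<open>fps_X\<close>-adic metric.
\<close>
definition qpochhammer_inf :: "'a::{t2_space,comm_ring_1} \<Rightarrow> 'a \<Rightarrow> 'a" where
  "qpochhammer_inf a q = (\<Prod>n. 1 - a * q ^ n)"

text \<open>
  The variable \<open>q\<close> is \<open>fps_X\<close>. The type \<open>int\<close> has no \<open>inverse\<close>, so the quotient is written with
  \<open>fps_right_inverse\<close>, whose second argument is the inverse of the constant coefficient of the
  denominator, here 1; see \<open>overcubic_fps_times_denominator\<close> below.
\<close>
definition overcubic_fps :: "int fps" where
  "overcubic_fps =
     (qpochhammer_inf (- fps_X) fps_X * qpochhammer_inf (- (fps_X ^ 2)) (fps_X ^ 2)) *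
     fps_right_inverse
       (qpochhammer_inf fps_X fps_X * qpochhammer_inf (fps_X ^ 2) (fps_X ^ 2)) 1"

definition overcubic :: "nat \<Rightarrow> int" where
  "overcubic n = fps_nth overcubic_fps n"

lemma fps_nth_mult_power_eq_0:
  fixes p a q :: "int fps"
  assumes "fps_nth a 0 = 0" "fps_nth q 0 = 0" "m \<le> n"
  shows "fps_nth (p * (a * q ^ n)) m = 0"
proof -
  have a: "a = fps_X * fps_shift 1 a"
    using assms(1) by (intro fps_ext) simp
  have q: "q = fps_X * fps_shift 1 q"
    using assms(2) by (intro fps_ext) simp
  have "p * (a * q ^ n) = fps_X ^ Suc n * (p * fps_shift 1 a * fps_shift 1 q ^ n)"
    by (subst a, subst q) (simp add: power_mult_distrib mult_ac)
  then show ?thesis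
    using assms(3) by (simp only: fps_X_power_mult_nth) simp
qed

lemma qpochhammer_inf_fps:
  fixes a q :: "int fps"
  assumes "fps_nth a 0 = 0" "fps_nth q 0 = 0"
  shows "(\<lambda>n. 1 - a * q ^ n) has_prod qpochhammer_inf a q"
    and "fps_nth (qpochhammer_inf a q) m = fps_nth (\<Prod>i\<le>m. 1 - a * q ^ i) m"
proof -
  let ?P = "\<lambda>n. \<Prod>i\<le>n. 1 - a * q ^ i"
  let ?L = "Abs_fps (\<lambda>m. fps_nth (?P m) m)"
  have stable: "fps_nth (?P n) m = fps_nth (?P m) m" if "m \<le> n" for m n
    using that
  proof (induction rule: dec_induct)
    case (step n)
    have "?P (Suc n) = ?P n - ?P n * (a * q ^ Suc n)"
      by (simp add: algebra_simps)
    moreover have "fps_nth (?P n * (a * q ^ Suc n)) m = 0"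
      using step.hyps by (intro fps_nth_mult_power_eq_0 assms) auto
    ultimately show ?case
      using step.IH by simp
  qed simp
  have "?P \<longlonglongrightarrow> ?L"
    unfolding tendsto_fps_iff
  proof
    fix m
    show "\<forall>\<^sub>F n in sequentially. fps_nth (?P n) m = fps_nth ?L m"
      using eventually_ge_at_top[of m] by eventually_elim (simp only: fps_nth_Abs_fps, rule stable)
  qed
  moreover have "fps_nth ?L 0 = 1"
    using assms by simp
  hence "?L \<noteq> 0"
    by (metis fps_zero_nth zero_neq_one)
  ultimately have *: "(\<lambda>n. 1 - a * q ^ n) has_prod ?L"
    by (simp add: has_prod_def raw_has_prod_def)
  hence eq: "?L = qpochhammer_inf a q"
    unfolding qpochhammer_inf_def by (rule has_prod_unique)
  show "(\<lambda>n. 1 - a * q ^ n) has_prod qpochhammer_inf a q"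
    using * eq by simp
  show "fps_nth (qpochhammer_inf a q) m = fps_nth (?P m) m"
    by (simp flip: eq)
qed

lemma overcubic_fps_times_denominator:
  "overcubic_fps * (qpochhammer_inf fps_X fps_X * qpochhammer_inf (fps_X ^ 2) (fps_X ^ 2)) =
   qpochhammer_inf (- fps_X) fps_X * qpochhammer_inf (- (fps_X ^ 2)) (fps_X ^ 2)"
proof -
  let ?D = "qpochhammer_inf fps_X fps_X * qpochhammer_inf (fps_X ^ 2) (fps_X ^ 2) :: int fps"
  have "fps_nth ?D 0 = 1"
    by (simp add: qpochhammer_inf_fps(2))
  hence "?D * fps_right_inverse ?D 1 = 1"
    by (intro fps_right_inverse) simp
  hence "c * (fps_right_inverse ?D 1 * ?D) = c" for c
    by (simp only: mult.commute[of _ ?D] mult_1_right)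
  thus ?thesis
    unfolding overcubic_fps_def by (subst mult.assoc)
qed

end

theory Submission
  imports Defs
    "HOL-Real_Asymp.Real_Asymp"
    "HOL-Computational_Algebra.Primes"
    "HOL-Library.Function_Algebras"
    "Jordan_Normal_Form.Char_Poly"
    "HOL-Complex_Analysis.Complex_Analysis"
    "HOL-Probability.Probability"
begin

text \<open>
  By Gauss's identity the generating function is \<open>1 / \<psi>\<close> with \<open>\<psi>(q) = \<phi>(-q) \<phi>(-q\<^sup>2)\<close>, where
  \<open>\<phi>(-q) = 1 + 2 \<Sum> (-1)\<^sup>n q\<^bsup>n * n\<^esup>\<close>. As \<open>\<psi> = 1\<close> modulo 2, the series agrees modulo a given power of 2 with \<open>\<psi>\<^sup>w\<close>,
  \<open>w = 2\<^sup>n - 1\<close>, which is a modular form of weight \<open>w\<close>.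
  On the lattice \<open>A\<close> of integral \<open>q\<close>-expansions of such forms every Hecke operator \<open>T\<^sub>p\<close>, \<open>p\<close> an odd prime, is
  nilpotent modulo 2. This is seen on periods of Eichler integrals: modulo 2, \<open>\<Gamma>(2)\<close> acts trivially on
  the binary forms and unipotently on functions of period 16, and on homomorphisms from \<open>\<Gamma>(2)\<close> to \<open>\<int>/2\<close> the
  operator \<open>T\<^sub>p\<close> is multiplication by \<open>p + 1\<close>, which is 0. The \<open>T\<^sub>p\<close> commute and \<open>A\<close> has finite rank \<open>D\<close>, so any
  \<open>D k\<close> of them multiply to a map of \<open>A\<close> into \<open>2\<^sup>k A\<close>. Hence the \<open>n\<close>-th coefficient is divisible by \<open>2\<^sup>k\<close> as soon as
  \<open>D k\<close> odd primes divide \<open>n\<close> exactly once, which holds for almost all \<open>n\<close> because \<open>\<Sum> 1/p\<close> diverges.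
\<close>

subsection \<open>The overcubic series modulo powers of 2\<close>

text \<open>The periods of a form are complex numbers and span no evident lattice, so divisibility
  by 2 means nothing for a single period. It gets a meaning for sequences: the periods of g, T g,
  T^2 g, ... for T = T_p are taken as one sequence, T becomes the shift, and the integer span of
  these sequences is finitely generated by the cocycle relation. If a power of the shift carries the
  span into its double, Cayley-Hamilton gives a monic integral equation for it whose lower
  coefficients are even. The equation returns to forms because a form of weight at least 3 whose
  periods all vanish is zero; the same fact bounds the rank of A. Forms of level 16 are spread out
  into families indexed by row vectors modulo 16. All periods are then taken along \<Gamma>(2),
  which has three generators, and the level survives only as a period in v; that this period is a
  power of 2 makes the action unipotent modulo 2. The exponents of nilpotence may vary with the
  operator and the vector: a Nakayama argument needs only the rank.\<close>

lemma gauss_square_identity_finite: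
  fixes q :: "'a::comm_ring_1"
  shows "(\<Prod>i=1..n. 1 + q ^ i) * (1 + 2 * (\<Sum>s=1..n. (-1) ^ s * q ^ (s\<^sup>2))) =
    (\<Prod>i=1..n. 1 - q ^ i) +
    2 * (\<Sum>s=1..n. (-1) ^ s * q ^ (s * (n + 1)) * ((\<Prod>i=Suc s..n. 1 - q ^ i) * (\<Prod>i=1..<s. 1 + q ^ i)))"
proof (induction n)
  case (Suc n)
  define x where "x = q ^ Suc n"
  define t where "t s = (\<Prod>i=Suc s..n. 1 - q ^ i) * (\<Prod>i=1..<s. 1 + q ^ i)" for s
  define u where "u s = (-1) ^ s * x ^ s * ((\<Prod>i=s..n. 1 - q ^ i) * (\<Prod>i=1..<s. 1 + q ^ i))" for s
  define D where "D = (\<Prod>i=1..n. 1 + q ^ i)"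
  define N where "N = (\<Prod>i=1..n. 1 - q ^ i)"
  define S where "S = 1 + 2 * (\<Sum>s=1..n. (-1) ^ s * q ^ (s\<^sup>2))"
  define e where "e s = (-1) ^ s * x ^ s * t s" for s
  have xs: "q ^ (s * (n + 1)) = x ^ s" for s
    unfolding x_def power_mult[symmetric] by (simp only: Suc_eq_plus1 mult.commute)
  have IH: "D * S = N + 2 * (\<Sum>s=1..n. e s)"
    using Suc.IH unfolding D_def S_def N_def e_def t_def xs by simp
  \<comment> \<open>With x = q^(n+1), the left side multiplies the old correction terms
    \<open>e s\<close> by 1 + x, while the new correction turns them into \<open>e s\<close> q^s (1
    - x). The difference telescopes in s; its boundary values account for the new term of the theta
    sum and for the change of the product N.\<close>
  have tele: "e s * (q ^ s * (1 - x) - (1 + x)) = u (Suc s) - u s" if "s \<in> {1..n}" for s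
  proof -
    have 1: "(\<Prod>i=s..n. 1 - q ^ i) = (1 - q ^ s) * (\<Prod>i=Suc s..n. 1 - q ^ i)"
      using that by (simp add: prod.atLeast_Suc_atMost)
    have 2: "(\<Prod>i=1..<Suc s. 1 + q ^ i) = (\<Prod>i=1..<s. 1 + q ^ i) * (1 + q ^ s)"
      using that by simp
    show ?thesis
      unfolding u_def e_def t_def 1 2 by (simp add: algebra_simps)
  qed
  have "(\<Sum>s=1..n. e s * (q ^ s * (1 - x) - (1 + x))) = (\<Sum>s=1..n. u (Suc s) - u s)"
    by (intro sum.cong refl tele)
  also have "\<dots> = u (Suc n) - u 1"
    by (rule sum_Suc_diff) simp
  also have "u (Suc n) = (-1) ^ Suc n * x ^ Suc n * D"
    by (simp add: u_def D_def atLeastLessThanSuc_atLeastAtMost)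
  also have "u 1 = - x * N"
    by (simp add: u_def N_def)
  finally have T: "(\<Sum>s=1..n. e s * (q ^ s * (1 - x) - (1 + x))) = (-1) ^ Suc n * x ^ Suc n * D + x * N"
    by simp
  have f: "(-1) ^ s * q ^ (s * (Suc n + 1)) * ((\<Prod>i=Suc s..Suc n. 1 - q ^ i) * (\<Prod>i=1..<s. 1 + q ^ i))
      = e s * q ^ s * (1 - x)" if "s \<in> {1..n}" for s
  proof -
    have "q ^ (s * (Suc n + 1)) = x ^ s * q ^ s"
      by (simp add: x_def mult.commute algebra_simps flip: power_mult power_add)
    moreover have "(\<Prod>i=Suc s..Suc n. 1 - q ^ i) = (\<Prod>i=Suc s..n. 1 - q ^ i) * (1 - x)"
      using that by (simp add: x_def)
    ultimately show ?thesis
      by (simp add: e_def t_def mult_ac)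
  qed
  have sq: "q ^ ((Suc n)\<^sup>2) = x ^ Suc n"
    unfolding x_def power_mult[symmetric] power2_eq_square by (rule refl)
  have last: "q ^ (Suc n * (Suc n + 1)) = x ^ Suc n * x"
    by (simp add: x_def algebra_simps flip: power_mult power_add)
  have lhs: "(\<Prod>i=1..Suc n. 1 + q ^ i) * (1 + 2 * (\<Sum>s=1..Suc n. (-1) ^ s * q ^ (s\<^sup>2))) =
      (1 + x) * (D * S) + 2 * (-1) ^ Suc n * x ^ Suc n * (1 + x) * D"
    unfolding sum.nat_ivl_Suc' prod.nat_ivl_Suc'
    by (simp add: D_def S_def sq x_def[symmetric] algebra_simps del: power_Suc)
  have "(\<Sum>s=1..Suc n. (-1) ^ s * q ^ (s * (Suc n + 1)) * ((\<Prod>i=Suc s..Suc n. 1 - q ^ i) * (\<Prod>i=1..<s. 1 + q ^ i)))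
     = (\<Sum>s=1..n. e s * q ^ s * (1 - x)) + (-1) ^ Suc n * x ^ Suc n * x * D"
  proof -
    have "(\<Sum>s=1..n. (-1) ^ s * q ^ (s * (Suc n + 1)) * ((\<Prod>i=Suc s..Suc n. 1 - q ^ i) * (\<Prod>i=1..<s. 1 + q ^ i)))
      = (\<Sum>s=1..n. e s * q ^ s * (1 - x))"
      by (intro sum.cong refl f)
    moreover have "(\<Prod>i=1..<Suc n. 1 + q ^ i) = D"
      by (simp add: D_def atLeastLessThanSuc_atLeastAtMost)
    ultimately show ?thesis
      by (simp only: sum.nat_ivl_Suc' last) (simp add: mult_ac)
  qed
  note A = this
  have B: "(\<Sum>s=1..n. e s * q ^ s * (1 - x)) = (\<Sum>s=1..n. e s) * (1 + x) +
      ((-1) ^ Suc n * x ^ Suc n * D + x * N)"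
    unfolding T[symmetric] sum_distrib_right sum.distrib[symmetric]
    by (intro sum.cong) (simp_all add: algebra_simps)
  have C: "(\<Prod>i=1..Suc n. 1 - q ^ i) = N * (1 - x)"
    by (simp add: N_def x_def)
  show ?case
    unfolding lhs IH A B C by (simp add: algebra_simps)
qed simp

lemma fps_mult_nth_cong:
  fixes a b a' b' :: "'a::comm_ring_1 fps"
  assumes "\<And>i. i \<le> m \<Longrightarrow> fps_nth a i = fps_nth a' i" "\<And>i. i \<le> m \<Longrightarrow> fps_nth b i = fps_nth b' i"
  shows "fps_nth (a * b) m = fps_nth (a' * b') m"
  unfolding fps_mult_nth by (intro sum.cong) (auto simp: assms)

lemma qpochhammer_inf_fps_nth:
  fixes a q :: "int fps"
  assumes "fps_nth a 0 = 0" "fps_nth q 0 = 0" "m \<le> n"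
  shows "fps_nth (qpochhammer_inf a q) m = fps_nth (\<Prod>i\<le>n. 1 - a * q ^ i) m"
  using \<open>m \<le> n\<close>
proof (induction rule: dec_induct)
  case base
  then show ?case by (simp add: qpochhammer_inf_fps(2) assms)
next
  case (step n)
  have "(\<Prod>i\<le>Suc n. 1 - a * q ^ i) = (\<Prod>i\<le>n. 1 - a * q ^ i) - (\<Prod>i\<le>n. 1 - a * q ^ i) * (a * q ^ Suc n)"
    by (simp add: algebra_simps)
  moreover have "fps_nth ((\<Prod>i\<le>n. 1 - a * q ^ i) * (a * q ^ Suc n)) m = 0"
    using step.hyps by (intro fps_nth_mult_power_eq_0 assms) auto
  ultimately show ?case
    using step.IH by simp
qed

text \<open>Coefficients of \<phi>(-q), the sum of (-1)^r q^(r^2) over all integers r. Since r^2 and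
  r have the same parity, the sign can be read off from the exponent.\<close>

definition theta4_coeff :: "nat \<Rightarrow> int" where
  "theta4_coeff n = (if n = 0 then 1 else if (\<exists>r. n = r\<^sup>2) then 2 * (-1) ^ n else 0)"

definition theta4_fps :: "nat \<Rightarrow> int fps" where
  "theta4_fps j = Abs_fps (\<lambda>n. if j dvd n then theta4_coeff (n div j) else 0)"

lemma theta4_fps_nth:
  assumes "j > 0" "m \<le> n"
  shows "fps_nth (theta4_fps j) m = fps_nth (1 + 2 * (\<Sum>s=1..n. (-1) ^ s * (fps_X ^ j) ^ (s\<^sup>2))) m"
proof -
  have *: "fps_nth ((-1) ^ s * (fps_X ^ j) ^ (s\<^sup>2) :: int fps) m = (if m = j * s\<^sup>2 then (-1) ^ s else 0)" for s
  proof -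
    have "(-1 :: int fps) ^ s = fps_const ((-1) ^ s)"
      by (simp add: minus_one_power_iff flip: fps_const_neg)
    then have "(-1) ^ s * (fps_X ^ j) ^ (s\<^sup>2) = (fps_const ((-1) ^ s) * fps_X ^ (j * s\<^sup>2) :: int fps)"
      by (simp only: power_mult)
    then show ?thesis
      by (simp only: fps_mult_left_const_nth fps_X_power_nth) auto
  qed
  have "fps_nth (2 * (\<Sum>s=1..n. (-1) ^ s * (fps_X ^ j) ^ (s\<^sup>2)) :: int fps) m =
      2 * (\<Sum>s=1..n. if m = j * s\<^sup>2 then (-1) ^ s else 0)"
    by (subst numeral_fps_const, subst fps_mult_left_const_nth, subst fps_sum_nth) (simp only: *)
  also have "(\<Sum>s=1..n. if m = j * s\<^sup>2 then (-1) ^ s else 0 :: int) =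
      (if m > 0 \<and> j dvd m \<and> (\<exists>r. m div j = r\<^sup>2) then (-1) ^ (m div j) else 0)"
  proof (cases "m > 0 \<and> j dvd m \<and> (\<exists>r. m div j = r\<^sup>2)")
    case True
    then obtain r where r: "m = j * r\<^sup>2"
      using \<open>j > 0\<close> by auto
    have "r > 0" using True r by (auto intro: Nat.gr0I)
    moreover have "r \<le> r\<^sup>2" using \<open>r > 0\<close> by (simp add: power2_eq_square)
    hence "r \<le> n" using r assms by (metis mult_le_mono1 One_nat_def Suc_leI le_trans nat_mult_1)
    moreover have "m = j * s\<^sup>2 \<longleftrightarrow> s = r" for s
      using r \<open>j > 0\<close> by (auto simp: power2_eq_iff_nonneg)
    ultimately show ?thesis using True r \<open>j > 0\<close> by (simp add: power2_eq_square minus_one_power_iff)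
  next
    case False
    have "m \<noteq> j * s\<^sup>2" if "s \<in> {1..n}" for s
      using False that \<open>j > 0\<close> by auto
    then show ?thesis using False by (simp add: sum.neutral)
  qed
  finally show ?thesis
    using \<open>j > 0\<close> by (auto simp: theta4_fps_def theta4_coeff_def dvd_div_eq_0_iff)
qed

text \<open>Gauss's identity for q^j, one coefficient at a time: the finite identity with m + 1
  factors holds exactly, and each of its correction terms is divisible by (q^j)^(m+2), so it cannot
  reach degree m.\<close>

lemma qpochhammer_mult_theta4:
  assumes j: "j > 0"
  shows "qpochhammer_inf (- (fps_X ^ j)) (fps_X ^ j) * theta4_fps j = qpochhammer_inf (fps_X ^ j) (fps_X ^ j)"
proof (rule fps_ext)
  fix m
  define Q :: "int fps" where "Q = fps_X ^ j"
  define n where "n = Suc m"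
  have Q0: "fps_nth Q 0 = 0" using j by (simp add: Q_def)
  have sh: "(\<Prod>i\<le>m. f (Suc i)) = prod f {1..n}" for f :: "nat \<Rightarrow> int fps"
    by (simp add: n_def prod.atLeast_Suc_atMost_Suc_shift atMost_atLeast0 del: prod.cl_ivl_Suc)
  have D: "fps_nth (qpochhammer_inf (- Q) Q) i = fps_nth (\<Prod>i=1..n. 1 + Q ^ i) i" if "i \<le> m" for i
    using qpochhammer_inf_fps_nth[of "-Q" Q i m] that Q0 sh[of "\<lambda>i. 1 + Q ^ i"] by simp
  have N: "fps_nth (qpochhammer_inf Q Q) m = fps_nth (\<Prod>i=1..n. 1 - Q ^ i) m"
    using qpochhammer_inf_fps_nth[of Q Q m m] Q0 sh[of "\<lambda>i. 1 - Q ^ i"] by simp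
  have S: "fps_nth (theta4_fps j) i = fps_nth (1 + 2 * (\<Sum>s=1..n. (-1) ^ s * Q ^ (s\<^sup>2))) i" if "i \<le> m" for i
    unfolding Q_def by (rule theta4_fps_nth) (use that j in \<open>auto simp: n_def\<close>)
  have "fps_nth (qpochhammer_inf (- Q) Q * theta4_fps j) m =
      fps_nth ((\<Prod>i=1..n. 1 + Q ^ i) * (1 + 2 * (\<Sum>s=1..n. (-1) ^ s * Q ^ (s\<^sup>2)))) m"
    by (intro fps_mult_nth_cong D S)
  also have "\<dots> = fps_nth (\<Prod>i=1..n. 1 - Q ^ i) m + fps_nth
    (2 * (\<Sum>s=1..n. (-1) ^ s * Q ^ (s * (n + 1)) * ((\<Prod>i=Suc s..n. 1 - Q ^ i) * (\<Prod>i=1..<s. 1 + Q ^ i)))) m"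
    by (subst gauss_square_identity_finite) simp
  also have "fps_nth
    (2 * (\<Sum>s=1..n. (-1) ^ s * Q ^ (s * (n + 1)) * ((\<Prod>i=Suc s..n. 1 - Q ^ i) * (\<Prod>i=1..<s. 1 + Q ^ i)))) m = 0"
    (is "fps_nth (2 * sum ?f _) m = 0")
  proof -
    have "fps_nth (?f s) m = 0" if "s \<in> {1..n}" for s
    proof -
      have "1 * (n + 1) \<le> s * (n + 1)"
        using that by (intro mult_le_mono1) auto
      then obtain r where r: "s * (n + 1) = Suc r" "m \<le> r"
        by (cases "s * (n + 1)") (auto simp: n_def)
      have "?f s = ((-1) ^ s * ((\<Prod>i=Suc s..n. 1 - Q ^ i) * (\<Prod>i=1..<s. 1 + Q ^ i))) * (Q * Q ^ r)"
        unfolding r(1) power_Suc by (simp only: mult_ac)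
      then show ?thesis
        by (simp only: fps_nth_mult_power_eq_0[OF Q0 Q0 r(2)])
    qed
    then have "fps_nth (sum ?f {1..n}) m = 0"
      unfolding fps_sum_nth by (rule sum.neutral[rule_format])
    then show ?thesis
      by (subst numeral_fps_const, subst fps_mult_left_const_nth) simp
  qed
  finally show "fps_nth (qpochhammer_inf (- (fps_X ^ j)) (fps_X ^ j) * theta4_fps j) m =
      fps_nth (qpochhammer_inf (fps_X ^ j) (fps_X ^ j)) m"
    using N by (simp add: Q_def)
qed

definition psi_fps :: "int fps" where
  "psi_fps = theta4_fps 1 * theta4_fps 2"

lemma overcubic_fps_mult_psi: "overcubic_fps * psi_fps = 1"
proof -
  let ?D = "qpochhammer_inf (- fps_X) fps_X * qpochhammer_inf (- (fps_X ^ 2)) (fps_X ^ 2) :: int fps"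
  have "fps_nth ?D 0 = 1"
    by (simp add: qpochhammer_inf_fps(2))
  hence nz: "?D \<noteq> 0" by auto
  have "?D * (overcubic_fps * psi_fps) = overcubic_fps *
      ((qpochhammer_inf (- (fps_X ^ 1)) (fps_X ^ 1) * theta4_fps 1) *
       (qpochhammer_inf (- (fps_X ^ 2)) (fps_X ^ 2) * theta4_fps 2))"
    by (simp only: psi_fps_def mult_ac power_one_right)
  also have "\<dots> = overcubic_fps * (qpochhammer_inf fps_X fps_X * qpochhammer_inf (fps_X ^ 2) (fps_X ^ 2))"
    by (subst (1 2) qpochhammer_mult_theta4) (simp_all only: power_one_right zero_less_one zero_less_numeral)
  finally have "?D * (overcubic_fps * psi_fps) = ?D * 1"
    unfolding overcubic_fps_times_denominator by simp
  then show ?thesis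
    using nz mult_cancel_left by blast
qed

lemma theta4_fps_cong_1: "\<exists>u. theta4_fps j = 1 + 2 * u"
proof
  show "theta4_fps j = 1 + 2 * Abs_fps (\<lambda>n. if n > 0 \<and> j dvd n then theta4_coeff (n div j) div 2 else 0)"
  proof (rule fps_ext)
    fix n
    show "fps_nth (theta4_fps j) n = fps_nth (1 + 2 * Abs_fps (\<lambda>n. if n > 0 \<and> j dvd n then theta4_coeff (n div j) div 2 else 0)) n"
      by (subst numeral_fps_const, subst fps_add_nth, subst fps_mult_left_const_nth)
         (auto simp: theta4_fps_def theta4_coeff_def dvd_div_eq_0_iff)
  qed
qed

text \<open>For k >= 1, squaring 1 + 2^k v gains one power of 2.\<close>

lemma two_power_power_cong_1:
  fixes x :: "'a::comm_ring_1"
  assumes "x = 1 + 2 * u"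
  shows "\<exists>v. x ^ (2 ^ n) = 1 + 2 ^ Suc n * v"
proof (induction n)
  case 0
  then show ?case using assms by auto
next
  case (Suc n)
  then obtain v where v: "x ^ (2 ^ n) = 1 + 2 ^ Suc n * v" by blast
  have "x ^ (2 ^ Suc n) = (x ^ (2 ^ n))\<^sup>2"
    by (simp add: power_mult[symmetric] mult.commute)
  also have "\<dots> = 1 + 2 ^ Suc (Suc n) * (v + 2 ^ n * v\<^sup>2)"
    unfolding v by (simp add: power2_eq_square algebra_simps)
  finally show ?case by blast
qed

text \<open>The series is the inverse of \<psi>; multiplying it by \<psi>^(2^n), which is 1 modulo
  2^(n+1), exchanges the inverse for a power with natural exponent, and such a power is a
  holomorphic modular form.\<close>

lemma overcubic_cong_psi_power:
  "2 ^ Suc n dvd overcubic i - fps_nth (psi_fps ^ (2 ^ n - 1)) i"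
proof -
  obtain u1 u2 where u: "theta4_fps 1 = 1 + 2 * u1" "theta4_fps 2 = 1 + 2 * u2"
    using theta4_fps_cong_1 by metis
  have "psi_fps = 1 + 2 * (u1 + u2 + 2 * u1 * u2)"
    unfolding psi_fps_def u by (simp add: algebra_simps)
  then obtain v where v: "psi_fps ^ (2 ^ n) = 1 + 2 ^ Suc n * v"
    using two_power_power_cong_1 by blast
  have "psi_fps ^ (2 ^ n) = psi_fps * psi_fps ^ (2 ^ n - 1)"
    using power_minus_mult[of "2 ^ n" psi_fps] by (simp only: mult.commute zero_less_power zero_less_numeral)
  then have "overcubic_fps * psi_fps ^ (2 ^ n) = psi_fps ^ (2 ^ n - 1)"
    by (simp only: mult.assoc[symmetric] overcubic_fps_mult_psi mult_1)
  then have "psi_fps ^ (2 ^ n - 1) = overcubic_fps + 2 ^ Suc n * (overcubic_fps * v)"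
    unfolding v distrib_left mult_1_right by (simp only: mult.left_commute)
  then have "overcubic_fps - psi_fps ^ (2 ^ n - 1) = 2 ^ Suc n * (- (overcubic_fps * v))"
    by (simp only: mult_minus_right) simp
  also have "(2 :: int fps) ^ Suc n = fps_const (2 ^ Suc n)"
    unfolding fps_const_power[symmetric] by (subst numeral_fps_const) (rule refl)
  finally have "fps_nth (overcubic_fps - psi_fps ^ (2 ^ n - 1)) i =
      2 ^ Suc n * fps_nth (- (overcubic_fps * v)) i"
    by (simp only: fps_mult_left_const_nth)
  then have "overcubic i - fps_nth (psi_fps ^ (2 ^ n - 1)) i = 2 ^ Suc n * fps_nth (- (overcubic_fps * v)) i"
    unfolding overcubic_def by (simp only: fps_sub_nth)
  then show ?thesis by simp
qed

subsection \<open>Numbers exactly divisible by many primes\<close>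

text \<open>Exact divisibility is the condition that Hecke operators can use: for n = p r with p not
  dividing r, the n-th coefficient of a form is the r-th coefficient of its image under T_p. It
  depends only on n modulo p^2.\<close>

definition exact_prime :: "nat \<Rightarrow> nat \<Rightarrow> bool" where
  "exact_prime p n \<longleftrightarrow> p dvd n \<and> \<not> p\<^sup>2 dvd n"

lemma exact_prime_mod:
  assumes "p\<^sup>2 dvd q"
  shows "exact_prime p (n mod q) \<longleftrightarrow> exact_prime p n"
  using assms unfolding exact_prime_def
  by (metis dvd_mod_iff dvd_power dvd_trans zero_less_numeral)

lemma card_exact_prime_residues:
  assumes "p > 0"
  shows "card {r. r < p\<^sup>2 \<and> \<not> exact_prime p r} = p\<^sup>2 - (p - 1)"
proof -
  have "{r. r < p\<^sup>2 \<and> exact_prime p r} = (\<lambda>i. p * i) ` {1..<p}"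
  proof (intro Set.set_eqI iffI)
    fix r assume "r \<in> {r. r < p\<^sup>2 \<and> exact_prime p r}"
    then obtain i where i: "r = p * i" "r < p\<^sup>2" "\<not> p\<^sup>2 dvd r"
      by (auto simp: exact_prime_def)
    then have "i \<noteq> 0" "i < p" by (auto simp: power2_eq_square intro: Nat.gr0I)
    then show "r \<in> (\<lambda>i. p * i) ` {1..<p}" using i by auto
  next
    fix r assume "r \<in> (\<lambda>i. p * i) ` {1..<p}"
    then obtain i where i: "r = p * i" "1 \<le> i" "i < p" by auto
    then have "r > 0" "r < p\<^sup>2" using assms by (auto simp: power2_eq_square)
    then show "r \<in> {r. r < p\<^sup>2 \<and> exact_prime p r}"
      using i by (auto simp: exact_prime_def dest: dvd_imp_le)
  qed
  then have "card {r. r < p\<^sup>2 \<and> exact_prime p r} = p - 1"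
    using assms by (simp add: card_image inj_on_def)
  moreover have "{r. r < p\<^sup>2 \<and> \<not> exact_prime p r} = {..<p\<^sup>2} - {r. r < p\<^sup>2 \<and> exact_prime p r}"
    by auto
  moreover have "card ({..<p\<^sup>2} - {r. r < p\<^sup>2 \<and> exact_prime p r}) = card {..<p\<^sup>2} - card {r. r < p\<^sup>2 \<and> exact_prime p r}"
    by (rule card_Diff_subset) auto
  ultimately show ?thesis by simp
qed

lemma card_residues_coprime_product:
  fixes P Q :: "nat \<Rightarrow> bool"
  assumes "coprime a b" "a > 0" "b > 0"
  assumes P: "\<And>n. P (n mod a) \<longleftrightarrow> P n" and Q: "\<And>n. Q (n mod b) \<longleftrightarrow> Q n"
  shows "card {r. r < a * b \<and> P r \<and> Q r} = card {r. r < a \<and> P r} * card {r. r < b \<and> Q r}"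
proof -
  have "bij_betw (\<lambda>r. (r mod a, r mod b)) {r. r < a * b \<and> P r \<and> Q r} ({r. r < a \<and> P r} \<times> {r. r < b \<and> Q r})"
    unfolding bij_betw_def
  proof
    show "inj_on (\<lambda>r. (r mod a, r mod b)) {r. r < a * b \<and> P r \<and> Q r}"
    proof (rule inj_onI)
      fix x y assume xy: "x \<in> {r. r < a * b \<and> P r \<and> Q r}" "y \<in> {r. r < a * b \<and> P r \<and> Q r}"
        "(x mod a, x mod b) = (y mod a, y mod b)"
      then have "[x = y] (mod a)" "[x = y] (mod b)"
        by (auto simp: cong_def)
      then have "[x = y] (mod a * b)"
        by (rule coprime_cong_mult_nat) (rule assms(1))
      then show "x = y" using xy by (simp add: cong_def)
    qed
    show "(\<lambda>r. (r mod a, r mod b)) ` {r. r < a * b \<and> P r \<and> Q r} = {r. r < a \<and> P r} \<times> {r. r < b \<and> Q r}"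
    proof (intro Set.set_eqI iffI)
      fix z assume "z \<in> (\<lambda>r. (r mod a, r mod b)) ` {r. r < a * b \<and> P r \<and> Q r}"
      then show "z \<in> {r. r < a \<and> P r} \<times> {r. r < b \<and> Q r}"
        using assms by auto
    next
      fix z assume z: "z \<in> {r. r < a \<and> P r} \<times> {r. r < b \<and> Q r}"
      obtain x where x: "[x = fst z] (mod a)" "[x = snd z] (mod b)"
        using binary_chinese_remainder_nat[OF assms(1)] by blast
      define y where "y = x mod (a * b)"
      have "y mod a = fst z" "y mod b = snd z"
        using x z by (auto simp: y_def cong_def mod_mult_self1 mod_mod_cancel)
      moreover have "y < a * b" using assms by (simp add: y_def)
      moreover have "P y" "Q y"
        using P[of y] Q[of y] z \<open>y mod a = fst z\<close> \<open>y mod b = snd z\<close> by auto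
      ultimately show "z \<in> (\<lambda>r. (r mod a, r mod b)) ` {r. r < a * b \<and> P r \<and> Q r}"
        by (intro image_eqI[of _ _ y]) auto
    qed
  qed
  then show ?thesis
    by (simp add: bij_betw_same_card card_cartesian_product)
qed

text \<open>By the Chinese remainder theorem the conditions for different primes are independent,
  and p - 1 of the p^2 residues are exactly divisible by p.\<close>

lemma card_no_exact_prime:
  assumes "finite B" "\<And>p. p \<in> B \<Longrightarrow> prime p"
  shows "real (card {r. r < (\<Prod>p\<in>B. p\<^sup>2) \<and> (\<forall>p\<in>B. \<not> exact_prime p r)}) =
    (\<Prod>p\<in>B. real (p\<^sup>2) - (real p - 1))"
  using assms
proof (induction B rule: finite_induct)
  case (insert p B)
  let ?P = "\<lambda>r. \<forall>p\<in>B. \<not> exact_prime p r"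
  define b where "b = (\<Prod>p\<in>B. p\<^sup>2)"
  have p: "prime p" using insert.prems by auto
  have bpos: "b > 0" using insert by (auto simp: b_def intro!: prod_pos prime_gt_0_nat)
  have cop: "coprime (p\<^sup>2) b"
    unfolding b_def using insert p by (intro prod_coprime_right) (auto intro: primes_coprime)
  have 1: "(\<not> exact_prime p (n mod p\<^sup>2)) = (\<not> exact_prime p n)" for n
    using exact_prime_mod[of p "p\<^sup>2" n] by simp
  have 2: "?P (n mod b) = ?P n" for n
    using exact_prime_mod[of _ b n] insert.hyps by (auto simp: b_def intro: dvd_prodI)
  have "card {r. r < p\<^sup>2 * b \<and> \<not> exact_prime p r \<and> ?P r} =
      card {r. r < p\<^sup>2 \<and> \<not> exact_prime p r} * card {r. r < b \<and> ?P r}"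
    using p by (intro card_residues_coprime_product cop bpos 1 2) (auto intro: prime_gt_0_nat)
  then have c: "card {r. r < (\<Prod>p\<in>insert p B. p\<^sup>2) \<and> (\<forall>p\<in>insert p B. \<not> exact_prime p r)} =
      card {r. r < p\<^sup>2 \<and> \<not> exact_prime p r} * card {r. r < b \<and> ?P r}"
    unfolding prod.insert[OF insert.hyps] b_def by (simp only: Set.ball_simps)
  have r: "real (card {r. r < p\<^sup>2 \<and> \<not> exact_prime p r}) = real (p\<^sup>2) - (real p - 1)"
  proof -
    have "p - 1 \<le> p\<^sup>2" by (cases p) (auto simp: power2_eq_square)
    then show ?thesis
      using card_exact_prime_residues[of p] prime_gt_0_nat[OF p] by (simp add: of_nat_diff)
  qed
  have "real (card {r. r < b \<and> ?P r}) = (\<Prod>p\<in>B. real (p\<^sup>2) - (real p - 1))"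
    unfolding b_def using insert.prems by (intro insert.IH) blast
  then show ?case
    by (subst c) (simp only: of_nat_mult r prod.insert[OF insert.hyps])
qed simp

text \<open>Erdos' argument: if the reciprocals of the primes above \<open>m\<close> summed to at most 1/2, then at
  least half of the numbers up to \<open>x\<close> would have the form \<open>a b\<^sup>2\<close> with \<open>a\<close> a squarefree product of
  primes up to \<open>m\<close>, but there are at most \<open>2\<^sup>m \<surd>x\<close> of those.\<close>

lemma ex_primes_reciprocal_sum_gt_half:
  "\<exists>B. finite B \<and> (\<forall>p\<in>B. prime p \<and> p > m) \<and> (\<Sum>p\<in>B. 1 / real p) > 1 / 2"
proof (rule ccontr)
  assume "\<not> ?thesis"
  then have small: "(\<Sum>p\<in>B. 1 / real p) \<le> 1 / 2" if "finite B" "\<forall>p\<in>B. prime p \<and> p > m" for B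
    using that by (meson linorder_not_le)
  \<comment> \<open>There are at most 2^m K numbers a b^2 up to x = K^2; this K makes that bound a
    quarter of x, less than the half that is claimed.\<close>
  define K where "K = (2::nat) ^ Suc (Suc m)"
  define x where "x = K\<^sup>2"
  define B where "B = {p. prime p \<and> m < p \<and> p \<le> x}"
  define A where "A = {n\<in>{1..x}. \<forall>p. prime p \<longrightarrow> p dvd n \<longrightarrow> p \<le> m}"
  have finB: "finite B" unfolding B_def by (rule finite_subset[of _ "{..x}"]) auto
  have "{1..x} \<subseteq> A \<union> (\<Union>p\<in>B. (\<lambda>i. p * i) ` {1..x div p})"
  proof
    fix n assume n: "n \<in> {1..x}"
    show "n \<in> A \<union> (\<Union>p\<in>B. (\<lambda>i. p * i) ` {1..x div p})"
    proof (cases "n \<in> A")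
      case False
      then obtain p where p: "prime p" "p dvd n" "p > m"
        using n by (auto simp: A_def not_le)
      then obtain i where i: "n = p * i" by (elim dvdE)
      have "p \<le> n" using p n by (auto dest: dvd_imp_le)
      then have "p \<in> B" using p n by (auto simp: B_def)
      moreover have "i \<in> {1..x div p}"
        using n i p by (auto simp: less_eq_div_iff_mult_less_eq prime_gt_0_nat mult.commute intro: Nat.gr0I)
      ultimately show ?thesis using i by blast
    qed simp
  qed
  then have "card {1..x} \<le> card (A \<union> (\<Union>p\<in>B. (\<lambda>i. p * i) ` {1..x div p}))"
    by (rule card_mono[rotated]) (auto simp: A_def finB)
  also have "\<dots> \<le> card A + card (\<Union>p\<in>B. (\<lambda>i. p * i) ` {1..x div p})"
    by (rule card_Un_le)
  also have "card (\<Union>p\<in>B. (\<lambda>i. p * i) ` {1..x div p}) \<le> (\<Sum>p\<in>B. card ((\<lambda>i. p * i) ` {1..x div p}))"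
    by (rule card_UN_le[OF finB])
  also have "(\<Sum>p\<in>B. card ((\<lambda>i. p * i) ` {1..x div p})) \<le> (\<Sum>p\<in>B. x div p)"
    by (intro sum_mono order_trans[OF card_image_le]) auto
  finally have "x \<le> card A + (\<Sum>p\<in>B. x div p)"
    by simp
  then have "real x \<le> real (card A) + real (\<Sum>p\<in>B. x div p)"
    by (metis of_nat_add of_nat_mono)
  also have "real (\<Sum>p\<in>B. x div p) \<le> (\<Sum>p\<in>B. real x * (1 / real p))"
    unfolding of_nat_sum by (intro sum_mono) (simp add: of_nat_div_le_of_nat)
  also have "\<dots> = real x * (\<Sum>p\<in>B. 1 / real p)"
    by (simp add: sum_distrib_left)
  also have "\<dots> \<le> real x * (1 / 2)"
    by (intro mult_left_mono small finB) (auto simp: B_def)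
  finally have A1: "real x \<le> 2 * real (card A)" by simp
  have "A \<subseteq> (\<lambda>(S, b). \<Prod>S * b\<^sup>2) ` (Pow {1..m} \<times> {1..K})"
  proof
    fix n assume n: "n \<in> A"
    define S where "S = {p \<in> prime_factors n. odd (multiplicity p n)}"
    define b where "b = (\<Prod>p\<in>prime_factors n. p ^ (multiplicity p n div 2))"
    have n0: "n > 0" using n by (auto simp: A_def)
    have "n = (\<Prod>p\<in>prime_factors n. p ^ multiplicity p n)"
      using n0 by (simp add: prime_factorization_nat)
    also have "\<dots> = (\<Prod>p\<in>prime_factors n. (if odd (multiplicity p n) then p else 1) * (p ^ (multiplicity p n div 2))\<^sup>2)"
    proof (intro prod.cong refl)
      fix p
      have "multiplicity p n = multiplicity p n mod 2 + (multiplicity p n div 2) * 2" by simp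
      then have "p ^ multiplicity p n = p ^ (multiplicity p n mod 2) * (p ^ (multiplicity p n div 2))\<^sup>2"
        by (metis power_add power_mult)
      then show "p ^ multiplicity p n = (if odd (multiplicity p n) then p else 1) * (p ^ (multiplicity p n div 2))\<^sup>2"
        by (simp add: odd_iff_mod_2_eq_one)
    qed
    also have "\<dots> = \<Prod>S * b\<^sup>2"
      unfolding prod.distrib S_def b_def prod_power_distrib
      by (simp add: prod.inter_filter)
    finally have eq: "n = \<Prod>S * b\<^sup>2" .
    have "S \<subseteq> {1..m}"
      using n by (auto simp: S_def A_def prime_factors_dvd prime_ge_1_nat)
    moreover have "b > 0" using eq n0 by (auto intro: Nat.gr0I)
    moreover have "b\<^sup>2 \<le> K\<^sup>2"
      using eq n n0 unfolding A_def x_def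
      by (metis (no_types, lifting) atLeastAtMost_iff dvd_imp_le dvd_triv_right le_trans mem_Collect_eq)
    then have "b \<le> K" by simp
    ultimately show "n \<in> (\<lambda>(S, b). \<Prod>S * b\<^sup>2) ` (Pow {1..m} \<times> {1..K})"
      by (intro image_eqI[of _ _ "(S, b)"]) (use eq in auto)
  qed
  then have "card A \<le> card ((\<lambda>(S, b). \<Prod>S * b\<^sup>2) ` (Pow {1..m} \<times> {1..K}))"
    by (rule card_mono[rotated]) auto
  also have "\<dots> \<le> card (Pow {1..m} \<times> {1..K})" by (rule card_image_le) auto
  also have "\<dots> = 2 ^ m * K" by (simp add: card_cartesian_product card_Pow)
  finally have "x \<le> 2 * (2 ^ m * K)" using A1 by linarith
  moreover have "x = 4 * (2 ^ m * K)" by (simp add: x_def K_def power2_eq_square)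
  moreover have "2 ^ m * K > 0" by (simp add: K_def)
  ultimately show False by linarith
qed

lemma ex_primes_reciprocal_sum_gt:
  "\<exists>B. finite B \<and> (\<forall>p\<in>B. prime p \<and> p > m) \<and> (\<Sum>p\<in>B. 1 / real p) \<ge> real n / 2"
proof (induction n)
  case 0
  then show ?case by (intro exI[of _ "{}"]) auto
next
  case (Suc n)
  then obtain B where B: "finite B" "\<forall>p\<in>B. prime p \<and> p > m" "(\<Sum>p\<in>B. 1 / real p) \<ge> real n / 2"
    by blast
  obtain C where C: "finite C" "\<forall>p\<in>C. prime p \<and> p > Max (insert m B)" "(\<Sum>p\<in>C. 1 / real p) > 1 / 2"
    using ex_primes_reciprocal_sum_gt_half[of "Max (insert m B)"] by blast
  have C2: "p > m" "p \<notin> B" if "p \<in> C" for p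
    using C(2) B(1) that by force+
  then have "B \<inter> C = {}" by blast
  then have "(\<Sum>p\<in>B \<union> C. 1 / real p) \<ge> real (Suc n) / 2"
    using B C by (simp add: sum.union_disjoint field_simps)
  then show ?case
    using B C C2 by (intro exI[of _ "B \<union> C"]) auto
qed

text \<open>The proportion of residues exactly divisible by no p in B is the product of the 1 - (p -
  1)/p^2. As p - 1 >= p/2, each factor is at most exp(-1/(2p)), and the sum of 1/p over B can be
  made as large as desired.\<close>

lemma ex_primes_product_less:
  fixes \<epsilon> :: real
  assumes "\<epsilon> > 0"
  shows "\<exists>B. finite B \<and> (\<forall>p\<in>B. prime p \<and> p > m) \<and>
    (\<Prod>p\<in>B. real (p\<^sup>2) - (real p - 1)) < \<epsilon> * (\<Prod>p\<in>B. real (p\<^sup>2))"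
proof -
  obtain n :: nat where n: "exp (- (real n / 4)) < \<epsilon>"
  proof -
    have "((\<lambda>n. exp (- (real n / 4))) \<longlongrightarrow> 0) sequentially" by real_asymp
    then have "\<forall>\<^sub>F n in sequentially. exp (- (real n / 4)) < \<epsilon>"
      using assms by (rule order_tendstoD)
    then show ?thesis using that by (auto simp: eventually_sequentially)
  qed
  obtain B where B: "finite B" "\<forall>p\<in>B. prime p \<and> p > m" "(\<Sum>p\<in>B. 1 / real p) \<ge> real n / 2"
    using ex_primes_reciprocal_sum_gt[of m n] by blast
  have pp: "p \<ge> 2" if "p \<in> B" for p using B that prime_ge_2_nat by blast
  have "(\<Prod>p\<in>B. real (p\<^sup>2) - (real p - 1)) \<le> (\<Prod>p\<in>B. real (p\<^sup>2) * exp (- (1 / (2 * real p))))"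
  proof (intro prod_mono conjI)
    fix p assume "p \<in> B"
    then have p: "real p \<ge> 2" using pp by force
    show "0 \<le> real (p\<^sup>2) - (real p - 1)" proof -
      have "real p \<le> (real p)\<^sup>2" using self_le_power[of "real p" 2] p by simp
      then show ?thesis unfolding of_nat_power by linarith
    qed
    have "real (p\<^sup>2) - (real p - 1) \<le> real (p\<^sup>2) * (1 - 1 / (2 * real p))"
      using p by (simp add: power2_eq_square field_simps)
    also have "\<dots> \<le> real (p\<^sup>2) * exp (- (1 / (2 * real p)))"
      using exp_ge_add_one_self[of "- (1 / (2 * real p))"] by (intro mult_left_mono) auto
    finally show "real (p\<^sup>2) - (real p - 1) \<le> real (p\<^sup>2) * exp (- (1 / (2 * real p)))" .
  qed
  also have "\<dots> = exp (- ((\<Sum>p\<in>B. 1 / real p) / 2)) * (\<Prod>p\<in>B. real (p\<^sup>2))"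
    using B(1) by (simp add: prod.distrib exp_sum[symmetric] sum_negf sum_divide_distrib mult.commute)
  also have "\<dots> \<le> exp (- (real n / 4)) * (\<Prod>p\<in>B. real (p\<^sup>2))"
    using B(3) by (intro mult_right_mono) (auto intro!: prod_nonneg)
  also have "\<dots> < \<epsilon> * (\<Prod>p\<in>B. real (p\<^sup>2))"
    using n pp by (intro mult_strict_right_mono prod_pos) force+
  finally show ?thesis using B by blast
qed

section \<open>Density of sets defined by exact divisibility\<close>

lemma card_periodic_le:
  fixes P :: "nat \<Rightarrow> bool"
  assumes "Q > 0" "\<And>n. P (n mod Q) \<longleftrightarrow> P n"
  shows "card {n. n < Q * t \<and> P n} = t * card {r. r < Q \<and> P r}"
proof (induction t)
  case (Suc t)
  have "{n. n < Q * Suc t \<and> P n} = {n. n < Q * t \<and> P n} \<union> (\<lambda>r. Q * t + r) ` {r. r < Q \<and> P r}"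
  proof (intro Set.set_eqI iffI)
    fix n assume n: "n \<in> {n. n < Q * Suc t \<and> P n}"
    show "n \<in> {n. n < Q * t \<and> P n} \<union> (\<lambda>r. Q * t + r) ` {r. r < Q \<and> P r}"
    proof (cases "n < Q * t")
      case False
      then have "n = Q * t + (n - Q * t)" "n - Q * t < Q" using n by auto
      moreover have "P (n - Q * t)"
        using n assms(2)[of n] assms(2)[of "n - Q * t"] \<open>n = Q * t + (n - Q * t)\<close>
        by (metis mem_Collect_eq mod_mult_self4)
      ultimately show ?thesis by blast
    qed (use n in auto)
  next
    fix n assume "n \<in> {n. n < Q * t \<and> P n} \<union> (\<lambda>r. Q * t + r) ` {r. r < Q \<and> P r}"
    then show "n \<in> {n. n < Q * Suc t \<and> P n}"
      using assms(2)[of n] by (auto; metis assms(2) mod_mult_self4)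
  qed
  moreover have "card ({n. n < Q * t \<and> P n} \<union> (\<lambda>r. Q * t + r) ` {r. r < Q \<and> P r}) =
      card {n. n < Q * t \<and> P n} + card ((\<lambda>r. Q * t + r) ` {r. r < Q \<and> P r})"
    by (rule card_Un_disjoint) auto
  ultimately show ?case using Suc by (simp add: card_image)
qed simp

text \<open>The last, incomplete period costs at most a constant number of elements; the strictness
  of the inequality for a full period absorbs it for large x.\<close>

lemma eventually_card_periodic_le:
  fixes P :: "nat \<Rightarrow> bool" and \<epsilon> :: real
  assumes "Q > 0" "\<And>n. P (n mod Q) \<longleftrightarrow> P n" "real (card {r. r < Q \<and> P r}) < \<epsilon> * real Q"
  shows "\<forall>\<^sub>F x in sequentially. real (card {n. n < x \<and> P n}) \<le> \<epsilon> * real x"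
proof -
  define c where "c = card {r. r < Q \<and> P r}"
  have bound: "real (card {n. n < x \<and> P n}) \<le> real x * (real c / real Q) + real c" for x
  proof -
    have "x < Q * Suc (x div Q)"
      using assms(1) by (metis dividend_less_times_div mult_Suc_right add.commute)
    then have "card {n. n < x \<and> P n} \<le> card {n. n < Q * Suc (x div Q) \<and> P n}"
      by (intro card_mono) auto
    also have "\<dots> = Suc (x div Q) * c"
      unfolding c_def by (rule card_periodic_le) (use assms in auto)
    finally have "real (card {n. n < x \<and> P n}) \<le> real (Suc (x div Q) * c)" by linarith
    also have "\<dots> = real (x div Q) * real c + real c" by (simp add: algebra_simps)
    also have "real (x div Q) \<le> real x / real Q" by (rule of_nat_div_le_of_nat)
    finally show ?thesis by (simp add: mult_right_mono)
  qed
  have pos: "\<epsilon> - real c / real Q > 0"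
    using assms(1,3) by (simp add: c_def field_simps)
  have "\<forall>\<^sub>F x in sequentially. real c / (\<epsilon> - real c / real Q) \<le> real x"
    by real_asymp
  then show ?thesis
  proof eventually_elim
    case (elim x)
    then have "real c \<le> real x * (\<epsilon> - real c / real Q)"
      using pos by (simp add: pos_divide_le_eq)
    then show ?case using bound[of x] by (simp add: algebra_simps)
  qed
qed

text \<open>Induction on N: a finite set B of primes above m is chosen such that few n are exactly
  divisible by none of them, and the induction hypothesis supplies N further primes above all of B.
  The bound m is generalised to keep these primes distinct from those in B.\<close>

lemma eventually_card_few_exact_primes:
  fixes \<epsilon> :: real
  assumes "\<epsilon> > 0"
  shows "\<forall>\<^sub>F x in sequentially. real (card {n. n < x \<and>
     \<not> (\<exists>S. finite S \<and> card S = N \<and> (\<forall>p\<in>S. prime p \<and> p > m \<and> exact_prime p n))}) \<le> \<epsilon> * real x"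
  using assms
proof (induction N arbitrary: m \<epsilon>)
  case 0
  have "\<exists>S. finite S \<and> card S = 0 \<and> (\<forall>p\<in>S. prime p \<and> p > m \<and> exact_prime p n)" for n
    by (intro exI[of _ "{}"]) auto
  then have "{n. n < x \<and> \<not> (\<exists>S. finite S \<and> card S = 0 \<and> (\<forall>p\<in>S. prime p \<and> p > m \<and> exact_prime p n))} = {}" for x
    by blast
  then show ?case using 0 by (simp only: card.empty) simp
next
  case (Suc N)
  obtain B where B: "finite B" "\<forall>p\<in>B. prime p \<and> p > m"
    "(\<Prod>p\<in>B. real (p\<^sup>2) - (real p - 1)) < (\<epsilon> / 2) * (\<Prod>p\<in>B. real (p\<^sup>2))"
    using ex_primes_product_less[of "\<epsilon> / 2" m] Suc.prems by auto
  define m' where "m' = Max (insert m B)"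
  define Q where "Q = (\<Prod>p\<in>B. p\<^sup>2)"
  define bad where "bad N m n \<longleftrightarrow> \<not> (\<exists>S. finite S \<and> card S = N \<and> (\<forall>p\<in>S. prime p \<and> p > m \<and> exact_prime p n))" for N m n
  have le: "m' \<ge> p" if "p \<in> B" for p using B that by (simp add: m'_def)
  have "m' \<ge> m" using B by (simp add: m'_def)
  have split: "bad N m' n \<or> (\<forall>p\<in>B. \<not> exact_prime p n)" if "bad (Suc N) m n" for n
  proof (rule ccontr)
    assume "\<not> ?thesis"
    then obtain S p where S: "finite S" "card S = N" "\<forall>p\<in>S. prime p \<and> p > m' \<and> exact_prime p n"
      and p: "p \<in> B" "exact_prime p n"
      unfolding bad_def by blast
    have "p \<notin> S" using le[OF p(1)] S(3) by (meson not_le)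
    have "\<forall>q\<in>insert p S. prime q \<and> q > m \<and> exact_prime q n"
      using S(3) B(2) p \<open>m' \<ge> m\<close> by (metis insert_iff le_less_trans)
    moreover have "finite (insert p S)" "card (insert p S) = Suc N"
      using S \<open>p \<notin> S\<close> by auto
    ultimately have "\<exists>S. finite S \<and> card S = Suc N \<and> (\<forall>p\<in>S. prime p \<and> p > m \<and> exact_prime p n)"
      by blast
    then show False using that unfolding bad_def by blast
  qed
  have 1: "\<forall>\<^sub>F x in sequentially. real (card {n. n < x \<and> bad N m' n}) \<le> \<epsilon> / 2 * real x"
    unfolding bad_def using Suc.prems by (intro Suc.IH) simp
  have 2: "\<forall>\<^sub>F x in sequentially. real (card {n. n < x \<and> (\<forall>p\<in>B. \<not> exact_prime p n)}) \<le> \<epsilon> / 2 * real x"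
  proof (rule eventually_card_periodic_le)
    show "Q > 0" using B by (auto simp: Q_def intro!: prod_pos prime_gt_0_nat)
    show "(\<forall>p\<in>B. \<not> exact_prime p (n mod Q)) = (\<forall>p\<in>B. \<not> exact_prime p n)" for n
      using exact_prime_mod[of _ Q n] B by (auto simp: Q_def intro: dvd_prodI)
    show "real (card {r. r < Q \<and> (\<forall>p\<in>B. \<not> exact_prime p r)}) < \<epsilon> / 2 * real Q"
      unfolding Q_def using B by (subst card_no_exact_prime) auto
  qed
  show ?case
    using 1 2
  proof eventually_elim
    case (elim x)
    have "{n. n < x \<and> bad (Suc N) m n} \<subseteq> {n. n < x \<and> bad N m' n} \<union> {n. n < x \<and> (\<forall>p\<in>B. \<not> exact_prime p n)}"
      using split by blast
    then have "card {n. n < x \<and> bad (Suc N) m n} \<le> card ({n. n < x \<and> bad N m' n} \<union> {n. n < x \<and> (\<forall>p\<in>B. \<not> exact_prime p n)})"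
      by (rule card_mono[rotated]) auto
    also have "\<dots> \<le> card {n. n < x \<and> bad N m' n} + card {n. n < x \<and> (\<forall>p\<in>B. \<not> exact_prime p n)}"
      by (rule card_Un_le)
    finally show ?case using elim unfolding bad_def by linarith
  qed
qed

lemma density_one_if_many_exact_primes:
  fixes A :: "nat set"
  assumes A: "\<And>n. (\<exists>S. finite S \<and> card S = N \<and> (\<forall>p\<in>S. prime p \<and> p > m \<and> exact_prime p n)) \<Longrightarrow> n \<in> A"
  shows "((\<lambda>X::real. real (card {n. real n \<le> X \<and> n \<in> A}) / X) \<longlongrightarrow> 1) at_top"
proof (rule tendstoI)
  fix \<epsilon> :: real assume "\<epsilon> > 0"
  have "\<forall>\<^sub>F x in sequentially. real (card {n. n < x \<and> n \<notin> A}) \<le> \<epsilon> / 4 * real x"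
  proof (rule eventually_mono[OF eventually_card_few_exact_primes[of "\<epsilon> / 4" N m]])
    fix x assume x: "real (card {n. n < x \<and>
     \<not> (\<exists>S. finite S \<and> card S = N \<and> (\<forall>p\<in>S. prime p \<and> p > m \<and> exact_prime p n))}) \<le> \<epsilon> / 4 * real x"
    have "card {n. n < x \<and> n \<notin> A} \<le> card {n. n < x \<and>
     \<not> (\<exists>S. finite S \<and> card S = N \<and> (\<forall>p\<in>S. prime p \<and> p > m \<and> exact_prime p n))}"
    proof (rule card_mono)
      show "{n. n < x \<and> n \<notin> A} \<subseteq> {n. n < x \<and>
        \<not> (\<exists>S. finite S \<and> card S = N \<and> (\<forall>p\<in>S. prime p \<and> p > m \<and> exact_prime p n))}"
        using A by blast
    qed auto
    then show "real (card {n. n < x \<and> n \<notin> A}) \<le> \<epsilon> / 4 * real x" using x by linarith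
  qed (use \<open>\<epsilon> > 0\<close> in auto)
  then obtain x0 where x0: "\<And>x. x \<ge> x0 \<Longrightarrow> real (card {n. n < x \<and> n \<notin> A}) \<le> \<epsilon> / 4 * real x"
    by (auto simp: eventually_sequentially)
  \<comment> \<open>The lower bound 4 / \<epsilon> on X makes the rounding error 1 at most a quarter
    of \<epsilon> X; the exceptional n cost at most half of it.\<close>
  have "\<forall>\<^sub>F X in at_top. X \<ge> max (real x0 + 1) (max 1 (4 / \<epsilon>))"
    by (rule eventually_ge_at_top)
  then show "\<forall>\<^sub>F X in at_top. dist (real (card {n. real n \<le> X \<and> n \<in> A}) / X) 1 < \<epsilon>"
  proof eventually_elim
    case (elim X)
    define x where "x = nat \<lfloor>X\<rfloor> + 1"
    have X: "X \<ge> 1" "X \<ge> real x0 + 1" "1 \<le> \<epsilon> / 4 * X" using elim \<open>\<epsilon> > 0\<close> by (auto simp: field_simps)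
    have lt: "real n \<le> X \<longleftrightarrow> n < x" for n
      using X by (simp add: x_def less_Suc_eq_le le_nat_iff le_floor_iff)
    have x: "real x \<le> X + 1" "X < real x" "x \<ge> x0"
      using X unfolding x_def by linarith+
    have "card {n. n < x} = card {n. n < x \<and> n \<in> A} + card {n. n < x \<and> n \<notin> A}"
    proof -
      have "{n. n < x} = {n. n < x \<and> n \<in> A} \<union> {n. n < x \<and> n \<notin> A}" by blast
      then show ?thesis by (metis (no_types, lifting) card_Un_disjoint finite_Collect_less_nat
          finite_Un disjoint_iff mem_Collect_eq)
    qed
    then have c: "real x = real (card {n. n < x \<and> n \<in> A}) + real (card {n. n < x \<and> n \<notin> A})"
      by (simp flip: of_nat_add)
    have b: "real (card {n. n < x \<and> n \<notin> A}) \<le> \<epsilon> / 4 * (X + 1)"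
      using x0[OF x(3)] x(1) \<open>\<epsilon> > 0\<close> by (meson mult_left_mono order_trans divide_nonneg_nonneg less_imp_le zero_le_numeral)
    define e where "e = \<epsilon> * X"
    have "\<epsilon> / 4 * (X + 1) \<le> e / 2" "1 \<le> e / 4"
      using X \<open>\<epsilon> > 0\<close> by (simp_all add: e_def field_simps)
    then have "\<bar>real (card {n. n < x \<and> n \<in> A}) - X\<bar> \<le> 3 / 4 * e"
      unfolding abs_le_iff using c b x by linarith
    then have "\<bar>real (card {n. n < x \<and> n \<in> A}) - X\<bar> \<le> 3 / 4 * \<epsilon> * X"
      by (simp add: e_def)
    then have "\<bar>real (card {n. n < x \<and> n \<in> A}) / X - 1\<bar> \<le> 3 / 4 * \<epsilon>"
      using X by (simp add: abs_le_iff field_simps)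
    then show ?case using \<open>\<epsilon> > 0\<close> by (simp add: lt dist_real_def)
  qed
qed

subsection \<open>Commuting operators nilpotent modulo 2\<close>

definition poly_shift :: "int poly \<Rightarrow> (nat \<Rightarrow> complex) \<Rightarrow> nat \<Rightarrow> complex" where
  "poly_shift p y j = (\<Sum>l\<le>degree p. of_int (coeff p l) * y (j + l))"

lemma poly_shift_altdef:
  assumes "degree p \<le> n"
  shows "poly_shift p y j = (\<Sum>l\<le>n. of_int (coeff p l) * y (j + l))"
  unfolding poly_shift_def using assms
  by (intro sum.mono_neutral_left) (auto simp: coeff_eq_0)

lemma poly_shift_0 [simp]: "poly_shift 0 y = (\<lambda>j. 0)"
  by (simp add: poly_shift_def fun_eq_iff)

lemma poly_shift_1 [simp]: "poly_shift 1 y = y"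
  by (simp add: poly_shift_def fun_eq_iff)

lemma poly_shift_add: "poly_shift (p + q) y j = poly_shift p y j + poly_shift q y j"
proof -
  define n where "n = max (degree p) (degree q)"
  have "degree p \<le> n" "degree q \<le> n" "degree (p + q) \<le> n"
    by (auto simp: n_def degree_add_le_max)
  then show ?thesis
    by (simp add: poly_shift_altdef[of _ n] sum.distrib ring_distribs)
qed

lemma poly_shift_sum: "poly_shift (\<Sum>i\<in>I. f i) y j = (\<Sum>i\<in>I. poly_shift (f i) y j)"
  by (induction I rule: infinite_finite_induct) (auto simp: poly_shift_add)

lemma poly_shift_smult: "poly_shift (Polynomial.smult c p) y j = of_int c * poly_shift p y j"
  by (simp add: poly_shift_altdef[of _ "degree p"] degree_smult_le sum_distrib_left mult.assoc)

lemma poly_shift_pCons: "poly_shift (pCons a p) y j = of_int a * y j + poly_shift p y (Suc j)"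
proof -
  have "poly_shift (pCons a p) y j = (\<Sum>l\<le>Suc (degree p). of_int (coeff (pCons a p) l) * y (j + l))"
    by (rule poly_shift_altdef) (simp add: degree_pCons_le)
  also have "\<dots> = of_int a * y j + poly_shift p y (Suc j)"
    by (subst sum.atMost_Suc_shift) (simp add: poly_shift_def)
  finally show ?thesis .
qed

lemma poly_shift_mult: "poly_shift (p * q) y j = poly_shift p (poly_shift q y) j"
proof (induction p arbitrary: j)
  case (pCons a p)
  show ?case
    by (simp add: mult_pCons_left poly_shift_add poly_shift_smult poly_shift_pCons pCons.IH)
qed simp

text \<open>The polynomial variable acts as the shift, so the vector y is killed by the
  characteristic matrix; multiplying by the adjugate shows that the determinant kills every entry.
  This covers linearly dependent sequences, so redundant generators are allowed.\<close>

lemma poly_shift_char_poly: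
  fixes B :: "nat \<Rightarrow> nat \<Rightarrow> int" and y :: "nat \<Rightarrow> nat \<Rightarrow> complex"
  assumes rec: "\<And>i j. i < D \<Longrightarrow> y i (Suc j) = (\<Sum>l<D. of_int (B i l) * y l j)"
    and i: "i < D"
  shows "poly_shift (char_poly (mat D D (\<lambda>(i, l). B i l))) (y i) j = 0"
proof -
  define M where "M = mat D D (\<lambda>(i, l). B i l)"
  define C where "C = char_poly_matrix M"
  have M: "M \<in> carrier_mat D D" by (simp add: M_def)
  have C: "C \<in> carrier_mat D D" unfolding C_def using M by (rule char_poly_matrix_closed)
  have zero: "(\<Sum>l<D. poly_shift (C $$ (k, l)) (y l) j) = 0" if "k < D" for k j
  proof -
    have "poly_shift (C $$ (k, l)) (y l) j = (if l = k then y k (Suc j) else 0) - of_int (B k l) * y l j"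
      if "l < D" for l
      using \<open>k < D\<close> that by (auto simp: C_def char_poly_matrix_def M_def poly_shift_pCons)
    then have "(\<Sum>l<D. poly_shift (C $$ (k, l)) (y l) j) =
        (\<Sum>l<D. (if l = k then y k (Suc j) else 0) - of_int (B k l) * y l j)"
      by simp
    also have "\<dots> = 0"
      using rec[OF \<open>k < D\<close>] \<open>k < D\<close> by (simp add: sum_subtractf)
    finally show ?thesis .
  qed
  have adj: "adj_mat C * C = det C \<cdot>\<^sub>m 1\<^sub>m D" "adj_mat C \<in> carrier_mat D D"
    using adj_mat[OF C] by auto
  have "poly_shift (det C) (y i) j = (\<Sum>l<D. poly_shift ((det C \<cdot>\<^sub>m 1\<^sub>m D) $$ (i, l)) (y l) j)"
  proof -
    have "poly_shift ((det C \<cdot>\<^sub>m 1\<^sub>m D) $$ (i, l)) (y l) j = (if l = i then poly_shift (det C) (y i) j else 0)"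
      if "l < D" for l using that i by auto
    then show ?thesis using i by simp
  qed
  also have "\<dots> = (\<Sum>l<D. \<Sum>k<D. poly_shift (adj_mat C $$ (i, k)) (poly_shift (C $$ (k, l)) (y l)) j)"
  proof (intro sum.cong refl)
    fix l assume "l \<in> {..<D}"
    then have "(det C \<cdot>\<^sub>m 1\<^sub>m D) $$ (i, l) = (\<Sum>k<D. adj_mat C $$ (i, k) * C $$ (k, l))"
      unfolding adj(1)[symmetric] using i adj(2) C
      by (auto simp: scalar_prod_def lessThan_atLeast0 intro!: sum.cong)
    then show "poly_shift ((det C \<cdot>\<^sub>m 1\<^sub>m D) $$ (i, l)) (y l) j =
      (\<Sum>k<D. poly_shift (adj_mat C $$ (i, k)) (poly_shift (C $$ (k, l)) (y l)) j)"
      by (simp add: poly_shift_sum poly_shift_mult)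
  qed
  also have "\<dots> = (\<Sum>k<D. \<Sum>l<D. poly_shift (adj_mat C $$ (i, k)) (poly_shift (C $$ (k, l)) (y l)) j)"
    by (rule sum.swap)
  also have "\<dots> = (\<Sum>k<D. poly_shift (adj_mat C $$ (i, k)) (\<lambda>j. \<Sum>l<D. poly_shift (C $$ (k, l)) (y l) j) j)"
    unfolding poly_shift_def[of "adj_mat C $$ _"]
    by (rule sum.cong[OF refl], subst sum.swap) (simp add: sum_distrib_left)
  also have "\<dots> = 0"
  proof (rule sum.neutral, rule ballI)
    fix k assume "k \<in> {..<D}"
    then have "(\<lambda>j. \<Sum>l<D. poly_shift (C $$ (k, l)) (y l) j) = (\<lambda>j. 0)"
      using zero by auto
    then show "poly_shift (adj_mat C $$ (i, k)) (\<lambda>j. \<Sum>l<D. poly_shift (C $$ (k, l)) (y l) j) j = 0"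
      by (simp add: poly_shift_def)
  qed
  finally show ?thesis
    by (simp add: C_def M_def char_poly_def)
qed

text \<open>Dividing the j-th term by 2^j replaces 2B by B; undoing this puts the factor 2^(D - l)
  on the l-th coefficient of the characteristic polynomial of B, which is even for l < D. The
  integers c depend on B only and therefore serve all solutions at once.\<close>

lemma two_divides_recurrence:
  fixes B :: "nat \<Rightarrow> nat \<Rightarrow> int"
  shows "\<exists>c::nat \<Rightarrow> int. \<forall>z::nat \<Rightarrow> nat \<Rightarrow> complex.
     (\<forall>i<D. \<forall>j. z i (Suc j) = (\<Sum>l<D. of_int (2 * B i l) * z l j)) \<longrightarrow>
     (\<forall>i<D. z i D = 2 * (\<Sum>l<D. of_int (c l) * z i l))"
proof -
  define p where "p = char_poly (mat D D (\<lambda>(i, l). B i l))"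
  have p: "degree p = D" "coeff p D = 1"
    using degree_monic_char_poly[of "mat D D (\<lambda>(i, l). B i l)" D] by (auto simp: p_def)
  define c where "c l = - coeff p l * 2 ^ (D - Suc l)" for l
  show ?thesis
  proof (intro exI[of _ c] allI impI)
    fix z :: "nat \<Rightarrow> nat \<Rightarrow> complex" and i
    assume z: "\<forall>i<D. \<forall>j. z i (Suc j) = (\<Sum>l<D. of_int (2 * B i l) * z l j)" and i: "i < D"
    define y where "y i j = z i j / 2 ^ j" for i j
    have "y i (Suc j) = (\<Sum>l<D. of_int (B i l) * y l j)" if "i < D" for i j
      using z that by (simp add: y_def sum_divide_distrib mult.assoc flip: sum_distrib_left)
    then have "poly_shift p (y i) 0 = 0"
      unfolding p_def using i by (intro poly_shift_char_poly)
    then have "(\<Sum>l<D. of_int (coeff p l) * y i l) + y i D = 0"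
      using p by (simp add: poly_shift_def flip: lessThan_Suc_atMost)
    then have "2 ^ D * ((\<Sum>l<D. of_int (coeff p l) * y i l) + y i D) = 0" by simp
    then have "(\<Sum>l<D. 2 ^ D * (of_int (coeff p l) * y i l)) + z i D = 0"
      by (simp add: ring_distribs sum_distrib_left y_def)
    moreover have "2 ^ D * (of_int (coeff p l) * y i l) = - (2 * (of_int (c l) * z i l))" if "l < D" for l
    proof -
      have "(2::complex) ^ D = 2 * 2 ^ (D - Suc l) * 2 ^ l"
        using that by (simp flip: power_Suc power_add add: Suc_diff_Suc)
      then show ?thesis by (simp add: c_def y_def)
    qed
    ultimately show "z i D = 2 * (\<Sum>l<D. of_int (c l) * z i l)"
      by (simp add: sum_negf sum_distrib_left add_eq_0_iff)
  qed
qed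

text \<open>Applied to a relation with complex coefficients between integers, such a functional
  makes the coefficients rational and keeps the one equal to c nonzero.\<close>

lemma rat_linear_functional:
  fixes c :: complex
  assumes "c \<noteq> 0"
  shows "\<exists>l :: complex \<Rightarrow> rat. (\<forall>x y. l (x + y) = l x + l y) \<and> (\<forall>q x. l (of_rat q * x) = q * l x) \<and> l c = 1"
proof -
  interpret vector_space_pair "\<lambda>(q::rat) (z::complex). of_rat q * z" "\<lambda>(q::rat) (z::rat). q * z"
    by unfold_locales (auto simp: algebra_simps of_rat_add of_rat_mult)
  have "vs1.independent {c}"
    using assms by (simp add: vs1.dependent_single)
  then obtain g where g: "Vector_Spaces.linear (\<lambda>(q::rat) (z::complex). of_rat q * z) (\<lambda>(q::rat) (z::rat). q * z) g"
      "g c = 1"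
    using linear_independent_extend[of "{c}" "\<lambda>_. 1"] by auto
  interpret g: Vector_Spaces.linear "\<lambda>(q::rat) (z::complex). of_rat q * z" "\<lambda>(q::rat) (z::rat). q * z" g
    by (rule g(1))
  show ?thesis
    using g(2) g.add g.scale by blast
qed

text \<open>The rational relation is scaled to integer coefficients without common divisor. Then
  some coefficient is odd, and the set J of odd ones gives a relation modulo 2. The quotient by 2 is
  again an integer combination of the sequences, so it stays in any lattice that contains
  them.\<close>

lemma ex_even_integer_relation:
  fixes a :: "nat \<Rightarrow> 'b \<Rightarrow> int" and c :: "nat \<Rightarrow> complex"
  assumes c: "\<And>n. (\<Sum>k\<le>D. c k * of_int (a k n)) = 0" "k0 \<le> D" "c k0 \<noteq> 0"
  shows "\<exists>J d. J \<noteq> {} \<and> J \<subseteq> {..D} \<and> (\<forall>n. (\<Sum>k\<in>J. a k n) = 2 * (\<Sum>k\<le>D. d k * a k n))"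
proof -
  obtain l :: "complex \<Rightarrow> rat" where l: "\<And>x y. l (x + y) = l x + l y" "\<And>q x. l (of_rat q * x) = q * l x"
    "l (c k0) = 1"
    using rat_linear_functional[OF c(3)] by blast
  have l0: "l 0 = 0" using l(1)[of 0 0] by simp
  have lsum: "l (\<Sum>k\<in>I. f k) = (\<Sum>k\<in>I. l (f k))" for I :: "nat set" and f
    by (induction I rule: infinite_finite_induct) (auto simp: l l0)
  have rel: "(\<Sum>k\<le>D. l (c k) * of_int (a k n)) = 0" for n
  proof -
    have "l (c k * of_int (a k n)) = l (c k) * of_int (a k n)" for k
      using l(2)[of "of_int (a k n)" "c k"] by (simp add: mult.commute)
    then show ?thesis using lsum[of "\<lambda>k. c k * of_int (a k n)" "{..D}"] c(1) l0 by simp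
  qed
  define N where "N = (\<Prod>k\<le>D. snd (quotient_of (l (c k))))"
  have "\<exists>s. of_int s = of_int N * l (c k)" if "k \<le> D" for k
  proof -
    have "l (c k) = of_int (fst (quotient_of (l (c k)))) / of_int (snd (quotient_of (l (c k))))"
      by (rule quotient_of_div) simp
    moreover have "snd (quotient_of (l (c k))) > 0" by (rule quotient_of_denom_pos') 
    moreover have "snd (quotient_of (l (c k))) dvd N"
      using dvd_prodI[of "{..D}" k "\<lambda>k. snd (quotient_of (l (c k)))"] that by (simp add: N_def)
    then obtain r where "N = snd (quotient_of (l (c k))) * r" by (elim dvdE)
    ultimately have "of_int (fst (quotient_of (l (c k))) * r) = of_int N * l (c k)"
      by (simp add: field_simps)
    then show ?thesis by blast
  qed
  then obtain s where s: "\<And>k. k \<le> D \<Longrightarrow> of_int (s k) = of_int N * l (c k)" by metis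
  have "N > 0" unfolding N_def by (intro prod_pos) (auto intro: quotient_of_denom_pos')
  then have "s k0 \<noteq> 0" using s[OF c(2)] l(3) by auto
  define G where "G = Gcd (s ` {..D})"
  have G0: "G \<noteq> 0" using \<open>s k0 \<noteq> 0\<close> c(2) by (auto simp: G_def Gcd_0_iff)
  have "\<exists>t. s k = G * t" if "k \<le> D" for k
    using that unfolding G_def by (metis Gcd_dvd atMost_iff dvdE imageI)
  then obtain t where t: "\<And>k. k \<le> D \<Longrightarrow> s k = G * t k" by metis
  have ts: "(\<Sum>k\<le>D. t k * a k n) = 0" for n
  proof -
    have "of_int (G * (\<Sum>k\<le>D. t k * a k n)) = (\<Sum>k\<le>D. of_int (s k) * of_int (a k n) :: rat)"
      by (simp add: sum_distrib_left t mult.assoc)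
    also have "\<dots> = of_int N * (\<Sum>k\<le>D. l (c k) * of_int (a k n))"
      by (simp add: s sum_distrib_left mult.assoc)
    also have "\<dots> = of_int 0"
      by (simp only: rel mult_zero_right of_int_0)
    finally have "G * (\<Sum>k\<le>D. t k * a k n) = 0"
      by (simp only: of_int_eq_iff)
    then show ?thesis using G0 by simp
  qed
  define J where "J = {k. k \<le> D \<and> odd (t k)}"
  have "J \<noteq> {}"
  proof
    assume "J = {}"
    then have "2 * G dvd s k" if "k \<le> D" for k
      using that t by (auto simp: J_def)
    then have "2 * G dvd G"
      unfolding G_def by (intro Gcd_greatest) auto
    then obtain r where "G = 2 * G * r" by (elim dvdE)
    from this[symmetric] have "G * (2 * r - 1) = 0" by (simp add: algebra_simps)
    then have "2 * r = 1" using G0 by simp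
    then show False by presburger
  qed
  moreover have "(\<Sum>k\<in>J. a k n) = 2 * (\<Sum>k\<le>D. (- (t k div 2)) * a k n)" for n
  proof -
    have "t k * a k n = 2 * ((t k div 2) * a k n) + (if odd (t k) then a k n else 0)" for k
    proof -
      have "t k = 2 * (t k div 2) + (if odd (t k) then 1 else 0)" by simp
      then have "t k * a k n = (2 * (t k div 2) + (if odd (t k) then 1 else 0)) * a k n" by simp
      then show ?thesis by (simp add: algebra_simps split: if_splits)
    qed
    then have "(\<Sum>k\<le>D. t k * a k n) = 2 * (\<Sum>k\<le>D. (t k div 2) * a k n) + (\<Sum>k\<le>D. if odd (t k) then a k n else 0)"
      by (simp only: sum.distrib sum_distrib_left)
    also have "(\<Sum>k\<le>D. if odd (t k) then a k n else 0) = (\<Sum>k\<in>J. a k n)"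
      unfolding J_def by (simp add: sum.inter_filter[symmetric])
    finally show ?thesis using ts[of n] by (simp add: sum_negf)
  qed
  moreover have "J \<subseteq> {..D}" by (auto simp: J_def)
  ultimately show ?thesis
    by (intro exI[of _ J] exI[of _ "\<lambda>k. - (t k div 2)"] conjI) blast+
qed

text \<open>Polynomials in the operators with natural numbers as coefficients; modulo 2 these
  represent all integral polynomials.\<close>

inductive_set operator_ring :: "('i \<Rightarrow> 'a \<Rightarrow> 'a) \<Rightarrow> 'i set \<Rightarrow> ('a::ab_group_add \<Rightarrow> 'a) set"
  for T :: "'i \<Rightarrow> 'a \<Rightarrow> 'a" and I :: "'i set" where
  id: "(\<lambda>x. x) \<in> operator_ring T I"
| zero: "(\<lambda>x. 0) \<in> operator_ring T I"
| add: "Y \<in> operator_ring T I \<Longrightarrow> Z \<in> operator_ring T I \<Longrightarrow> (\<lambda>x. Y x + Z x) \<in> operator_ring T I"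
| comp: "i \<in> I \<Longrightarrow> Y \<in> operator_ring T I \<Longrightarrow> (\<lambda>x. T i (Y x)) \<in> operator_ring T I"

text \<open>\<open>rank\<close> says that A/2A has dimension at most D over the field of two
  elements, in the form that produces a relation. \<open>T_nilpotent\<close> lets the exponent
  depend on the operator and on the element.\<close>

locale commuting_operators =
  fixes T :: "'i \<Rightarrow> 'a::ab_group_add \<Rightarrow> 'a" and I :: "'i set" and A :: "'a set" and D :: nat
  assumes T_add: "\<And>i x y. i \<in> I \<Longrightarrow> T i (x + y) = T i x + T i y"
    and T_comm: "\<And>i j x. i \<in> I \<Longrightarrow> j \<in> I \<Longrightarrow> T i (T j x) = T j (T i x)"
    and A_0: "0 \<in> A"
    and A_diff: "\<And>x y. x \<in> A \<Longrightarrow> y \<in> A \<Longrightarrow> x - y \<in> A"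
    and T_A: "\<And>i x. i \<in> I \<Longrightarrow> x \<in> A \<Longrightarrow> T i x \<in> A"
    and T_nilpotent: "\<And>i x. i \<in> I \<Longrightarrow> x \<in> A \<Longrightarrow> \<exists>e. \<exists>b\<in>A. (T i ^^ e) x = b + b"
    and rank: "\<And>x. (\<And>k. k \<le> D \<Longrightarrow> x k \<in> A) \<Longrightarrow>
        \<exists>J. J \<noteq> {} \<and> J \<subseteq> {..D} \<and> (\<exists>b\<in>A. (\<Sum>k\<in>J. x k) = b + b)"
begin

lemma A_add: "x \<in> A \<Longrightarrow> y \<in> A \<Longrightarrow> x + y \<in> A"
  using A_diff[of x "0 - y"] A_diff[of 0 y] A_0 by simp

definition A2 :: "'a set" where "A2 = {b + b | b. b \<in> A}"

lemma A2_add: "x \<in> A2 \<Longrightarrow> y \<in> A2 \<Longrightarrow> x + y \<in> A2"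
  unfolding A2_def by (auto simp: algebra_simps) (metis A_add add.assoc add.commute)

lemma A2_diff: "x \<in> A2 \<Longrightarrow> y \<in> A2 \<Longrightarrow> x - y \<in> A2"
  unfolding A2_def by clarsimp (metis A_diff add_diff_add)

lemma T_0: "i \<in> I \<Longrightarrow> T i 0 = 0"
  using T_add[of i 0 0] by simp

lemma op_add: "Y \<in> operator_ring T I \<Longrightarrow> Y (x + y) = Y x + Y y"
  by (induction Y rule: operator_ring.induct) (auto simp: T_add algebra_simps)

lemma op_A: "Y \<in> operator_ring T I \<Longrightarrow> x \<in> A \<Longrightarrow> Y x \<in> A"
  by (induction Y rule: operator_ring.induct) (auto simp: A_0 A_add T_A)

lemma op_A2: "Y \<in> operator_ring T I \<Longrightarrow> x \<in> A2 \<Longrightarrow> Y x \<in> A2"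
  unfolding A2_def using op_add op_A by blast

lemma op_comm: "Y \<in> operator_ring T I \<Longrightarrow> i \<in> I \<Longrightarrow> Y (T i x) = T i (Y x)"
  by (induction Y rule: operator_ring.induct) (auto simp: T_0 T_add T_comm)

lemma op_sum:
  assumes "finite J" "\<And>j. j \<in> J \<Longrightarrow> Y j \<in> operator_ring T I"
  shows "(\<lambda>x. \<Sum>j\<in>J. Y j x) \<in> operator_ring T I"
  using assms by (induction J rule: finite_induct) (auto intro: operator_ring.intros)

lemma fold_op: "set is \<subseteq> I \<Longrightarrow> (\<lambda>x. fold T is x) \<in> operator_ring T I"
proof (induction "is" rule: rev_induct)
  case (snoc i "is")
  then show ?case
    using operator_ring.comp[of i I "\<lambda>x. fold T is x" T] by simp
qed (auto simp: id_def intro: operator_ring.id)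

text \<open>The successive images of a, starting with a itself, are D + 1 vectors, so they satisfy a
  relation modulo 2A. Its earliest member x is the sum of the later ones, which is W x with W a
  multiple of a single nilpotent operator. As the operators commute, W is nilpotent on x modulo 2A;
  hence x lies in 2A, and so does the last vector.\<close>

lemma fold_T_in_A2:
  assumes "is": "set is \<subseteq> I" "length is = D" and a: "a \<in> A"
  shows "fold T is a \<in> A2"
proof -
  define x where "x j = fold T (take j is) a" for j
  have sub: "set (take j is) \<subseteq> I" "set (drop j is) \<subseteq> I" for j
    using "is" by (meson set_take_subset set_drop_subset subset_trans)+
  have xA: "x j \<in> A" for j
    unfolding x_def using op_A[OF fold_op[OF sub(1)[of j]] a] .
  obtain J b where J: "J \<noteq> {}" "J \<subseteq> {..D}" "b \<in> A" "(\<Sum>k\<in>J. x k) = b + b"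
    using rank[of x] xA by blast
  have finJ: "finite J" using J(2) finite_subset by blast
  define j where "j = Min J"
  have j: "j \<in> J" "\<And>k. k \<in> J \<Longrightarrow> j \<le> k"
    using J finJ by (auto simp: j_def)
  have later: "\<exists>Y\<in>operator_ring T I. x k = Y (x l)" if "l \<le> k" for k l
  proof
    show "(\<lambda>x. fold T (drop l (take k is)) x) \<in> operator_ring T I"
      by (rule fold_op) (meson sub(1) set_drop_subset subset_trans)
    have "take k is = take l is @ drop l (take k is)"
      using that by (metis append_take_drop_id min.absorb1 take_take)
    then show "x k = fold T (drop l (take k is)) (x l)"
      unfolding x_def by (metis comp_apply fold_append)
  qed
  have "x j \<in> A2"
  proof (cases "j < D")
    case False
    then have "J = {j}" using J(2) j by force
    then show ?thesis using J by (auto simp: A2_def)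
  next
    case True
    define i where "i = is ! j"
    have i: "i \<in> I" using True "is" by (auto simp: i_def)
    have xS: "x (Suc j) = T i (x j)"
      using True "is" by (simp add: x_def i_def take_Suc_conv_app_nth)
    have "\<forall>k\<in>J - {j}. \<exists>Y\<in>operator_ring T I. x k = Y (x (Suc j))"
      using later j by (metis DiffE Suc_leI insertI1 le_neq_implies_less)
    then obtain Y where Y: "\<And>k. k \<in> J - {j} \<Longrightarrow> Y k \<in> operator_ring T I \<and> x k = Y k (x (Suc j))"
      by metis
    define Z where "Z x = (\<Sum>k\<in>J - {j}. Y k x)" for x
    have Z: "Z \<in> operator_ring T I"
      unfolding Z_def by (rule op_sum) (use finJ Y in auto)
    define W where "W x = T i (Z x)" for x
    have W: "W \<in> operator_ring T I"
      unfolding W_def using i Z by (intro operator_ring.comp)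
    have "b + b = x j + (\<Sum>k\<in>J - {j}. x k)"
      using J(4) sum.remove[OF finJ j(1), of x] by simp
    also have "(\<Sum>k\<in>J - {j}. x k) = W (x j)"
      unfolding W_def Z_def op_comm[OF Z[unfolded Z_def] i, symmetric] using Y by (auto simp: xS intro: sum.cong)
    finally have "x j + W (x j) = b + b" by simp
    then have "x j - W (x j) = (b + b) - (W (x j) + W (x j))"
      by (simp add: algebra_simps)
    moreover have "b + b \<in> A2" "W (x j) + W (x j) \<in> A2"
      using J(3) op_A[OF W xA] by (auto simp: A2_def)
    ultimately have d: "x j - W (x j) \<in> A2"
      using A2_diff by metis
    \<comment> \<open>W preserves 2A, so x agrees modulo 2A with every iterate of W on x; the
      exponent is chosen below so that already the power of \<open>T i\<close> sends x into
      2A.\<close>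
    have Wp: "x j - (W ^^ e) (x j) \<in> A2" for e
    proof (induction e)
      case 0
      have "0 + 0 \<in> A2" unfolding A2_def using A_0 by blast
      then show ?case by simp
    next
      case (Suc e)
      have "W (x j) = W (x j - (W ^^ e) (x j)) + W ((W ^^ e) (x j))"
        using op_add[OF W, of "x j - (W ^^ e) (x j)" "(W ^^ e) (x j)"] by simp
      then have "x j - (W ^^ Suc e) (x j) = (x j - W (x j)) + W (x j - (W ^^ e) (x j))"
        by (simp add: algebra_simps)
      then show ?case using A2_add[OF d op_A2[OF W Suc]] by metis
    qed
    obtain e where e: "(T i ^^ e) (x j) \<in> A2"
      using T_nilpotent[OF i xA[of j]] unfolding A2_def by blast
    have TA: "(T i ^^ n) x \<in> A" if "x \<in> A" for n x
      using that by (induction n) (auto simp: T_A i)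
    have Zn: "(Z ^^ n) x \<in> A2" if "x \<in> A2" for n x
      using that by (induction n) (auto simp: op_A2 Z)
    have ZT: "Z ((T i ^^ n) x) = (T i ^^ n) (Z x)" for n x
      by (induction n) (auto simp: op_comm[OF Z i])
    have "(W ^^ n) x = (Z ^^ n) ((T i ^^ n) x)" for n x
    proof (induction n arbitrary: x)
      case (Suc n)
      have "(W ^^ Suc n) x = (W ^^ n) (W x)" by (simp add: funpow_Suc_right del: funpow.simps)
      also have "\<dots> = (Z ^^ n) ((T i ^^ n) (Z (T i x)))"
        by (simp add: Suc W_def op_comm[OF Z i])
      also have "\<dots> = (Z ^^ n) (Z ((T i ^^ n) (T i x)))" by (simp add: ZT)
      also have "\<dots> = (Z ^^ Suc n) ((T i ^^ Suc n) x)"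
        by (simp add: funpow_Suc_right del: funpow.simps)
      finally show ?case .
    qed simp
    then have "(W ^^ e) (x j) \<in> A2" using Zn[OF e] by simp
    then show ?thesis using A2_add[OF Wp[of e]] by (metis diff_add_cancel)
  qed
  moreover obtain Y where "Y \<in> operator_ring T I" "x D = Y (x j)"
    using later[of j D] j J(2) by auto
  ultimately have "x D \<in> A2" using op_A2 by simp
  then show ?thesis using "is" by (simp add: x_def)
qed

lemma fold_T_double_power:
  assumes "set is \<subseteq> I" "length is = D * k" "a \<in> A"
  shows "\<exists>b\<in>A. fold T is a = ((\<lambda>x. x + x) ^^ k) b"
  using assms
proof (induction k arbitrary: "is" a)
  case (Suc k)
  have "fold T (take D is) a \<in> A2"
    using Suc.prems by (intro fold_T_in_A2) (auto dest: in_set_takeD)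
  then obtain b where b: "b \<in> A" "fold T (take D is) a = b + b" by (auto simp: A2_def)
  have sub: "set (drop D is) \<subseteq> I" using Suc.prems(1) set_drop_subset by (metis subset_trans)
  obtain c where c: "c \<in> A" "fold T (drop D is) b = ((\<lambda>x. x + x) ^^ k) c"
    using Suc.IH[of "drop D is" b] sub Suc.prems b by auto
  have "fold T is a = fold T (drop D is) (fold T (take D is) a)"
    by (metis append_take_drop_id comp_apply fold_append)
  also have "\<dots> = fold T (drop D is) b + fold T (drop D is) b"
    using b op_add[OF fold_op[OF sub]] by simp
  finally show ?case using c by auto
qed auto

end

subsection \<open>The group \<open>\<Gamma>(2)\<close>\<close>

type_synonym mat2 = "int \<times> int \<times> int \<times> int"

fun mmul :: "mat2 \<Rightarrow> mat2 \<Rightarrow> mat2" where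
  "mmul (a, b, c, d) (a', b', c', d') = (a * a' + b * c', a * b' + b * d', c * a' + d * c', c * b' + d * d')"

fun mdet :: "mat2 \<Rightarrow> int" where
  "mdet (a, b, c, d) = a * d - b * c"

fun madj :: "mat2 \<Rightarrow> mat2" where
  "madj (a, b, c, d) = (d, - b, - c, a)"

fun vact :: "int \<times> int \<Rightarrow> mat2 \<Rightarrow> int \<times> int" where
  "vact (x, y) (a, b, c, d) = (x * a + y * c, x * b + y * d)"

definition SL2 :: "mat2 set" where
  "SL2 = {M. mdet M = 1}"

fun cong_1_mod_2 :: "mat2 \<Rightarrow> bool" where
  "cong_1_mod_2 (a, b, c, d) \<longleftrightarrow> odd a \<and> even b \<and> even c \<and> odd d"

text \<open>\<open>Delta2 1\<close> is \<Gamma>(2), and \<open>Delta2 p\<close> contains the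
  matrices defining T_p. Congruence to 1 modulo 2 is imposed on them too, so that they act trivially
  on binary forms modulo 2.\<close>

definition Delta2 :: "int \<Rightarrow> mat2 set" where
  "Delta2 p = {M. mdet M = p \<and> cong_1_mod_2 M}"

lemma mmul_assoc: "mmul (mmul L M) N = mmul L (mmul M N)"
  by (cases L; cases M; cases N) (simp add: algebra_simps)

lemma mdet_mmul [simp]: "mdet (mmul M N) = mdet M * mdet N"
  by (cases M; cases N) (simp add: algebra_simps)

lemma mdet_madj [simp]: "mdet (madj M) = mdet M"
  by (cases M) simp

lemma mmul_1 [simp]: "mmul (1, 0, 0, 1) M = M" "mmul M (1, 0, 0, 1) = M"
  by (cases M; simp)+

lemma mmul_madj: "mdet M = 1 \<Longrightarrow> mmul (madj M) M = (1, 0, 0, 1)" "mdet M = 1 \<Longrightarrow> mmul M (madj M) = (1, 0, 0, 1)"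
  by (cases M; simp add: algebra_simps)+

lemma madj_mmul: "madj (mmul M N) = mmul (madj N) (madj M)"
  by (cases M; cases N) (simp add: algebra_simps)

lemma vact_mmul: "vact v (mmul M N) = vact (vact v M) N"
  by (cases v; cases M; cases N) (simp add: algebra_simps)

lemma vact_1 [simp]: "vact v (1, 0, 0, 1) = v"
  by (cases v) simp

lemma SL2_madj: "M \<in> SL2 \<Longrightarrow> madj M \<in> SL2"
  by (simp add: SL2_def)

lemma cong_1_mod_2_mmul: "cong_1_mod_2 M \<Longrightarrow> cong_1_mod_2 N \<Longrightarrow> cong_1_mod_2 (mmul M N)"
  by (cases M; cases N) auto

lemma cong_1_mod_2_madj [simp]: "cong_1_mod_2 (madj M) = cong_1_mod_2 M"
  by (cases M) auto

lemma Delta2_mmul: "M \<in> Delta2 p \<Longrightarrow> N \<in> Delta2 q \<Longrightarrow> mmul M N \<in> Delta2 (p * q)"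
  by (simp add: Delta2_def cong_1_mod_2_mmul)

lemma Delta2_madj: "M \<in> Delta2 p \<Longrightarrow> madj M \<in> Delta2 p"
  by (simp add: Delta2_def)

definition Gamma2_gens :: "mat2 set" where
  "Gamma2_gens = {(1, 2, 0, 1), (1, 0, -2, 1), (-1, 0, 0, -1)}"

lemma Gamma2_gens_subset: "Gamma2_gens \<subseteq> Delta2 1"
  by (auto simp: Gamma2_gens_def Delta2_def)

text \<open>Euclidean descent on |a| + |c|. Since a is odd and c even, their absolute values differ,
  and for c nonzero adding or subtracting twice the smaller entry shortens the larger one; this is
  what the generators do. For c = 0 only signed even translations remain.\<close>

lemma Gamma2_induct [consumes 1, case_names one gen inv]:
  assumes "M \<in> Delta2 1"
    and one: "P (1, 0, 0, 1)"
    and gen: "\<And>G M. G \<in> Gamma2_gens \<Longrightarrow> M \<in> Delta2 1 \<Longrightarrow> P M \<Longrightarrow> P (mmul G M)"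
    and inv: "\<And>G M. G \<in> Gamma2_gens \<Longrightarrow> M \<in> Delta2 1 \<Longrightarrow> P M \<Longrightarrow> P (mmul (madj G) M)"
  shows "P M"
proof -
  have T: "(1, 2, 0, 1) \<in> Gamma2_gens" and U: "(1, 0, -2, 1) \<in> Gamma2_gens" and N: "(-1, 0, 0, -1) \<in> Gamma2_gens"
    by (auto simp: Gamma2_gens_def)
  have H: "(1, 2, 0, 1) \<in> Gamma2_gens \<union> madj ` Gamma2_gens" "(1, 0, -2, 1) \<in> Gamma2_gens \<union> madj ` Gamma2_gens"
    "madj (1, 2, 0, 1) \<in> Gamma2_gens \<union> madj ` Gamma2_gens" "madj (1, 0, -2, 1) \<in> Gamma2_gens \<union> madj ` Gamma2_gens"
    using T U by blast+
  \<comment> \<open>The descent multiplies M by H, whereas \<open>gen\<close> and \<open>inv\<close>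
    build matrices up; cancelling H is again multiplication by a generator or by the inverse of
    one.\<close>
  have cancel: "P M" if M: "M \<in> Delta2 1" and H: "H \<in> Gamma2_gens \<union> madj ` Gamma2_gens" and P: "P (mmul H M)" for H M
  proof -
    have H1: "H \<in> Delta2 1" using H Gamma2_gens_subset Delta2_madj by blast
    then have HM: "mmul H M \<in> Delta2 1" using M Delta2_mmul by fastforce
    have "mmul (madj H) (mmul H M) = M"
      using H1 by (simp add: mmul_madj Delta2_def flip: mmul_assoc)
    then show ?thesis
      using H P gen[of "madj H" "mmul H M"] inv[of H "mmul H M"] HM by auto
  qed
  have base: "P (a, b, 0, d)" if "(a, b, 0, d) \<in> Delta2 1" for a b d
  proof -
    have up: "P (1, 2 * int n, 0, 1)" for n
    proof (induction n)
      case (Suc n)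
      then show ?case using gen[OF T, of "(1, 2 * int n, 0, 1)"] by (simp add: Delta2_def add.commute)
    qed (use one in simp)
    have down: "P (1, - (2 * int n), 0, 1)" for n
    proof (induction n)
      case (Suc n)
      then show ?case using inv[OF T, of "(1, - (2 * int n), 0, 1)"] by (simp add: Delta2_def algebra_simps)
    qed (use one in simp)
    have pos: "P (1, b, 0, 1)" if "even b" for b
    proof -
      obtain m where m: "b = 2 * m" using \<open>even b\<close> by (elim evenE)
      show ?thesis
        using up[of "nat m"] down[of "nat (- m)"] by (cases "m \<ge> 0") (auto simp: m)
    qed
    have "a * d = 1" "even b" using that by (auto simp: Delta2_def)
    then consider "a = 1" "d = 1" | "a = -1" "d = -1"
      by (metis zmult_eq_1_iff)
    then show ?thesis
    proof cases
      case 2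
      then show ?thesis
        using gen[OF N, of "(1, -b, 0, 1)"] pos[of "-b"] \<open>even b\<close> by (simp add: Delta2_def)
    qed (use pos \<open>even b\<close> in simp)
  qed
  have "P (a, b, c, d)" if "(a, b, c, d) \<in> Delta2 1" for a b c d
    using that
  proof (induction "nat (\<bar>a\<bar> + \<bar>c\<bar>)" arbitrary: a b c d rule: less_induct)
    case less
    have odd: "odd a" "even c" "odd d" "even b" and det: "a * d - b * c = 1"
      using less.prems by (auto simp: Delta2_def)
    have "\<bar>a\<bar> \<noteq> \<bar>c\<bar>" using odd by (metis even_abs_add_iff abs_eq_iff even_minus)
    have step: "P (a, b, c, d)" if "H \<in> Gamma2_gens \<union> madj ` Gamma2_gens"
      "mmul H (a, b, c, d) = (a', b', c', d')" "\<bar>a'\<bar> + \<bar>c'\<bar> < \<bar>a\<bar> + \<bar>c\<bar>" for H a' b' c' d'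
    proof (rule cancel[OF less.prems that(1)])
      have "H \<in> Delta2 1" using that(1) Gamma2_gens_subset Delta2_madj by blast
      then have "(a', b', c', d') \<in> Delta2 1"
        using Delta2_mmul[OF _ less.prems] that(2) by fastforce
      then show "P (mmul H (a, b, c, d))"
        using less.hyps[of a' c' b' d'] that(2,3) by simp
    qed
    show ?case
    proof (cases "c = 0")
      case True
      then show ?thesis using base less.prems by simp
    next
      case c: False
      have a: "a \<noteq> 0" using odd by auto
      show ?thesis
      proof (cases "\<bar>a\<bar> > \<bar>c\<bar>")
        case True
        show ?thesis
        proof (cases "(a > 0) = (c > 0)")
          case pos: True
          show ?thesis
            by (rule step[of "madj (1, 2, 0, 1)" "a - 2 * c" "b - 2 * d" c d, OF H(3)])
               (use True pos a c in auto)
        next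
          case neg: False
          show ?thesis
            by (rule step[of "(1, 2, 0, 1)" "a + 2 * c" "b + 2 * d" c d, OF H(1)])
               (use True neg a c in auto)
        qed
      next
        case False
        then have lt: "\<bar>a\<bar> < \<bar>c\<bar>" using \<open>\<bar>a\<bar> \<noteq> \<bar>c\<bar>\<close> by simp
        show ?thesis
        proof (cases "(a > 0) = (c > 0)")
          case pos: True
          show ?thesis
            by (rule step[of "(1, 0, -2, 1)" a b "c - 2 * a" "d - 2 * b", OF H(2)])
               (use lt pos a c in auto)
        next
          case neg: False
          show ?thesis
            by (rule step[of "madj (1, 0, -2, 1)" a b "c + 2 * a" "d + 2 * b", OF H(4)])
               (use lt neg a c in auto)
        qed
      qed
    qed
  qed
  then show ?thesis using assms(1) by (cases M) auto
qed

subsection \<open>Hecke cosets\<close>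

text \<open>Representatives of the cosets \<open>Delta2 1\<close> h in \<open>Delta2 p\<close>. The
  translations are even to keep h congruent to 1 modulo 2; for odd p they still cover all residues
  modulo p.\<close>

definition hreps :: "nat \<Rightarrow> mat2 set" where
  "hreps p = insert (int p, 0, 0, 1) ((\<lambda>k. (1, 2 * int k, 0, int p)) ` {..<p})"

lemma finite_hreps [simp]: "finite (hreps p)"
  by (simp add: hreps_def)

lemma card_hreps:
  assumes "p > 1"
  shows "card (hreps p) = Suc p"
proof -
  have "(int p, 0, 0, 1) \<notin> (\<lambda>k. (1, 2 * int k, 0, int p)) ` {..<p}" using assms by auto
  moreover have "card ((\<lambda>k. (1::int, 2 * int k, 0::int, int p)) ` {..<p}) = p"
    by (subst card_image) (auto simp: inj_on_def)
  ultimately show ?thesis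
    unfolding hreps_def by (subst card_insert_disjoint) auto
qed

lemma hreps_subset: "odd p \<Longrightarrow> hreps p \<subseteq> Delta2 (int p)"
  by (auto simp: hreps_def Delta2_def)

text \<open>As p divides the determinant, the columns are proportional modulo p: either the first is
  zero, or the second is 2k times the first for some k, p being odd. In each case the matching
  representative can be divided off on the right.\<close>

lemma hecke_decomposition:
  assumes p: "prime p" "odd p" and M: "M \<in> Delta2 (int p)"
  shows "\<exists>g\<in>Delta2 1. \<exists>h\<in>hreps p. M = mmul g h"
proof -
  obtain a b c d where M_eq: "M = (a, b, c, d)" by (cases M)
  have det: "a * d - b * c = int p" and par: "odd a" "even b" "even c" "odd d"
    using M by (auto simp: Delta2_def M_eq)
  have pp: "prime (int p)" "int p > 0" "odd (int p)" using p by (auto simp: prime_gt_0_nat)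
  show ?thesis
  proof (cases "int p dvd a \<and> int p dvd c")
    case True
    then obtain a' c' where ac: "a = int p * a'" "c = int p * c'" by (auto elim!: dvdE)
    have "int p * (a' * d - b * c') = int p * 1" using det ac by (simp add: algebra_simps)
    then have "a' * d - b * c' = 1" using pp by (simp only: mult_cancel_left) auto
    then have "(a', b, c', d) \<in> Delta2 1" using par ac by (auto simp: Delta2_def)
    moreover have "M = mmul (a', b, c', d) (int p, 0, 0, 1)" by (simp add: M_eq ac)
    moreover have "(int p, 0, 0, 1) \<in> hreps p" by (simp add: hreps_def)
    ultimately show ?thesis by blast
  next
    case False
    have "\<exists>k. int p dvd b - 2 * k * a \<and> int p dvd d - 2 * k * c"
    proof (cases "int p dvd a")
      case True
      then have nc: "\<not> int p dvd c" using False by auto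
      have "coprime (int p) c" using pp(1) nc by (rule prime_imp_coprime)
      then have "coprime (2 * c) (int p)"
        using pp(3) by (auto simp: coprime_commute[of _ "int p"])
      then obtain x where x: "[(2 * c) * x = 1] (mod int p)"
        using cong_solve_coprime_int by blast
      define k where "k = x * d"
      have k: "[(2 * c) * k = d] (mod int p)"
        using cong_scalar_right[OF x, of d] by (simp add: k_def mult.assoc)
      have "int p dvd b * c" using det True by (metis dvd_diff_right_iff dvd_mult2 dvd_refl)
      then have "int p dvd b" using nc pp prime_dvd_mult_iff by blast
      then have "int p dvd b - 2 * k * a" using True by simp
      moreover have "int p dvd d - 2 * k * c"
        using k by (simp add: cong_iff_dvd_diff dvd_diff_commute mult_ac)
      ultimately show ?thesis by blast
    next
      case na: False
      have "coprime (int p) a" using pp(1) na by (rule prime_imp_coprime)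
      then have "coprime (2 * a) (int p)"
        using pp(3) by (auto simp: coprime_commute[of _ "int p"])
      then obtain x where x: "[(2 * a) * x = 1] (mod int p)"
        using cong_solve_coprime_int by blast
      define k where "k = x * b"
      have k: "[(2 * a) * k = b] (mod int p)"
        using cong_scalar_right[OF x, of b] by (simp add: k_def mult.assoc)
      have kb: "int p dvd b - 2 * k * a"
        using k by (simp add: cong_iff_dvd_diff dvd_diff_commute mult_ac)
      have "a * (d - 2 * k * c) = int p + c * (b - 2 * k * a)"
        using det by (simp add: algebra_simps)
      then have "int p dvd a * (d - 2 * k * c)" using kb by simp
      then have "int p dvd d - 2 * k * c" using na pp prime_dvd_mult_iff by blast
      then show ?thesis using kb by blast
    qed
    then obtain k' where k': "int p dvd b - 2 * k' * a" "int p dvd d - 2 * k' * c" by blast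
    define k where "k = nat (k' mod int p)"
    have k: "k < p" "int k = k' mod int p" using pp by (auto simp: k_def nat_less_iff)
    obtain t where t: "k' = int k + int p * t" using k(2) by (metis mod_mult_div_eq mult.commute)
    have "b - 2 * int k * a = (b - 2 * k' * a) + int p * (2 * t * a)"
      "d - 2 * int k * c = (d - 2 * k' * c) + int p * (2 * t * c)"
      by (simp_all add: t algebra_simps)
    then have "int p dvd b - 2 * int k * a" "int p dvd d - 2 * int k * c"
      using k' by (metis dvd_add dvd_triv_left)+
    then obtain b' d' where bd: "b - 2 * int k * a = int p * b'" "d - 2 * int k * c = int p * d'"
      by (auto elim!: dvdE)
    have "even (int p * b')" "odd (int p * d')"
      unfolding bd[symmetric] using par by auto
    then have par': "even b'" "odd d'" using pp by auto
    have beq: "b = int p * b' + 2 * int k * a" "d = int p * d' + 2 * int k * c" using bd by linarith+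
    have "int p * (a * d' - b' * c) = int p * 1" using det unfolding beq by (simp add: algebra_simps)
    then have "a * d' - b' * c = 1" using pp by (simp only: mult_cancel_left) auto
    then have "(a, b', c, d') \<in> Delta2 1" using par par' by (auto simp: Delta2_def)
    moreover have "M = mmul (a, b', c, d') (1, 2 * int k, 0, int p)" by (simp add: M_eq beq)
    moreover have "(1, 2 * int k, 0, int p) \<in> hreps p" using k(1) unfolding hreps_def by blast
    ultimately show ?thesis by blast
  qed
qed

lemma hecke_decomposition_unique:
  assumes p: "prime p" "odd p" and g: "g \<in> Delta2 1" "h \<in> hreps p" "h' \<in> hreps p" and eq: "h' = mmul g h"
  shows "h = h'"
proof -
  obtain a b c d where g_eq: "g = (a, b, c, d)" by (cases g)
  have pp: "prime (int p)" "int p > 1" "odd (int p)" using p prime_gt_1_nat[OF p(1)] by auto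
  have det: "a * d - b * c = 1" using g by (auto simp: g_eq Delta2_def)
  consider "h = (int p, 0, 0, 1)" "h' = (int p, 0, 0, 1)"
    | k where "h = (int p, 0, 0, 1)" "h' = (1, 2 * int k, 0, int p)"
    | k where "h' = (int p, 0, 0, 1)" "h = (1, 2 * int k, 0, int p)"
    | k k' where "h = (1, 2 * int k, 0, int p)" "h' = (1, 2 * int k', 0, int p)" "k < p" "k' < p"
    using g(2,3) unfolding hreps_def by auto
  then show ?thesis
  proof cases
    case 2
    then have "1 = int p * a" using eq g_eq by (simp add: mult.commute)
    then have "int p dvd 1" by (metis dvd_triv_left)
    then show ?thesis using pp by simp
  next
    case 3
    then have "c = 0" "a = int p" using eq g_eq by auto
    then have "int p dvd 1" using det by (metis dvd_triv_left diff_zero mult_zero_right)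
    then show ?thesis using pp by simp
  next
    case 4
    then have "a = 1" "c = 0" "2 * int k' = 2 * int k + int p * b" using eq g_eq by (auto simp: mult.commute)
    then have "int p dvd 2 * (int k' - int k)" by simp
    moreover have "coprime (int p) 2" using pp by simp
    ultimately have "int p dvd int k' - int k"
      using coprime_dvd_mult_right_iff by blast
    then have "int k' = int k"
      using 4(3,4) by (metis (no_types, opaque_lifting) mod_eq_dvd_iff mod_pos_pos_trivial of_nat_0_le_iff of_nat_less_iff)
    then show ?thesis using 4 by simp
  qed simp
qed

definition hdec :: "nat \<Rightarrow> mat2 \<Rightarrow> mat2 \<times> mat2" where
  "hdec p M = (SOME (g, h). g \<in> Delta2 1 \<and> h \<in> hreps p \<and> M = mmul g h)"

lemma hdec:
  assumes "prime p" "odd p" "M \<in> Delta2 (int p)"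
  shows "fst (hdec p M) \<in> Delta2 1" "snd (hdec p M) \<in> hreps p" "mmul (fst (hdec p M)) (snd (hdec p M)) = M"
proof -
  have "\<exists>x. case x of (g, h) \<Rightarrow> g \<in> Delta2 1 \<and> h \<in> hreps p \<and> M = mmul g h"
  proof -
    obtain g h where "g \<in> Delta2 1" "h \<in> hreps p" "M = mmul g h"
      using hecke_decomposition[OF assms] by blast
    then show ?thesis by (intro exI[of _ "(g, h)"]) simp
  qed
  then have "case hdec p M of (g, h) \<Rightarrow> g \<in> Delta2 1 \<and> h \<in> hreps p \<and> M = mmul g h"
    unfolding hdec_def by (rule someI_ex)
  then show "fst (hdec p M) \<in> Delta2 1" "snd (hdec p M) \<in> hreps p" "mmul (fst (hdec p M)) (snd (hdec p M)) = M"
    by (auto split: prod.splits)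
qed

lemma hrep_mult_Delta2:
  assumes "odd p" "h \<in> hreps p" "g \<in> Delta2 1"
  shows "mmul h g \<in> Delta2 (int p)"
  using Delta2_mmul[of h "int p" g 1] hreps_subset[OF assms(1)] assms by auto

text \<open>This makes sums over representatives invariant under g: right multiplication permutes
  the cosets. Injectivity comes from uniqueness of representatives, surjectivity from
  finiteness.\<close>

lemma hdec_bij:
  assumes p: "prime p" "odd p" and g: "g \<in> Delta2 1"
  shows "bij_betw (\<lambda>h. snd (hdec p (mmul h g))) (hreps p) (hreps p)"
proof -
  have inj: "inj_on (\<lambda>h. snd (hdec p (mmul h g))) (hreps p)"
  proof (rule inj_onI)
    fix h k assume h: "h \<in> hreps p" "k \<in> hreps p" and eq: "snd (hdec p (mmul h g)) = snd (hdec p (mmul k g))"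
    define r where "r = snd (hdec p (mmul h g))"
    define x where "x = fst (hdec p (mmul h g))"
    define y where "y = fst (hdec p (mmul k g))"
    note hd = hdec[OF p hrep_mult_Delta2[OF p(2) h(1) g]]
    note kd = hdec[OF p hrep_mult_Delta2[OF p(2) h(2) g]]
    have x: "mmul x r = mmul h g" "mmul y r = mmul k g" "x \<in> Delta2 1" "y \<in> Delta2 1"
      using hd kd eq by (auto simp: x_def y_def r_def)
    have gg: "mmul g (madj g) = (1, 0, 0, 1)" using g by (simp add: mmul_madj Delta2_def)
    have yy: "mmul (madj y) y = (1, 0, 0, 1)" using x by (simp add: mmul_madj Delta2_def)
    have "mmul (mmul x (madj y)) (mmul y r) = mmul x r"
      by (metis mmul_assoc mmul_1(1) yy)
    then have "mmul (mmul x (madj y)) (mmul k g) = mmul h g" by (simp add: x)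
    then have "mmul (mmul x (madj y)) k = h"
      by (metis gg mmul_1(2) mmul_assoc)
    moreover have "mmul x (madj y) \<in> Delta2 1"
      using Delta2_mmul[OF x(3) Delta2_madj[OF x(4)]] by simp
    ultimately show "h = k"
      using hecke_decomposition_unique[OF p _ h(2,1)] by metis
  qed
  moreover have "(\<lambda>h. snd (hdec p (mmul h g))) ` hreps p \<subseteq> hreps p"
    using hdec[OF p hrep_mult_Delta2[OF p(2) _ g]] by auto
  ultimately show ?thesis
    by (simp add: bij_betw_def endo_inj_surj)
qed

text \<open>\<open>half i M\<close> for \<open>M = 1 + 2X\<close> is an entry of \<open>X\<close>; modulo 2 these are homomorphisms.\<close>

fun half :: "nat \<Rightarrow> mat2 \<Rightarrow> int" where
  "half i (a, b, c, d) = (if i = 0 then b div 2 else if i = 1 then c div 2 else (a - 1) div 2)"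

lemma half_mmul:
  assumes "cong_1_mod_2 M" "cong_1_mod_2 N"
  shows "even (half i (mmul M N) - half i M - half i N)"
proof -
  obtain a b c d a' b' c' d' where MN: "M = (2 * a + 1, 2 * b, 2 * c, 2 * d + 1)" "N = (2 * a' + 1, 2 * b', 2 * c', 2 * d' + 1)"
    using assms by (cases M; cases N) (auto elim!: evenE oddE)
  have "half 0 (mmul M N) - half 0 M - half 0 N = 2 * (a * b' + b * d')"
  proof -
    have "(2 * a + 1) * (2 * b') + 2 * b * (2 * d' + 1) = 2 * (2 * (a * b' + b * d') + b + b')"
      by (simp add: algebra_simps)
    then show ?thesis unfolding MN mmul.simps half.simps by simp
  qed
  moreover have "half 1 (mmul M N) - half 1 M - half 1 N = 2 * (c * a' + d * c')"
  proof -
    have "2 * c * (2 * a' + 1) + (2 * d + 1) * (2 * c') = 2 * (2 * (c * a' + d * c') + c + c')"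
      by (simp add: algebra_simps)
    then show ?thesis unfolding MN mmul.simps half.simps by simp
  qed
  moreover have "half i (mmul M N) - half i M - half i N = 2 * (a * a' + b * c')" if "i \<noteq> 0" "i \<noteq> 1"
  proof -
    have "(2 * a + 1) * (2 * a' + 1) + 2 * b * (2 * c') - 1 = 2 * (2 * (a * a' + b * c') + a + a')"
      by (simp add: algebra_simps)
    then show ?thesis unfolding MN mmul.simps half.simps using that by simp
  qed
  ultimately show ?thesis
    by (metis dvd_triv_left)
qed

text \<open>T_p annihilates homomorphisms into \<int>/2. In h g = x r the function
  \<open>half\<close> is additive modulo 2 although h and r have determinant p. In the sum over h
  the contributions of h and r cancel, because r permutes the representatives, and (p + 1)
  \<open>half i g\<close> remains, which is even.\<close>

lemma half_hdec_sum:
  assumes p: "prime p" "odd p" and g: "g \<in> Delta2 1"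
  shows "even (\<Sum>h\<in>hreps p. half i (fst (hdec p (mmul h g))))"
proof -
  define x where "x h = fst (hdec p (mmul h g))" for h
  define r where "r h = snd (hdec p (mmul h g))" for h
  have "even (half i (x h) + half i (r h) - (half i h + half i g))" if h: "h \<in> hreps p" for h
  proof -
    note hd = hdec[OF p hrep_mult_Delta2[OF p(2) h g], folded x_def r_def]
    have c: "cong_1_mod_2 (x h)" "cong_1_mod_2 (r h)" "cong_1_mod_2 h" "cong_1_mod_2 g"
      using hd h g hreps_subset[OF p(2)] by (auto simp: Delta2_def)
    have "even (half i (mmul (x h) (r h)) - half i (x h) - half i (r h))" "even (half i (mmul h g) - half i h - half i g)"
      by (intro half_mmul c)+
    then show ?thesis unfolding hd(3) by presburger
  qed
  then have "even (\<Sum>h\<in>hreps p. half i (x h) + half i (r h) - (half i h + half i g))"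
    by (intro dvd_sum)
  also have "(\<Sum>h\<in>hreps p. half i (x h) + half i (r h) - (half i h + half i g)) =
      (\<Sum>h\<in>hreps p. half i (x h)) + (\<Sum>h\<in>hreps p. half i (r h)) - (\<Sum>h\<in>hreps p. half i h) - (\<Sum>h\<in>hreps p. half i g)"
    by (simp add: sum.distrib sum_subtractf)
  also have "(\<Sum>h\<in>hreps p. half i (r h)) = (\<Sum>h\<in>hreps p. half i h)"
    unfolding r_def by (rule sum.reindex_bij_betw[OF hdec_bij[OF p g]])
  also have "(\<Sum>h\<in>hreps p. half i g) = int (Suc p) * half i g"
    using card_hreps[OF prime_gt_1_nat[OF p(1)]] by simp
  finally show ?thesis using p(2) by (simp add: x_def)
qed

subsection \<open>The action on the upper half plane\<close>

fun mob :: "mat2 \<Rightarrow> complex \<Rightarrow> complex" where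
  "mob (a, b, c, d) t = (of_int a * t + of_int b) / (of_int c * t + of_int d)"

fun jfac :: "mat2 \<Rightarrow> complex \<Rightarrow> complex" where
  "jfac (a, b, c, d) t = of_int c * t + of_int d"

definition uhp :: "complex set" where
  "uhp = {t. Im t > 0}"

lemma open_uhp: "open uhp"
  unfolding uhp_def by (rule open_halfspace_Im_gt)

lemma convex_uhp: "convex uhp"
  unfolding uhp_def by (rule convex_halfspace_Im_gt)

lemma jfac_nonzero:
  assumes "t \<in> uhp" "mdet M \<noteq> 0"
  shows "jfac M t \<noteq> 0"
proof (cases M)
  case (fields a b c d)
  show ?thesis
  proof
    assume "jfac M t = 0"
    then have *: "of_int c * t + of_int d = 0" by (simp add: fields)
    then have "of_int c * Im t = 0" by (simp add: complex_eq_iff)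
    then have "c = 0" using assms by (simp add: uhp_def)
    moreover from this have "d = 0" using * by simp
    ultimately show False using assms by (simp add: fields)
  qed
qed

lemma Im_mob:
  assumes "t \<in> uhp" "mdet M \<noteq> 0"
  shows "Im (mob M t) = of_int (mdet M) * Im t / (cmod (jfac M t))\<^sup>2"
proof (cases M)
  case (fields a b c d)
  have "Im (of_int a * t + of_int b) * Re (of_int c * t + of_int d) -
      Re (of_int a * t + of_int b) * Im (of_int c * t + of_int d) = of_int (mdet M) * Im t"
    by (simp add: fields algebra_simps)
  then show ?thesis
    by (simp only: fields mob.simps jfac.simps Im_divide cmod_power2)
qed

lemma mob_in_uhp:
  assumes "t \<in> uhp" "mdet M > 0"
  shows "mob M t \<in> uhp"
  using assms Im_mob[of t M] jfac_nonzero[of t M] by (simp add: uhp_def)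

lemma jfac_mmul:
  assumes "t \<in> uhp" "mdet N \<noteq> 0"
  shows "jfac (mmul M N) t = jfac M (mob N t) * jfac N t"
  using jfac_nonzero[OF assms] by (cases M; cases N) (simp add: field_simps)

lemma mob_mmul:
  assumes "t \<in> uhp" "mdet M > 0" "mdet N > 0"
  shows "mob (mmul M N) t = mob M (mob N t)"
proof -
  have 1: "jfac N t \<noteq> 0" using assms by (intro jfac_nonzero) auto
  obtain a b c d where M: "M = (a, b, c, d)" by (cases M)
  obtain a' b' c' d' where N: "N = (a', b', c', d')" by (cases N)
  define n where "n = of_int a' * t + of_int b'"
  define j where "j = of_int c' * t + of_int d'"
  have "mob M (mob N t) = (of_int a * (n / j) + of_int b) / (of_int c * (n / j) + of_int d)"
    by (simp add: M N n_def j_def)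
  also have "\<dots> = ((of_int a * n + of_int b * j) / j) / ((of_int c * n + of_int d * j) / j)"
    using 1 by (simp add: N j_def[symmetric] add_divide_distrib)
  also have "\<dots> = (of_int a * n + of_int b * j) / (of_int c * n + of_int d * j)"
    using 1 by (simp add: N j_def[symmetric])
  also have "\<dots> = mob (mmul M N) t"
    by (simp add: M N n_def j_def algebra_simps)
  finally show ?thesis by simp
qed

lemma has_field_derivative_mob:
  assumes "t \<in> uhp" "mdet M \<noteq> 0"
  shows "(mob M has_field_derivative of_int (mdet M) / (jfac M t)\<^sup>2) (at t)"
proof (cases M)
  case (fields a b c d)
  have nz: "of_int c * t + of_int d \<noteq> 0" using jfac_nonzero[OF assms] by (simp add: fields)
  have "((\<lambda>t. (of_int a * t + of_int b) / (of_int c * t + of_int d)) has_field_derivative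
     of_int (a * d - b * c) / (of_int c * t + of_int d)\<^sup>2) (at t)"
    using nz by (auto intro!: derivative_eq_intros simp: field_simps power2_eq_square)
  moreover have "mob M = (\<lambda>t. (of_int a * t + of_int b) / (of_int c * t + of_int d))"
    by (simp add: fields fun_eq_iff)
  ultimately show ?thesis by (simp add: fields)
qed

section \<open>Reduction theory for the full modular group\<close>

definition SL2_reps :: "mat2 set" where
  "SL2_reps = {(1, 0, 0, 1), (0, -1, 1, 0), (1, 1, 0, 1), (0, -1, 1, 1), (1, 0, 1, 1), (1, -1, 1, 0)}"

lemma SL2_reps_subset: "SL2_reps \<subseteq> SL2"
  by (auto simp: SL2_reps_def SL2_def)

text \<open>The group modulo 2 has six elements, and \<open>SL2_reps\<close> contains one matrix
  over each.\<close>

lemma SL2_decomposition: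
  assumes "M \<in> SL2"
  shows "\<exists>g\<in>Delta2 1. \<exists>r\<in>SL2_reps. M = mmul g r"
proof (cases M)
  case (fields a b c d)
  have det: "a * d - b * c = 1" using assms by (simp add: SL2_def fields)
  have "\<exists>r\<in>SL2_reps. cong_1_mod_2 (mmul M (madj r))"
  proof -
    have "odd (a * d - b * c)" using det by simp
    then show ?thesis unfolding SL2_reps_def fields by auto
  qed
  then obtain r where r: "r \<in> SL2_reps" "cong_1_mod_2 (mmul M (madj r))" by blast
  have dr: "mdet r = 1" using r SL2_reps_subset by (auto simp: SL2_def)
  have "mmul (mmul M (madj r)) r = M"
    using dr by (simp add: mmul_assoc mmul_madj)
  moreover have "mmul M (madj r) \<in> Delta2 1"
    using r dr assms by (simp add: Delta2_def SL2_def)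
  ultimately show ?thesis using r by metis
qed

text \<open>Minimise |c t + d| over the group, then translate into the strip. Minimality against the
  inversion gives |z| >= 1 for the image z, hence Im z >= sqrt 3 / 2; the cruder 1/2 is enough for
  the bounds at the cusps.\<close>

lemma SL2_reduction:
  assumes t: "t \<in> uhp"
  shows "\<exists>M\<in>SL2. \<bar>Re (mob M t)\<bar> \<le> 1 / 2 \<and> Im (mob M t) \<ge> 1 / 2"
proof -
  define y where "y = Im t"
  have y: "y > 0" using t by (simp add: y_def uhp_def)
  \<comment> \<open>Values at most 1 already bound c and d, so the minimum runs over a finite set,
    nonempty because of the identity.\<close>
  define S where "S = {M\<in>SL2. cmod (jfac M t) \<le> 1}"
  define R where "R = (\<lambda>M. cmod (jfac M t)) ` S"
  have "R \<subseteq> (\<lambda>(c, d). cmod (of_int c * t + of_int d)) `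
      ({-\<lceil>1 / y\<rceil>..\<lceil>1 / y\<rceil>} \<times> {-\<lceil>1 + cmod t / y\<rceil>..\<lceil>1 + cmod t / y\<rceil>})"
  proof
    fix x assume "x \<in> R"
    then obtain a b c d where x: "x = cmod (of_int c * t + of_int d)" "x \<le> 1"
      by (auto simp: R_def S_def)
    have "\<bar>of_int c\<bar> * y \<le> x"
      using abs_Im_le_cmod[of "of_int c * t + of_int d"] y by (simp add: x abs_mult y_def)
    then have c: "\<bar>of_int c\<bar> \<le> 1 / y" using x y by (simp add: pos_le_divide_eq)
    have "\<bar>of_int d\<bar> \<le> cmod (of_int c * t + of_int d) + cmod (of_int c * t)"
      using norm_triangle_ineq4[of "of_int c * t + of_int d" "of_int c * t"] by simp
    also have "\<dots> \<le> 1 + (1 / y) * cmod t"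
      using x mult_right_mono[OF c, of "cmod t"] by (intro add_mono) (auto simp: norm_mult)
    finally have d: "\<bar>of_int d\<bar> \<le> 1 + cmod t / y" by simp
    show "x \<in> (\<lambda>(c, d). cmod (of_int c * t + of_int d)) `
      ({-\<lceil>1 / y\<rceil>..\<lceil>1 / y\<rceil>} \<times> {-\<lceil>1 + cmod t / y\<rceil>..\<lceil>1 + cmod t / y\<rceil>})"
      by (rule image_eqI[of _ _ "(c, d)"]) (use x c d in \<open>simp_all add: abs_le_iff, linarith+\<close>)
  qed
  then have fin: "finite R" by (rule finite_subset) auto
  have "(1, 0, 0, 1) \<in> S" by (simp add: S_def SL2_def)
  then have "R \<noteq> {}" by (auto simp: R_def)
  then have "Min R \<in> R" using fin by simp
  then obtain M where M: "M \<in> S" "cmod (jfac M t) = Min R" by (auto simp: R_def)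
  have minimal: "cmod (jfac M t) \<le> cmod (jfac N t)" if "N \<in> SL2" for N
  proof (cases "N \<in> S")
    case True
    then show ?thesis using fin M by (auto simp: R_def intro: Min_le)
  next
    case False
    then show ?thesis using that M by (auto simp: S_def)
  qed
  define n where "n = round (Re (mob M t))"
  define K where "K = mmul (1, - n, 0, 1) M"
  have MS: "M \<in> SL2" using M by (simp add: S_def)
  have KS: "K \<in> SL2" using MS by (simp add: K_def SL2_def)
  have dets: "mdet M = 1" "mdet K = 1" using MS KS by (auto simp: SL2_def)
  have K: "mob K t = mob M t - of_int n"
    unfolding K_def using t dets by (subst mob_mmul) auto
  have jK: "jfac K t = jfac M t" by (cases M) (simp add: K_def)
  have re: "\<bar>Re (mob K t)\<bar> \<le> 1 / 2"
    unfolding K n_def using of_int_round_abs_le[of "Re (mob M t)"] by (simp add: abs_minus_commute)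
  have "cmod (jfac M t) \<le> cmod (jfac (mmul (0, -1, 1, 0) K) t)"
    using KS by (intro minimal) (simp add: SL2_def)
  also have "\<dots> = cmod (mob K t) * cmod (jfac M t)"
    using t dets by (subst jfac_mmul) (auto simp: norm_mult jK)
  finally have "1 \<le> cmod (mob K t)"
    using jfac_nonzero[OF t, of M] dets by simp
  then have "1 \<le> (cmod (mob K t))\<^sup>2" by simp
  then have "1 \<le> (Re (mob K t))\<^sup>2 + (Im (mob K t))\<^sup>2" by (simp add: cmod_power2)
  moreover have "(Re (mob K t))\<^sup>2 \<le> (1 / 2)\<^sup>2" using re by (metis abs_le_square_iff abs_of_nonneg zero_le_divide_1_iff zero_le_numeral)
  ultimately have "(1 / 2)\<^sup>2 \<le> (Im (mob K t))\<^sup>2" by (simp add: power2_eq_square)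
  moreover have "Im (mob K t) > 0" using mob_in_uhp[OF t, of K] dets by (simp add: uhp_def)
  ultimately have "1 / 2 \<le> Im (mob K t)" by (meson less_imp_le power2_le_imp_le)
  then show ?thesis using KS re by blast
qed

subsection \<open>Substitutions in binary forms\<close>

text \<open>The image of X^i Y^(m-i) under X -> aX + bY, Y -> cX + dY, written with Y = 1. Thus
  \<open>Rcoef\<close> is the matrix of the action on binary forms of degree m. It is integral, and
  the congruences for periods rest on that.\<close>

fun Rpoly :: "nat \<Rightarrow> mat2 \<Rightarrow> nat \<Rightarrow> int poly" where
  "Rpoly m (a, b, c, d) i = [:b, a:] ^ i * [:d, c:] ^ (m - i)"

definition Rcoef :: "nat \<Rightarrow> mat2 \<Rightarrow> nat \<Rightarrow> nat \<Rightarrow> int" where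
  "Rcoef m M i k = coeff (Rpoly m M i) k"

definition homogenize :: "nat \<Rightarrow> int poly \<Rightarrow> 'a::comm_ring_1 \<Rightarrow> 'a \<Rightarrow> 'a" where
  "homogenize n p x y = (\<Sum>k\<le>n. of_int (coeff p k) * x ^ k * y ^ (n - k))"

lemma homogenize_linear_mult:
  assumes "degree p \<le> n"
  shows "homogenize (Suc n) ([:b, a:] * p) x y = (of_int a * x + of_int b * y) * homogenize n p x y"
proof -
  have "coeff p (Suc n) = 0" using assms by (simp add: coeff_eq_0)
  have 1: "(\<Sum>k\<le>Suc n. of_int (coeff (Polynomial.smult b p) k) * x ^ k * y ^ (Suc n - k)) =
      (\<Sum>k\<le>n. of_int (coeff (Polynomial.smult b p) k) * x ^ k * y ^ (Suc n - k))"
    using \<open>coeff p (Suc n) = 0\<close> by simp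
  have 2: "(\<Sum>k\<le>Suc n. of_int (coeff (pCons 0 (Polynomial.smult a p)) k) * x ^ k * y ^ (Suc n - k)) =
      (\<Sum>k\<le>n. of_int (coeff (Polynomial.smult a p) k) * x ^ Suc k * y ^ (n - k))"
    by (subst sum.atMost_Suc_shift) simp
  have "homogenize (Suc n) ([:b, a:] * p) x y =
     (\<Sum>k\<le>Suc n. of_int (coeff (Polynomial.smult b p) k) * x ^ k * y ^ (Suc n - k)) +
     (\<Sum>k\<le>Suc n. of_int (coeff (pCons 0 (Polynomial.smult a p)) k) * x ^ k * y ^ (Suc n - k))"
    unfolding homogenize_def sum.distrib[symmetric]
    by (intro sum.cong refl) (simp add: mult_pCons_left algebra_simps)
  also have "\<dots> = (\<Sum>k\<le>n. of_int (coeff p k) * x ^ k * y ^ (n - k) * (of_int a * x + of_int b * y))"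
    unfolding 1 2 sum.distrib[symmetric]
    by (intro sum.cong refl) (simp add: Suc_diff_le algebra_simps)
  finally show ?thesis
    by (simp add: homogenize_def sum_distrib_left mult.commute)
qed

lemma homogenize_power_mult:
  assumes "degree p \<le> n"
  shows "homogenize (i + n) ([:b, a:] ^ i * p) x y = (of_int a * x + of_int b * y) ^ i * homogenize n p x y
    \<and> degree ([:b, a:] ^ i * p) \<le> i + n"
proof (induction i)
  case (Suc i)
  have "degree ([:b, a:] * ([:b, a:] ^ i * p)) \<le> degree [:b, a:] + degree ([:b, a:] ^ i * p)"
    by (rule degree_mult_le)
  also have "\<dots> \<le> 1 + (i + n)"
    using Suc by (intro add_mono) auto
  finally show ?case
    using Suc homogenize_linear_mult[of "[:b, a:] ^ i * p" "i + n" b a x y]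
    by (simp add: mult.assoc del: mult_pCons_left)
qed (use assms in simp)

text \<open>x and y range over an arbitrary commutative ring: linear polynomials give the
  composition rule \<open>Rcoef_mmul\<close>, while y = 1 and complex x give the identities for
  integrals.\<close>

lemma sum_Rcoef:
  fixes x y :: "'a::comm_ring_1"
  assumes "i \<le> m"
  shows "(\<Sum>k\<le>m. of_int (Rcoef m (a, b, c, d) i k) * x ^ k * y ^ (m - k)) =
     (of_int a * x + of_int b * y) ^ i * (of_int c * x + of_int d * y) ^ (m - i)"
proof -
  have "homogenize (m - i + 0) ([:d, c:] ^ (m - i) * 1) x y =
      (of_int c * x + of_int d * y) ^ (m - i) * homogenize 0 1 x y \<and> degree ([:d, c:] ^ (m - i) * 1) \<le> m - i + 0"
    by (rule homogenize_power_mult) simp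
  then have "homogenize (m - i) ([:d, c:] ^ (m - i)) x y = (of_int c * x + of_int d * y) ^ (m - i)"
    "degree ([:d, c:] ^ (m - i)) \<le> m - i"
    by (simp_all add: homogenize_def)
  then show ?thesis
    using homogenize_power_mult[of "[:d, c:] ^ (m - i)" "m - i" i b a x y] assms
    by (simp add: homogenize_def Rcoef_def)
qed

lemma Rcoef_mmul:
  assumes "i \<le> m" "l \<le> m"
  shows "(\<Sum>k\<le>m. Rcoef m M i k * Rcoef m N k l) = Rcoef m (mmul M N) i l"
proof -
  obtain a b c d a' b' c' d' where MN: "M = (a, b, c, d)" "N = (a', b', c', d')"
    by (cases M; cases N)
  have oi: "(of_int a :: int poly) = [:a:]" for a by (simp add: of_int_poly)
  have "(\<Sum>k\<le>m. of_int (Rcoef m M i k) * Rpoly m N k) =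
     (of_int a * [:b', a':] + of_int b * [:d', c':]) ^ i * (of_int c * [:b', a':] + of_int d * [:d', c':]) ^ (m - i)"
    using sum_Rcoef[OF assms(1), of a b c d "[:b', a':]" "[:d', c':]"] by (simp add: MN mult.assoc)
  also have "\<dots> = Rpoly m (mmul M N) i"
    by (simp add: MN oi algebra_simps)
  finally have "coeff (\<Sum>k\<le>m. of_int (Rcoef m M i k) * Rpoly m N k) l = coeff (Rpoly m (mmul M N) i) l"
    by simp
  then show ?thesis
    by (simp add: coeff_sum oi Rcoef_def)
qed

lemma Rcoef_1: "i \<le> m \<Longrightarrow> Rcoef m (1, 0, 0, 1) i k = (if k = i then 1 else 0)"
proof -
  have "[:0, 1::int:] ^ i = monom 1 i" by (simp add: monom_altdef)
  moreover have "[:1::int:] ^ (m - i) = 1" by (simp flip: one_pCons)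
  ultimately show ?thesis by (simp add: Rcoef_def)
qed

lemma Rcoef_parity:
  assumes "cong_1_mod_2 M"
  shows "even (Rcoef m M i k - (if k = i then 1 else 0))"
proof (cases M)
  case (fields a b c d)
  have par: "odd a" "even b" "even c" "odd d" using assms by (auto simp: fields)
  define Q where "Q j p \<longleftrightarrow> (\<forall>k. even (coeff p k - (if k = j then 1 else 0)))" for j :: nat and p :: "int poly"
  have 1: "Q 0 ([:d, c:] ^ n)" for n
  proof (induction n)
    case (Suc n)
    show ?case unfolding Q_def
    proof
      fix k
      have e: "even (coeff ([:d, c:] ^ n) j - (if j = 0 then 1 else 0))" for j
        using Suc by (simp add: Q_def)
      show "even (coeff ([:d, c:] ^ Suc n) k - (if k = 0 then 1 else 0))"
        using e[of k] par by (cases k) (auto simp: mult_pCons_left)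
    qed
  qed (simp add: Q_def)
  have "Q i ([:b, a:] ^ i * ([:d, c:] ^ (m - i)))"
  proof (induction i)
    case 0
    then show ?case using 1[of m] by simp
  next
    case (Suc i)
    have "Q i ([:b, a:] ^ i * q)" if "Q 0 q" for q i
      using that
    proof (induction i)
      case (Suc i)
      show ?case unfolding Q_def
      proof
        fix k
        have e: "even (coeff ([:b, a:] ^ i * q) j - (if j = i then 1 else 0))" for j
          using Suc by (simp add: Q_def)
        define P where "P = [:b, a:] ^ i * q"
        have "[:b, a:] ^ Suc i * q = [:b, a:] * P" by (simp only: P_def power_Suc mult.assoc)
        then show "even (coeff ([:b, a:] ^ Suc i * q) k - (if k = Suc i then 1 else 0))"
          using e[of "k - 1"] par by (cases k) (auto simp: mult_pCons_left P_def[symmetric] split: if_splits)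
      qed
    qed simp
    then show ?case using 1 by blast
  qed
  then show ?thesis by (simp add: Q_def Rcoef_def fields)
qed

subsection \<open>Periodic functions modulo 2\<close>

definition vmod :: "nat \<Rightarrow> int \<times> int \<Rightarrow> int \<times> int" where
  "vmod s v = (fst v mod 2 ^ s, snd v mod 2 ^ s)"

definition periodic :: "nat \<Rightarrow> (int \<times> int \<Rightarrow> 'a) \<Rightarrow> bool" where
  "periodic s f \<longleftrightarrow> (\<forall>v w. vmod s v = vmod s w \<longrightarrow> f v = f w)"

definition vbox :: "nat \<Rightarrow> (int \<times> int) set" where
  "vbox s = {0..<2 ^ s} \<times> {0..<2 ^ s}"

lemma finite_vbox [simp]: "finite (vbox s)"
  by (simp add: vbox_def)

lemma vmod_in_vbox [simp]: "vmod s v \<in> vbox s"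
  by (simp add: vmod_def vbox_def)

lemma vmod_vbox: "v \<in> vbox s \<Longrightarrow> vmod s v = v"
  by (auto simp: vmod_def vbox_def)

lemma vmod_vmod [simp]: "vmod s (vmod s v) = vmod s v"
  by (simp add: vmod_def)

lemma periodicD: "periodic s f \<Longrightarrow> vmod s v = vmod s w \<Longrightarrow> f v = f w"
  unfolding periodic_def by blast

lemma vmod_vact_cong: "vmod s v = vmod s w \<Longrightarrow> vmod s (vact v M) = vmod s (vact w M)"
  by (cases v; cases w; cases M) (auto simp: vmod_def intro!: mod_add_cong mod_mult_cong)

section \<open>The unipotent action on functions modulo 2\<close>

definition vdiff :: "mat2 \<Rightarrow> (int \<times> int \<Rightarrow> int) \<Rightarrow> int \<times> int \<Rightarrow> int" where
  "vdiff M f v = f (vact v M) - f v"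

fun vdiffs :: "mat2 list \<Rightarrow> (int \<times> int \<Rightarrow> int) \<Rightarrow> int \<times> int \<Rightarrow> int" where
  "vdiffs [] f = f"
| "vdiffs (M # Ms) f = vdiffs Ms (vdiff M f)"

definition fil :: "nat \<Rightarrow> (int \<times> int \<Rightarrow> int) \<Rightarrow> bool" where
  "fil k f \<longleftrightarrow> (\<forall>Ms v. length Ms = k \<longrightarrow> list_all cong_1_mod_2 Ms \<longrightarrow> even (vdiffs Ms f v))"

lemma vdiffs_even_cong:
  "(\<And>v. even (f v - g v)) \<Longrightarrow> even (vdiffs Ms f v - vdiffs Ms g v)"
proof (induction Ms arbitrary: f g v)
  case (Cons M Ms)
  have "even (vdiff M f v - vdiff M g v)" for v
    using Cons.prems[of v] Cons.prems[of "vact v M"] unfolding vdiff_def by presburger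
  then show ?case unfolding vdiffs.simps by (rule Cons.IH)
qed simp

lemma vdiffs_append: "vdiffs (Ms @ Ns) f = vdiffs Ns (vdiffs Ms f)"
  by (induction Ms arbitrary: f) auto

lemma vdiffs_add: "vdiffs Ms (\<lambda>v. f v + g v) v = vdiffs Ms f v + vdiffs Ms g v"
proof (induction Ms arbitrary: f g)
  case (Cons M Ms)
  have "vdiff M (\<lambda>v. f v + g v) = (\<lambda>v. vdiff M f v + vdiff M g v)"
    by (simp add: fun_eq_iff vdiff_def)
  then show ?case using Cons by simp
qed simp

lemma periodic_vdiff: "periodic s f \<Longrightarrow> periodic s (vdiff M f)"
  unfolding periodic_def vdiff_def by (metis vmod_vact_cong)

lemma periodic_vdiffs: "periodic s f \<Longrightarrow> periodic s (vdiffs Ms f)"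
  by (induction Ms arbitrary: f) (auto simp: periodic_vdiff)

definition vtr :: "int \<times> int \<Rightarrow> int \<times> int \<Rightarrow> int \<times> int" where
  "vtr u v = (fst v + fst u, snd v + snd u)"

text \<open>Translations by \<open>2\<^sup>s\<close> commute with matrices \<open>M = 1\<close> modulo 2 on functions of period \<open>2\<^sup>s\<^sup>+\<^sup>1\<close>.\<close>

lemma vdiffs_vtr:
  assumes "periodic (Suc s) f" "list_all cong_1_mod_2 Ms" "2 ^ s dvd fst u" "2 ^ s dvd snd u"
  shows "vdiffs Ms (\<lambda>v. f (vtr u v)) = (\<lambda>v. vdiffs Ms f (vtr u v))"
  using assms(1,2)
proof (induction Ms arbitrary: f)
  case (Cons M Ms)
  obtain a b c d where M: "M = (2 * a + 1, 2 * b, 2 * c, 2 * d + 1)"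
    using Cons.prems(2) by (cases M) (auto elim!: evenE oddE)
  obtain x y where u: "u = (2 ^ s * x, 2 ^ s * y)"
    using assms(3,4) by (cases u) (auto elim!: dvdE)
  have "vdiff M (\<lambda>v. f (vtr u v)) = (\<lambda>v. vdiff M f (vtr u v))"
  proof
    fix v
    have "fst (vact (vtr u v) M) = fst (vtr u (vact v M)) + 2 ^ Suc s * (x * a + y * c)"
      "snd (vact (vtr u v) M) = snd (vtr u (vact v M)) + 2 ^ Suc s * (x * b + y * d)"
      by (cases v; simp add: M u vtr_def algebra_simps)+
    then have "vmod (Suc s) (vact (vtr u v) M) = vmod (Suc s) (vtr u (vact v M))"
      by (simp add: vmod_def)
    then have "f (vact (vtr u v) M) = f (vtr u (vact v M))"
      by (rule periodicD[OF Cons.prems(1)])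
    then show "vdiff M (\<lambda>v. f (vtr u v)) v = vdiff M f (vtr u v)"
      by (simp add: vdiff_def)
  qed
  then show ?case
    using Cons.IH[OF periodic_vdiff[OF Cons.prems(1)]] Cons.prems by simp
qed simp

lemma fil_appendI:
  assumes "\<And>Ms. length Ms = k \<Longrightarrow> list_all cong_1_mod_2 Ms \<Longrightarrow> fil l (vdiffs Ms f)"
  shows "fil (k + l) f"
  unfolding fil_def
proof (intro allI impI)
  fix Ms :: "mat2 list" and v
  assume Ms: "length Ms = k + l" "list_all cong_1_mod_2 Ms"
  have "list_all cong_1_mod_2 (take k Ms @ drop k Ms)" using Ms by simp
  then have 1: "list_all cong_1_mod_2 (take k Ms)" "list_all cong_1_mod_2 (drop k Ms)"
    unfolding list_all_append by auto
  have "vdiffs Ms f = vdiffs (drop k Ms) (vdiffs (take k Ms) f)"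
    by (metis append_take_drop_id vdiffs_append)
  then show "even (vdiffs Ms f v)"
    using assms[of "take k Ms"] 1 Ms(1) by (simp add: fil_def del: split_paired_All)
qed

text \<open>Induction on s. Let N be 1 plus translation by half a period in one coordinate. Modulo 2
  its square is zero, and it commutes with the action; functions killed by N for both coordinates
  have, modulo 2, the smaller period. Treating the coordinates one after the other doubles the
  length twice, from L to 4L.\<close>

lemma ex_fil: "\<exists>L. \<forall>f. periodic s f \<longrightarrow> fil L f"
proof (induction s)
  case 0
  have "fil 1 f" if f: "periodic 0 f" for f
    unfolding fil_def
  proof (intro allI impI)
    fix Ms :: "mat2 list" and v assume "length Ms = 1"
    then obtain M where "Ms = [M]" by (auto simp: length_Suc_conv)
    moreover have "f (vact v M) = f v" by (rule periodicD[OF f]) (simp add: vmod_def)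
    ultimately show "even (vdiffs Ms f v)" by (simp add: vdiff_def)
  qed
  then show ?case by blast
next
  case (Suc s)
  then obtain L where L: "\<And>f. periodic s f \<Longrightarrow> fil L f" by blast
  define t :: int where "t = 2 ^ s"
  define N where "N u f v = f v + f (vtr u v)" for u :: "int \<times> int" and f :: "int \<times> int \<Rightarrow> int" and v
  have vmod_vtr: "vmod k (vtr u v) = vmod k (vtr u w)" if "vmod k v = vmod k w" for k u v w
    using that by (auto simp: vmod_def vtr_def intro: mod_add_cong)
  have N_per: "periodic (Suc s) (N u f)" if "periodic (Suc s) f" for u f
    using that unfolding periodic_def N_def by (metis vmod_vtr)
  have N_comm: "vdiffs Ms (N u f) = N u (vdiffs Ms f)"
    if "periodic (Suc s) f" "list_all cong_1_mod_2 Ms" "u \<in> {(t, 0), (0, t)}" for Ms u f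
    unfolding N_def fun_eq_iff vdiffs_add using vdiffs_vtr[OF that(1,2), of u] that(3) by (auto simp: t_def)
  have N_twice: "even (N u (N u f) v)" if "periodic (Suc s) f" "u \<in> {(t, 0), (0, t)}" for u f v
  proof -
    have "vmod (Suc s) (vtr u (vtr u v)) = vmod (Suc s) v"
      using that(2) by (auto simp: vmod_def vtr_def t_def)
    then have "f (vtr u (vtr u v)) = f v" by (rule periodicD[OF that(1)])
    then show ?thesis by (simp add: N_def)
  qed
  have N_swap: "N u (N w f) = N w (N u f)" for u w f
    by (simp add: N_def fun_eq_iff vtr_def algebra_simps)
  have N_even: "even (N u f v)" if "\<And>v. even (f v)" for u f v
    using that by (simp add: N_def)
  have base: "fil L f" if f: "periodic (Suc s) f" and e: "\<And>v. even (N (t, 0) f v)" "\<And>v. even (N (0, t) f v)" for f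
  proof -
    have m: "f (x + t * int n, y) mod 2 = f (x, y) mod 2" "f (x, y + t * int n) mod 2 = f (x, y) mod 2" for x y n
    proof (induction n)
      case (Suc n)
      {
        case 1
        then show ?case using Suc(1) e(1)[of "(x + t * int n, y)"]
          by (simp add: N_def vtr_def algebra_simps) presburger
      next
        case 2
        then show ?case using Suc(2) e(2)[of "(x, y + t * int n)"]
          by (simp add: N_def vtr_def algebra_simps) presburger
      }
    qed auto
    have "periodic s (\<lambda>v. f v mod 2)"
      unfolding periodic_def
    proof (intro allI impI)
      fix v w assume vw: "vmod s v = vmod s w"
      have tpos: "t > 0" by (simp add: t_def)
      have red: "f (x, y) mod 2 = f (x mod t, y mod t) mod 2" for x y
      proof -
        have r1: "f (x, y) mod 2 = f (x mod t, y) mod 2" for x y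
        proof (cases "x div t \<ge> 0")
          case True
          then show ?thesis using m(1)[of "x mod t" "nat (x div t)" y] by simp
        next
          case False
          then have "x mod t = x + t * int (nat (- (x div t)))"
            by (simp add: minus_mult_right[symmetric] minus_div_mult_eq_mod[symmetric] mult.commute)
          then show ?thesis using m(1)[of x "nat (- (x div t))" y] by simp
        qed
        have r2: "f (x, y) mod 2 = f (x, y mod t) mod 2" for x y
        proof (cases "y div t \<ge> 0")
          case True
          then show ?thesis using m(2)[of x "y mod t" "nat (y div t)"] by simp
        next
          case False
          then have "y mod t = y + t * int (nat (- (y div t)))"
            by (simp add: minus_mult_right[symmetric] minus_div_mult_eq_mod[symmetric] mult.commute)
          then show ?thesis using m(2)[of x y "nat (- (y div t))"] by simp
        qed
        show ?thesis using r1 r2 by simp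
      qed
      show "f v mod 2 = f w mod 2"
        using vw red[of "fst v" "snd v"] red[of "fst w" "snd w"] by (simp add: vmod_def t_def)
    qed
    then have "fil L (\<lambda>v. f v mod 2)" by (rule L)
    moreover have "even (vdiffs Ms f v - vdiffs Ms (\<lambda>v. f v mod 2) v)" for Ms v
      by (rule vdiffs_even_cong) presburger
    ultimately show ?thesis
      unfolding fil_def by (simp del: split_paired_All)
  qed
  have two: "fil (L + L) f" if f: "periodic (Suc s) f" and e: "\<And>v. even (N (0, t) f v)" for f
  proof (rule fil_appendI)
    fix Ms :: "mat2 list" assume Ms: "length Ms = L" "list_all cong_1_mod_2 Ms"
    have "fil L (N (t, 0) f)"
      using f e by (intro base N_per N_twice) (auto simp: N_swap[of "(0, t)"] intro: N_even)
    then have "even (N (t, 0) (vdiffs Ms f) v)" for v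
      using N_comm[OF f Ms(2), of "(t, 0)"] Ms unfolding fil_def by (metis insertI1)
    moreover have "even (N (0, t) (vdiffs Ms f) v)" for v
    proof -
      have "even (vdiffs Ms (N (0, t) f) v - vdiffs Ms (\<lambda>_. 0) v)"
        by (rule vdiffs_even_cong) (use e in simp)
      moreover have "vdiffs Ms (\<lambda>_. 0) v = 0"
        using vdiffs_add[of Ms "\<lambda>_. 0" "\<lambda>_. 0" v] by simp
      ultimately show ?thesis using N_comm[OF f Ms(2), of "(0, t)"] by simp
    qed
    ultimately show "fil L (vdiffs Ms f)"
      using f by (intro base periodic_vdiffs)
  qed
  have "fil ((L + L) + (L + L)) f" if f: "periodic (Suc s) f" for f
  proof (rule fil_appendI)
    fix Ms :: "mat2 list" assume Ms: "length Ms = L + L" "list_all cong_1_mod_2 Ms"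
    have "fil (L + L) (N (0, t) f)"
      using f by (intro two N_per N_twice) auto
    then have "even (N (0, t) (vdiffs Ms f) v)" for v
      using N_comm[OF f Ms(2), of "(0, t)"] Ms unfolding fil_def by (metis insertI1 insertI2)
    then show "fil (L + L) (vdiffs Ms f)"
      using f by (intro two periodic_vdiffs)
  qed
  then show ?case by blast
qed

subsection \<open>Nilpotence of Hecke operators on periods modulo 2\<close>

inductive_set zspan :: "(nat \<Rightarrow> complex) set \<Rightarrow> (nat \<Rightarrow> complex) set" for X where
  zero: "(\<lambda>_. 0) \<in> zspan X"
| base: "x \<in> X \<Longrightarrow> x \<in> zspan X"
| diff: "x \<in> zspan X \<Longrightarrow> y \<in> zspan X \<Longrightarrow> (\<lambda>j. x j - y j) \<in> zspan X"

lemma zspan_neg: "x \<in> zspan X \<Longrightarrow> (\<lambda>j. - x j) \<in> zspan X"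
  using zspan.diff[OF zspan.zero, of x X] by simp

lemma zspan_add: "x \<in> zspan X \<Longrightarrow> y \<in> zspan X \<Longrightarrow> (\<lambda>j. x j + y j) \<in> zspan X"
  using zspan.diff[of x X "\<lambda>j. - y j"] zspan_neg[of y X] by simp

lemma zspan_sum: "(\<And>i. i \<in> I \<Longrightarrow> f i \<in> zspan X) \<Longrightarrow> (\<lambda>j. \<Sum>i\<in>I. f i j) \<in> zspan X"
  by (induction I rule: infinite_finite_induct) (auto intro: zspan.zero zspan_add)

lemma zspan_nat_scale: "x \<in> zspan X \<Longrightarrow> (\<lambda>j. of_nat n * x j) \<in> zspan X"
  by (induction n) (auto intro: zspan.zero zspan_add simp: ring_distribs)

lemma zspan_scale:
  assumes "x \<in> zspan X"
  shows "(\<lambda>j. of_int n * x j) \<in> zspan X"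
proof (cases "n \<ge> 0")
  case True
  then show ?thesis using zspan_nat_scale[OF assms, of "nat n"] by simp
next
  case False
  then show ?thesis using zspan_neg[OF zspan_nat_scale[OF assms, of "nat (-n)"]] by simp
qed

lemma zspan_subset:
  assumes "X \<subseteq> zspan Y"
  shows "zspan X \<subseteq> zspan Y"
proof
  fix x assume "x \<in> zspan X"
  then show "x \<in> zspan Y"
    by induction (use assms in \<open>auto intro: zspan.zero zspan.diff\<close>)
qed

lemma zspan_finite:
  assumes "x \<in> zspan (z ` {..<D})"
  shows "\<exists>n::nat \<Rightarrow> int. x = (\<lambda>j. \<Sum>b<D. of_int (n b) * z b j)"
  using assms
proof induction
  case zero
  then show ?case by (intro exI[of _ "\<lambda>_. 0"]) simp
next
  case (base x)
  then obtain b where "b < D" "x = z b" by auto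
  have "(\<Sum>c<D. of_int (if c = b then 1 else 0) * z c j) = (\<Sum>c<D. if c = b then z b j else 0)" for j
    by (intro sum.cong) auto
  then show ?case
    using \<open>b < D\<close> \<open>x = z b\<close>
    by (intro exI[of _ "\<lambda>i. if i = b then 1 else 0"]) (simp add: fun_eq_iff)
next
  case (diff x y)
  then obtain n n' where "x = (\<lambda>j. \<Sum>b<D. of_int (n b) * z b j)" "y = (\<lambda>j. \<Sum>b<D. of_int (n' b) * z b j)"
    by blast
  then show ?case
    by (intro exI[of _ "\<lambda>b. n b - n' b"]) (simp add: ring_distribs sum_subtractf)
qed

lemma fil_vdiff: "fil (Suc k) f \<Longrightarrow> cong_1_mod_2 M \<Longrightarrow> fil k (vdiff M f)"
  unfolding fil_def
proof (intro allI impI)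
  fix Ms v
  assume f: "\<forall>Ms v. length Ms = Suc k \<longrightarrow> list_all cong_1_mod_2 Ms \<longrightarrow> even (vdiffs Ms f v)"
    and M: "cong_1_mod_2 M" and Ms: "length Ms = k" "list_all cong_1_mod_2 Ms"
  show "even (vdiffs Ms (vdiff M f) v)"
    using f[rule_format, of "M # Ms" v] M Ms by simp
qed

lemma sum_vbox_reindex:
  fixes f :: "int \<times> int \<Rightarrow> int" and F :: "int \<times> int \<Rightarrow> complex"
  assumes "periodic s f" "periodic s F"
    and "\<And>v. vmod s (vact (vact v M) M') = vmod s v" "\<And>v. vmod s (vact (vact v M') M) = vmod s v"
  shows "(\<Sum>v\<in>vbox s. of_int (f v) * F (vact v M)) = (\<Sum>v\<in>vbox s. of_int (f (vact v M')) * F v)"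
proof (rule sum.reindex_bij_witness[where i = "\<lambda>u. vmod s (vact u M')" and j = "\<lambda>v. vmod s (vact v M)"])
  have red: "vmod s (vact (vmod s v) N) = vmod s (vact v N)" for v N
    by (rule vmod_vact_cong) simp
  fix v assume v: "v \<in> vbox s"
  show "vmod s (vact (vmod s (vact v M)) M') = v" "vmod s (vact (vmod s (vact v M')) M) = v"
    using v by (simp_all add: red assms vmod_vbox)
  have "vmod s (vact (vmod s (vact v M)) M') = vmod s v"
    by (simp add: red assms)
  then have "f (vact (vmod s (vact v M)) M') = f v"
    by (rule periodicD[OF assms(1)])
  moreover have "F (vmod s (vact v M)) = F (vact v M)"
    by (rule periodicD[OF assms(2)]) simp
  ultimately show "of_int (f (vact (vmod s (vact v M)) M')) * F (vmod s (vact v M)) = of_int (f v) * F (vact v M)"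
    by simp
qed auto

text \<open>\<open>e j g v i\<close> stands for the i-th coefficient of the period along g of
  component v, after T_p has been applied j times to a form. The assumptions are the dependence on v
  modulo 2^s, the cocycle rule, and the integral formula for T_p.\<close>

locale period_sequences =
  fixes m s p :: nat and e :: "nat \<Rightarrow> mat2 \<Rightarrow> int \<times> int \<Rightarrow> nat \<Rightarrow> complex"
  assumes p: "prime p" "odd p"
    and e_periodic: "\<And>j g i. periodic s (\<lambda>v. e j g v i)"
    and e_cocycle: "\<And>j g g' v i. g \<in> Delta2 1 \<Longrightarrow> g' \<in> Delta2 1 \<Longrightarrow> i \<le> m \<Longrightarrow>
        e j (mmul g g') v i = e j g v i + (\<Sum>k\<le>m. of_int (Rcoef m g i k) * e j g' (vact v g) k)"
    and e_hecke: "\<And>j g v i. g \<in> Delta2 1 \<Longrightarrow> i \<le> m \<Longrightarrow>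
        e (Suc j) g v i = (\<Sum>h\<in>hreps p. \<Sum>k\<le>m. of_int (Rcoef m (madj h) i k) *
           e j (fst (hdec p (mmul h g))) (vact v (madj h)) k)"
begin

definition per :: "mat2 \<Rightarrow> int \<times> int \<Rightarrow> nat \<Rightarrow> nat \<Rightarrow> complex" where
  "per g v i = (\<lambda>j. e j g v i)"

text \<open>Periods summed over v with integer weights. Moving a matrix from v to f lets the
  filtration of functions act on periods.\<close>

definition wper :: "mat2 \<Rightarrow> (int \<times> int \<Rightarrow> int) \<Rightarrow> nat \<Rightarrow> nat \<Rightarrow> complex" where
  "wper g f i = (\<lambda>j. \<Sum>v\<in>vbox s. of_int (f v) * e j g v i)"

definition E0 :: "(nat \<Rightarrow> complex) set" where
  "E0 = zspan {per g v i | g v i. g \<in> Delta2 1 \<and> i \<le> m}"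

text \<open>A chain of lattices between E0, which is \<open>Ek L\<close> for a suitable L, and
  \<open>Ek 0\<close>, which is 2 E0. The shift, that is T_p, moves one step down the chain each
  time (\<open>shift_Ek\<close>).\<close>

definition Ek :: "nat \<Rightarrow> (nat \<Rightarrow> complex) set" where
  "Ek k = zspan ({\<lambda>j. 2 * per g v i j | g v i. g \<in> Delta2 1 \<and> i \<le> m} \<union>
     {wper g f i | g f i. g \<in> Delta2 1 \<and> i \<le> m \<and> periodic s f \<and> fil k f})"

lemma per_E0: "g \<in> Delta2 1 \<Longrightarrow> i \<le> m \<Longrightarrow> per g v i \<in> E0"
  unfolding E0_def by (rule zspan.base) blast

lemma wper_E0: "g \<in> Delta2 1 \<Longrightarrow> i \<le> m \<Longrightarrow> wper g f i \<in> E0"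
  using per_E0[of g i] unfolding E0_def wper_def per_def by (intro zspan_sum zspan_scale) auto

lemma wper_Ek: "g \<in> Delta2 1 \<Longrightarrow> i \<le> m \<Longrightarrow> periodic s f \<Longrightarrow> fil k f \<Longrightarrow> wper g f i \<in> Ek k"
  unfolding Ek_def by (rule zspan.base) blast

lemma two_E0:
  assumes "x \<in> E0"
  shows "(\<lambda>j. 2 * x j) \<in> Ek k"
  using assms unfolding E0_def
proof induction
  case zero
  then show ?case by (simp add: Ek_def zspan.zero)
next
  case (base x)
  then show ?case unfolding Ek_def by (intro zspan.base) blast
next
  case (diff x y)
  then show ?case using zspan.diff unfolding Ek_def by (fastforce simp: algebra_simps)
qed

lemma even_E0:
  assumes "x \<in> E0" "even n"
  shows "(\<lambda>j. of_int n * x j) \<in> Ek k"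
proof -
  obtain l where "n = 2 * l" using assms(2) by (elim evenE)
  moreover have "(\<lambda>j. of_int l * x j) \<in> E0"
    using assms(1) unfolding E0_def by (rule zspan_scale)
  ultimately show ?thesis using two_E0[of "\<lambda>j. of_int l * x j" k] by (simp add: mult.assoc)
qed

definition congr :: "nat \<Rightarrow> (nat \<Rightarrow> complex) \<Rightarrow> (nat \<Rightarrow> complex) \<Rightarrow> bool" where
  "congr k x y \<longleftrightarrow> (\<lambda>j. x j - y j) \<in> Ek k"

lemma congr_refl: "congr k x x"
  by (simp add: congr_def Ek_def zspan.zero)

lemma congr_sym: "congr k x y \<Longrightarrow> congr k y x"
  unfolding congr_def Ek_def by (drule zspan_neg) simp

lemma congr_trans:
  assumes "congr k x y" "congr k y z"
  shows "congr k x z"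
proof -
  have "(\<lambda>j. (x j - y j) + (y j - z j)) \<in> Ek k"
    using assms unfolding congr_def Ek_def by (rule zspan_add)
  then show ?thesis by (simp add: congr_def)
qed

lemma congr_add:
  assumes "congr k x y" "congr k x' y'"
  shows "congr k (\<lambda>j. x j + x' j) (\<lambda>j. y j + y' j)"
proof -
  have "(\<lambda>j. (x j - y j) + (x' j - y' j)) \<in> Ek k"
    using assms unfolding congr_def Ek_def by (rule zspan_add)
  then show ?thesis by (simp add: congr_def algebra_simps)
qed

lemma congr_diff:
  assumes "congr k x y" "congr k x' y'"
  shows "congr k (\<lambda>j. x j - x' j) (\<lambda>j. y j - y' j)"
proof -
  have "(\<lambda>j. (x j - y j) - (x' j - y' j)) \<in> Ek k"
    using assms unfolding congr_def Ek_def by (rule zspan.diff)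
  then show ?thesis by (simp add: congr_def algebra_simps)
qed

lemma congr_sum:
  assumes "\<And>i. i \<in> I \<Longrightarrow> congr k (f i) (g i)"
  shows "congr k (\<lambda>j. \<Sum>i\<in>I. f i j) (\<lambda>j. \<Sum>i\<in>I. g i j)"
proof -
  have "(\<lambda>j. \<Sum>i\<in>I. f i j - g i j) \<in> Ek k"
    using assms unfolding congr_def Ek_def by (rule zspan_sum)
  then show ?thesis by (simp add: congr_def sum_subtractf)
qed

lemma congr_even: "x \<in> E0 \<Longrightarrow> even (n - n') \<Longrightarrow> congr k (\<lambda>j. of_int n * x j) (\<lambda>j. of_int n' * x j)"
  using even_E0[of x "n - n'" k] by (simp add: congr_def algebra_simps)

text \<open>Modulo 2 the action on coefficients is trivial, so only the action on \<open>v\<close> remains.\<close>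

lemma congr_Rcoef_sum:
  assumes g: "g \<in> Delta2 1" "i \<le> m" and M: "cong_1_mod_2 M"
  shows "congr k (\<lambda>j. \<Sum>v\<in>vbox s. of_int (f v) * (\<Sum>l\<le>m. of_int (Rcoef m M i l) * e j g (vact v M) l))
     (\<lambda>j. \<Sum>v\<in>vbox s. of_int (f v) * e j g (vact v M) i)"
proof (rule congr_sum)
  fix v
  have "congr k (\<lambda>j. \<Sum>l\<le>m. of_int (f v * Rcoef m M i l) * per g (vact v M) l j)
       (\<lambda>j. \<Sum>l\<le>m. of_int (f v * (if l = i then 1 else 0)) * per g (vact v M) l j)"
  proof (intro congr_sum congr_even per_E0)
    fix l
    show "even (f v * Rcoef m M i l - f v * (if l = i then 1 else 0))"
      using Rcoef_parity[OF M, of m i l] by (metis dvd_mult right_diff_distrib)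
  qed (use g in auto)
  moreover have "(\<Sum>l\<le>m. of_int (f v * (if l = i then 1 else 0)) * per g (vact v M) l j) =
      of_int (f v) * e j g (vact v M) i" for j
  proof -
    have "(\<Sum>l\<le>m. of_int (f v * (if l = i then 1 else 0)) * per g (vact v M) l j) =
       (\<Sum>l\<le>m. if l = i then of_int (f v) * e j g (vact v M) i else 0)"
      by (intro sum.cong) (auto simp: per_def)
    then show ?thesis using g by simp
  qed
  ultimately show "congr k (\<lambda>j. of_int (f v) * (\<Sum>l\<le>m. of_int (Rcoef m M i l) * e j g (vact v M) l))
       (\<lambda>j. of_int (f v) * e j g (vact v M) i)"
    by (simp add: sum_distrib_left per_def mult.assoc)
qed

text \<open>A substitution in the sum over v moves M onto f as its inverse M', and f composed with
  M' differs from f by \<open>vdiff M' f\<close>, one step lower in the filtration. M' inverts M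
  only modulo 2^s, which admits matrices of odd determinant.\<close>

lemma congr_wper_vact:
  assumes g: "g \<in> Delta2 1" "i \<le> m" and f: "periodic s f" "fil (Suc k) f" and M': "cong_1_mod_2 M'"
    and "\<And>v. vmod s (vact (vact v M) M') = vmod s v" "\<And>v. vmod s (vact (vact v M') M) = vmod s v"
  shows "congr k (\<lambda>j. \<Sum>v\<in>vbox s. of_int (f v) * e j g (vact v M) i) (wper g f i)"
proof -
  have "(\<Sum>v\<in>vbox s. of_int (f v) * e j g (vact v M) i) - wper g f i j = wper g (vdiff M' f) i j" for j
    unfolding wper_def vdiff_def sum_vbox_reindex[OF f(1) e_periodic assms(6,7)]
    by (simp add: algebra_simps sum_subtractf)
  moreover have "wper g (vdiff M' f) i \<in> Ek k"
    using g f M' by (intro wper_Ek periodic_vdiff fil_vdiff)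
  ultimately show ?thesis by (simp add: congr_def)
qed

text \<open>Modulo \<open>Ek k\<close> the cocycle rule loses both its twists, the one on binary
  forms and the one on v, and becomes additivity in g.\<close>

lemma congr_wper_mmul:
  assumes g: "g \<in> Delta2 1" "g' \<in> Delta2 1" "i \<le> m" and f: "periodic s f" "fil (Suc k) f"
  shows "congr k (wper (mmul g g') f i) (\<lambda>j. wper g f i j + wper g' f i j)"
proof -
  have c: "cong_1_mod_2 g" "mdet g = 1" using g by (auto simp: Delta2_def)
  have "congr k (\<lambda>j. \<Sum>v\<in>vbox s. of_int (f v) * (\<Sum>l\<le>m. of_int (Rcoef m g i l) * e j g' (vact v g) l)) (wper g' f i)"
  proof (rule congr_trans[OF congr_Rcoef_sum congr_wper_vact[where M' = "madj g"]])
    show "vmod s (vact (vact v g) (madj g)) = vmod s v" "vmod s (vact (vact v (madj g)) g) = vmod s v" for v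
      using c by (simp_all add: mmul_madj flip: vact_mmul)
  qed (use g f c in auto)
  then have "congr k (\<lambda>j. wper g f i j +
       (\<Sum>v\<in>vbox s. of_int (f v) * (\<Sum>l\<le>m. of_int (Rcoef m g i l) * e j g' (vact v g) l)))
       (\<lambda>j. wper g f i j + wper g' f i j)"
    by (intro congr_add congr_refl)
  moreover have "wper (mmul g g') f i j = wper g f i j +
       (\<Sum>v\<in>vbox s. of_int (f v) * (\<Sum>l\<le>m. of_int (Rcoef m g i l) * e j g' (vact v g) l))" for j
    unfolding wper_def e_cocycle[OF g] by (simp add: distrib_left sum.distrib)
  ultimately show ?thesis by presburger
qed

definition gen :: "nat \<Rightarrow> mat2" where
  "gen l = (if l = 0 then (1, 2, 0, 1) else if l = 1 then (1, 0, -2, 1) else (-1, 0, 0, -1))"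

lemma gen_Delta2: "gen l \<in> Delta2 1"
  by (auto simp: gen_def Delta2_def)

text \<open>An additive map on \<Gamma>(2) into a group killed by 2 is determined by its values on
  three generators, and the functions \<open>half\<close> are the dual coordinates modulo 2. The
  difference K of the two sides is additive and vanishes on the generators.\<close>

lemma congr_wper_half:
  assumes g: "g \<in> Delta2 1" and i: "i \<le> m" and f: "periodic s f" "fil (Suc k) f"
  shows "congr k (wper g f i) (\<lambda>j. \<Sum>l<3. of_int (half l g) * wper (gen l) f i j)"
proof -
  define H where "H g j = (\<Sum>l<3. of_int (half l g) * wper (gen l) f i j)" for g j
  define K where "K g j = wper g f i j - H g j" for g j
  have H_mmul: "congr k (H (mmul g g')) (\<lambda>j. H g j + H g' j)" if "g \<in> Delta2 1" "g' \<in> Delta2 1" for g g'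
  proof -
    have "congr k (\<lambda>j. \<Sum>l<3. of_int (half l (mmul g g')) * wper (gen l) f i j)
        (\<lambda>j. \<Sum>l<3. of_int (half l g + half l g') * wper (gen l) f i j)"
    proof (intro congr_sum congr_even wper_E0 gen_Delta2 i)
      fix l
      show "even (half l (mmul g g') - (half l g + half l g'))"
        using half_mmul[of g g' l] that by (simp add: Delta2_def diff_diff_eq)
    qed
    then show ?thesis unfolding H_def by (simp add: algebra_simps sum.distrib)
  qed
  have K_mmul: "congr k (K (mmul g g')) (\<lambda>j. K g j + K g' j)" if "g \<in> Delta2 1" "g' \<in> Delta2 1" for g g'
    using congr_diff[OF congr_wper_mmul[OF that i f] H_mmul[OF that]]
    by (simp add: K_def[abs_def] algebra_simps)
  have one: "(1, 0, 0, 1) \<in> Delta2 1" by (simp add: Delta2_def)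
  have K_one: "congr k (K (1, 0, 0, 1)) (\<lambda>j. 0)"
    using congr_diff[OF K_mmul[OF one one] congr_refl[of k "K (1, 0, 0, 1)"]]
    by (simp add: congr_sym)
  have K_gen: "congr k (K G) (\<lambda>j. 0)" if "G \<in> Gamma2_gens" for G
  proof -
    have e: "(\<lambda>j. 2 * wper (gen l) f i j) \<in> Ek k" for l
      by (intro two_E0 wper_E0 gen_Delta2 i)
    from that consider "G = gen 0" | "G = gen 1" | "G = gen 2"
      by (auto simp: Gamma2_gens_def gen_def)
    then show ?thesis
    proof cases
      case 1
      then have "K G = (\<lambda>j. 0)"
        by (simp add: K_def H_def fun_eq_iff numeral_3_eq_3) (simp add: gen_def)
      then show ?thesis by (simp add: congr_refl)
    next
      case 2
      \<comment> \<open>\<open>half 1\<close> equals -1 on this generator, so the two sides differ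
        by twice a period; the same happens below for the generator -1 and
        \<open>half 2\<close>.\<close>
      then have "K G = (\<lambda>j. 2 * wper (gen 1) f i j)"
        by (simp add: K_def H_def fun_eq_iff numeral_3_eq_3) (simp add: gen_def)
      then show ?thesis using e[of 1] by (simp add: congr_def)
    next
      case 3
      then have "K G = (\<lambda>j. 2 * wper (gen 2) f i j)"
        by (simp add: K_def H_def fun_eq_iff numeral_3_eq_3) (simp add: gen_def)
      then show ?thesis using e[of 2] by (simp add: congr_def)
    qed
  qed
  have K_inv: "congr k (K (madj G)) (\<lambda>j. 0)" if "G \<in> Gamma2_gens" for G
  proof -
    have G: "G \<in> Delta2 1" using that Gamma2_gens_subset by blast
    then have 1: "mmul (madj G) G = (1, 0, 0, 1)" by (simp add: mmul_madj Delta2_def)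
    have "congr k (\<lambda>j. K (madj G) j + K G j) (\<lambda>j. 0)"
      using congr_trans[OF congr_sym[OF K_mmul[OF Delta2_madj[OF G] G]]] K_one by (simp add: 1)
    from congr_diff[OF this K_gen[OF that]] show ?thesis by simp
  qed
  have "congr k (K g) (\<lambda>j. 0)"
    using g
  proof (induction rule: Gamma2_induct)
    case (gen G M)
    then have "congr k (K (mmul G M)) (\<lambda>j. K G j + K M j)"
      using Gamma2_gens_subset by (intro K_mmul) auto
    moreover have "congr k (\<lambda>j. K G j + K M j) (\<lambda>j. 0 + 0)"
      by (intro congr_add gen K_gen)
    ultimately show ?case using congr_trans by simp
  next
    case (inv G M)
    then have "congr k (K (mmul (madj G) M)) (\<lambda>j. K (madj G) j + K M j)"
      using Gamma2_gens_subset by (intro K_mmul Delta2_madj) auto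
    moreover have "congr k (\<lambda>j. K (madj G) j + K M j) (\<lambda>j. 0 + 0)"
      by (intro congr_add inv K_inv)
    ultimately show ?case using congr_trans by simp
  qed (rule K_one)
  then show ?thesis unfolding congr_def K_def H_def by simp
qed

lemma shift_E0: "x \<in> E0 \<Longrightarrow> (\<lambda>j. x (Suc j)) \<in> E0"
  unfolding E0_def
proof (induction rule: zspan.induct)
  case (base x)
  then obtain g v i where x: "x = per g v i" "g \<in> Delta2 1" "i \<le> m" by blast
  have "(\<lambda>j. \<Sum>h\<in>hreps p. \<Sum>k\<le>m. of_int (Rcoef m (madj h) i k) *
        per (fst (hdec p (mmul h g))) (vact v (madj h)) k j) \<in> E0"
    unfolding E0_def using x hdec(1)[OF p hrep_mult_Delta2[OF p(2)]]
    by (intro zspan_sum zspan_scale per_E0[unfolded E0_def]) auto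
  then show ?case
    using e_hecke[OF x(2,3)] by (simp add: x per_def E0_def)
qed (auto intro: zspan.zero zspan.diff)

text \<open>The point where T_p gains divisibility. Modulo \<open>Ek k\<close> the Hecke sum is an
  additive map summed over the matrices x in h g = x r. In the coordinates \<open>half\<close> its
  coefficients are the sums of \<open>half_hdec_sum\<close>, hence even, and even multiples of
  elements of E0 lie in \<open>Ek k\<close>.\<close>

lemma shift_wper:
  assumes g: "g \<in> Delta2 1" and i: "i \<le> m" and f: "periodic s f" "fil (Suc k) f"
  shows "(\<lambda>j. wper g f i (Suc j)) \<in> Ek k"
proof -
  define x where "x h = fst (hdec p (mmul h g))" for h
  have x: "x h \<in> Delta2 1" if "h \<in> hreps p" for h
    unfolding x_def using hdec(1)[OF p hrep_mult_Delta2[OF p(2) that g]] .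
  \<comment> \<open>r inverts p modulo 2^s, so r h inverts \<open>madj h\<close> modulo 2^s. One
    more power of 2 makes r odd also for s = 0, as is required for r h to be congruent to 1 modulo
    2.\<close>
  have "coprime (int p) (2 ^ Suc s)" using p(2) by simp
  then obtain r where r: "[int p * r = 1] (mod 2 ^ Suc s)" using cong_solve_coprime_int by blast
  then have "[int p * r = 1] (mod 2)" by (rule cong_dvd_modulus) simp
  then have "odd (int p * r)" by (simp add: cong_iff_dvd_diff)
  then have "odd r" by simp
  have r': "[int p * r = 1] (mod 2 ^ s)" using r by (rule cong_dvd_modulus) simp
  have step: "congr k (\<lambda>j. \<Sum>v\<in>vbox s. of_int (f v) * e j (x h) (vact v (madj h)) i) (wper (x h) f i)"
    if h: "h \<in> hreps p" for h
  proof -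
    obtain a b c d where hh: "h = (a, b, c, d)" by (cases h)
    have hD: "mdet h = int p" "cong_1_mod_2 h" using h hreps_subset[OF p(2)] by (auto simp: Delta2_def)
    define q where "q = (r * a, r * b, r * c, r * d)"
    have rp: "vmod s (int p * r * fst v, int p * r * snd v) = vmod s v" for v
      using cong_scalar_right[OF r', of "fst v"] cong_scalar_right[OF r', of "snd v"]
      unfolding vmod_def cong_iff_dvd_diff by (simp add: mod_eq_dvd_iff)
    have det: "a * d - b * c = int p" using hD(1) by (simp add: hh)
    have "vact (vact v (madj h)) q = (int p * r * fst v, int p * r * snd v)"
      "vact (vact v q) (madj h) = (int p * r * fst v, int p * r * snd v)" for v
      unfolding det[symmetric] by (cases v; simp add: hh q_def algebra_simps)+
    moreover have "cong_1_mod_2 q" using hD(2) \<open>odd r\<close> by (simp add: hh q_def)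
    ultimately show ?thesis
      using x[OF h] i f by (intro congr_wper_vact[where M' = q]) (simp_all add: rp)
  qed
  have "congr k (\<lambda>j. wper g f i (Suc j)) (\<lambda>j. \<Sum>h\<in>hreps p. wper (x h) f i j)"
  proof -
    have "wper g f i (Suc j) = (\<Sum>h\<in>hreps p. \<Sum>v\<in>vbox s. of_int (f v) *
        (\<Sum>l\<le>m. of_int (Rcoef m (madj h) i l) * e j (x h) (vact v (madj h)) l))" for j
      unfolding wper_def e_hecke[OF g i] x_def sum_distrib_left by (subst sum.swap) simp
    moreover have "congr k (\<lambda>j. \<Sum>h\<in>hreps p. \<Sum>v\<in>vbox s. of_int (f v) *
        (\<Sum>l\<le>m. of_int (Rcoef m (madj h) i l) * e j (x h) (vact v (madj h)) l))
        (\<lambda>j. \<Sum>h\<in>hreps p. wper (x h) f i j)"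
    proof (rule congr_sum)
      fix h assume h: "h \<in> hreps p"
      have "cong_1_mod_2 (madj h)" using h hreps_subset[OF p(2)] by (auto simp: Delta2_def)
      then show "congr k (\<lambda>j. \<Sum>v\<in>vbox s. of_int (f v) *
        (\<Sum>l\<le>m. of_int (Rcoef m (madj h) i l) * e j (x h) (vact v (madj h)) l)) (wper (x h) f i)"
        by (intro congr_trans[OF congr_Rcoef_sum step] x h i)
    qed
    ultimately show ?thesis by presburger
  qed
  also have "congr k (\<lambda>j. \<Sum>h\<in>hreps p. wper (x h) f i j)
      (\<lambda>j. \<Sum>h\<in>hreps p. \<Sum>l<3. of_int (half l (x h)) * wper (gen l) f i j)"
    by (intro congr_sum congr_wper_half x i f)
  finally (congr_trans) have "congr k (\<lambda>j. wper g f i (Suc j))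
      (\<lambda>j. \<Sum>h\<in>hreps p. \<Sum>l<3. of_int (half l (x h)) * wper (gen l) f i j)" .
  moreover have "(\<lambda>j. \<Sum>h\<in>hreps p. \<Sum>l<3. of_int (half l (x h)) * wper (gen l) f i j) \<in> Ek k"
  proof -
    have "(\<lambda>j. \<Sum>l<3. of_int (\<Sum>h\<in>hreps p. half l (x h)) * wper (gen l) f i j) \<in> Ek k"
      using even_E0[OF wper_E0[OF gen_Delta2 i] half_hdec_sum[OF p g, folded x_def]]
      unfolding Ek_def by (intro zspan_sum)
    moreover have "(\<Sum>h\<in>hreps p. \<Sum>l<3. of_int (half l (x h)) * wper (gen l) f i j) =
        (\<Sum>l<3. of_int (\<Sum>h\<in>hreps p. half l (x h)) * wper (gen l) f i j)" for j
      by (subst sum.swap) (simp add: sum_distrib_right)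
    ultimately show ?thesis by simp
  qed
  ultimately have "(\<lambda>j. (wper g f i (Suc j) - (\<Sum>h\<in>hreps p. \<Sum>l<3. of_int (half l (x h)) * wper (gen l) f i j))
     + (\<Sum>h\<in>hreps p. \<Sum>l<3. of_int (half l (x h)) * wper (gen l) f i j)) \<in> Ek k"
    unfolding congr_def Ek_def by (rule zspan_add)
  then show ?thesis by simp
qed

lemma shift_Ek: "x \<in> Ek (Suc k) \<Longrightarrow> (\<lambda>j. x (Suc j)) \<in> Ek k"
  unfolding Ek_def[of "Suc k"]
proof (induction rule: zspan.induct)
  case zero
  then show ?case by (simp add: Ek_def zspan.zero)
next
  case (base x)
  then consider g v i where "x = (\<lambda>j. 2 * per g v i j)" "g \<in> Delta2 1" "i \<le> m"
    | g f i where "x = wper g f i" "g \<in> Delta2 1" "i \<le> m" "periodic s f" "fil (Suc k) f"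
    by blast
  then show ?case
  proof cases
    case 1
    then show ?thesis using two_E0[OF shift_E0[OF per_E0]] by blast
  next
    case 2
    then show ?thesis using shift_wper by blast
  qed
next
  case (diff x y)
  then show ?case using zspan.diff unfolding Ek_def by fast
qed

lemma shift_Ek_iterated: "x \<in> Ek k \<Longrightarrow> (\<lambda>j. x (j + k)) \<in> Ek 0"
proof (induction k arbitrary: x)
  case (Suc k)
  then show ?case using Suc.IH[OF shift_Ek[OF Suc.prems]] by simp
qed simp

text \<open>With the indicator function of the class of v as weight, \<open>wper\<close> returns the
  period at v itself, and \<open>ex_fil\<close> puts every periodic function into one common step of
  the filtration.\<close>

lemma E0_subset_Ek: "\<exists>L. E0 \<subseteq> Ek L"
proof -
  obtain L where L: "\<And>f. periodic s f \<Longrightarrow> fil L f" using ex_fil by blast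
  have "per g v i \<in> Ek L" if "g \<in> Delta2 1" "i \<le> m" for g v i
  proof -
    define f :: "int \<times> int \<Rightarrow> int" where "f w = (if vmod s w = vmod s v then 1 else 0)" for w
    have f: "periodic s f" unfolding periodic_def f_def by simp
    have "wper g f i j = per g v i j" for j
    proof -
      have "wper g f i j = (\<Sum>w\<in>vbox s. if w = vmod s v then e j g w i else 0)"
        unfolding wper_def by (intro sum.cong) (auto simp: f_def vmod_vbox)
      also have "\<dots> = e j g (vmod s v) i" by (simp add: sum.delta)
      also have "\<dots> = e j g v i" by (rule periodicD[OF e_periodic]) simp
      finally show ?thesis by (simp add: per_def)
    qed
    then have "wper g f i = per g v i" by auto
    then show ?thesis using wper_Ek[OF that f L[OF f]] by simp
  qed
  then have "E0 \<subseteq> Ek L"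
    unfolding E0_def Ek_def by (intro zspan_subset) auto
  then show ?thesis by blast
qed

lemma Ek_0: "x \<in> Ek 0 \<Longrightarrow> \<exists>y\<in>E0. x = (\<lambda>j. 2 * y j)"
  unfolding Ek_def
proof (induction rule: zspan.induct)
  case zero
  then show ?case unfolding E0_def by (intro bexI[of _ "\<lambda>_. 0"]) (auto intro: zspan.zero)
next
  case (base x)
  then consider g v i where "x = (\<lambda>j. 2 * per g v i j)" "g \<in> Delta2 1" "i \<le> m"
    | g f i where "x = wper g f i" "g \<in> Delta2 1" "i \<le> m" "fil 0 f"
    by blast
  then show ?case
  proof cases
    case 1
    then show ?thesis using per_E0 by blast
  next
    case 2
    have "f v = 2 * (f v div 2)" for v
      using 2(4) by (cases v) (simp add: fil_def)
    then have "x = (\<lambda>j. 2 * wper g (\<lambda>v. f v div 2) i j)"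
      unfolding 2 wper_def sum_distrib_left fun_eq_iff
      by (intro allI sum.cong refl) (metis mult.assoc of_int_mult of_int_numeral)
    then show ?thesis using wper_E0[OF 2(2,3)] by blast
  qed
next
  case (diff x y)
  then obtain x' y' where "x' \<in> E0" "y' \<in> E0" "x = (\<lambda>j. 2 * x' j)" "y = (\<lambda>j. 2 * y' j)" by blast
  then show ?case
    by (intro bexI[of _ "\<lambda>j. x' j - y' j"]) (auto simp: E0_def algebra_simps intro: zspan.diff)
qed

text \<open>The cocycle rule expresses the period along a product through periods along the factors,
  with integer coefficients, and periods depend on v only modulo 2^s.\<close>

lemma E0_finitely_generated:
  "E0 \<subseteq> zspan {per g v i | g v i. g \<in> Gamma2_gens \<and> v \<in> vbox s \<and> i \<le> m}" (is "_ \<subseteq> zspan ?Z")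
proof -
  have box: "per g v i \<in> zspan ?Z" if "g \<in> Gamma2_gens" "i \<le> m" for g v i
  proof -
    have "e j g (vmod s v) i = e j g v i" for j by (rule periodicD[OF e_periodic]) simp
    then have "per g v i = per g (vmod s v) i" by (simp add: per_def)
    then show ?thesis using that vmod_in_vbox by (intro zspan.base) blast
  qed
  have one: "(1, 0, 0, 1) \<in> Delta2 1" by (simp add: Delta2_def)
  have e_one: "e j (1, 0, 0, 1) v i = 0" if "i \<le> m" for j v i
  proof -
    have "(\<Sum>k\<le>m. of_int (Rcoef m (1, 0, 0, 1) i k) * e j (1, 0, 0, 1) v k) =
       (\<Sum>k\<le>m. if k = i then e j (1, 0, 0, 1) v k else 0)"
      by (intro sum.cong) (auto simp: Rcoef_1[OF that])
    then show ?thesis using e_cocycle[OF one one that, of j v] that by simp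
  qed
  have per_inv: "per (madj G) v i \<in> zspan ?Z" if "G \<in> Gamma2_gens" "i \<le> m" for G v i
  proof -
    have G: "G \<in> Delta2 1" using that Gamma2_gens_subset by blast
    then have 1: "mmul (madj G) G = (1, 0, 0, 1)" by (simp add: mmul_madj Delta2_def)
    have "per (madj G) v i = (\<lambda>j. - (\<Sum>k\<le>m. of_int (Rcoef m (madj G) i k) * per G (vact v (madj G)) k j))"
      using e_cocycle[OF Delta2_madj[OF G] G that(2), of _ v] e_one[OF that(2), of _ v]
      by (simp add: 1 per_def fun_eq_iff eq_neg_iff_add_eq_0)
    then show ?thesis
      by (simp only:) (intro zspan_neg zspan_sum zspan_scale box that; simp)
  qed
  have "\<forall>v i. i \<le> m \<longrightarrow> per g v i \<in> zspan ?Z" if "g \<in> Delta2 1" for g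
    using that
  proof (induction rule: Gamma2_induct)
    case one
    then show ?case by (auto simp: per_def e_one intro: zspan.zero)
  next
    case (gen G M)
    then have G: "G \<in> Delta2 1" using Gamma2_gens_subset by blast
    show ?case
    proof (intro allI impI)
      fix v i assume i: "i \<le> m"
      have "(\<lambda>j. per G v i j + (\<Sum>k\<le>m. of_int (Rcoef m G i k) * per M (vact v G) k j)) \<in> zspan ?Z"
        by (intro zspan_add zspan_sum zspan_scale box[OF gen(1) i]) (use gen(3) in blast)
      then show "per (mmul G M) v i \<in> zspan ?Z"
        using e_cocycle[OF G gen(2) i] by (simp add: per_def)
    qed
  next
    case (inv G M)
    then have G: "madj G \<in> Delta2 1" using Gamma2_gens_subset Delta2_madj by blast
    show ?case
    proof (intro allI impI)
      fix v i assume i: "i \<le> m"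
      have "(\<lambda>j. per (madj G) v i j + (\<Sum>k\<le>m. of_int (Rcoef m (madj G) i k) * per M (vact v (madj G)) k j)) \<in> zspan ?Z"
        by (intro zspan_add zspan_sum zspan_scale per_inv[OF inv(1) i]) (use inv(3) in blast)
      then show "per (mmul (madj G) M) v i \<in> zspan ?Z"
        using e_cocycle[OF G inv(2) i] by (simp add: per_def)
    qed
  qed
  then show ?thesis unfolding E0_def by (intro zspan_subset) blast
qed

text \<open>L shifts carry E0 into 2 E0, so on finitely many generators the shift by L is twice an
  integer matrix and \<open>two_divides_recurrence\<close> applies. One set of coefficients serves
  all periods, so the recurrence can be read as an identity of forms.\<close>

theorem periods_recurrence:
  "\<exists>(D::nat) L (c::nat \<Rightarrow> int). \<forall>g\<in>Delta2 1. \<forall>v. \<forall>i\<le>m.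
     e (D * L) g v i = 2 * (\<Sum>l<D. of_int (c l) * e (l * L) g v i)"
proof -
  let ?Z = "{per g v i | g v i. g \<in> Gamma2_gens \<and> v \<in> vbox s \<and> i \<le> m}"
  have "?Z = (\<lambda>(g, v, i). per g v i) ` (Gamma2_gens \<times> vbox s \<times> {..m})"
  proof (rule subset_antisym; rule subsetI)
    fix x assume "x \<in> ?Z"
    then obtain g v i where "x = per g v i" "g \<in> Gamma2_gens" "v \<in> vbox s" "i \<le> m" by blast
    then show "x \<in> (\<lambda>(g, v, i). per g v i) ` (Gamma2_gens \<times> vbox s \<times> {..m})"
      by (intro image_eqI[of _ _ "(g, v, i)"]) auto
  next
    fix x assume "x \<in> (\<lambda>(g, v, i). per g v i) ` (Gamma2_gens \<times> vbox s \<times> {..m})"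
    then obtain g v i where "x = per g v i" "g \<in> Gamma2_gens" "v \<in> vbox s" "i \<le> m"
      by (elim imageE SigmaE) auto
    then show "x \<in> ?Z" by blast
  qed
  moreover have "finite Gamma2_gens" by (simp add: Gamma2_gens_def)
  ultimately have fin: "finite ?Z" by simp
  obtain D z where z: "?Z = z ` {..<D::nat}"
    using finite_imp_nat_seg_image_inj_on[OF fin] unfolding lessThan_def by (elim exE conjE)
  obtain L where L: "E0 \<subseteq> Ek L" using E0_subset_Ek by blast
  have zE: "z b \<in> E0" if "b < D" for b
  proof -
    have "z b \<in> ?Z" using that z by blast
    then obtain g v i where "z b = per g v i" "g \<in> Gamma2_gens" "i \<le> m" by blast
    then show ?thesis by (simp add: per_E0 subsetD[OF Gamma2_gens_subset])
  qed
  have E0_z: "x \<in> zspan (z ` {..<D})" if "x \<in> E0" for x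
    using subsetD[OF E0_finitely_generated that] unfolding z .
  have fin: "\<exists>n::nat \<Rightarrow> int. x = (\<lambda>j. \<Sum>b<D. of_int (n b) * z b j)" if "x \<in> E0" for x
    using zspan_finite[OF E0_z[OF that]] .
  have "\<exists>n::nat \<Rightarrow> int. \<forall>j. z b (j + L) = (\<Sum>l<D. of_int (2 * n l) * z l j)" if "b < D" for b
  proof -
    have "(\<lambda>j. z b (j + L)) \<in> Ek 0" using shift_Ek_iterated L zE[OF that] by blast
    then obtain y where y: "y \<in> E0" "(\<lambda>j. z b (j + L)) = (\<lambda>j. 2 * y j)" using Ek_0 by blast
    obtain n :: "nat \<Rightarrow> int" where "y = (\<lambda>j. \<Sum>b<D. of_int (n b) * z b j)" using fin[OF y(1)] by blast
    then have "z b (j + L) = (\<Sum>l<D. of_int (2 * n l) * z l j)" for j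
      using fun_cong[OF y(2), of j] by (simp add: sum_distrib_left mult.assoc)
    then show ?thesis by blast
  qed
  then obtain B where B: "\<And>b j. b < D \<Longrightarrow> z b (j + L) = (\<Sum>l<D. of_int (2 * B b l) * z l j)"
    by metis
  obtain c :: "nat \<Rightarrow> int" where c: "\<forall>z::nat \<Rightarrow> nat \<Rightarrow> complex.
     (\<forall>i<D. \<forall>j. z i (Suc j) = (\<Sum>l<D. of_int (2 * B i l) * z l j)) \<longrightarrow>
     (\<forall>i<D. z i D = 2 * (\<Sum>l<D. of_int (c l) * z i l))"
    using two_divides_recurrence[of D B] by (elim exE)
  have "\<forall>i<D. \<forall>j. z i (Suc j * L) = (\<Sum>l<D. of_int (2 * B i l) * z l (j * L))"
  proof (intro allI impI)
    fix i j assume "i < D"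
    then have "z i (j * L + L) = (\<Sum>l<D. of_int (2 * B i l) * z l (j * L))" by (rule B)
    then show "z i (Suc j * L) = (\<Sum>l<D. of_int (2 * B i l) * z l (j * L))"
      by (simp only: mult_Suc add.commute)
  qed
  then have zrec: "z b (D * L) = 2 * (\<Sum>l<D. of_int (c l) * z b (l * L))" if "b < D" for b
    using c[THEN spec, of "\<lambda>b j. z b (j * L)"] that by simp
  have rec: "x (D * L) = 2 * (\<Sum>l<D. of_int (c l) * x (l * L))" if "x \<in> zspan (z ` {..<D})" for x
    using that
  proof induction
    case (base x)
    then show ?case using zrec by blast
  next
    case (diff x y)
    then show ?case by (simp add: algebra_simps sum_subtractf)
  qed simp
  have "e (D * L) g v i = 2 * (\<Sum>l<D. of_int (c l) * e (l * L) g v i)" if "g \<in> Delta2 1" "i \<le> m" for g v i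
    using rec[OF E0_z[OF per_E0[OF that, of v]]] unfolding per_def .
  then show ?thesis by blast
qed

end

subsection \<open>Moderate growth\<close>

text \<open>Twice the hyperbolic cosine of the distance between t and \<i>; this is why a Mobius map
  changes it by a bounded factor only.\<close>

definition mu :: "complex \<Rightarrow> real" where
  "mu t = (1 + (cmod t)\<^sup>2) / Im t"

definition moderate :: "(complex \<Rightarrow> complex) \<Rightarrow> bool" where
  "moderate f \<longleftrightarrow> (\<exists>C K. \<forall>t\<in>uhp. cmod (f t) \<le> C * mu t ^ K)"

lemma mu_bounds:
  assumes "t \<in> uhp"
  shows "mu t \<ge> 2" "mu t \<ge> 1 / Im t" "mu t \<ge> cmod t"
proof -
  have y: "Im t > 0" using assms by (simp add: uhp_def)
  have le: "Im t \<le> cmod t" using abs_Im_le_cmod[of t] by simp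
  have "2 * cmod t \<le> 1 + (cmod t)\<^sup>2"
    using zero_le_power2[of "cmod t - 1"] by (simp add: power2_diff)
  then have "2 * Im t \<le> 1 + (cmod t)\<^sup>2" using le by linarith
  then show "mu t \<ge> 2" using y by (simp add: mu_def pos_le_divide_eq)
  show "mu t \<ge> 1 / Im t" using y by (simp add: mu_def divide_right_mono)
  have "cmod t * Im t \<le> cmod t * cmod t" using le by (intro mult_left_mono) auto
  then show "mu t \<ge> cmod t" using y by (simp add: mu_def pos_le_divide_eq power2_eq_square)
qed

lemma moderateI:
  assumes "\<And>t. t \<in> uhp \<Longrightarrow> cmod (f t) \<le> C * mu t ^ K"
  shows "moderate f"
  using assms unfolding moderate_def by blast

lemma moderateE:
  assumes "moderate f"
  obtains C K where "C \<ge> 0" "\<And>t. t \<in> uhp \<Longrightarrow> cmod (f t) \<le> C * mu t ^ K"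
proof -
  obtain C K where CK: "\<And>t. t \<in> uhp \<Longrightarrow> cmod (f t) \<le> C * mu t ^ K"
    using assms unfolding moderate_def by blast
  have "cmod (f t) \<le> \<bar>C\<bar> * mu t ^ K" if "t \<in> uhp" for t
  proof -
    have "mu t ^ K \<ge> 0" using mu_bounds(1)[OF that] by simp
    then have "C * mu t ^ K \<le> \<bar>C\<bar> * mu t ^ K" by (intro mult_right_mono) auto
    then show ?thesis using CK[OF that] by linarith
  qed
  then show ?thesis using that[of "\<bar>C\<bar>" K] by simp
qed

lemma moderate_const: "moderate (\<lambda>t. c)"
  by (rule moderateI[of _ "cmod c" 0]) simp

lemma moderate_ident: "moderate (\<lambda>t. t)"
  by (rule moderateI[of _ 1 1]) (simp add: mu_bounds)

lemma moderate_add: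
  assumes "moderate f" "moderate g"
  shows "moderate (\<lambda>t. f t + g t)"
proof -
  obtain C K where f: "C \<ge> 0" "\<And>t. t \<in> uhp \<Longrightarrow> cmod (f t) \<le> C * mu t ^ K"
    using moderateE[OF assms(1)] by blast
  obtain C' K' where g: "C' \<ge> 0" "\<And>t. t \<in> uhp \<Longrightarrow> cmod (g t) \<le> C' * mu t ^ K'"
    using moderateE[OF assms(2)] by blast
  show ?thesis
  proof (rule moderateI[of _ "C + C'" "K + K'"])
    fix t assume t: "t \<in> uhp"
    have m: "mu t \<ge> 1" using mu_bounds(1)[OF t] by simp
    have "C * mu t ^ K \<le> C * mu t ^ (K + K')" "C' * mu t ^ K' \<le> C' * mu t ^ (K + K')"
      using f(1) g(1) m by (intro mult_left_mono power_increasing; simp)+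
    then show "cmod (f t + g t) \<le> (C + C') * mu t ^ (K + K')"
      using f(2)[OF t] g(2)[OF t] norm_triangle_ineq[of "f t" "g t"] by (simp add: distrib_right)
  qed
qed

lemma moderate_mult:
  assumes "moderate f" "moderate g"
  shows "moderate (\<lambda>t. f t * g t)"
proof -
  obtain C K where f: "C \<ge> 0" "\<And>t. t \<in> uhp \<Longrightarrow> cmod (f t) \<le> C * mu t ^ K"
    using moderateE[OF assms(1)] by blast
  obtain C' K' where g: "C' \<ge> 0" "\<And>t. t \<in> uhp \<Longrightarrow> cmod (g t) \<le> C' * mu t ^ K'"
    using moderateE[OF assms(2)] by blast
  show ?thesis
  proof (rule moderateI[of _ "C * C'" "K + K'"])
    fix t assume t: "t \<in> uhp"
    have "mu t \<ge> 0" using mu_bounds(1)[OF t] by simp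
    then have "cmod (f t) * cmod (g t) \<le> (C * mu t ^ K) * (C' * mu t ^ K')"
      using f g t by (intro mult_mono) auto
    then show "cmod (f t * g t) \<le> C * C' * mu t ^ (K + K')"
      by (simp add: norm_mult power_add mult_ac)
  qed
qed

lemma moderate_power: "moderate f \<Longrightarrow> moderate (\<lambda>t. f t ^ n)"
  by (induction n) (auto intro: moderate_const moderate_mult)

lemma moderate_sum: "(\<And>i. i \<in> I \<Longrightarrow> moderate (f i)) \<Longrightarrow> moderate (\<lambda>t. \<Sum>i\<in>I. f i t)"
  by (induction I rule: infinite_finite_induct) (auto intro: moderate_const moderate_add)

lemma moderate_mob:
  assumes "moderate f" "mdet M > 0"
  shows "moderate (\<lambda>t. f (mob M t))"
proof -
  obtain C K where f: "C \<ge> 0" "\<And>t. t \<in> uhp \<Longrightarrow> cmod (f t) \<le> C * mu t ^ K"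
    using moderateE[OF assms(1)] by blast
  obtain a b c d where M: "M = (a, b, c, d)" by (cases M)
  have det: "a * d - b * c \<ge> 1" using assms(2) by (simp add: M)
  define S where "S = (real_of_int a)\<^sup>2 + (real_of_int b)\<^sup>2 + (real_of_int c)\<^sup>2 + (real_of_int d)\<^sup>2"
  have lin: "(cmod (of_int x * t + of_int y))\<^sup>2 \<le> ((real_of_int x)\<^sup>2 + (real_of_int y)\<^sup>2) * (1 + (cmod t)\<^sup>2)" for x y t
  proof -
    have "cmod (of_int x * t + of_int y) \<le> \<bar>real_of_int x\<bar> * cmod t + \<bar>real_of_int y\<bar> * 1"
      using norm_triangle_ineq[of "of_int x * t" "of_int y"] by (simp add: norm_mult)
    then have "(cmod (of_int x * t + of_int y))\<^sup>2 \<le> (\<bar>real_of_int x\<bar> * cmod t + \<bar>real_of_int y\<bar> * 1)\<^sup>2"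
      by (intro power_mono) auto
    also have "\<dots> \<le> ((real_of_int x)\<^sup>2 + (real_of_int y)\<^sup>2) * (1 + (cmod t)\<^sup>2)"
      using zero_le_power2[of "\<bar>real_of_int x\<bar> - \<bar>real_of_int y\<bar> * cmod t"]
      by (simp add: power2_eq_square algebra_simps)
    finally show ?thesis .
  qed
  have mu_le: "mu (mob M t) \<le> S * mu t" if t: "t \<in> uhp" for t
  proof -
    define j where "j = of_int c * t + of_int d"
    have j0: "j \<noteq> 0" using jfac_nonzero[OF t, of M] det by (simp add: j_def M)
    have y: "Im t > 0" using t by (simp add: uhp_def)
    have "mu (mob M t) = (1 + (cmod (of_int a * t + of_int b))\<^sup>2 / (cmod j)\<^sup>2) / (of_int (mdet M) * Im t / (cmod j)\<^sup>2)"
      using Im_mob[OF t, of M] det by (simp add: mu_def M j_def norm_divide power_divide)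
    also have "\<dots> = ((cmod j)\<^sup>2 + (cmod (of_int a * t + of_int b))\<^sup>2) / (of_int (mdet M) * Im t)"
    proof -
      have "(1 + X / e) / (D / e) = (e + X) / D" if "e \<noteq> 0" for X e D :: real
      proof -
        have "1 + X / e = (e + X) / e" using that by (simp add: field_simps)
        then show ?thesis using that by simp
      qed
      then show ?thesis using j0 by simp
    qed
    also have "\<dots> \<le> ((cmod j)\<^sup>2 + (cmod (of_int a * t + of_int b))\<^sup>2) / Im t"
    proof (rule divide_left_mono)
      have "1 \<le> mdet M" using det by (simp add: M)
      then have "1 \<le> real_of_int (mdet M)" by (metis of_int_1 of_int_le_iff)
      then show "Im t \<le> of_int (mdet M) * Im t" using y by (simp add: mult_le_cancel_right1)
      then show "0 < of_int (mdet M) * Im t * Im t" using y by (intro mult_pos_pos) auto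
    qed auto
    also have "\<dots> \<le> (S * (1 + (cmod t)\<^sup>2)) / Im t"
      using lin[of c t d] lin[of a t b] y
      by (intro divide_right_mono) (auto simp: S_def j_def algebra_simps)
    finally show ?thesis by (simp add: mu_def)
  qed
  show ?thesis
  proof (rule moderateI[of _ "C * S ^ K" K])
    fix t assume t: "t \<in> uhp"
    have "mob M t \<in> uhp" using mob_in_uhp t assms(2) by blast
    then have "cmod (f (mob M t)) \<le> C * mu (mob M t) ^ K" using f by blast
    also have "\<dots> \<le> C * (S * mu t) ^ K"
      using mu_le[OF t] mu_bounds(1)[OF \<open>mob M t \<in> uhp\<close>] f(1) by (intro mult_left_mono power_mono) auto
    finally show "cmod (f (mob M t)) \<le> C * S ^ K * mu t ^ K" by (simp add: power_mult_distrib mult_ac)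
  qed
qed

lemma moderate_jfac: "moderate (jfac M)"
proof (cases M)
  case (fields a b c d)
  then have "jfac M = (\<lambda>t. of_int c * t + of_int d)" by (simp add: fun_eq_iff)
  then show ?thesis by (auto intro!: moderate_add moderate_mult moderate_const moderate_ident)
qed

lemma moderate_inverse_jfac:
  assumes "mdet M \<noteq> 0"
  shows "moderate (\<lambda>t. inverse (jfac M t))"
proof (rule moderateI[of _ 1 1])
  fix t assume t: "t \<in> uhp"
  obtain a b c d where M: "M = (a, b, c, d)" by (cases M)
  have y: "Im t > 0" using t by (simp add: uhp_def)
  have m: "mu t \<ge> 1" "mu t \<ge> 1 / Im t" using mu_bounds[OF t] by auto
  show "cmod (inverse (jfac M t)) \<le> 1 * mu t ^ 1"
  proof (cases "c = 0")
    case True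
    then have "d \<noteq> 0" using assms by (simp add: M)
    then have "\<bar>real_of_int d\<bar> \<ge> 1" by linarith
    then have "inverse \<bar>real_of_int d\<bar> \<le> 1" by (simp add: inverse_le_1_iff)
    then show ?thesis using m True by (simp add: M norm_inverse)
  next
    case False
    then have "\<bar>real_of_int c\<bar> \<ge> 1" by linarith
    then have "Im t \<le> \<bar>real_of_int c\<bar> * Im t" using y by (simp add: mult_le_cancel_right1)
    also have "\<dots> \<le> cmod (jfac M t)"
      using abs_Im_le_cmod[of "jfac M t"] y by (simp add: M abs_mult)
    finally have "inverse (cmod (jfac M t)) \<le> 1 / Im t"
      using y le_imp_inverse_le[of "Im t" "cmod (jfac M t)"] by (simp add: inverse_eq_divide)
    then show ?thesis using m by (simp add: norm_inverse)
  qed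
qed

text \<open>On the segment from \<i> to t one has |z| <= \<open>mu t\<close> and Im z >= 1 /
  \<open>mu t\<close>, so \<open>mu z\<close> is at most twice the cube of \<open>mu t\<close>; the
  mean value bound then loses only powers of \<open>mu t\<close>.\<close>

lemma moderate_primitive:
  assumes f: "moderate f" and F: "\<And>t. t \<in> uhp \<Longrightarrow> (F has_field_derivative f t) (at t)"
  shows "moderate F"
proof -
  obtain C K where C: "C \<ge> 0" "\<And>t. t \<in> uhp \<Longrightarrow> cmod (f t) \<le> C * mu t ^ K"
    using moderateE[OF f] by blast
  have diff: "cmod (F t - F \<i>) \<le> C * (2 * mu t ^ 3) ^ K * (2 * mu t)" if t: "t \<in> uhp" for t
  proof -
    have y: "Im t > 0" using t by (simp add: uhp_def)
    note m = mu_bounds[OF t]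
    have i: "\<i> \<in> uhp" by (simp add: uhp_def)
    have seg: "closed_segment \<i> t \<subseteq> uhp" using i t convex_uhp by (simp add: closed_segment_subset)
    have bound: "cmod (f z) \<le> C * (2 * mu t ^ 3) ^ K" if z: "z \<in> closed_segment \<i> t" for z
    proof -
      have zu: "z \<in> uhp" using seg z by blast
      obtain u where u: "0 \<le> u" "u \<le> 1" "z = (1 - u) *\<^sub>R \<i> + u *\<^sub>R t"
        using z by (auto simp: closed_segment_def)
      have "cmod z \<le> (1 - u) * 1 + u * cmod t"
        using norm_triangle_ineq[of "(1 - u) *\<^sub>R \<i>" "u *\<^sub>R t"] u by simp
      also have "\<dots> \<le> (1 - u) * mu t + u * mu t"
        using u m by (intro add_mono mult_left_mono) auto
      finally have z1: "cmod z \<le> mu t" by (simp add: algebra_simps)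
      have "1 / mu t \<le> Im t" using m(2) y m(1) by (simp add: field_simps)
      moreover have "1 / mu t \<le> 1" using m(1) by simp
      ultimately have "(1 - u) * (1 / mu t) + u * (1 / mu t) \<le> (1 - u) * 1 + u * Im t"
        using u by (intro add_mono mult_left_mono) auto
      moreover have "Im z = (1 - u) * 1 + u * Im t" using u by simp
      moreover have "(1 - u) * (1 / mu t) + u * (1 / mu t) = 1 / mu t"
        unfolding distrib_right[symmetric] by simp
      ultimately have z2: "1 / mu t \<le> Im z" by linarith
      have "(cmod z)\<^sup>2 \<le> mu t ^ 2" using z1 by (intro power_mono) auto
      moreover have "1 \<le> mu t ^ 2" using m(1) by (simp add: one_le_power)
      ultimately have "1 + (cmod z)\<^sup>2 \<le> 2 * mu t ^ 2" by linarith
      then have "mu z \<le> (2 * mu t ^ 2) / (1 / mu t)"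
        unfolding mu_def[of z] using z2 m(1) by (intro frac_le) auto
      then have "mu z \<le> 2 * mu t ^ 3" by (simp add: power2_eq_square power3_eq_cube)
      then have "C * mu z ^ K \<le> C * (2 * mu t ^ 3) ^ K"
        using C(1) mu_bounds(1)[OF zu] by (intro mult_left_mono power_mono) auto
      then show ?thesis using C(2)[OF zu] by linarith
    qed
    have "cmod (F t - F \<i>) \<le> C * (2 * mu t ^ 3) ^ K * cmod (t - \<i>)"
    proof (rule field_differentiable_bound[of "closed_segment \<i> t" F f])
      show "(F has_field_derivative f z) (at z within closed_segment \<i> t)" if "z \<in> closed_segment \<i> t" for z
        using F seg that by (meson has_field_derivative_at_within subsetD)
    qed (use bound in auto)
    also have "\<dots> \<le> C * (2 * mu t ^ 3) ^ K * (2 * mu t)"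
    proof (rule mult_left_mono)
      show "cmod (t - \<i>) \<le> 2 * mu t"
        using norm_triangle_ineq4[of t \<i>] m by simp
    qed (use C(1) m(1) in auto)
    finally show ?thesis .
  qed
  have "moderate (\<lambda>t. F t - F \<i>)"
  proof (rule moderateI[of _ "C * 2 ^ K * 2" "3 * K + 1"])
    fix t assume "t \<in> uhp"
    then show "cmod (F t - F \<i>) \<le> C * 2 ^ K * 2 * mu t ^ (3 * K + 1)"
      using diff[of t] by (simp add: power_mult_distrib power_add mult_ac flip: power_mult)
  qed
  then have "moderate (\<lambda>t. (F t - F \<i>) + F \<i>)" by (intro moderate_add moderate_const)
  then show ?thesis by simp
qed

section \<open>Behaviour at the cusps and at the real line\<close>

lemma periodic_int_shift:
  fixes k :: "complex \<Rightarrow> complex" and P :: real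
  assumes per: "\<And>t. t \<in> uhp \<Longrightarrow> k (t + of_real P) = k t" and t: "t \<in> uhp"
  shows "k (t + of_int n * of_real P) = k t"
proof -
  have nat: "k (t + of_nat n * of_real P) = k t" if "t \<in> uhp" for t n
  proof (induction n)
    case (Suc n)
    have "t + of_nat n * of_real P \<in> uhp" using that by (simp add: uhp_def)
    then have "k (t + of_nat n * of_real P + of_real P) = k t" using per Suc by simp
    then show ?case by (simp add: algebra_simps)
  qed simp
  show ?thesis
  proof (cases "n \<ge> 0")
    case True
    then show ?thesis using nat[OF t, of "nat n"] by simp
  next
    case False
    define t' where "t' = t + of_int n * of_real P"
    have "t' \<in> uhp" using t by (simp add: t'_def uhp_def)
    moreover have "t' + of_nat (nat (- n)) * of_real P = t"
      using False by (simp add: t'_def)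
    ultimately have "k t = k t'" using nat[of t' "nat (- n)"] by metis
    then show ?thesis by (simp add: t'_def)
  qed
qed

text \<open>A periodic function of moderate growth has a removable singularity at the cusp, as a
  function of \<open>exp (2 \<pi> \<i> t / P)\<close>.\<close>

lemma periodic_moderate_bounded:
  fixes k :: "complex \<Rightarrow> complex" and P :: real
  assumes hol: "k holomorphic_on uhp" and "moderate k" and P: "P > 0"
    and per: "\<And>t. t \<in> uhp \<Longrightarrow> k (t + of_real P) = k t"
  shows "\<exists>B. \<forall>t. Im t \<ge> 1 / 2 \<longrightarrow> cmod (k t) \<le> B"
proof -
  define c where "c = of_real P / (2 * of_real pi * \<i>)"
  define F where "F q = k (c * Ln q)" for q
  have c0: "c \<noteq> 0" using P by (simp add: c_def)
  have cz: "c * z = of_real (P / (2 * pi)) * (- \<i> * z)" for z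
    by (simp add: c_def field_simps)
  have Im_c: "Im (c * z) = - (P / (2 * pi)) * Re z" "Re (c * z) = P / (2 * pi) * Im z" for z
    unfolding cz by simp_all
  have in_uhp: "c * z \<in> uhp \<longleftrightarrow> Re z < 0" for z
  proof -
    have key: "0 < - b * x \<longleftrightarrow> x < 0" if "b > 0" for b x :: real
      using that by (auto simp: mult_less_0_iff)
    show ?thesis
      unfolding uhp_def mem_Collect_eq Im_c by (rule key) (use P in simp)
  qed
  have F_exp: "F (exp z) = k (c * z)" if "Re z < 0" for z
  proof -
    obtain n :: int where n: "Ln (exp z) = z + of_int (2 * n) * of_real pi * \<i>"
      using exp_eq[of "Ln (exp z)" z] by (auto simp: exp_Ln mult_ac)
    have "c * Ln (exp z) = c * z + of_int n * of_real P"
      unfolding n c_def by (simp add: field_simps)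
    then show ?thesis
      unfolding F_def using periodic_int_shift[of k P "c * z" n] per that in_uhp by simp
  qed
  \<comment> \<open>\<open>Ln\<close> has its cut along the negative reals. Periodicity of k makes F
    independent of the branch, so near the cut F is written with the branch Ln(-q) + \<pi>
    \<i>.\<close>
  have F_hol: "F holomorphic_on ball 0 1 - {0}"
  proof -
    define A where "A = (ball 0 1 - {0}) - (\<real>\<^sub>\<le>\<^sub>0 :: complex set)"
    define B where "B = (ball 0 1 - {0}) - uminus ` (\<real>\<^sub>\<le>\<^sub>0 :: complex set)"
    have opA: "open A" unfolding A_def by (intro open_Diff closed_nonpos_Reals_complex) auto
    have opB: "open B" unfolding B_def by (intro open_Diff closed_negations closed_nonpos_Reals_complex) auto
    have "F holomorphic_on A"
      unfolding F_def
    proof (rule holomorphic_on_compose_gen[OF _ hol, unfolded o_def])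
      show "(\<lambda>q. c * Ln q) holomorphic_on A"
        by (intro holomorphic_intros) (auto simp: A_def)
      show "(\<lambda>q. c * Ln q) ` A \<subseteq> uhp"
      proof (rule image_subsetI)
        fix q assume "q \<in> A"
        then have "q \<noteq> 0" "cmod q < 1" by (auto simp: A_def)
        then show "c * Ln q \<in> uhp" by (simp add: in_uhp)
      qed
    qed
    moreover have "F holomorphic_on B"
    proof -
      have holB: "(\<lambda>q. k (c * (Ln (- q) + of_real pi * \<i>))) holomorphic_on B"
      proof (rule holomorphic_on_compose_gen[OF _ hol, unfolded o_def])
        show "(\<lambda>q. c * (Ln (- q) + of_real pi * \<i>)) holomorphic_on B"
        proof (intro holomorphic_intros)
          fix q assume "q \<in> B"
          then have "q \<notin> uminus ` \<real>\<^sub>\<le>\<^sub>0" by (simp add: B_def)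
          then show "- q \<notin> \<real>\<^sub>\<le>\<^sub>0" by (metis image_eqI minus_minus)
        qed
        show "(\<lambda>q. c * (Ln (- q) + of_real pi * \<i>)) ` B \<subseteq> uhp"
        proof (rule image_subsetI)
          fix q assume "q \<in> B"
          then have "q \<noteq> 0" "cmod q < 1" by (auto simp: B_def)
          then show "c * (Ln (- q) + of_real pi * \<i>) \<in> uhp" by (simp add: in_uhp)
        qed
      qed
      have F_B: "F q = k (c * (Ln (- q) + of_real pi * \<i>))" if "q \<in> B" for q
      proof -
        have q: "q \<noteq> 0" "cmod q < 1" using that by (auto simp: B_def)
        have "exp (Ln (- q) + of_real pi * \<i>) = q"
          using q by (simp add: exp_add exp_Ln)
        moreover have "Re (Ln (- q) + of_real pi * \<i>) < 0" using q by simp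
        ultimately show ?thesis using F_exp by metis
      qed
      show ?thesis by (rule holomorphic_transform[OF holB]) (simp add: F_B)
    qed
    moreover have "A \<union> B = ball 0 1 - {0}"
    proof -
      have "q \<in> A \<union> B" if "q \<in> ball 0 1 - {0}" for q
      proof (rule ccontr)
        assume "q \<notin> A \<union> B"
        then have "q \<in> \<real>\<^sub>\<le>\<^sub>0" "- q \<in> \<real>\<^sub>\<le>\<^sub>0" using that by (auto simp: A_def B_def)
        then have "q = 0" by (auto simp: complex_nonpos_Reals_iff complex_eq_iff)
        then show False using that by simp
      qed
      moreover have "A \<union> B \<subseteq> ball 0 1 - {0}" unfolding A_def B_def by blast
      ultimately show ?thesis by blast
    qed
    ultimately show ?thesis using holomorphic_on_Un[OF _ _ opA opB] by metis
  qed
  obtain C K where C: "C \<ge> 0" "\<And>t. t \<in> uhp \<Longrightarrow> cmod (k t) \<le> C * mu t ^ K"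
    using moderateE[OF \<open>moderate k\<close>] by blast
  define b where "b = P / (2 * pi)"
  have b: "b > 0" using P by (simp add: b_def)
  define A where "A = (1 + P\<^sup>2 + b\<^sup>2) / b"
  \<comment> \<open>With x = - ln |q|, moderate growth bounds |F q| by a power of x, while |q| =
    exp(-x). Hence q F(q) tends to 0, and the singularity at 0 is removable.\<close>
  have small: "cmod (q * F q) \<le> C * A ^ K * ((- ln (cmod q)) ^ K / exp (- ln (cmod q)))"
    if q: "q \<noteq> 0" "cmod q < exp (-1)" for q
  proof -
    define x where "x = - ln (cmod q)"
    have "ln (cmod q) < ln (exp (-1))" using q by (subst ln_less_cancel_iff) auto
    then have x: "x > 1" by (simp add: x_def)
    define t where "t = c * Ln q"
    have im: "Im t = b * x" unfolding t_def Im_c using q by (simp add: b_def x_def)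
    have t: "t \<in> uhp" using im b x by (simp add: uhp_def)
    have "\<bar>Im (Ln q)\<bar> \<le> pi" using q Im_Ln_le_pi[of q] mpi_less_Im_Ln[of q] by simp
    then have "\<bar>Re t\<bar> \<le> P / (2 * pi) * pi"
      using P unfolding t_def Im_c abs_mult by (intro mult_mono) auto
    then have re: "\<bar>Re t\<bar> \<le> P" using P by simp
    have "(Re t)\<^sup>2 \<le> P\<^sup>2" using re P by (metis abs_le_square_iff abs_of_pos)
    then have "1 + (cmod t)\<^sup>2 \<le> 1 + P\<^sup>2 + (b * x)\<^sup>2" by (simp add: cmod_power2 im)
    also have "\<dots> \<le> (1 + P\<^sup>2 + b\<^sup>2) * x\<^sup>2"
    proof -
      have "1 \<le> x\<^sup>2" using x by (simp add: one_le_power)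
      then have "(1 + P\<^sup>2) * 1 \<le> (1 + P\<^sup>2) * x\<^sup>2" by (intro mult_left_mono) auto
      then show ?thesis by (simp add: algebra_simps power_mult_distrib)
    qed
    finally have "mu t \<le> ((1 + P\<^sup>2 + b\<^sup>2) * x\<^sup>2) / (b * x)"
      unfolding mu_def im using b x by (intro divide_right_mono) auto
    moreover have "(S * x\<^sup>2) / (b * x) = (S / b) * x" for S
      using x b by (simp add: power2_eq_square)
    ultimately have "mu t \<le> A * x" unfolding A_def by metis
    then have "C * mu t ^ K \<le> C * (A * x) ^ K"
      using C(1) mu_bounds(1)[OF t] by (intro mult_left_mono power_mono) auto
    then have "cmod (F q) \<le> C * (A * x) ^ K" using C(2)[OF t] by (simp add: F_def t_def)
    then have "cmod q * cmod (F q) \<le> cmod q * (C * (A * x) ^ K)" by (intro mult_left_mono) auto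
    moreover have "exp (- ln (cmod q)) = 1 / cmod q" using q by (simp add: exp_minus inverse_eq_divide)
    ultimately show ?thesis by (simp add: norm_mult x_def[symmetric] power_mult_distrib mult_ac)
  qed
  have "((\<lambda>q. (q - 0) * F q) \<longlongrightarrow> 0) (at 0)"
  proof (rule tendsto_norm_zero_cancel, rule tendsto_sandwich[of "\<lambda>_. 0" _ _
      "\<lambda>q. C * A ^ K * ((- ln (cmod q)) ^ K / exp (- ln (cmod q)))"])
    have lim: "filterlim (\<lambda>q::complex. - ln (cmod q)) at_top (at 0)"
    proof -
      have "filterlim (\<lambda>x::real. - ln x) at_top (at_right 0)" by real_asymp
      moreover have "filterlim (\<lambda>q::complex. cmod q) (at_right 0) (at 0)"
        unfolding filterlim_at by (auto simp: eventually_at intro!: tendsto_eq_intros exI[of _ 1])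
      ultimately show ?thesis by (rule filterlim_compose)
    qed
    have "((\<lambda>x::real. x ^ K / exp x) \<longlongrightarrow> 0) at_top" by (rule tendsto_power_div_exp_0)
    from filterlim_compose[OF this lim]
    show "((\<lambda>q. C * A ^ K * ((- ln (cmod q)) ^ K / exp (- ln (cmod q)))) \<longlongrightarrow> 0) (at 0)"
      by (rule tendsto_mult_right_zero)
    show "\<forall>\<^sub>F q in at 0. cmod ((q - 0) * F q) \<le> C * A ^ K * ((- ln (cmod q)) ^ K / exp (- ln (cmod q)))"
      unfolding eventually_at using small by (intro exI[of _ "exp (-1)"]) (auto simp: dist_norm)
  qed auto
  then obtain G where G: "G holomorphic_on ball 0 1" "\<And>q. q \<in> ball 0 1 - {0} \<Longrightarrow> G q = F q"
    using holomorphic_on_extend_lim[OF F_hol] by auto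
  \<comment> \<open>The modulus of exp(2 \<pi> \<i> t / P) at height Im t = 1/2.\<close>
  define r where "r = exp (- pi / P)"
  have r: "r < 1" using P by (simp add: r_def)
  have "compact (G ` cball 0 r)"
    using G(1) r by (intro compact_continuous_image holomorphic_on_imp_continuous_on)
      (auto elim: holomorphic_on_subset)
  then obtain B where B: "\<And>q. q \<in> cball 0 r \<Longrightarrow> cmod (G q) \<le> B"
    by (meson bounded_iff compact_imp_bounded imageI)
  have "cmod (k t) \<le> B" if "Im t \<ge> 1 / 2" for t
  proof -
    define z where "z = t / c"
    have zt: "c * z = t" using c0 by (simp add: z_def)
    have "b * Re z = - Im t" using Im_c(1)[of z] unfolding zt by (simp add: b_def)
    then have "b * Re z \<le> - (1 / 2)" using that by simp
    then have re: "Re z \<le> - pi / P" using P by (simp add: b_def field_simps)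
    then have "cmod (exp z) \<le> r" by (simp add: r_def)
    then have "cmod (G (exp z)) \<le> B" by (intro B) simp
    moreover have "- pi / P < 0" using P by (simp add: divide_neg_pos)
    then have neg: "Re z < 0" using re by linarith
    moreover have "G (exp z) = F (exp z)" using neg by (intro G(2)) auto
    ultimately show ?thesis using F_exp[of z] by (simp add: zt)
  qed
  then show ?thesis by blast
qed

text \<open>Extended by zero to the lower half plane, h is continuous across the real line and hence
  entire; an entire function that is zero on a half plane vanishes.\<close>

lemma vanishing_at_real_line_imp_zero:
  assumes hol: "h holomorphic_on uhp" and m: "m > 0"
    and bound: "\<And>t. t \<in> uhp \<Longrightarrow> (cmod (h t))\<^sup>2 \<le> C * Im t ^ m" and t: "t \<in> uhp"
  shows "h t = 0"
proof -
  define f where "f z = (if Im z > 0 then h z else 0)" for z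
  have cont: "isCont f z" for z
  proof (cases "Im z = 0")
    case False
    show ?thesis
    proof (cases "Im z > 0")
      case True
      then have "\<forall>\<^sub>F w in nhds z. f w = h w"
        using open_uhp eventually_nhds_in_open[of uhp z] by (auto simp: uhp_def f_def elim: eventually_mono)
      moreover have "isCont h z"
        using holomorphic_on_imp_continuous_on[OF hol] True
          continuous_on_eq_continuous_at[OF open_uhp, of h] by (auto simp: uhp_def)
      ultimately show ?thesis using isCont_cong by blast
    next
      case neg: False
      then have "Im z < 0" using False by simp
      then have "\<forall>\<^sub>F w in nhds z. f w = 0"
        using eventually_nhds_in_open[OF open_halfspace_Im_lt[of 0], of z] by (auto simp: f_def elim: eventually_mono)
      then show ?thesis using isCont_cong[of f "\<lambda>_. 0" z] by simp
    qed
  next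
    case True
    have "(f \<longlongrightarrow> 0) (at z)"
    proof -
      have "((\<lambda>w. (cmod (f w))\<^sup>2) \<longlongrightarrow> 0) (at z)"
      proof (rule tendsto_sandwich[of "\<lambda>_. 0" _ _ "\<lambda>w. \<bar>C\<bar> * \<bar>Im w\<bar> ^ m"])
        show "((\<lambda>w. \<bar>C\<bar> * \<bar>Im w\<bar> ^ m) \<longlongrightarrow> 0) (at z)"
          using m True by (auto intro!: tendsto_eq_intros)
        have "(cmod (f w))\<^sup>2 \<le> \<bar>C\<bar> * \<bar>Im w\<bar> ^ m" for w
        proof (cases "Im w > 0")
          case True
          then have "(cmod (f w))\<^sup>2 \<le> C * Im w ^ m" using bound[of w] by (simp add: f_def uhp_def)
          also have "\<dots> \<le> \<bar>C\<bar> * \<bar>Im w\<bar> ^ m" using True by (intro mult_mono) auto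
          finally show ?thesis .
        qed (simp add: f_def)
        then show "\<forall>\<^sub>F w in at z. (cmod (f w))\<^sup>2 \<le> \<bar>C\<bar> * \<bar>Im w\<bar> ^ m" by simp
      qed auto
      then have "((\<lambda>w. sqrt ((cmod (f w))\<^sup>2)) \<longlongrightarrow> sqrt 0) (at z)" by (rule tendsto_real_sqrt)
      then show ?thesis by (simp add: tendsto_norm_zero_iff)
    qed
    then show ?thesis using True by (simp add: isCont_def f_def)
  qed
  have "f holomorphic_on UNIV"
  proof (rule holomorphic_on_paste_across_line[of UNIV "- \<i>" f 0])
    have "f holomorphic_on {z. Im z < 0}"
      by (rule holomorphic_transform[of "\<lambda>_. 0"]) (auto simp: f_def)
    moreover have "f holomorphic_on {z. Im z > 0}"
      by (rule holomorphic_transform[of h]) (use hol in \<open>auto simp: f_def uhp_def\<close>)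
    ultimately show "f holomorphic_on UNIV \<inter> {z. - \<i> \<bullet> z < 0}" "f holomorphic_on UNIV \<inter> {z. 0 < - \<i> \<bullet> z}"
      by (simp_all add: inner_complex_def)
    show "continuous_on UNIV f" using cont by (simp add: continuous_at_imp_continuous_on)
  qed auto
  moreover have "- \<i> islimpt {z. Im z < 0}"
    by (rule interior_limit_point) (simp add: interior_open open_halfspace_Im_lt)
  ultimately have "f t = 0"
    by (intro analytic_continuation[of f UNIV "{z. Im z < 0}" "- \<i>" t]) (auto simp: f_def)
  then show ?thesis using t by (simp add: f_def uhp_def)
qed

subsection \<open>Modular families, Hecke operators and period polynomials\<close>

text \<open>
  A family \<open>g\<close> indexed by row vectors modulo \<open>2\<^sup>s\<close> encodes a modular form \<open>g (0, 1)\<close> of level \<open>2\<^sup>s\<close>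
  with its translates under \<open>\<Gamma>(2)\<close>: \<open>g v\<close> is the translate by any matrix with bottom row \<open>v\<close>.
\<close>

definition modular_family :: "nat \<Rightarrow> nat \<Rightarrow> (int \<Rightarrow> complex) \<Rightarrow> (int \<times> int \<Rightarrow> complex \<Rightarrow> complex) \<Rightarrow> bool" where
  "modular_family s w chi g \<longleftrightarrow> periodic s g \<and> (\<forall>v. g v holomorphic_on uhp \<and> moderate (g v)) \<and>
     (\<forall>M\<in>Delta2 1. \<forall>v. \<forall>t\<in>uhp. g v (mob M t) = jfac M t ^ w * g (vact v M) t) \<and>
     (\<forall>u v. \<forall>t\<in>uhp. odd u \<longrightarrow> g (u * fst v, u * snd v) t = chi u * g v t)"

lemma modular_familyD:
  assumes "modular_family s w chi g"
  shows "periodic s g" "g v holomorphic_on uhp" "moderate (g v)"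
    "M \<in> Delta2 1 \<Longrightarrow> t \<in> uhp \<Longrightarrow> g v (mob M t) = jfac M t ^ w * g (vact v M) t"
    "odd u \<Longrightarrow> t \<in> uhp \<Longrightarrow> g (u * fst v, u * snd v) t = chi u * g v t"
  using assms unfolding modular_family_def by blast+

lemma modular_family_sum:
  assumes "\<And>i. i \<in> I \<Longrightarrow> modular_family s w chi (g i)"
  shows "modular_family s w chi (\<lambda>v t. \<Sum>i\<in>I. c i * g i v t)"
  unfolding modular_family_def
proof (intro conjI allI ballI impI)
  show "periodic s (\<lambda>v t. \<Sum>i\<in>I. c i * g i v t)"
    unfolding periodic_def
  proof (intro allI impI)
    fix v w' assume "vmod s v = vmod s w'"
    then have "g i v = g i w'" if "i \<in> I" for i
      using modular_familyD(1)[OF assms[OF that]] by (rule periodicD[rotated])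
    then show "(\<lambda>t. \<Sum>i\<in>I. c i * g i v t) = (\<lambda>t. \<Sum>i\<in>I. c i * g i w' t)"
      by (intro ext sum.cong) auto
  qed
  fix v
  show "(\<lambda>t. \<Sum>i\<in>I. c i * g i v t) holomorphic_on uhp"
    using modular_familyD(2)[OF assms] by (intro holomorphic_intros)
  show "moderate (\<lambda>t. \<Sum>i\<in>I. c i * g i v t)"
    using modular_familyD(3)[OF assms] by (intro moderate_sum moderate_mult moderate_const)
  fix t assume t: "t \<in> uhp"
  show "(\<Sum>i\<in>I. c i * g i v (mob M t)) = jfac M t ^ w * (\<Sum>i\<in>I. c i * g i (vact v M) t)"
    if "M \<in> Delta2 1" for M
    using modular_familyD(4)[OF assms that t] by (simp add: sum_distrib_left mult_ac)
  show "(\<Sum>i\<in>I. c i * g i (u * fst v, u * snd v) t) = chi u * (\<Sum>i\<in>I. c i * g i v t)" if "odd u" for u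
    using modular_familyD(5)[OF assms that t, of _ v] by (simp add: sum_distrib_left mult_ac)
qed

text \<open>The row vector moves by the adjugate of h, its inverse up to a scalar; with this choice
  each summand depends only on the coset of h. The power p^(w - 1) makes the action on integrals of
  forms integral (\<open>primitive_hecke\<close>).\<close>

definition hecke :: "nat \<Rightarrow> nat \<Rightarrow> (int \<times> int \<Rightarrow> complex \<Rightarrow> complex) \<Rightarrow> int \<times> int \<Rightarrow> complex \<Rightarrow> complex" where
  "hecke w p g v t = of_nat p ^ (w - 1) * (\<Sum>h\<in>hreps p. g (vact v (madj h)) (mob h t) / jfac h t ^ w)"

lemma hreps_det: "p > 0 \<Longrightarrow> h \<in> hreps p \<Longrightarrow> mdet h = int p"
  by (auto simp: hreps_def)

text \<open>Obtained from the adjugates of both sides of h g = x r. It matches the row vector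
  reached through h and x with the one reached through g and r.\<close>

lemma hdec_vact:
  assumes p: "prime p" "odd p" and h: "h \<in> hreps p" and g: "g \<in> Delta2 1"
  shows "mmul (madj h) (fst (hdec p (mmul h g))) = mmul g (madj (snd (hdec p (mmul h g))))"
proof -
  define x where "x = fst (hdec p (mmul h g))"
  define r where "r = snd (hdec p (mmul h g))"
  note hd = hdec[OF p hrep_mult_Delta2[OF p(2) h g], folded x_def r_def]
  have 1: "mmul g (madj g) = (1, 0, 0, 1)" using g by (simp add: mmul_madj Delta2_def)
  have 2: "mmul (madj x) x = (1, 0, 0, 1)" using hd(1) by (simp add: mmul_madj Delta2_def)
  have "mmul (madj r) (madj x) = mmul (madj g) (madj h)"
    using hd(3) by (metis madj_mmul)
  then have "mmul g (mmul (mmul (madj r) (madj x)) x) = mmul g (mmul (mmul (madj g) (madj h)) x)" by simp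
  then have "mmul g (madj r) = mmul (madj h) x"
    by (metis 1 2 mmul_1 mmul_assoc)
  then show ?thesis by (simp add: x_def r_def)
qed

lemma modular_family_hecke:
  assumes p: "prime p" "odd p" and g: "modular_family s w chi g" and w: "w > 0"
  shows "modular_family s w chi (hecke w p g)"
  unfolding modular_family_def
proof (intro conjI allI ballI impI)
  have p0: "p > 0" using p by (simp add: prime_gt_0_nat)
  have hdet: "mdet h > 0" "mdet h \<noteq> 0" if "h \<in> hreps p" for h using hreps_det[OF p0 that] p0 by auto
  show "periodic s (hecke w p g)"
    unfolding periodic_def
  proof (intro allI impI)
    fix v v' assume v: "vmod s v = vmod s v'"
    have "g (vact v M) = g (vact v' M)" for M
      using modular_familyD(1)[OF g] by (rule periodicD) (rule vmod_vact_cong[OF v])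
    then show "hecke w p g v = hecke w p g v'" by (simp add: fun_eq_iff hecke_def)
  qed
  fix v
  have hol: "(\<lambda>t. g v' (mob h t)) holomorphic_on uhp" if h: "h \<in> hreps p" for h v'
  proof (rule holomorphic_on_compose_gen[OF _ modular_familyD(2)[OF g], unfolded o_def])
    show "mob h holomorphic_on uhp"
      using has_field_derivative_mob[OF _ hdet(2)[OF h]] open_uhp
      by (auto simp: holomorphic_on_open)
    show "mob h ` uhp \<subseteq> uhp" using mob_in_uhp hdet(1)[OF h] by blast
  qed
  have jhol: "jfac h holomorphic_on uhp" for h
  proof (cases h)
    case (fields a b c d)
    then have "jfac h = (\<lambda>t. of_int c * t + of_int d)" by (simp add: fun_eq_iff)
    then show ?thesis by (auto intro: holomorphic_intros)
  qed
  show "hecke w p g v holomorphic_on uhp"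
    unfolding hecke_def[abs_def]
    using hol jhol hdet(2) jfac_nonzero
    by (intro holomorphic_on_mult holomorphic_on_const holomorphic_on_sum holomorphic_on_divide holomorphic_on_power) auto
  show "moderate (hecke w p g v)"
    unfolding hecke_def[abs_def] divide_inverse power_inverse[symmetric]
    using modular_familyD(3)[OF g] hdet
    by (intro moderate_mult moderate_const moderate_sum moderate_power moderate_mob moderate_inverse_jfac)
  fix t assume t: "t \<in> uhp"
  show "hecke w p g v (mob M t) = jfac M t ^ w * hecke w p g (vact v M) t" if M: "M \<in> Delta2 1" for M
  proof -
    have Mdet: "mdet M = 1" using M by (simp add: Delta2_def)
    have jM: "jfac M t \<noteq> 0" using jfac_nonzero[OF t, of M] Mdet by simp
    define x where "x h = fst (hdec p (mmul h M))" for h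
    define r where "r h = snd (hdec p (mmul h M))" for h
    have h_term: "g (vact v (madj h)) (mob h (mob M t)) / jfac h (mob M t) ^ w =
        jfac M t ^ w * (g (vact (vact v M) (madj (r h))) (mob (r h) t) / jfac (r h) t ^ w)" if h: "h \<in> hreps p" for h
    proof -
      note hd = hdec[OF p hrep_mult_Delta2[OF p(2) h M], folded x_def r_def]
      have xdet: "mdet (x h) = 1" using hd(1) by (simp add: Delta2_def)
      note rdet = hdet[OF hd(2)]
      have rt: "mob (r h) t \<in> uhp" using mob_in_uhp[OF t rdet(1)] .
      have "mob h (mob M t) = mob (mmul (x h) (r h)) t"
        using hd(3) mob_mmul[OF t hdet(1)[OF h], of M] Mdet by simp
      also have "\<dots> = mob (x h) (mob (r h) t)" using mob_mmul[OF t _ rdet(1)] xdet by simp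
      finally have "g (vact v (madj h)) (mob h (mob M t)) =
          jfac (x h) (mob (r h) t) ^ w * g (vact (vact v (madj h)) (x h)) (mob (r h) t)"
        using modular_familyD(4)[OF g hd(1) rt] by simp
      moreover have "vact (vact v (madj h)) (x h) = vact (vact v M) (madj (r h))"
        using hdec_vact[OF p h M] by (simp add: x_def r_def flip: vact_mmul)
      moreover have "jfac h (mob M t) * jfac M t = jfac (x h) (mob (r h) t) * jfac (r h) t"
        using jfac_mmul[OF t, of M h] jfac_mmul[OF t rdet(2), of "x h"] Mdet hd(3) by simp
      moreover have "jfac h (mob M t) \<noteq> 0" "jfac (r h) t \<noteq> 0"
        using jfac_nonzero[OF mob_in_uhp[OF t], of M h] jfac_nonzero[OF t rdet(2)] hdet[OF h] Mdet by auto
      ultimately show ?thesis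
        using jM by (simp add: field_simps flip: power_mult_distrib)
    qed
    have "(\<Sum>h\<in>hreps p. g (vact v (madj h)) (mob h (mob M t)) / jfac h (mob M t) ^ w) =
        jfac M t ^ w * (\<Sum>h\<in>hreps p. g (vact (vact v M) (madj (r h))) (mob (r h) t) / jfac (r h) t ^ w)"
      by (simp add: h_term sum_distrib_left)
    also have "(\<Sum>h\<in>hreps p. g (vact (vact v M) (madj (r h))) (mob (r h) t) / jfac (r h) t ^ w) =
        (\<Sum>h\<in>hreps p. g (vact (vact v M) (madj h)) (mob h t) / jfac h t ^ w)"
      unfolding r_def by (rule sum.reindex_bij_betw[OF hdec_bij[OF p M]])
    finally show ?thesis by (simp add: hecke_def)
  qed
  show "hecke w p g (u * fst v, u * snd v) t = chi u * hecke w p g v t" if u: "odd u" for u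
  proof -
    have "vact (u * fst v, u * snd v) M = (u * fst (vact v M), u * snd (vact v M))" for M
      by (cases v; cases M) (simp add: algebra_simps)
    then have "g (vact (u * fst v, u * snd v) (madj h)) (mob h t) = chi u * g (vact v (madj h)) (mob h t)"
      if "h \<in> hreps p" for h
      using modular_familyD(5)[OF g u mob_in_uhp[OF t hdet(1)[OF that]], of "vact v (madj h)"] by simp
    then show ?thesis by (simp add: hecke_def sum_distrib_left mult_ac)
  qed
qed

section \<open>Primitives and period polynomials\<close>

definition primitive :: "nat \<Rightarrow> nat \<Rightarrow> (int \<times> int \<Rightarrow> complex \<Rightarrow> complex) \<Rightarrow> (int \<times> int \<Rightarrow> nat \<Rightarrow> complex \<Rightarrow> complex) \<Rightarrow> bool" where
  "primitive s m g G \<longleftrightarrow> periodic s G \<and>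
     (\<forall>v. \<forall>i\<le>m. \<forall>t\<in>uhp. (G v i has_field_derivative g v t * t ^ i) (at t))"

lemma primitiveD:
  assumes "primitive s m g G"
  shows "periodic s G" "i \<le> m \<Longrightarrow> t \<in> uhp \<Longrightarrow> (G v i has_field_derivative g v t * t ^ i) (at t)"
  using assms unfolding primitive_def by blast+

lemma ex_primitive:
  assumes "modular_family s w chi g"
  shows "\<exists>G. primitive s m g G"
proof -
  \<comment> \<open>One choice of primitive for each integrand: components that are equal as
    functions get equal primitives, so periodicity in v is inherited.\<close>
  define prim where "prim f = (SOME F. \<forall>t\<in>uhp. (F has_field_derivative f t) (at t))" for f :: "complex \<Rightarrow> complex"
  have prim: "(prim f has_field_derivative f t) (at t)" if hol: "f holomorphic_on uhp" and t: "t \<in> uhp" for f t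
  proof -
    obtain F where "\<And>x. x \<in> uhp \<Longrightarrow> (F has_field_derivative f x) (at x within uhp)"
      using holomorphic_convex_primitive'[OF convex_uhp open_uhp hol] by blast
    then have "\<exists>F. \<forall>t\<in>uhp. (F has_field_derivative f t) (at t)"
      using at_within_open[OF _ open_uhp] by metis
    then have "\<forall>t\<in>uhp. (prim f has_field_derivative f t) (at t)"
      unfolding prim_def by (rule someI_ex)
    then show ?thesis using t by blast
  qed
  have "primitive s m g (\<lambda>v i. prim (\<lambda>t. g v t * t ^ i))"
    unfolding primitive_def
  proof (intro conjI allI ballI impI)
    show "periodic s (\<lambda>v i. prim (\<lambda>t. g v t * t ^ i))"
      unfolding periodic_def using periodicD[OF modular_familyD(1)[OF assms]] by metis
    fix v i t assume "t \<in> uhp"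
    then show "(prim (\<lambda>t. g v t * t ^ i) has_field_derivative g v t * t ^ i) (at t)"
      using modular_familyD(2)[OF assms] by (intro prim holomorphic_intros)
  qed
  then show ?thesis by blast
qed

lemma primitive_sum:
  assumes "\<And>i. i \<in> I \<Longrightarrow> primitive s m (g i) (G i)"
  shows "primitive s m (\<lambda>v t. \<Sum>i\<in>I. c i * g i v t) (\<lambda>v k t. \<Sum>i\<in>I. c i * G i v k t)"
  unfolding primitive_def
proof (intro conjI allI ballI impI)
  show "periodic s (\<lambda>v k t. \<Sum>i\<in>I. c i * G i v k t)"
    unfolding periodic_def
  proof (intro allI impI)
    fix v w' assume "vmod s v = vmod s w'"
    then have "G i v = G i w'" if "i \<in> I" for i
      using primitiveD(1)[OF assms[OF that]] by (rule periodicD[rotated])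
    then show "(\<lambda>k t. \<Sum>i\<in>I. c i * G i v k t) = (\<lambda>k t. \<Sum>i\<in>I. c i * G i w' k t)"
      by (intro ext sum.cong) auto
  qed
  fix v k t assume kt: "k \<le> m" "t \<in> uhp"
  have "((\<lambda>t. \<Sum>i\<in>I. c i * G i v k t) has_field_derivative (\<Sum>i\<in>I. c i * (g i v t * t ^ k))) (at t)"
    using primitiveD(2)[OF assms kt] by (intro DERIV_sum DERIV_cmult)
  then show "((\<lambda>t. \<Sum>i\<in>I. c i * G i v k t) has_field_derivative (\<Sum>i\<in>I. c i * g i v t) * t ^ k) (at t)"
    by (simp add: sum_distrib_right mult.assoc)
qed

text \<open>The failure of the i-th integral to transform like a binary form under M, measured at
  the point \<i>; by \<open>period_eq\<close> any other point gives the same value.\<close>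

definition period :: "nat \<Rightarrow> (int \<times> int \<Rightarrow> nat \<Rightarrow> complex \<Rightarrow> complex) \<Rightarrow> mat2 \<Rightarrow> int \<times> int \<Rightarrow> nat \<Rightarrow> complex" where
  "period m G M v i = G v i (mob M \<i>) - (\<Sum>k\<le>m. of_int (Rcoef m M i k) * G (vact v M) k \<i>)"

lemma sum_Rcoef_1:
  fixes t :: "'a::comm_ring_1"
  assumes "i \<le> m"
  shows "(\<Sum>k\<le>m. of_int (Rcoef m (a, b, c, d) i k) * t ^ k) =
     (of_int a * t + of_int b) ^ i * (of_int c * t + of_int d) ^ (m - i)"
  using sum_Rcoef[OF assms, of a b c d t 1] by simp

text \<open>The difference of the two sums has derivative zero. Two factors of the weight m + 2
  cancel against the derivative of the Mobius map; the remaining m-th power of ct + d turns (Mt)^i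
  into (at + b)^i (ct + d)^(m-i).\<close>

lemma period_eq:
  assumes g: "modular_family s (m + 2) chi g" and G: "primitive s m g G"
    and M: "M \<in> Delta2 1" and i: "i \<le> m" and t: "t \<in> uhp"
  shows "G v i (mob M t) = (\<Sum>k\<le>m. of_int (Rcoef m M i k) * G (vact v M) k t) + period m G M v i"
proof -
  obtain a b c d where Meq: "M = (a, b, c, d)" by (cases M)
  have Mdet: "mdet M = 1" using M by (simp add: Delta2_def)
  define f where "f t = G v i (mob M t) - (\<Sum>k\<le>m. of_int (Rcoef m M i k) * G (vact v M) k t)" for t
  have f': "(f has_field_derivative 0) (at t)" if t: "t \<in> uhp" for t
  proof -
    have Mt: "mob M t \<in> uhp" using mob_in_uhp[OF t, of M] Mdet by simp
    define j where "j = jfac M t"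
    have j: "j \<noteq> 0" using jfac_nonzero[OF t, of M] Mdet by (simp add: j_def)
    have "((\<lambda>t. G v i (mob M t)) has_field_derivative (g v (mob M t) * mob M t ^ i) * (1 / j\<^sup>2)) (at t)"
      using DERIV_chain2[OF primitiveD(2)[OF G i Mt] has_field_derivative_mob[OF t, of M]] Mdet by (simp add: j_def)
    moreover have "((\<lambda>t. \<Sum>k\<le>m. of_int (Rcoef m M i k) * G (vact v M) k t) has_field_derivative
        (\<Sum>k\<le>m. of_int (Rcoef m M i k) * (g (vact v M) t * t ^ k))) (at t)"
      using primitiveD(2)[OF G _ t] by (intro DERIV_sum DERIV_cmult) auto
    ultimately have "(f has_field_derivative (g v (mob M t) * mob M t ^ i) * (1 / j\<^sup>2) -
        (\<Sum>k\<le>m. of_int (Rcoef m M i k) * (g (vact v M) t * t ^ k))) (at t)"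
      unfolding f_def[abs_def] by (rule DERIV_diff)
    moreover have "(g v (mob M t) * mob M t ^ i) * (1 / j\<^sup>2) = (\<Sum>k\<le>m. of_int (Rcoef m M i k) * (g (vact v M) t * t ^ k))"
    proof -
      have ji: "j ^ i * mob M t ^ i = (of_int a * t + of_int b) ^ i"
        using j by (simp add: j_def Meq flip: power_mult_distrib)
      have "(g v (mob M t) * mob M t ^ i) * (1 / j\<^sup>2) = g (vact v M) t * (j ^ m * mob M t ^ i)"
      proof -
        have "g v (mob M t) = j ^ m * j\<^sup>2 * g (vact v M) t"
          using modular_familyD(4)[OF g M t] by (simp only: power_add j_def)
        then show ?thesis using j by simp
      qed
      also have "j ^ m = j ^ i * j ^ (m - i)" using i by (simp flip: power_add)
      also have "j ^ i * j ^ (m - i) * mob M t ^ i = (of_int a * t + of_int b) ^ i * j ^ (m - i)"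
        using ji by (simp add: mult_ac)
      also have "\<dots> = (\<Sum>k\<le>m. of_int (Rcoef m M i k) * t ^ k)"
        using sum_Rcoef_1[OF i, of a b c d t] by (simp add: j_def Meq)
      finally show ?thesis by (simp add: sum_distrib_left mult_ac)
    qed
    ultimately show ?thesis by simp
  qed
  have "\<exists>c. \<forall>t\<in>uhp. f t = c"
    using has_field_derivative_zero_constant[OF convex_uhp] f' has_field_derivative_at_within by metis
  then have "f t = f \<i>" using t by (auto simp: uhp_def)
  then show ?thesis by (simp add: f_def period_def algebra_simps)
qed

lemma period_periodic:
  assumes "primitive s m g G"
  shows "periodic s (\<lambda>v. period m G M v i)"
  unfolding periodic_def
proof (intro allI impI)
  fix v v' assume v: "vmod s v = vmod s v'"
  have "G v = G v'" "G (vact v M) = G (vact v' M)"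
    using periodicD[OF primitiveD(1)[OF assms]] v vmod_vact_cong[OF v] by blast+
  then show "period m G M v i = period m G M v' i" by (simp add: period_def)
qed

lemma period_cocycle:
  assumes g: "modular_family s (m + 2) chi g" and G: "primitive s m g G"
    and M: "M \<in> Delta2 1" "N \<in> Delta2 1" and i: "i \<le> m"
  shows "period m G (mmul M N) v i = period m G M v i + (\<Sum>k\<le>m. of_int (Rcoef m M i k) * period m G N (vact v M) k)"
proof -
  have ii: "\<i> \<in> uhp" by (simp add: uhp_def)
  have det: "mdet M = 1" "mdet N = 1" using M by (auto simp: Delta2_def)
  have Ni: "mob N \<i> \<in> uhp" using mob_in_uhp[OF ii, of N] det by simp
  have "G v i (mob (mmul M N) \<i>) = G v i (mob M (mob N \<i>))"
    using mob_mmul[OF ii, of M N] det by simp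
  also have "\<dots> = (\<Sum>k\<le>m. of_int (Rcoef m M i k) * G (vact v M) k (mob N \<i>)) + period m G M v i"
    by (rule period_eq[OF g G M(1) i Ni])
  also have "(\<Sum>k\<le>m. of_int (Rcoef m M i k) * G (vact v M) k (mob N \<i>)) =
     (\<Sum>k\<le>m. of_int (Rcoef m M i k) * ((\<Sum>l\<le>m. of_int (Rcoef m N k l) * G (vact (vact v M) N) l \<i>) + period m G N (vact v M) k))"
    by (intro sum.cong refl arg_cong2[where f = "(*)"] period_eq[OF g G M(2) _ ii]) auto
  also have "\<dots> = (\<Sum>k\<le>m. \<Sum>l\<le>m. of_int (Rcoef m M i k * Rcoef m N k l) * G (vact (vact v M) N) l \<i>) +
      (\<Sum>k\<le>m. of_int (Rcoef m M i k) * period m G N (vact v M) k)"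
    by (simp add: distrib_left sum.distrib sum_distrib_left mult.assoc)
  also have "(\<Sum>k\<le>m. \<Sum>l\<le>m. of_int (Rcoef m M i k * Rcoef m N k l) * G (vact (vact v M) N) l \<i>) =
      (\<Sum>l\<le>m. of_int (\<Sum>k\<le>m. Rcoef m M i k * Rcoef m N k l) * G (vact (vact v M) N) l \<i>)"
    by (subst sum.swap) (simp add: sum_distrib_right)
  also have "\<dots> = (\<Sum>l\<le>m. of_int (Rcoef m (mmul M N) i l) * G (vact v (mmul M N)) l \<i>)"
    by (intro sum.cong refl) (simp add: Rcoef_mmul[OF i] vact_mmul)
  finally show ?thesis by (simp add: period_def)
qed

definition hecke_primitive :: "nat \<Rightarrow> nat \<Rightarrow> (int \<times> int \<Rightarrow> nat \<Rightarrow> complex \<Rightarrow> complex) \<Rightarrow> int \<times> int \<Rightarrow> nat \<Rightarrow> complex \<Rightarrow> complex" where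
  "hecke_primitive m p G v i t = (\<Sum>h\<in>hreps p. \<Sum>k\<le>m. of_int (Rcoef m (madj h) i k) * G (vact v (madj h)) k (mob h t))"

text \<open>With j = \<open>jfac h t\<close>, substituting z = ht into the form attached to
  \<open>madj h\<close> gives (p/j)^m t^i, and the Mobius map contributes p/j^2. Together this is
  p^(m+1)/j^(m+2) times t^i, the normalisation of \<open>hecke\<close> in weight m + 2.\<close>

lemma primitive_hecke:
  assumes p: "prime p" and G: "primitive s m g G"
  shows "primitive s m (hecke (m + 2) p g) (hecke_primitive m p G)"
  unfolding primitive_def
proof (intro conjI allI ballI impI)
  have p0: "p > 0" using p by (simp add: prime_gt_0_nat)
  show "periodic s (hecke_primitive m p G)"
    unfolding periodic_def
  proof (intro allI impI)
    fix v v' assume v: "vmod s v = vmod s v'"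
    have "G (vact v M) = G (vact v' M)" for M
      using primitiveD(1)[OF G] by (rule periodicD) (rule vmod_vact_cong[OF v])
    then show "hecke_primitive m p G v = hecke_primitive m p G v'" by (simp add: fun_eq_iff hecke_primitive_def)
  qed
  fix v i t assume i: "i \<le> m" and t: "t \<in> uhp"
  have "((\<lambda>t. \<Sum>k\<le>m. of_int (Rcoef m (madj h) i k) * G (vact v (madj h)) k (mob h t)) has_field_derivative
      of_nat p ^ (m + 1) * (g (vact v (madj h)) (mob h t) / jfac h t ^ (m + 2)) * t ^ i) (at t)" if h: "h \<in> hreps p" for h
  proof -
    obtain a b c d where heq: "h = (a, b, c, d)" by (cases h)
    have hdet: "mdet h = int p" using hreps_det[OF p0 h] .
    have ht: "mob h t \<in> uhp" using mob_in_uhp[OF t, of h] hdet p0 by simp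
    define j where "j = jfac h t"
    define z where "z = mob h t"
    define P where "P = (of_nat p :: complex)"
    have j: "j \<noteq> 0" using jfac_nonzero[OF t, of h] hdet p0 by (simp add: j_def)
    have det: "of_int a * of_int d - of_int b * of_int c = P"
      using hdet by (simp add: heq P_def) (metis of_int_diff of_int_mult of_int_of_nat_eq)
    have "((\<lambda>t. \<Sum>k\<le>m. of_int (Rcoef m (madj h) i k) * G (vact v (madj h)) k (mob h t)) has_field_derivative
       (\<Sum>k\<le>m. of_int (Rcoef m (madj h) i k) * (g (vact v (madj h)) z * z ^ k * (P / j\<^sup>2)))) (at t)"
      using DERIV_chain2[OF primitiveD(2)[OF G _ ht] has_field_derivative_mob[OF t, of h]] hdet p0
      by (intro DERIV_sum DERIV_cmult) (auto simp: z_def P_def j_def)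
    also have "(\<Sum>k\<le>m. of_int (Rcoef m (madj h) i k) * (g (vact v (madj h)) z * z ^ k * (P / j\<^sup>2))) =
       g (vact v (madj h)) z * (P / j\<^sup>2) * (\<Sum>k\<le>m. of_int (Rcoef m (madj h) i k) * z ^ k)"
      by (simp add: sum_distrib_left mult_ac)
    also have "(\<Sum>k\<le>m. of_int (Rcoef m (madj h) i k) * z ^ k) =
       (of_int d * z - of_int b) ^ i * (of_int a - of_int c * z) ^ (m - i)"
      using sum_Rcoef_1[OF i, of d "-b" "-c" a z] by (simp add: heq)
    also have "of_int d * z - of_int b = t * (P / j)"
    proof -
      have zj: "z * j = of_int a * t + of_int b" using j by (simp add: z_def j_def heq)
      have "(of_int d * z - of_int b) * j = of_int d * (z * j) - of_int b * j" by (simp add: algebra_simps)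
      also have "\<dots> = t * P" unfolding zj det[symmetric] by (simp add: j_def heq algebra_simps)
      finally show ?thesis using j by (simp add: field_simps)
    qed
    also have "of_int a - of_int c * z = P / j"
    proof -
      have zj: "z * j = of_int a * t + of_int b" using j by (simp add: z_def j_def heq)
      have "(of_int a - of_int c * z) * j = of_int a * j - of_int c * (z * j)" by (simp add: algebra_simps)
      also have "\<dots> = P" unfolding zj det[symmetric] by (simp add: j_def heq algebra_simps)
      finally show ?thesis using j by (simp add: field_simps)
    qed
    also have "(t * (P / j)) ^ i * (P / j) ^ (m - i) = t ^ i * (P / j) ^ m"
    proof -
      have "(t * y) ^ i * y ^ (m - i) = t ^ i * y ^ m" for y
        using i by (simp add: power_mult_distrib mult.assoc flip: power_add)
      then show ?thesis .
    qed
    also have "g (vact v (madj h)) z * (P / j\<^sup>2) * (t ^ i * (P / j) ^ m) = P ^ (m + 1) * (g (vact v (madj h)) z / j ^ (m + 2)) * t ^ i"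
      by (simp add: power_divide power_add power2_eq_square mult_ac)
    finally show ?thesis by (simp add: z_def P_def j_def)
  qed
  then have "(hecke_primitive m p G v i has_field_derivative
     (\<Sum>h\<in>hreps p. of_nat p ^ (m + 1) * (g (vact v (madj h)) (mob h t) / jfac h t ^ (m + 2)) * t ^ i)) (at t)"
    unfolding hecke_primitive_def[abs_def] by (intro DERIV_sum)
  then show "(hecke_primitive m p G v i has_field_derivative hecke (m + 2) p g v t * t ^ i) (at t)"
    by (simp add: hecke_def sum_distrib_left sum_distrib_right)
qed

text \<open>Along h M = x r the integrals attached to h become those attached to r plus a period
  along x. As r runs through all representatives, the first parts add up to the transform of the
  Hecke primitive, and only the periods remain.\<close>

lemma period_hecke:
  assumes p: "prime p" "odd p" and g: "modular_family s (m + 2) chi g" and G: "primitive s m g G"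
    and M: "M \<in> Delta2 1" and i: "i \<le> m"
  shows "period m (hecke_primitive m p G) M v i = (\<Sum>h\<in>hreps p. \<Sum>k\<le>m. of_int (Rcoef m (madj h) i k) *
           period m G (fst (hdec p (mmul h M))) (vact v (madj h)) k)"
proof -
  have p0: "p > 0" using p by (simp add: prime_gt_0_nat)
  have ii: "\<i> \<in> uhp" by (simp add: uhp_def)
  have Mdet: "mdet M = 1" using M by (simp add: Delta2_def)
  define x where "x h = fst (hdec p (mmul h M))" for h
  define r where "r h = snd (hdec p (mmul h M))" for h
  have h_term: "(\<Sum>k\<le>m. of_int (Rcoef m (madj h) i k) * G (vact v (madj h)) k (mob h (mob M \<i>))) =
      (\<Sum>k\<le>m. of_int (Rcoef m M i k) * (\<Sum>l\<le>m. of_int (Rcoef m (madj (r h)) k l) * G (vact (vact v M) (madj (r h))) l (mob (r h) \<i>))) +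
      (\<Sum>k\<le>m. of_int (Rcoef m (madj h) i k) * period m G (x h) (vact v (madj h)) k)"
    if h: "h \<in> hreps p" for h
  proof -
    note hd = hdec[OF p hrep_mult_Delta2[OF p(2) h M], folded x_def r_def]
    have xdet: "mdet (x h) = 1" using hd(1) by (simp add: Delta2_def)
    have hdet: "mdet h > 0" "mdet (r h) > 0" using hreps_det[OF p0] h hd(2) p0 by auto
    have rt: "mob (r h) \<i> \<in> uhp" using mob_in_uhp[OF ii hdet(2)] .
    have "mob h (mob M \<i>) = mob (mmul (x h) (r h)) \<i>"
      using hd(3) mob_mmul[OF ii hdet(1), of M] Mdet by simp
    also have "\<dots> = mob (x h) (mob (r h) \<i>)" using mob_mmul[OF ii _ hdet(2)] xdet by simp
    finally have mo: "mob h (mob M \<i>) = mob (x h) (mob (r h) \<i>)" .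
    have eq: "mmul (madj h) (x h) = mmul M (madj (r h))"
      using hdec_vact[OF p h M] by (simp add: x_def r_def)
    have "(\<Sum>k\<le>m. of_int (Rcoef m (madj h) i k) * G (vact v (madj h)) k (mob h (mob M \<i>))) =
      (\<Sum>k\<le>m. of_int (Rcoef m (madj h) i k) * ((\<Sum>l\<le>m. of_int (Rcoef m (x h) k l) * G (vact (vact v (madj h)) (x h)) l (mob (r h) \<i>))
         + period m G (x h) (vact v (madj h)) k))"
      unfolding mo by (intro sum.cong refl arg_cong2[where f = "(*)"] period_eq[OF g G hd(1) _ rt]) auto
    also have "\<dots> = (\<Sum>k\<le>m. \<Sum>l\<le>m. of_int (Rcoef m (madj h) i k * Rcoef m (x h) k l) * G (vact v (mmul (madj h) (x h))) l (mob (r h) \<i>))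
       + (\<Sum>k\<le>m. of_int (Rcoef m (madj h) i k) * period m G (x h) (vact v (madj h)) k)"
      by (simp add: distrib_left sum.distrib sum_distrib_left mult.assoc vact_mmul)
    also have "(\<Sum>k\<le>m. \<Sum>l\<le>m. of_int (Rcoef m (madj h) i k * Rcoef m (x h) k l) * G (vact v (mmul (madj h) (x h))) l (mob (r h) \<i>)) =
       (\<Sum>l\<le>m. of_int (\<Sum>k\<le>m. Rcoef m (madj h) i k * Rcoef m (x h) k l) * G (vact v (mmul (madj h) (x h))) l (mob (r h) \<i>))"
      by (subst sum.swap) (simp add: sum_distrib_right)
    also have "\<dots> = (\<Sum>l\<le>m. of_int (\<Sum>k\<le>m. Rcoef m M i k * Rcoef m (madj (r h)) k l) * G (vact v (mmul M (madj (r h)))) l (mob (r h) \<i>))"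
      by (intro sum.cong refl) (simp add: Rcoef_mmul[OF i] eq)
    also have "\<dots> = (\<Sum>k\<le>m. of_int (Rcoef m M i k) * (\<Sum>l\<le>m. of_int (Rcoef m (madj (r h)) k l) * G (vact (vact v M) (madj (r h))) l (mob (r h) \<i>)))"
      unfolding sum_distrib_left of_int_sum sum_distrib_right by (subst sum.swap) (simp add: vact_mmul mult.assoc)
    finally show ?thesis .
  qed
  have "hecke_primitive m p G v i (mob M \<i>) =
      (\<Sum>h\<in>hreps p. \<Sum>k\<le>m. of_int (Rcoef m M i k) * (\<Sum>l\<le>m. of_int (Rcoef m (madj (r h)) k l) * G (vact (vact v M) (madj (r h))) l (mob (r h) \<i>))) +
      (\<Sum>h\<in>hreps p. \<Sum>k\<le>m. of_int (Rcoef m (madj h) i k) * period m G (x h) (vact v (madj h)) k)"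
    unfolding hecke_primitive_def by (subst sum.distrib[symmetric]) (rule sum.cong[OF refl h_term])
  also have "(\<Sum>h\<in>hreps p. \<Sum>k\<le>m. of_int (Rcoef m M i k) * (\<Sum>l\<le>m. of_int (Rcoef m (madj (r h)) k l) * G (vact (vact v M) (madj (r h))) l (mob (r h) \<i>))) =
      (\<Sum>h\<in>hreps p. \<Sum>k\<le>m. of_int (Rcoef m M i k) * (\<Sum>l\<le>m. of_int (Rcoef m (madj h) k l) * G (vact (vact v M) (madj h)) l (mob h \<i>)))"
    unfolding r_def by (rule sum.reindex_bij_betw[OF hdec_bij[OF p M], of "\<lambda>h. \<Sum>k\<le>m. of_int (Rcoef m M i k) * (\<Sum>l\<le>m. of_int (Rcoef m (madj h) k l) * G (vact (vact v M) (madj h)) l (mob h \<i>))"])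
  also have "\<dots> = (\<Sum>k\<le>m. of_int (Rcoef m M i k) * hecke_primitive m p G (vact v M) k \<i>)"
    unfolding hecke_primitive_def sum_distrib_left by (rule sum.swap)
  finally show ?thesis by (simp add: period_def[of m "hecke_primitive m p G"] x_def)
qed

section \<open>A form is determined by its periods\<close>

lemma ex_nontrivial_solution:
  fixes A :: "'k \<Rightarrow> 'j \<Rightarrow> complex"
  assumes "finite J" "finite K" "card J < card K"
  shows "\<exists>c. (\<exists>k\<in>K. c k \<noteq> 0) \<and> (\<forall>j\<in>J. (\<Sum>k\<in>K. c k * A k j) = 0)"
  using assms
proof (induction J arbitrary: K A rule: finite_induct)
  case empty
  then have "K \<noteq> {}" by auto
  then obtain k where "k \<in> K" by blast
  then show ?case by (intro exI[of _ "\<lambda>_. 1"]) auto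
next
  case (insert j J)
  show ?case
  proof (cases "\<forall>k\<in>K. A k j = 0")
    case True
    have "card J < card K" using insert by simp
    then obtain c where "\<exists>k\<in>K. c k \<noteq> 0" "\<forall>j\<in>J. (\<Sum>k\<in>K. c k * A k j) = 0"
      using insert.IH[of K A] insert.prems by blast
    then show ?thesis using True by (intro exI[of _ c]) auto
  next
    case False
    then obtain k0 where k0: "k0 \<in> K" "A k0 j \<noteq> 0" by blast
    define K' where "K' = K - {k0}"
    have K': "finite K'" "card J < card K'" "k0 \<notin> K'" "K = insert k0 K'"
      using insert k0 by (auto simp: K'_def)
    define r where "r k = A k j / A k0 j" for k
    obtain c where c: "\<exists>k\<in>K'. c k \<noteq> 0" "\<forall>i\<in>J. (\<Sum>k\<in>K'. c k * (A k i - r k * A k0 i)) = 0"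
      using insert.IH[of K' "\<lambda>k i. A k i - r k * A k0 i"] K' by blast
    define c' where "c' k = (if k = k0 then - (\<Sum>k\<in>K'. c k * r k) else c k)" for k
    have s: "(\<Sum>k\<in>K. c' k * A k i) = (\<Sum>k\<in>K'. c k * (A k i - r k * A k0 i))" for i
    proof -
      have "(\<Sum>k\<in>K. c' k * A k i) = c' k0 * A k0 i + (\<Sum>k\<in>K'. c' k * A k i)"
        using K' by simp
      also have "(\<Sum>k\<in>K'. c' k * A k i) = (\<Sum>k\<in>K'. c k * A k i)"
        using K'(3) by (intro sum.cong) (auto simp: c'_def)
      finally show ?thesis
        by (simp add: c'_def right_diff_distrib sum_subtractf sum_distrib_right mult.assoc)
    qed
    have "(\<Sum>k\<in>K'. c k * (A k j - r k * A k0 j)) = 0"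
      using k0 by (simp add: r_def)
    moreover have "\<exists>k\<in>K. c' k \<noteq> 0" using c(1) K' by (auto simp: c'_def)
    ultimately show ?thesis using c(2) s by (intro exI[of _ c']) auto
  qed
qed

lemma period_zero_if_zero_on_gens:
  assumes g: "modular_family s (m + 2) chi g" and G: "primitive s m g G"
    and gens: "\<And>M v i. M \<in> Gamma2_gens \<Longrightarrow> v \<in> vbox s \<Longrightarrow> i \<le> m \<Longrightarrow> period m G M v i = 0"
    and M: "M \<in> Delta2 1" and i: "i \<le> m"
  shows "period m G M v i = 0"
proof -
  have gens': "period m G M v i = 0" if "M \<in> Gamma2_gens" "i \<le> m" for M v i
  proof -
    have "period m G M v i = period m G M (vmod s v) i"
      by (rule periodicD[OF period_periodic[OF G]]) simp
    then show ?thesis using gens[OF that(1) vmod_in_vbox that(2)] by simp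
  qed
  have one: "(1, 0, 0, 1) \<in> Delta2 1" by (simp add: Delta2_def)
  have p_one: "period m G (1, 0, 0, 1) v i = 0" if "i \<le> m" for v i
  proof -
    have "(\<Sum>k\<le>m. of_int (Rcoef m (1, 0, 0, 1) i k) * period m G (1, 0, 0, 1) v k) =
       (\<Sum>k\<le>m. if k = i then period m G (1, 0, 0, 1) v k else 0)"
      by (intro sum.cong) (auto simp: Rcoef_1[OF that])
    then show ?thesis using period_cocycle[OF g G one one that, of v] that by simp
  qed
  have inv: "period m G (madj M) v i = 0" if "M \<in> Gamma2_gens" "i \<le> m" for M v i
  proof -
    have M: "M \<in> Delta2 1" using that Gamma2_gens_subset by blast
    then have 1: "mmul (madj M) M = (1, 0, 0, 1)" by (simp add: mmul_madj Delta2_def)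
    show ?thesis
      using period_cocycle[OF g G Delta2_madj[OF M] M that(2), of v] p_one[OF that(2)]
      by (simp add: 1 gens'[OF that(1)])
  qed
  have "\<forall>v i. i \<le> m \<longrightarrow> period m G M v i = 0"
    using M
  proof (induction rule: Gamma2_induct)
    case (gen H M)
    then have H: "H \<in> Delta2 1" using Gamma2_gens_subset by blast
    show ?case
      using period_cocycle[OF g G H gen(2)] gen(3) gens'[OF gen(1)] by simp
  next
    case (inv H M)
    then have H: "madj H \<in> Delta2 1" using Gamma2_gens_subset Delta2_madj by blast
    show ?case
      using period_cocycle[OF g G H inv(2)] inv(3) \<open>\<And>v M i. M \<in> Gamma2_gens \<Longrightarrow> i \<le> m \<Longrightarrow> period m G (madj M) v i = 0\<close>[OF inv(1)] by simp
  qed (use p_one in blast)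
  then show ?thesis using i by blast
qed

text \<open>
  The Eichler integral \<open>eichler n G t\<close> is the antiderivative of \<open>g z (t - z)\<^sup>n\<close> along \<open>z\<close>, evaluated at \<open>t\<close>.
\<close>

definition eichler :: "nat \<Rightarrow> (nat \<Rightarrow> complex \<Rightarrow> complex) \<Rightarrow> complex \<Rightarrow> complex" where
  "eichler n G t = (\<Sum>i\<le>n. of_nat (n choose i) * (-1) ^ i * t ^ (n - i) * G i t)"

text \<open>The terms in which some G i is differentiated add up to f (t - t)^(n+1) = 0; the others
  combine by (n+1 choose i)(n+1-i) = (n+1)(n choose i).\<close>

lemma eichler_derivative:
  assumes G: "\<And>i. i \<le> Suc n \<Longrightarrow> (G i has_field_derivative f * t ^ i) (at t)"
  shows "(eichler (Suc n) G has_field_derivative of_nat (Suc n) * eichler n G t) (at t)"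
proof -
  have "(eichler (Suc n) G has_field_derivative
      (\<Sum>i\<le>Suc n. of_nat (Suc n choose i) * (-1) ^ i * t ^ (Suc n - i) * (f * t ^ i) +
         of_nat (Suc n choose i) * (-1) ^ i * (of_nat (Suc n - i) * t ^ (Suc n - i - 1)) * G i t)) (at t)"
    unfolding eichler_def[abs_def]
  proof (rule DERIV_sum)
    fix i assume "i \<in> {..Suc n}"
    then have "(G i has_field_derivative f * t ^ i) (at t)" using G by simp
    then show "((\<lambda>t. of_nat (Suc n choose i) * (-1) ^ i * t ^ (Suc n - i) * G i t) has_field_derivative
         of_nat (Suc n choose i) * (-1) ^ i * t ^ (Suc n - i) * (f * t ^ i) +
         of_nat (Suc n choose i) * (-1) ^ i * (of_nat (Suc n - i) * t ^ (Suc n - i - 1)) * G i t) (at t)"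
      by (auto intro!: derivative_eq_intros)
  qed
  moreover have "(\<Sum>i\<le>Suc n. of_nat (Suc n choose i) * (-1) ^ i * t ^ (Suc n - i) * (f * t ^ i)) = 0"
  proof -
    have "(\<Sum>i\<le>Suc n. of_nat (Suc n choose i) * (-1) ^ i * t ^ (Suc n - i) * (f * t ^ i)) =
       (\<Sum>i\<le>Suc n. f * (of_nat (Suc n choose i) * (- t) ^ i * t ^ (Suc n - i)))"
      by (intro sum.cong refl) (simp add: power_minus[of t] mult_ac)
    also have "\<dots> = f * (- t + t) ^ Suc n"
      unfolding binomial_ring sum_distrib_left ..
    finally show ?thesis by simp
  qed
  moreover have "(\<Sum>i\<le>Suc n. of_nat (Suc n choose i) * (-1) ^ i * (of_nat (Suc n - i) * t ^ (Suc n - i - 1)) * G i t) =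
      of_nat (Suc n) * eichler n G t"
  proof -
    have "(\<Sum>i\<le>Suc n. of_nat (Suc n choose i) * (-1) ^ i * (of_nat (Suc n - i) * t ^ (Suc n - i - 1)) * G i t) =
      (\<Sum>i\<le>n. of_nat (Suc n choose i) * (-1) ^ i * (of_nat (Suc n - i) * t ^ (Suc n - i - 1)) * G i t)"
      by simp
    also have "\<dots> = (\<Sum>i\<le>n. of_nat (Suc n) * (of_nat (n choose i) * (-1) ^ i * t ^ (n - i) * G i t))"
    proof (intro sum.cong refl)
      fix i assume "i \<in> {..n}"
      then have "(Suc n choose i) * (Suc n - i) = Suc n * (n choose i)"
        using binomial_absorb_comp[of "Suc n" i] by (simp add: mult.commute)
      then have "of_nat (Suc n choose i) * of_nat (Suc n - i) = (of_nat (Suc n) * of_nat (n choose i) :: complex)"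
        by (metis of_nat_mult)
      note bin = this
      have pow: "Suc n - i - 1 = n - i" by simp
      have "of_nat (Suc n choose i) * (-1) ^ i * (of_nat (Suc n - i) * t ^ (Suc n - i - 1)) * G i t =
         (of_nat (Suc n choose i) * of_nat (Suc n - i)) * ((-1) ^ i * t ^ (n - i) * G i t)"
        unfolding pow by (simp only: mult_ac)
      then show "of_nat (Suc n choose i) * (-1) ^ i * (of_nat (Suc n - i) * t ^ (Suc n - i - 1)) * G i t =
          of_nat (Suc n) * (of_nat (n choose i) * (-1) ^ i * t ^ (n - i) * G i t)"
        unfolding bin by (simp only: mult_ac)
    qed
    finally show ?thesis by (simp add: eichler_def sum_distrib_left)
  qed
  ultimately show ?thesis by (simp only: sum.distrib add_0)
qed

lemma eichler_zero_imp_zero: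
  assumes G: "\<And>i t. i \<le> n \<Longrightarrow> t \<in> uhp \<Longrightarrow> (G i has_field_derivative g t * t ^ i) (at t)"
    and zero: "\<And>t. t \<in> uhp \<Longrightarrow> eichler n G t = 0" and t: "t \<in> uhp"
  shows "g t = 0"
  using assms
proof (induction n)
  case 0
  have "(G 0 has_field_derivative g t) (at t)" using 0(1)[of 0 t] t by simp
  moreover have "(G 0 has_field_derivative 0) (at t)"
  proof (rule DERIV_cong_ev[THEN iffD1, OF refl _ refl])
    have "\<forall>\<^sub>F x in nhds t. x \<in> uhp" using open_uhp t by (rule eventually_nhds_in_open)
    then show "\<forall>\<^sub>F x in nhds t. 0 = G 0 x" by eventually_elim (use 0(2) in \<open>simp add: eichler_def\<close>)
  qed simp
  ultimately show ?case using DERIV_unique by blast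
next
  case (Suc n)
  have "eichler n G x = 0" if x: "x \<in> uhp" for x
  proof -
    have "(eichler (Suc n) G has_field_derivative of_nat (Suc n) * eichler n G x) (at x)"
      using Suc.prems(1)[OF _ x] by (rule eichler_derivative)
    moreover have "(eichler (Suc n) G has_field_derivative 0) (at x)"
    proof (rule DERIV_cong_ev[THEN iffD1, OF refl _ refl])
      have "\<forall>\<^sub>F x in nhds x. x \<in> uhp" using open_uhp x by (rule eventually_nhds_in_open)
      then show "\<forall>\<^sub>F x in nhds x. 0 = eichler (Suc n) G x" by eventually_elim (use Suc.prems(2) in simp)
    qed simp
    ultimately have "of_nat (Suc n) * eichler n G x = 0" using DERIV_unique by blast
    then show ?thesis by (simp del: of_nat_Suc)
  qed
  then show ?case using Suc.IH Suc.prems(1) t by simp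
qed

text \<open>Compare coefficients of X^k in (ct + d)^m (Mt (cX + d) - (aX + b))^m = (t - X)^m, which
  expresses that Mt - MX is (t - X) divided by (ct + d)(cX + d).\<close>

lemma Rcoef_binomial:
  assumes "a * d - b * c = 1" and z: "of_int c * t + of_int d \<noteq> (0::complex)" and k: "k \<le> m"
  shows "(of_int c * t + of_int d) ^ m * (\<Sum>i\<le>m. of_nat (m choose i) * (-1) ^ i *
      ((of_int a * t + of_int b) / (of_int c * t + of_int d)) ^ (m - i) * of_int (Rcoef m (a, b, c, d) i k))
    = of_nat (m choose k) * (-1) ^ k * t ^ (m - k)"
proof -
  define j where "j = of_int c * t + of_int d"
  define n where "n = of_int a * t + of_int b"
  have det: "of_int a * of_int d - of_int b * of_int c = (1::complex)"
    using arg_cong[OF assms(1), of "of_int :: int \<Rightarrow> complex"] by simp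
  define A where "A = (\<Sum>k\<le>m. monom (j ^ m * (\<Sum>i\<le>m. of_nat (m choose i) * (-1) ^ i * (n / j) ^ (m - i) * of_int (Rcoef m (a, b, c, d) i k))) k)"
  define B where "B = (\<Sum>k\<le>m. monom (of_nat (m choose k) * (-1) ^ k * t ^ (m - k)) k)"
  have "poly A x = poly B x" for x
  proof -
    have "poly A x = j ^ m * (\<Sum>i\<le>m. of_nat (m choose i) * (-1) ^ i * (n / j) ^ (m - i) * (\<Sum>k\<le>m. of_int (Rcoef m (a, b, c, d) i k) * x ^ k))"
      unfolding A_def poly_sum poly_monom sum_distrib_left sum_distrib_right
      by (subst sum.swap) (simp add: mult.assoc)
    also have "\<dots> = j ^ m * (\<Sum>i\<le>m. of_nat (m choose i) * (- (of_int a * x + of_int b)) ^ i * ((n / j) * (of_int c * x + of_int d)) ^ (m - i))"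
    proof (rule arg_cong[of _ _ "\<lambda>x. j ^ m * x"], rule sum.cong[OF refl])
      fix i assume "i \<in> {..m}"
      then have i: "i \<le> m" by simp
      show "of_nat (m choose i) * (-1) ^ i * (n / j) ^ (m - i) * (\<Sum>k\<le>m. of_int (Rcoef m (a, b, c, d) i k) * x ^ k) =
        of_nat (m choose i) * (- (of_int a * x + of_int b)) ^ i * ((n / j) * (of_int c * x + of_int d)) ^ (m - i)"
        unfolding sum_Rcoef_1[OF i] power_minus[of "of_int a * x + of_int b"] power_mult_distrib
        by (simp only: mult_ac)
    qed
    also have "\<dots> = j ^ m * (- (of_int a * x + of_int b) + (n / j) * (of_int c * x + of_int d)) ^ m"
      unfolding binomial_ring ..
    also have "\<dots> = (- (of_int a * x + of_int b) * j + n * (of_int c * x + of_int d)) ^ m"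
    proof -
      have "j * (- A + (n / j) * B) = - A * j + n * B" for A B
        using z[folded j_def] by (simp add: algebra_simps)
      then show ?thesis by (simp only: power_mult_distrib[symmetric])
    qed
    also have "- (of_int a * x + of_int b) * j + n * (of_int c * x + of_int d) =
       (of_int a * of_int d - of_int b * of_int c) * (- x + t)"
      by (simp add: j_def n_def algebra_simps)
    also have "\<dots> = - x + t" by (simp add: det)
    also have "(- x + t) ^ m = (\<Sum>k\<le>m. of_nat (m choose k) * (- x) ^ k * t ^ (m - k))"
      unfolding binomial_ring ..
    also have "\<dots> = poly B x"
      unfolding B_def poly_sum poly_monom by (intro sum.cong refl) (simp add: power_minus[of x] mult_ac)
    finally show ?thesis .
  qed
  then have "A = B" using poly_eq_poly_eq_iff by blast
  then have "coeff A k = coeff B k" by simp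
  then show ?thesis
    using k by (simp add: A_def B_def coeff_sum n_def j_def)
qed

text \<open>Without periods the primitives transform like binary forms, so their Eichler integral
  behaves as a modular form of weight -m.\<close>

lemma eichler_invariant:
  assumes g: "modular_family s (m + 2) chi g" and G: "primitive s m g G"
    and zero: "\<And>v i. i \<le> m \<Longrightarrow> period m G M v i = 0" and M: "M \<in> Delta2 1" and t: "t \<in> uhp"
  shows "jfac M t ^ m * eichler m (G v) (mob M t) = eichler m (G (vact v M)) t"
proof -
  obtain a b c d where Meq: "M = (a, b, c, d)" by (cases M)
  have det: "a * d - b * c = 1" using M by (simp add: Delta2_def Meq)
  have j: "of_int c * t + of_int d \<noteq> 0" using jfac_nonzero[OF t, of M] det by (simp add: Meq)
  have "eichler m (G v) (mob M t) = (\<Sum>i\<le>m. of_nat (m choose i) * (-1) ^ i * mob M t ^ (m - i) *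
      (\<Sum>k\<le>m. of_int (Rcoef m M i k) * G (vact v M) k t))"
    unfolding eichler_def using period_eq[OF g G M _ t] zero by (intro sum.cong) auto
  then have "jfac M t ^ m * eichler m (G v) (mob M t) = (\<Sum>k\<le>m. (jfac M t ^ m * (\<Sum>i\<le>m. of_nat (m choose i) * (-1) ^ i * mob M t ^ (m - i) *
      of_int (Rcoef m M i k))) * G (vact v M) k t)"
    by (simp add: sum_distrib_left sum_distrib_right mult.assoc) (rule sum.swap)
  also have "\<dots> = (\<Sum>k\<le>m. (of_nat (m choose k) * (-1) ^ k * t ^ (m - k)) * G (vact v M) k t)"
    using Rcoef_binomial[OF det j] by (intro sum.cong) (simp_all add: Meq)
  finally show ?thesis by (simp add: eichler_def)
qed

text \<open>The Eichler integral h has weight -m and moderate growth, hence is bounded at every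
  cusp. Reduction theory then gives |h(t)|^2 <= C (Im t)^m up to a constant, which tends to 0 at the
  real line, so h = 0; differentiating down to degree 0 leaves g = 0.\<close>

theorem zero_periods_imp_zero:
  assumes g: "modular_family s (m + 2) chi g" and G: "primitive s m g G" and m: "m > 0"
    and zero: "\<And>M v i. M \<in> Delta2 1 \<Longrightarrow> i \<le> m \<Longrightarrow> period m G M v i = 0" and t: "t \<in> uhp"
  shows "g v t = 0"
proof -
  define h where "h v = eichler m (G v)" for v
  have inv: "jfac M t ^ m * h v (mob M t) = h (vact v M) t" if "M \<in> Delta2 1" "t \<in> uhp" for M v t
    unfolding h_def using eichler_invariant[OF g G zero that] that by simp
  have h_per: "h v = h w" if "vmod s v = vmod s w" for v w
    unfolding h_def using periodicD[OF primitiveD(1)[OF G] that] by simp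
  have G_hol: "G v i holomorphic_on uhp" if "i \<le> m" for v i
    unfolding holomorphic_on_open[OF open_uhp] using primitiveD(2)[OF G that] by blast
  have h_hol: "h v holomorphic_on uhp" for v
    unfolding h_def eichler_def[abs_def] by (intro holomorphic_intros G_hol) auto
  have G_mod: "moderate (G v i)" if "i \<le> m" for v i
  proof (rule moderate_primitive)
    show "moderate (\<lambda>t. g v t * t ^ i)"
      using modular_familyD(3)[OF g] by (intro moderate_mult moderate_power moderate_ident)
    show "(G v i has_field_derivative g v t * t ^ i) (at t)" if "t \<in> uhp" for t
      using primitiveD(2)[OF G \<open>i \<le> m\<close> that] .
  qed
  have h_mod: "moderate (h v)" for v
    unfolding h_def eichler_def[abs_def]
    by (intro moderate_sum moderate_mult moderate_const moderate_power moderate_ident G_mod) auto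
  \<comment> \<open>Translation by P, conjugated by any K, is congruent to 1 modulo P; hence it lies
    in \<Gamma>(2) and fixes row vectors modulo 2^s. The extra factor 2 takes care of s = 0.\<close>
  define P :: int where "P = 2 ^ Suc s"
  have bounded: "\<exists>B. \<forall>t. Im t \<ge> 1 / 2 \<longrightarrow> cmod (jfac K t ^ m * h v (mob K t)) \<le> B" if K: "K \<in> SL2" for K v
  proof (rule periodic_moderate_bounded[of _ "of_int P"])
    have Kdet: "mdet K = 1" using K by (simp add: SL2_def)
    obtain a b c d where Keq: "K = (a, b, c, d)" by (cases K)
    have jK: "jfac K = (\<lambda>t. of_int c * t + of_int d)" by (simp add: fun_eq_iff Keq)
    show "(\<lambda>t. jfac K t ^ m * h v (mob K t)) holomorphic_on uhp"
    proof (intro holomorphic_on_mult holomorphic_on_power)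
      show "jfac K holomorphic_on uhp" unfolding jK by (intro holomorphic_intros)
      show "(\<lambda>t. h v (mob K t)) holomorphic_on uhp"
      proof (rule holomorphic_on_compose_gen[OF _ h_hol, unfolded o_def])
        show "mob K holomorphic_on uhp"
          using has_field_derivative_mob[of _ K] Kdet open_uhp by (auto simp: holomorphic_on_open)
        show "mob K ` uhp \<subseteq> uhp"
          by (rule image_subsetI, rule mob_in_uhp) (simp_all add: Kdet)
      qed
    qed
    show "moderate (\<lambda>t. jfac K t ^ m * h v (mob K t))"
      using h_mod Kdet by (intro moderate_mult moderate_power moderate_jfac moderate_mob) auto
    show "real_of_int P > 0" by (simp add: P_def)
    fix t assume t: "t \<in> uhp"
    define T where "T = (1::int, P, 0::int, 1::int)"
    define N where "N = mmul (mmul K T) (madj K)"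
    have detT: "mdet T = 1" by (simp add: T_def)
    have Tt: "mob T t = t + of_real (of_int P)" "jfac T t = 1" by (simp_all add: T_def)
    have Neq: "N = (1 - P * (a * c), P * (a * a), - (P * (c * c)), 1 + P * (a * c))"
      using Kdet by (simp add: N_def T_def Keq algebra_simps)
    have ND: "N \<in> Delta2 1" using Kdet detT by (simp add: Delta2_def N_def) (simp add: Neq P_def flip: N_def)
    have Ndet: "mdet N = 1" using ND by (simp add: Delta2_def)
    have NK: "mmul N K = mmul K T" using Kdet by (simp add: N_def mmul_assoc mmul_madj)
    have Kt: "mob K t \<in> uhp" using mob_in_uhp[OF t, of K] Kdet by simp
    have "vmod s (vact v N) = vmod s v"
    proof -
      obtain x y where v: "v = (x, y)" by (cases v)
      have "vact v N = (x + 2 ^ s * (2 * (- (x * (a * c)) - y * (c * c))), y + 2 ^ s * (2 * (x * (a * a) + y * (a * c))))"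
        by (simp add: Neq v P_def algebra_simps)
      then show ?thesis by (simp add: vmod_def v)
    qed
    then have hN: "h (vact v N) = h v" by (rule h_per)
    have "mob K (t + of_real (of_int P)) = mob (mmul N K) t"
      unfolding NK using mob_mmul[OF t, of K T] Kdet detT by (simp add: Tt)
    also have "\<dots> = mob N (mob K t)" using mob_mmul[OF t, of N K] Ndet Kdet by simp
    finally have 1: "mob K (t + of_real (of_int P)) = mob N (mob K t)" .
    have "jfac K (t + of_real (of_int P)) = jfac (mmul N K) t"
      unfolding NK using jfac_mmul[OF t, of T K] detT by (simp add: Tt)
    also have "\<dots> = jfac N (mob K t) * jfac K t" using jfac_mmul[OF t, of K N] Kdet by simp
    finally have 2: "jfac K (t + of_real (of_int P)) = jfac N (mob K t) * jfac K t" .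
    show "jfac K (t + of_real (of_int P)) ^ m * h v (mob K (t + of_real (of_int P))) = jfac K t ^ m * h v (mob K t)"
      unfolding 1 2 using inv[OF ND Kt, of v] by (simp add: hN power_mult_distrib mult_ac)
  qed
  have "\<forall>K\<in>SL2_reps. \<forall>v. \<exists>B. \<forall>t. Im t \<ge> 1 / 2 \<longrightarrow> cmod (jfac K t ^ m * h v (mob K t)) \<le> B"
    using bounded SL2_reps_subset by blast
  then obtain B where B: "\<And>K v t. K \<in> SL2_reps \<Longrightarrow> Im t \<ge> 1 / 2 \<Longrightarrow> cmod (jfac K t ^ m * h v (mob K t)) \<le> B K v"
    by metis
  define C where "C = (\<Sum>K\<in>SL2_reps. \<Sum>v\<in>vbox s. \<bar>B K v\<bar>)"
  have fin: "finite SL2_reps" by (simp add: SL2_reps_def)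
  have C: "cmod (jfac K t ^ m * h v (mob K t)) \<le> C" if "K \<in> SL2_reps" "Im t \<ge> 1 / 2" for K v t
  proof -
    have "h v = h (vmod s v)" by (rule h_per) simp
    then have "cmod (jfac K t ^ m * h v (mob K t)) \<le> \<bar>B K (vmod s v)\<bar>"
      using B[OF that, of "vmod s v"] by simp
    also have "\<dots> \<le> (\<Sum>v\<in>vbox s. \<bar>B K v\<bar>)"
      by (rule member_le_sum) auto
    also have "\<dots> \<le> C"
      unfolding C_def using that(1) fin by (intro member_le_sum[of K _ "\<lambda>K. \<Sum>v\<in>vbox s. \<bar>B K v\<bar>"]) (auto intro: sum_nonneg)
    finally show ?thesis .
  qed
  \<comment> \<open>Move t to z with Im z >= 1/2 and return by N K with K among the six
    representatives. C bounds the part coming from K, and Im t = Im z / |j|^2 turns |j|^(-2m) into a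
    power of Im t.\<close>
  have bound: "(cmod (h v t))\<^sup>2 \<le> (C\<^sup>2 * 2 ^ m) * Im t ^ m" if t: "t \<in> uhp" for v t
  proof -
    obtain M where M: "M \<in> SL2" "Im (mob M t) \<ge> 1 / 2" using SL2_reduction[OF t] by blast
    have Mdet: "mdet M = 1" using M by (simp add: SL2_def)
    define z where "z = mob M t"
    have z: "z \<in> uhp" using mob_in_uhp[OF t, of M] Mdet by (simp add: z_def)
    obtain N K where NK: "N \<in> Delta2 1" "K \<in> SL2_reps" "madj M = mmul N K"
      using SL2_decomposition[OF SL2_madj[OF M(1)]] by blast
    have dets: "mdet N = 1" "mdet K = 1" using NK SL2_reps_subset by (auto simp: Delta2_def SL2_def)
    have Kz: "mob K z \<in> uhp" using mob_in_uhp[OF z, of K] dets by simp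
    have tz: "mob (madj M) z = t"
      unfolding z_def using mob_mmul[OF t, of "madj M" M] Mdet by (simp add: mmul_madj)
    define j where "j = jfac (madj M) z"
    have j0: "j \<noteq> 0" unfolding j_def by (rule jfac_nonzero[OF z]) (simp add: Mdet)
    have imt: "Im t = Im z / (cmod j)\<^sup>2"
      using Im_mob[OF z, of "madj M"] Mdet by (simp add: tz j_def)
    have t2: "t = mob N (mob K z)"
      using mob_mmul[OF z, of N K] dets by (simp add: NK(3)[symmetric] tz)
    have "j = jfac N (mob K z) * jfac K z"
      unfolding j_def NK(3) using jfac_mmul[OF z, of K N] dets by simp
    then have "j ^ m * h v t = jfac K z ^ m * h (vact v N) (mob K z)"
      using inv[OF NK(1) Kz, of v] by (simp add: t2[symmetric] power_mult_distrib mult_ac)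
    then have "cmod (j ^ m * h v t) \<le> C"
      using C[OF NK(2), of z] M(2) by (simp add: z_def)
    then have "(cmod (j ^ m * h v t))\<^sup>2 \<le> C\<^sup>2" by (intro power_mono) auto
    then have "((cmod j)\<^sup>2) ^ m * (cmod (h v t))\<^sup>2 \<le> C\<^sup>2"
      by (simp add: norm_mult norm_power power_mult_distrib flip: power_mult) (simp add: mult.commute)
    then have "(cmod (h v t))\<^sup>2 \<le> C\<^sup>2 * (1 / (cmod j)\<^sup>2) ^ m"
      using j0 by (simp add: power_divide field_simps)
    also have "\<dots> \<le> C\<^sup>2 * (2 * Im t) ^ m"
    proof (intro mult_left_mono power_mono)
      have "1 \<le> 2 * Im z" using M(2) by (simp add: z_def)
      then show "1 / (cmod j)\<^sup>2 \<le> 2 * Im t" unfolding imt by (simp add: divide_right_mono)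
    qed auto
    finally show ?thesis by (simp add: power_mult_distrib mult_ac)
  qed
  have "h v t = 0" if "t \<in> uhp" for v t
    using vanishing_at_real_line_imp_zero[OF h_hol m bound that] .
  then show ?thesis
    using eichler_zero_imp_zero[of m "G v" "g v" t] primitiveD(2)[OF G] t by (simp add: h_def)
qed

text \<open>A family is determined by its periods along the three generators for finitely many v and
  i. D is the number of index triples, so D + 1 families have a nontrivial combination with all
  periods zero, and that combination vanishes.\<close>

theorem modular_family_finite_rank:
  assumes m: "m > 0"
  shows "\<exists>D. \<forall>g. (\<forall>k\<le>D. modular_family s (m + 2) chi (g k)) \<longrightarrow>
    (\<exists>c::nat \<Rightarrow> complex. (\<exists>k\<le>D. c k \<noteq> 0) \<and> (\<forall>v. \<forall>t\<in>uhp. (\<Sum>k\<le>D. c k * g k v t) = 0))"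
proof -
  define J where "J = Gamma2_gens \<times> vbox s \<times> {..m}"
  have J: "finite J" by (simp add: J_def Gamma2_gens_def)
  show ?thesis
  proof (intro exI[of _ "card J"] allI impI)
    fix g :: "nat \<Rightarrow> int \<times> int \<Rightarrow> complex \<Rightarrow> complex"
    assume g: "\<forall>k\<le>card J. modular_family s (m + 2) chi (g k)"
    then have "\<forall>k. \<exists>G. k \<le> card J \<longrightarrow> primitive s m (g k) G"
      using ex_primitive[where m = m] by blast
    then obtain G where G: "\<And>k. k \<le> card J \<Longrightarrow> primitive s m (g k) (G k)" by metis
    obtain c :: "nat \<Rightarrow> complex" where c: "\<exists>k\<le>card J. c k \<noteq> 0"
      "\<forall>x\<in>J. (\<Sum>k\<le>card J. c k * (case x of (M, v, i) \<Rightarrow> period m (G k) M v i)) = 0"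
      using ex_nontrivial_solution[OF J, of "{..card J}" "\<lambda>k (M, v, i). period m (G k) M v i"] by auto
    define g' where "g' v t = (\<Sum>k\<le>card J. c k * g k v t)" for v t
    define G' where "G' v i t = (\<Sum>k\<le>card J. c k * G k v i t)" for v i t
    have g': "modular_family s (m + 2) chi g'"
      unfolding g'_def[abs_def] by (rule modular_family_sum) (use g in auto)
    have G': "primitive s m g' G'"
      unfolding g'_def[abs_def] G'_def[abs_def] by (rule primitive_sum) (use G in auto)
    have per: "period m G' M v i = (\<Sum>k\<le>card J. c k * period m (G k) M v i)" for M v i
      unfolding period_def G'_def right_diff_distrib sum_subtractf sum_distrib_left
      by (subst sum.swap) (simp add: mult_ac)
    have zero: "period m G' M v i = 0" if "M \<in> Delta2 1" "i \<le> m" for M v i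
    proof (rule period_zero_if_zero_on_gens[OF g' G' _ that])
      fix M v i assume "M \<in> Gamma2_gens" "v \<in> vbox s" "i \<le> m"
      then show "period m G' M v i = 0" using c(2) by (force simp: per J_def)
    qed
    have "g' v t = 0" if "t \<in> uhp" for v t
      using zero_periods_imp_zero[OF g' G' m zero that] .
    then show "\<exists>c::nat \<Rightarrow> complex. (\<exists>k\<le>card J. c k \<noteq> 0) \<and> (\<forall>v. \<forall>t\<in>uhp. (\<Sum>k\<le>card J. c k * g k v t) = 0)"
      using c(1) unfolding g'_def by blast
  qed
qed

text \<open>The recurrence of the periods says that one fixed combination of Hecke iterates of g has
  all periods zero; such a combination is zero.\<close>

theorem hecke_nilpotent_mod_2:
  assumes p: "prime p" "odd p" and g: "modular_family s (m + 2) chi g" and m: "m > 0"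
  shows "\<exists>(D::nat) L (c::nat \<Rightarrow> int). \<forall>v. \<forall>t\<in>uhp.
     ((hecke (m + 2) p ^^ (D * L)) g) v t = 2 * (\<Sum>l<D. of_int (c l) * ((hecke (m + 2) p ^^ (l * L)) g) v t)"
proof -
  obtain G where G: "primitive s m g G" using ex_primitive[OF g] by blast
  define gs where "gs j = (hecke (m + 2) p ^^ j) g" for j
  define Gs where "Gs j = (hecke_primitive m p ^^ j) G" for j
  have gs: "modular_family s (m + 2) chi (gs j)" for j
  proof (induction j)
    case 0
    then show ?case using g by (simp only: gs_def funpow.simps id_apply)
  next
    case (Suc j)
    have "gs (Suc j) = hecke (m + 2) p (gs j)" by (simp only: gs_def funpow.simps o_apply)
    then show ?case using modular_family_hecke[OF p Suc] by (simp only: add_gr_0 zero_less_numeral simp_thms)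
  qed
  have Gs: "primitive s m (gs j) (Gs j)" for j
  proof (induction j)
    case 0
    then show ?case using G by (simp only: gs_def Gs_def funpow.simps id_apply)
  next
    case (Suc j)
    have "gs (Suc j) = hecke (m + 2) p (gs j)" "Gs (Suc j) = hecke_primitive m p (Gs j)"
      by (simp_all only: gs_def Gs_def funpow.simps o_apply)
    then show ?case using primitive_hecke[OF p(1) Suc] by (simp only:)
  qed
  interpret period_sequences m s p "\<lambda>j M v i. period m (Gs j) M v i"
  proof
    show "periodic s (\<lambda>v. period m (Gs j) M v i)" for j M i
      by (rule period_periodic[OF Gs])
    show "period m (Gs j) (mmul M N) v i = period m (Gs j) M v i + (\<Sum>k\<le>m. of_int (Rcoef m M i k) * period m (Gs j) N (vact v M) k)"
      if "M \<in> Delta2 1" "N \<in> Delta2 1" "i \<le> m" for j M N v i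
      by (rule period_cocycle[OF gs Gs that])
    show "period m (Gs (Suc j)) M v i = (\<Sum>h\<in>hreps p. \<Sum>k\<le>m. of_int (Rcoef m (madj h) i k) *
           period m (Gs j) (fst (hdec p (mmul h M))) (vact v (madj h)) k)"
      if "M \<in> Delta2 1" "i \<le> m" for j M v i
      using period_hecke[OF p gs Gs that] by (simp add: Gs_def)
  qed (rule p)+
  obtain D L :: nat and c :: "nat \<Rightarrow> int" where c0: "\<forall>M\<in>Delta2 1. \<forall>v. \<forall>i\<le>m.
     period m (Gs (D * L)) M v i = 2 * (\<Sum>l<D. of_int (c l) * period m (Gs (l * L)) M v i)"
    using periods_recurrence by (elim exE)
  have c: "period m (Gs (D * L)) M v i = 2 * (\<Sum>l<D. of_int (c l) * period m (Gs (l * L)) M v i)"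
    if "M \<in> Delta2 1" "i \<le> m" for M v i
    using c0 that by blast
  define a :: "nat \<Rightarrow> complex" where "a l = (if l = D then 1 else - 2 * of_int (c l))" for l
  define g' where "g' v t = (\<Sum>l\<le>D. a l * gs (l * L) v t)" for v t
  define G' where "G' v i t = (\<Sum>l\<le>D. a l * Gs (l * L) v i t)" for v i t
  have g': "modular_family s (m + 2) chi g'"
    unfolding g'_def[abs_def] by (rule modular_family_sum[OF gs])
  have G': "primitive s m g' G'"
    unfolding g'_def[abs_def] G'_def[abs_def] by (rule primitive_sum[OF Gs])
  have asum: "(\<Sum>l\<le>D. a l * x l) = x D - 2 * (\<Sum>l<D. of_int (c l) * x l)" for x :: "nat \<Rightarrow> complex"
    by (simp add: a_def lessThan_Suc_atMost[symmetric] sum_negf sum_distrib_left mult.assoc)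
  have per: "period m G' M v i = (\<Sum>l\<le>D. a l * period m (Gs (l * L)) M v i)" for M v i
    unfolding period_def G'_def right_diff_distrib sum_subtractf sum_distrib_left
    by (subst sum.swap) (simp add: mult_ac)
  have zero: "period m G' M v i = 0" if "M \<in> Delta2 1" "i \<le> m" for M v i
    unfolding per asum using c[OF that] by simp
  have "g' v t = 0" if "t \<in> uhp" for v t
    using zero_periods_imp_zero[OF g' G' m zero that] .
  then have "gs (D * L) v t = 2 * (\<Sum>l<D. of_int (c l) * gs (l * L) v t)" if "t \<in> uhp" for v t
    using that unfolding g'_def asum by simp
  then show ?thesis unfolding gs_def by blast
qed

subsection \<open>Poisson summation for the Gaussian\<close>

abbreviation unit_integral :: "(real \<Rightarrow> real) \<Rightarrow> real" where
  "unit_integral f \<equiv> integral {-1/2..1/2} f"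

lemma unit_integral_cos:
  fixes j :: int
  shows "unit_integral (\<lambda>u. cos (2 * pi * of_int j * u)) = (if j = 0 then 1 else 0)"
proof (cases "j = 0")
  case False
  define c where "c = 2 * pi * of_int j"
  have c: "c \<noteq> 0" using False by (simp add: c_def)
  have "((\<lambda>u. cos (c * u)) has_integral (sin (c * (1/2)) / c - sin (c * (-1/2)) / c)) {-1/2..1/2}"
    by (rule fundamental_theorem_of_calculus)
       (use c in \<open>auto intro!: derivative_eq_intros simp flip: has_real_derivative_iff_has_vector_derivative\<close>)
  moreover have "c * (1/2) = of_int j * pi" "c * (-1/2) = of_int (-j) * pi" by (simp_all add: c_def)
  ultimately have "((\<lambda>u. cos (c * u)) has_integral 0) {-1/2..1/2}"
    by (simp add: sin_times_pi_eq_0 sin_zero_iff_int2) (metis sin_npi_int mult.commute sin_minus mult_minus_left diff_0_right div_0 minus_zero)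
  then show ?thesis using False by (simp add: c_def integral_unique)
qed simp

lemma unit_integral_sin_sin:
  fixes M M' :: nat
  shows "unit_integral (\<lambda>u. sin ((2 * real M + 1) * pi * u) * sin ((2 * real M' + 1) * pi * u)) =
    (if M = M' then 1 / 2 else 0)"
proof -
  have "sin ((2 * real M + 1) * pi * u) * sin ((2 * real M' + 1) * pi * u) =
     (1 / 2) * (cos (2 * pi * of_int (int M - int M') * u) - cos (2 * pi * of_int (int M + int M' + 1) * u))" for u
  proof -
    have 1: "(2 * real M + 1) * pi * u - (2 * real M' + 1) * pi * u = 2 * pi * of_int (int M - int M') * u"
      and 2: "(2 * real M + 1) * pi * u + (2 * real M' + 1) * pi * u = 2 * pi * of_int (int M + int M' + 1) * u"
      by (simp_all add: algebra_simps)
    show ?thesis unfolding sin_times_sin 1 2 by simp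
  qed
  then have "unit_integral (\<lambda>u. sin ((2 * real M + 1) * pi * u) * sin ((2 * real M' + 1) * pi * u)) =
     (1 / 2) * (unit_integral (\<lambda>u. cos (2 * pi * of_int (int M - int M') * u)) -
        unit_integral (\<lambda>u. cos (2 * pi * of_int (int M + int M' + 1) * u)))"
    by (simp only:) (subst integral_mult_right, subst integral_diff,
        auto intro!: integrable_continuous_interval continuous_intros)
  then show ?thesis unfolding unit_integral_cos by auto
qed

text \<open>The sines are the numerators of the Dirichlet kernel, (2M + 1) \<pi> being their
  frequencies. On an interval of length 1 their squares integrate to 1/2, whence the factor 1/2 in
  the bound.\<close>

lemma bessel_inequality:
  fixes h :: "real \<Rightarrow> real"
  assumes h: "continuous_on {-1/2..1/2} h" and C: "\<And>u. u \<in> {-1/2..1/2} \<Longrightarrow> \<bar>h u\<bar> \<le> C"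
  defines "b \<equiv> \<lambda>M::nat. unit_integral (\<lambda>u. h u * sin ((2 * real M + 1) * pi * u))"
  shows "(\<Sum>M<K. (b M)\<^sup>2) \<le> C\<^sup>2 / 2"
proof -
  define s where "s M u = sin ((2 * real M + 1) * pi * u)" for M :: nat and u
  define S where "S u = (\<Sum>M<K. 2 * b M * s M u)" for u
  have s_cont: "continuous_on {-1/2..1/2} (s M)" for M
    unfolding s_def by (intro continuous_intros)
  have S_cont: "continuous_on {-1/2..1/2} S"
    unfolding S_def by (intro continuous_intros s_cont)
  note int = integrable_continuous_interval
  have hS: "unit_integral (\<lambda>u. h u * S u) = 2 * (\<Sum>M<K. (b M)\<^sup>2)"
  proof -
    have "unit_integral (\<lambda>u. h u * S u) = unit_integral (\<lambda>u. \<Sum>M<K. 2 * b M * (h u * s M u))"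
      by (simp add: S_def sum_distrib_left mult_ac)
    also have "\<dots> = (\<Sum>M<K. 2 * b M * unit_integral (\<lambda>u. h u * s M u))"
    proof (subst integral_sum)
      show "(\<lambda>u. 2 * b M * (h u * s M u)) integrable_on {-1/2..1/2}" for M
        by (intro int continuous_intros h s_cont)
    qed auto
    finally show ?thesis by (simp add: b_def s_def sum_distrib_left power2_eq_square mult_ac)
  qed
  have SS: "unit_integral (\<lambda>u. S u * S u) = 2 * (\<Sum>M<K. (b M)\<^sup>2)"
  proof -
    have "unit_integral (\<lambda>u. S u * S u) = unit_integral (\<lambda>u. \<Sum>M<K. \<Sum>M'<K. 4 * b M * b M' * (s M u * s M' u))"
      by (simp add: S_def sum_product mult_ac)
    also have "\<dots> = (\<Sum>M<K. \<Sum>M'<K. 4 * b M * b M' * unit_integral (\<lambda>u. s M u * s M' u))"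
    proof -
      have i1: "(\<lambda>u. 4 * b M * b M' * (s M u * s M' u)) integrable_on {-1/2..1/2}" for M M'
        by (intro int continuous_intros s_cont)
      have "unit_integral (\<lambda>u. \<Sum>M'<K. 4 * b M * b M' * (s M u * s M' u)) =
          (\<Sum>M'<K. 4 * b M * b M' * unit_integral (\<lambda>u. s M u * s M' u))" for M
        by (subst integral_sum) (use i1 in auto)
      moreover have "(\<lambda>u. \<Sum>M'<K. 4 * b M * b M' * (s M u * s M' u)) integrable_on {-1/2..1/2}" for M
        by (intro integrable_sum i1) auto
      ultimately show ?thesis by (subst integral_sum) auto
    qed
    also have "\<dots> = (\<Sum>M<K. \<Sum>M'<K. if M' = M then 2 * (b M)\<^sup>2 else 0)"
      unfolding s_def unit_integral_sin_sin by (intro sum.cong refl) (auto simp: power2_eq_square)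
    finally show ?thesis by (simp add: sum_distrib_left)
  qed
  have "0 \<le> unit_integral (\<lambda>u. (h u - S u)\<^sup>2)"
    by (intro integral_nonneg int continuous_intros h S_cont) auto
  also have "unit_integral (\<lambda>u. (h u - S u)\<^sup>2) = unit_integral (\<lambda>u. (h u)\<^sup>2 - 2 * (h u * S u) + S u * S u)"
    by (simp add: power2_eq_square algebra_simps)
  also have "\<dots> = unit_integral (\<lambda>u. (h u)\<^sup>2) - 2 * unit_integral (\<lambda>u. h u * S u) + unit_integral (\<lambda>u. S u * S u)"
    by (subst integral_add, (intro int continuous_intros h S_cont)+,
        subst integral_diff, (intro int continuous_intros h S_cont)+) simp
  also have "unit_integral (\<lambda>u. (h u)\<^sup>2) \<le> unit_integral (\<lambda>u. C\<^sup>2)"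
  proof (intro integral_le int continuous_intros h)
    fix u assume "u \<in> {-1/2..1/2::real}"
    then have "\<bar>h u\<bar>\<^sup>2 \<le> C\<^sup>2" by (intro power_mono C) auto
    then show "(h u)\<^sup>2 \<le> C\<^sup>2" by simp
  qed
  finally show ?thesis unfolding hS SS by simp
qed

lemma dirichlet_kernel:
  "sin (pi * u) * (1 + 2 * (\<Sum>k=1..M. cos (2 * pi * real k * u))) = sin ((2 * real M + 1) * pi * u)"
proof (induction M)
  case (Suc M)
  have "sin ((2 * real (Suc M) + 1) * pi * u) - sin ((2 * real M + 1) * pi * u) = 2 * sin (pi * u) * cos (2 * pi * real (Suc M) * u)"
    unfolding sin_diff_sin by (simp add: algebra_simps add_divide_distrib diff_divide_distrib)
  then show ?case using Suc by (simp add: algebra_simps)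
qed (simp add: mult.commute)

text \<open>The Fourier transform of the Gaussian, read off from the characteristic function of the
  standard normal distribution after scaling by sqrt (2 \<pi> y).\<close>

lemma gaussian_cos_integral:
  fixes y :: real
  assumes y: "y > 0"
  shows "integrable lborel (\<lambda>x. exp (- pi * y * x\<^sup>2) * cos (2 * pi * k * x))"
    and "(LBINT x. exp (- pi * y * x\<^sup>2) * cos (2 * pi * k * x)) = exp (- pi * k\<^sup>2 / y) / sqrt y"
proof -
  define t where "t = 2 * pi * k / sqrt (2 * pi * y)"
  define f where "f x = std_normal_density x * cos (t * x)" for x
  have t2: "t\<^sup>2 / 2 = pi * k\<^sup>2 / y" using y by (simp add: t_def power_divide power_mult_distrib) (simp add: field_simps power2_eq_square)
  have "integrable lborel (\<lambda>x. std_normal_density x *\<^sub>R iexp (t * x))"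
    by (rule Bochner_Integration.integrable_bound[OF integrable_normal_density[of 1 0]]) auto
  then have c_int: "integrable lborel (\<lambda>x. std_normal_density x *\<^sub>R iexp (t * x))" .
  have f_meas: "f \<in> borel_measurable lborel" unfolding f_def[abs_def] by measurable
  have f_int: "integrable lborel f"
    by (rule Bochner_Integration.integrable_bound[OF integrable_normal_density[of 1 0] f_meas])
       (auto simp: f_def abs_mult intro!: mult_left_le)
  have "(CLINT x|lborel. std_normal_density x *\<^sub>R iexp (t * x)) = exp (- (t\<^sup>2) / 2)"
    using fun_cong[OF char_std_normal_distribution, of t]
    unfolding char_def by (subst (asm) integral_density) auto
  then have "Re (CLINT x|lborel. std_normal_density x *\<^sub>R iexp (t * x)) = exp (- (t\<^sup>2) / 2)" by simp
  also have "Re (CLINT x|lborel. std_normal_density x *\<^sub>R iexp (t * x)) = (LBINT x. f x)"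
    by (subst integral_Re[OF c_int, symmetric]) (simp add: f_def[abs_def] Re_exp)
  finally have f_val: "(LBINT x. f x) = exp (- (t\<^sup>2) / 2)" .
  define c where "c = sqrt (2 * pi * y)"
  have c: "c > 0" using y by (simp add: c_def)
  have scale: "f (0 + c * x) = (1 / sqrt (2 * pi)) * (exp (- pi * y * x\<^sup>2) * cos (2 * pi * k * x))" for x
    using y c by (simp add: f_def std_normal_density_def t_def c_def power_mult_distrib field_simps)
  have "integrable lborel (\<lambda>x. f (0 + c * x))"
    using lborel_integrable_real_affine[OF f_int, of c 0] c by simp
  then have "integrable lborel (\<lambda>x. sqrt (2 * pi) * f (0 + c * x))" by simp
  then show "integrable lborel (\<lambda>x. exp (- pi * y * x\<^sup>2) * cos (2 * pi * k * x))"
    unfolding scale by (simp add: mult.assoc[symmetric])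
  have "(LBINT x. f x) = c * (LBINT x. f (0 + c * x))"
    using lborel_integral_real_affine[of c f 0] c by simp
  also have "(LBINT x. f (0 + c * x)) = (1 / sqrt (2 * pi)) * (LBINT x. exp (- pi * y * x\<^sup>2) * cos (2 * pi * k * x))"
    unfolding scale by simp
  finally have "exp (- (t\<^sup>2) / 2) = c / sqrt (2 * pi) * (LBINT x. exp (- pi * y * x\<^sup>2) * cos (2 * pi * k * x))"
    using f_val by simp
  also have "c / sqrt (2 * pi) = sqrt y" by (simp add: c_def real_sqrt_mult)
  also have "- (t\<^sup>2) / 2 = - pi * k\<^sup>2 / y" using t2 by simp
  finally show "(LBINT x. exp (- pi * y * x\<^sup>2) * cos (2 * pi * k * x)) = exp (- pi * k\<^sup>2 / y) / sqrt y"
    using y by simp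
qed

text \<open>
  Summed over \<open>n < N\<close> only, the error of the \<open>M\<close>-th partial sum on the Fourier side is, by the Dirichlet
  kernel, a sine coefficient of a function bounded uniformly in \<open>N\<close>. By Bessel's inequality the
  squares of these errors are summable in \<open>M\<close>, uniformly in \<open>N\<close>, so the limiting errors tend to 0.
\<close>

lemma poisson_half:
  fixes y :: real
  assumes y: "y > 0"
  assumes sums: "(\<lambda>n. 2 * exp (- pi * y * (real n + 1/2)\<^sup>2)) sums A"
  shows "(\<lambda>M. (1 + 2 * (\<Sum>k=1..M. (-1) ^ k * exp (- pi * (real k)\<^sup>2 / y))) / sqrt y) \<longlonglongrightarrow> A"
proof -
  define \<phi> where "\<phi> x = exp (- pi * y * x\<^sup>2)" for x
  \<comment> \<open>As u runs through [-1/2, 1/2], n + 1/2 + u covers [n, n + 1], so unit integrals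
    of F add up to integrals over [0, N]. The reflected term makes F even; its derivative at 0 then
    vanishes, and the quotient h below extends continuously by 0.\<close>
  define F where "F N u = (\<Sum>n<N. \<phi> (real n + 1/2 + u) + \<phi> (real n + 1/2 - u))" for N :: nat and u
  define s where "s M u = sin ((2 * real M + 1) * pi * u)" for M :: nat and u :: real
  define h where "h N u = (if u = 0 then 0 else (F N u - F N 0) / sin (pi * u))" for N u
  define b where "b N M = unit_integral (\<lambda>u. h N u * s M u)" for N M
  define I where "I N k = integral {0..real N} (\<lambda>x. \<phi> x * cos (2 * pi * real k * x))" for N k :: nat
  note int = integrable_continuous_interval
  have \<phi>_cont: "continuous_on X (\<lambda>x. \<phi> (f x))" if "continuous_on X f" for X f
    unfolding \<phi>_def by (intro continuous_intros that)
  have \<phi>_even: "\<phi> (- x) = \<phi> x" for x by (simp add: \<phi>_def)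
  have \<phi>': "(\<phi> has_real_derivative - 2 * pi * y * x * \<phi> x) (at x)" for x
    unfolding \<phi>_def by (auto intro!: derivative_eq_intros)
  define a where "a = pi * y"
  have a: "a > 0" using y by (simp add: a_def)
  \<comment> \<open>The constant comes from exp z >= 1 + z + z^2/2 at z = a x^2. It bounds the
    derivative of \<phi> by \<open>K0\<close> / (1 + x^2), so the derivatives of F N are bounded
    independently of N.\<close>
  define K0 where "K0 = 2 * a * (1 + 2 / a + 2 / a\<^sup>2)"
  have K0: "K0 \<ge> 0" using a by (simp add: K0_def)
  have \<phi>'_bound: "\<bar>- 2 * pi * y * x * \<phi> x\<bar> \<le> K0 / (1 + x\<^sup>2)" for x
  proof -
    define z where "z = a * x\<^sup>2"
    have z: "z \<ge> 0" using a by (simp add: z_def)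
    have ez: "1 + z + z\<^sup>2 / 2 \<le> exp z" using exp_lower_Taylor_quadratic[OF z] .
    have x1: "\<bar>x\<bar> \<le> 1 + x\<^sup>2"
      using zero_le_power2[of "\<bar>x\<bar> - 1/2"] by (simp add: power2_eq_square algebra_simps)
    have "\<bar>x\<bar> * (1 + x\<^sup>2) \<le> (1 + x\<^sup>2) * (1 + x\<^sup>2)" using x1 by (intro mult_right_mono) auto
    also have "\<dots> = 1 + (2 / a) * z + (2 / a\<^sup>2) * (z\<^sup>2 / 2)"
      using a by (simp add: z_def power2_eq_square field_simps)
    also have "\<dots> \<le> (1 + 2 / a + 2 / a\<^sup>2) * (1 + z + z\<^sup>2 / 2)"
    proof -
      define p q r where "p = 2 / a" "q = 2 / a\<^sup>2" "r = z\<^sup>2 / 2"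
      have "p \<ge> 0" "q \<ge> 0" "r \<ge> 0" using a by (simp_all add: p_q_r_def)
      then have "0 \<le> p + q + z + r + p * r + q * z" using z by (intro add_nonneg_nonneg mult_nonneg_nonneg)
      then show ?thesis unfolding p_q_r_def[symmetric] by (simp add: algebra_simps)
    qed
    also have "\<dots> \<le> (1 + 2 / a + 2 / a\<^sup>2) * exp z" using a by (intro mult_left_mono ez) auto
    finally have "2 * a * (\<bar>x\<bar> * (1 + x\<^sup>2)) \<le> 2 * a * ((1 + 2 / a + 2 / a\<^sup>2) * exp z)"
      using a by (intro mult_left_mono) auto
    then have "2 * a * \<bar>x\<bar> * (1 + x\<^sup>2) \<le> K0 * exp z" by (simp add: K0_def mult_ac)
    then have "2 * a * \<bar>x\<bar> / exp z \<le> K0 / (1 + x\<^sup>2)"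
      by (simp add: divide_le_eq pos_le_divide_eq add_pos_nonneg mult_ac)
    moreover have "\<bar>- 2 * pi * y * x * \<phi> x\<bar> = 2 * a * \<bar>x\<bar> / exp z"
      using y by (simp add: \<phi>_def z_def a_def abs_mult exp_minus field_simps)
    ultimately show ?thesis by simp
  qed
  define S where "S = (\<Sum>n. 1 / (1 + (real n)\<^sup>2))"
  have summ: "summable (\<lambda>n. 1 / (1 + (real n)\<^sup>2))"
    by (rule summable_comparison_test_ev[OF _ inverse_power_summable[of 2]])
       (auto simp: inverse_eq_divide intro!: eventually_sequentiallyI[of 1] frac_le)
  have Ssum: "(\<Sum>n<N. 1 / (1 + (real n)\<^sup>2)) \<le> S" for N
    unfolding S_def by (rule sum_le_suminf[OF summ]) (auto intro: add_nonneg_nonneg)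
  define F' where "F' N u = (\<Sum>n<N. - 2 * pi * y * (real n + 1/2 + u) * \<phi> (real n + 1/2 + u)
      - (- 2 * pi * y * (real n + 1/2 - u) * \<phi> (real n + 1/2 - u)))" for N u
  have F_deriv: "(F N has_real_derivative F' N u) (at u)" for N u
  proof -
    have 1: "((\<lambda>u. \<phi> (c + u)) has_real_derivative - 2 * pi * y * (c + u) * \<phi> (c + u)) (at u)" for c
      unfolding \<phi>_def by (auto intro!: derivative_eq_intros)
    have 2: "((\<lambda>u. \<phi> (c - u)) has_real_derivative - (- 2 * pi * y * (c - u) * \<phi> (c - u))) (at u)" for c
      unfolding \<phi>_def by (auto intro!: derivative_eq_intros simp: algebra_simps)
    show ?thesis
      unfolding F_def[abs_def] F'_def
      by (intro DERIV_sum, rule DERIV_cong[OF DERIV_add[OF 1 2]]) simp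
  qed
  define C where "C = 2 * K0 * S"
  have C: "C \<ge> 0" using K0 Ssum[of 0] by (simp add: C_def)
  have F'_bound: "\<bar>F' N u\<bar> \<le> C" if u: "\<bar>u\<bar> \<le> 1/2" for N u
  proof -
    have t: "\<bar>- 2 * pi * y * x * \<phi> x\<bar> \<le> K0 / (1 + (real n)\<^sup>2)" if "x \<ge> real n" for x n
    proof -
      have "(real n)\<^sup>2 \<le> x\<^sup>2" using that by (intro power_mono) auto
      then have "K0 / (1 + x\<^sup>2) \<le> K0 / (1 + (real n)\<^sup>2)"
        using K0 by (intro divide_left_mono mult_pos_pos add_pos_nonneg) auto
      then show ?thesis using \<phi>'_bound[of x] by linarith
    qed
    have "\<bar>F' N u\<bar> \<le> (\<Sum>n<N. K0 / (1 + (real n)\<^sup>2) + K0 / (1 + (real n)\<^sup>2))"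
      unfolding F'_def
    proof (rule order_trans[OF sum_abs], rule sum_mono)
      fix n
      have "real n + 1/2 + u \<ge> real n" "real n + 1/2 - u \<ge> real n" using u by auto
      from t[OF this(1)] t[OF this(2)]
      show "\<bar>- 2 * pi * y * (real n + 1/2 + u) * \<phi> (real n + 1/2 + u)
      - (- 2 * pi * y * (real n + 1/2 - u) * \<phi> (real n + 1/2 - u))\<bar> \<le> K0 / (1 + (real n)\<^sup>2) + K0 / (1 + (real n)\<^sup>2)"
        by linarith
    qed
    also have "\<dots> = 2 * K0 * (\<Sum>n<N. 1 / (1 + (real n)\<^sup>2))"
      by (simp add: sum_distrib_left)
    also have "\<dots> \<le> C" unfolding C_def using K0 by (intro mult_left_mono Ssum) auto
    finally show ?thesis .
  qed
  \<comment> \<open>Jordan's inequality, from concavity of the sine on [0, \<pi>].\<close>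
  have sin_lower: "2 * \<bar>u\<bar> \<le> \<bar>sin (pi * u)\<bar>" if "\<bar>u\<bar> \<le> 1/2" for u
  proof -
    have pos: "2 * v \<le> sin (pi * v)" if "0 \<le> v" "v \<le> 1/2" for v :: real
    proof -
      have "concave_on {0..pi} sin"
        by (rule f''_le0_imp_concave[where f' = cos and f'' = "\<lambda>x. - sin x"])
           (auto intro!: derivative_eq_intros sin_ge_zero)
      then have "(1 - 2 * v) * sin 0 + (2 * v) * sin (pi / 2) \<le> sin ((1 - 2 * v) *\<^sub>R 0 + (2 * v) *\<^sub>R (pi / 2))"
        by (rule concave_onD) (use that in auto)
      then show ?thesis by (simp add: mult.commute)
    qed
    show ?thesis
    proof (cases "u \<ge> 0")
      case True
      then have "sin (pi * u) \<ge> 2 * u" using pos that by auto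
      then show ?thesis using True by simp
    next
      case False
      then have "sin (pi * (- u)) \<ge> 2 * (- u)" using pos[of "-u"] that by auto
      then show ?thesis using False by simp
    qed
  qed
  have F_diff: "\<bar>F N u - F N 0\<bar> \<le> C * \<bar>u\<bar>" if "\<bar>u\<bar> \<le> 1/2" for N u
  proof -
    have "norm (F N u - F N 0) \<le> C * norm (u - 0)"
    proof (rule field_differentiable_bound[of "{-1/2..1/2}" "F N" "F' N"])
      show "(F N has_field_derivative F' N z) (at z within {- 1 / 2..1 / 2})" for z
        using F_deriv has_field_derivative_at_within by blast
      show "norm (F' N z) \<le> C" if "z \<in> {- 1 / 2..1 / 2}" for z
        using F'_bound[of z N] that by auto
    qed (use that in auto)
    then show ?thesis by simp
  qed
  have h_bound: "\<bar>h N u\<bar> \<le> C / 2" if u: "u \<in> {-1/2..1/2}" for N u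
  proof (cases "u = 0")
    case False
    have "\<bar>u\<bar> \<le> 1/2" using u by auto
    note 1 = F_diff[OF this, of N] and 2 = sin_lower[OF this]
    have "\<bar>h N u\<bar> = \<bar>F N u - F N 0\<bar> / \<bar>sin (pi * u)\<bar>" using False by (simp add: h_def)
    also have "\<dots> \<le> (C * \<bar>u\<bar>) / (2 * \<bar>u\<bar>)" using 1 2 False C by (intro frac_le) auto
    finally show ?thesis using False by simp
  qed (use C in \<open>simp add: h_def\<close>)
  have h_cont: "continuous_on {-1/2..1/2} (h N)" for N
  proof (rule continuous_at_imp_continuous_on, rule ballI)
    fix u :: real assume u: "u \<in> {-1/2..1/2}"
    have Fc: "isCont (F N) u" for u using F_deriv DERIV_isCont by blast
    show "isCont (h N) u"
    proof (cases "u = 0")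
      case False
      have "sin (pi * u) \<noteq> 0" using sin_lower[of u] False u by (cases "\<bar>u\<bar> \<le> 1/2") auto
      then have "isCont (\<lambda>u. (F N u - F N 0) / sin (pi * u)) u" by (intro continuous_intros Fc) auto
      moreover have "\<forall>\<^sub>F v in nhds u. v \<noteq> 0" using False by (rule t1_space_nhds)
      then have "\<forall>\<^sub>F v in nhds u. h N v = (F N v - F N 0) / sin (pi * v)"
        by eventually_elim (simp add: h_def)
      ultimately show ?thesis
        using isCont_cong[of "h N" "\<lambda>v. (F N v - F N 0) / sin (pi * v)" u] by simp
    next
      case True
      have "F' N 0 = 0" by (simp add: F'_def)
      then have "((\<lambda>v. (F N v - F N 0) / v) \<longlongrightarrow> 0) (at 0)"
        using F_deriv[of N 0] by (simp add: has_field_derivative_iff)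
      moreover have "((\<lambda>v. v / sin (pi * v)) \<longlongrightarrow> inverse pi) (at 0)" by real_asymp
      ultimately have "((\<lambda>v. ((F N v - F N 0) / v) * (v / sin (pi * v))) \<longlongrightarrow> 0 * inverse pi) (at 0)"
        by (rule tendsto_mult)
      moreover have "\<forall>\<^sub>F v in at 0. ((F N v - F N 0) / v) * (v / sin (pi * v)) = h N v"
        unfolding eventually_at_filter by (rule always_eventually) (auto simp: h_def)
      ultimately have "(h N \<longlongrightarrow> 0) (at 0)" by (simp add: tendsto_cong)
      then show ?thesis using True by (simp add: isCont_def h_def)
    qed
  qed
  have F_cont: "continuous_on X (F N)" for N X
    using F_deriv DERIV_isCont by (intro continuous_at_imp_continuous_on) blast
  \<comment> \<open>The sign comes from the half-integral centres: cos (2 \<pi> k (n + 1/2 + u)) =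
    (-1)^k cos (2 \<pi> k u).\<close>
  have FI: "unit_integral (\<lambda>u. F N u * cos (2 * pi * real k * u)) = 2 * ((-1) ^ k * I N k)" for N k
  proof (induction N)
    case 0
    then show ?case by (simp add: F_def I_def)
  next
    case (Suc N)
    define c where "c = real N + 1/2"
    define g where "g x = \<phi> x * cos (2 * pi * real k * x)" for x
    have g_cont: "continuous_on X g" for X unfolding g_def by (intro continuous_intros \<phi>_cont)
    have cosk: "cos (2 * pi * real k * (c + u)) = (-1) ^ k * cos (2 * pi * real k * u)" for u
    proof -
      have "2 * pi * real k * (c + u) = 2 * pi * real k * u + real (k * (2 * N + 1)) * pi"
        by (simp add: c_def algebra_simps)
      then have "cos (2 * pi * real k * (c + u)) = cos (2 * pi * real k * u) * cos (real (k * (2 * N + 1)) * pi)"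
        by (simp only: cos_add sin_npi mult_zero_right diff_zero)
      also have "cos (real (k * (2 * N + 1)) * pi) = (-1) ^ (k * (2 * N + 1))" by (rule cos_npi)
      also have "(-1 :: real) ^ (k * (2 * N + 1)) = (-1) ^ k"
        by (simp add: power_add power_mult[of _ 2] mult.left_commute[of k 2])
      finally show ?thesis by simp
    qed
    have sh: "unit_integral (\<lambda>u. g (c + u)) = integral {real N..real (Suc N)} g"
    proof -
      have "(g has_integral integral {-1/2 + c..1/2 + c} g) (cbox (-1/2 + c) (1/2 + c))"
        by (simp add: integrable_integral int g_cont)
      from has_integral_affinity[OF this, of 1 c]
      have "unit_integral (\<lambda>u. g (u + c)) = integral {-1/2 + c..1/2 + c} g"
        by (intro integral_unique) (simp add: image_add_atLeastAtMost')
      then show ?thesis by (simp add: c_def add.commute)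
    qed
    have 1: "unit_integral (\<lambda>u. \<phi> (c + u) * cos (2 * pi * real k * u)) = (-1) ^ k * integral {real N..real (Suc N)} g"
    proof -
      have "\<phi> (c + u) * cos (2 * pi * real k * u) = (-1) ^ k * g (c + u)" for u
        unfolding g_def cosk by (simp add: mult_ac flip: power_mult_distrib)
      then show ?thesis using sh by simp
    qed
    have 2: "unit_integral (\<lambda>u. \<phi> (c - u) * cos (2 * pi * real k * u)) = unit_integral (\<lambda>u. \<phi> (c + u) * cos (2 * pi * real k * u))"
      using Henstock_Kurzweil_Integration.integral_reflect_real[of "1/2" "-1/2" "\<lambda>u. \<phi> (c + u) * cos (2 * pi * real k * u)"] by simp
    have "unit_integral (\<lambda>u. F (Suc N) u * cos (2 * pi * real k * u)) = unit_integral (\<lambda>u. F N u * cos (2 * pi * real k * u) +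
       (\<phi> (c + u) * cos (2 * pi * real k * u) + \<phi> (c - u) * cos (2 * pi * real k * u)))"
      by (simp add: F_def c_def algebra_simps)
    also have "\<dots> = unit_integral (\<lambda>u. F N u * cos (2 * pi * real k * u)) +
       (unit_integral (\<lambda>u. \<phi> (c + u) * cos (2 * pi * real k * u)) + unit_integral (\<lambda>u. \<phi> (c - u) * cos (2 * pi * real k * u)))"
      by (subst integral_add, (intro int continuous_intros F_cont \<phi>_cont)+,
          subst integral_add, (intro int continuous_intros F_cont \<phi>_cont)+) simp
    also have "\<dots> = 2 * ((-1) ^ k * (I N k + integral {real N..real (Suc N)} g))"
      unfolding Suc 2 1 by (simp add: algebra_simps)
    also have "I N k + integral {real N..real (Suc N)} g = I (Suc N) k"
      unfolding I_def g_def[symmetric]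
      by (rule Henstock_Kurzweil_Integration.integral_combine) (auto intro: int g_cont)
    finally show ?case .
  qed
  \<comment> \<open>h times the sine is F - F(0) times the Dirichlet kernel, which has integral 1;
    so b is the error of the M-th Fourier partial sum of F at 0.\<close>
  have b_eq: "b N M = 2 * I N 0 + 2 * (\<Sum>k=1..M. 2 * ((-1) ^ k * I N k)) - F N 0" for N M
  proof -
    define D where "D u = 1 + 2 * (\<Sum>k=1..M. cos (2 * pi * real k * u))" for u
    have D_cont: "continuous_on X D" for X unfolding D_def by (intro continuous_intros)
    have "h N u * s M u = (F N u - F N 0) * D u" if "u \<in> {-1/2..1/2}" for u
    proof (cases "u = 0")
      case False
      have "sin (pi * u) \<noteq> 0" using sin_lower[of u] False that by (cases "\<bar>u\<bar> \<le> 1/2") auto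
      then show ?thesis
        unfolding s_def D_def dirichlet_kernel[symmetric] using False by (simp add: h_def)
    qed (simp add: h_def)
    then have "b N M = unit_integral (\<lambda>u. (F N u - F N 0) * D u)"
      unfolding b_def by (intro integral_cong) auto
    also have "\<dots> = unit_integral (\<lambda>u. F N u * D u - F N 0 * D u)" by (simp add: algebra_simps)
    also have "\<dots> = unit_integral (\<lambda>u. F N u * D u) - F N 0 * unit_integral D"
      by (subst integral_diff, (intro int continuous_intros F_cont D_cont)+) simp
    also have "unit_integral D = 1 + 2 * (\<Sum>k=1..M. unit_integral (\<lambda>u. cos (2 * pi * real k * u)))"
      unfolding D_def by (subst integral_add, (intro int continuous_intros)+) (simp add: integral_sum int continuous_intros)
    also have "(\<Sum>k=1..M. unit_integral (\<lambda>u. cos (2 * pi * real k * u))) = 0"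
    proof (rule sum.neutral, rule ballI)
      fix k assume "k \<in> {1..M}"
      then show "unit_integral (\<lambda>u. cos (2 * pi * real k * u)) = 0"
        using unit_integral_cos[of "int k"] by simp
    qed
    also have "unit_integral (\<lambda>u. F N u * D u) = unit_integral (\<lambda>u. F N u * cos (2 * pi * real 0 * u) +
        2 * (\<Sum>k=1..M. F N u * cos (2 * pi * real k * u)))"
      by (simp add: D_def distrib_left sum_distrib_left mult_ac)
    also have "\<dots> = unit_integral (\<lambda>u. F N u * cos (2 * pi * real 0 * u)) + 2 * (\<Sum>k=1..M. unit_integral (\<lambda>u. F N u * cos (2 * pi * real k * u)))"
      by (subst integral_add, (intro int continuous_intros F_cont)+) (simp add: integral_sum int continuous_intros F_cont)
    finally show ?thesis unfolding FI by simp
  qed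
  have I_lim: "(\<lambda>N. 2 * I N k) \<longlonglongrightarrow> exp (- pi * (real k)\<^sup>2 / y) / sqrt y" for k
  proof -
    define g where "g x = \<phi> x * cos (2 * pi * real k * x)" for x
    have g_cont: "continuous_on X g" for X unfolding g_def by (intro continuous_intros \<phi>_cont)
    have g_int: "integrable lborel g" using gaussian_cos_integral(1)[OF y, of "real k"] by (simp add: g_def[abs_def] \<phi>_def)
    have g_meas: "g \<in> borel_measurable borel" using g_cont by (rule borel_measurable_continuous_onI)
    have "(\<lambda>N. LBINT x. indicator {- real N..real N} x *\<^sub>R g x) \<longlonglongrightarrow> (LBINT x. g x)"
    proof (rule integral_dominated_convergence[where w = "\<lambda>x. norm (g x)"])
      show "integrable lborel (\<lambda>x. norm (g x))" using g_int by simp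
      show "AE x in lborel. (\<lambda>N. indicator {- real N..real N} x *\<^sub>R g x) \<longlonglongrightarrow> g x"
      proof (rule AE_I2)
        fix x
        have "\<forall>\<^sub>F N in sequentially. indicator {- real N..real N} x *\<^sub>R g x = g x"
          using eventually_ge_at_top[of "nat \<lceil>\<bar>x\<bar>\<rceil>"]
        proof eventually_elim
          case (elim N)
          then have "\<bar>x\<bar> \<le> real N" by linarith
          then show ?case by (simp add: indicator_def abs_le_iff)
        qed
        then show "(\<lambda>N. indicator {- real N..real N} x *\<^sub>R g x) \<longlonglongrightarrow> g x" by (rule tendsto_eventually)
      qed
    qed (use g_meas in \<open>auto simp: indicator_def\<close>)
    moreover have "(LBINT x. indicator {- real N..real N} x *\<^sub>R g x) = 2 * I N k" for N
    proof -
      have si: "set_integrable lborel {- real N..real N} g"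
        using g_int unfolding set_integrable_def by (rule integrable_mult_indicator[rotated]) auto
      have "(LBINT x. indicator {- real N..real N} x *\<^sub>R g x) = integral {- real N..real N} g"
        using set_borel_integral_eq_integral(2)[OF si] by (simp add: set_lebesgue_integral_def)
      also have "\<dots> = integral {- real N..0} g + integral {0..real N} g"
        by (rule Henstock_Kurzweil_Integration.integral_combine[symmetric]) (auto intro: int g_cont)
      also have "integral {- real N..0} g = integral {- real N..-0} (\<lambda>x. g (- x))"
        by (simp add: g_def[abs_def] \<phi>_even)
      also have "\<dots> = integral {0..real N} g"
        by (rule Henstock_Kurzweil_Integration.integral_reflect_real)
      finally show ?thesis by (simp add: I_def g_def[abs_def])
    qed
    moreover have "(LBINT x. g x) = exp (- pi * (real k)\<^sup>2 / y) / sqrt y"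
      using gaussian_cos_integral(2)[OF y, of "real k"] by (simp add: g_def[abs_def] \<phi>_def)
    ultimately show ?thesis by simp
  qed
  define b' where "b' M = 1 / sqrt y + 2 * (\<Sum>k=1..M. (-1) ^ k * (exp (- pi * (real k)\<^sup>2 / y) / sqrt y)) - A" for M
  have F_lim: "(\<lambda>N. F N 0) \<longlonglongrightarrow> A"
  proof -
    have "F N 0 = (\<Sum>n<N. 2 * exp (- pi * y * (real n + 1/2)\<^sup>2))" for N by (simp add: F_def \<phi>_def)
    then show ?thesis using sums by (simp add: sums_def)
  qed
  have b_lim: "(\<lambda>N. b N M) \<longlonglongrightarrow> b' M" for M
  proof -
    have "(\<lambda>N. 2 * I N 0 + 2 * (\<Sum>k=1..M. (-1) ^ k * (2 * I N k)) - F N 0) \<longlonglongrightarrow>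
      exp (- pi * (real 0)\<^sup>2 / y) / sqrt y + 2 * (\<Sum>k=1..M. (-1) ^ k * (exp (- pi * (real k)\<^sup>2 / y) / sqrt y)) - A"
      by (intro tendsto_intros I_lim F_lim)
    then show ?thesis by (simp add: b_eq b'_def mult_ac)
  qed
  have "(\<Sum>M<K. (b' M)\<^sup>2) \<le> (C / 2)\<^sup>2 / 2" for K
  proof (rule LIMSEQ_le_const2)
    show "(\<lambda>N. \<Sum>M<K. (b N M)\<^sup>2) \<longlonglongrightarrow> (\<Sum>M<K. (b' M)\<^sup>2)" by (intro tendsto_intros b_lim)
    show "\<exists>N. \<forall>n\<ge>N. (\<Sum>M<K. (b n M)\<^sup>2) \<le> (C / 2)\<^sup>2 / 2"
      using bessel_inequality[OF h_cont h_bound] by (auto simp: b_def s_def)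
  qed
  then have "summable (\<lambda>M. (b' M)\<^sup>2)" by (intro summableI_nonneg_bounded[where x = "(C / 2)\<^sup>2 / 2"]) auto
  then have "(\<lambda>M. (b' M)\<^sup>2) \<longlonglongrightarrow> 0" by (rule summable_LIMSEQ_zero)
  then have "(\<lambda>M. sqrt ((b' M)\<^sup>2)) \<longlonglongrightarrow> sqrt 0" by (rule tendsto_real_sqrt)
  then have "b' \<longlonglongrightarrow> 0" by (simp add: tendsto_rabs_zero_iff)
  then have "(\<lambda>M. b' M + A) \<longlonglongrightarrow> 0 + A" by (intro tendsto_add) auto
  moreover have "b' M + A = (1 + 2 * (\<Sum>k=1..M. (-1) ^ k * exp (- pi * (real k)\<^sup>2 / y))) / sqrt y" for M
    by (simp add: b'_def add_divide_distrib sum_divide_distrib sum_distrib_left)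
  ultimately show ?thesis by simp
qed

subsection \<open>Integral power series in the nome\<close>

text \<open>
  The nome is \<open>exp (\<pi> \<i> t)\<close> rather than \<open>exp (2 \<pi> \<i> t)\<close>, which makes all the modular forms below
  forms for subgroups of \<open>\<Gamma>(2)\<close>.
\<close>

definition nome :: "complex \<Rightarrow> complex" where
  "nome t = exp (of_real pi * \<i> * t)"

definition complex_fps :: "int fps \<Rightarrow> complex fps" where
  "complex_fps F = Abs_fps (\<lambda>n. of_int (fps_nth F n))"

lemma fps_nth_complex_fps [simp]: "fps_nth (complex_fps F) n = of_int (fps_nth F n)"
  by (simp add: complex_fps_def)

lemma complex_fps_mult: "complex_fps (F * G) = complex_fps F * complex_fps G"
  by (rule fps_ext) (simp add: fps_mult_nth)

lemma complex_fps_power: "complex_fps (F ^ n) = complex_fps F ^ n"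
proof (induction n)
  case 0
  show ?case by (rule fps_ext) simp
qed (simp add: complex_fps_mult)

lemma norm_nome: "cmod (nome t) = exp (- pi * Im t)"
  by (simp add: nome_def)

lemma norm_nome_less_1: "t \<in> uhp \<Longrightarrow> cmod (nome t) < 1"
  by (simp add: norm_nome uhp_def)

lemma nome_add: "nome (s + t) = nome s * nome t"
  by (simp add: nome_def exp_add distrib_left)

lemma nome_of_nat_mult: "nome (of_nat n * t) = nome t ^ n"
  by (simp add: nome_def mult_ac flip: exp_of_nat_mult)

lemma nome_1: "nome 1 = -1"
  using exp_pi_i by (simp add: nome_def mult.commute)

lemma nome_2: "nome 2 = 1"
  using nome_add[of 1 1] by (simp add: nome_1)

lemma holomorphic_nome [holomorphic_intros]: "f holomorphic_on A \<Longrightarrow> (\<lambda>t. nome (f t)) holomorphic_on A"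
  unfolding nome_def by (intro holomorphic_intros)

lemma bounded_fps_norm_sums:
  assumes "\<And>n. \<bar>fps_nth F n\<bar> \<le> 2" "cmod q < 1"
  shows "summable (\<lambda>n. norm (fps_nth (complex_fps F) n * q ^ n))"
    "norm (\<Sum>n. fps_nth (complex_fps F) n * q ^ n) \<le> 2 / (1 - cmod q)"
proof -
  have g: "(\<lambda>n. 2 * cmod q ^ n) sums (2 * (1 / (1 - cmod q)))"
    using assms(2) by (intro sums_mult geometric_sums) simp
  have le: "norm (fps_nth (complex_fps F) n * q ^ n) \<le> 2 * cmod q ^ n" for n
  proof -
    have "\<bar>real_of_int (fps_nth F n)\<bar> \<le> 2" using assms(1)[of n] by linarith
    then show ?thesis by (simp add: norm_mult norm_power mult_right_mono)
  qed
  show 1: "summable (\<lambda>n. norm (fps_nth (complex_fps F) n * q ^ n))"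
    by (rule summable_comparison_test'[OF sums_summable[OF g], of 0]) (use le in simp)
  have "norm (\<Sum>n. fps_nth (complex_fps F) n * q ^ n) \<le> (\<Sum>n. norm (fps_nth (complex_fps F) n * q ^ n))"
    by (rule summable_norm[OF 1])
  also have "\<dots> \<le> (\<Sum>n. 2 * cmod q ^ n)"
    by (rule suminf_le[OF le 1 sums_summable[OF g]])
  also have "\<dots> = 2 / (1 - cmod q)" using g by (simp add: sums_iff)
  finally show "norm (\<Sum>n. fps_nth (complex_fps F) n * q ^ n) \<le> 2 / (1 - cmod q)" .
qed

lemma bounded_fps_conv_radius:
  assumes "\<And>n. \<bar>fps_nth F n\<bar> \<le> 2"
  shows "fps_conv_radius (complex_fps F) \<ge> 1"
  unfolding fps_conv_radius_def
proof (rule conv_radius_geI_ex)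
  fix r :: real assume r: "0 < r" "ereal r < 1"
  show "\<exists>z. norm z = r \<and> summable (\<lambda>n. fps_nth (complex_fps F) n * z ^ n)"
  proof (intro exI conjI)
    show "summable (\<lambda>n. fps_nth (complex_fps F) n * complex_of_real r ^ n)"
      by (rule summable_norm_cancel, rule bounded_fps_norm_sums[OF assms]) (use r in auto)
  qed (use r in auto)
qed

definition nome_series :: "int fps \<Rightarrow> complex \<Rightarrow> complex" where
  "nome_series F t = eval_fps (complex_fps F) (nome t)"

lemma nome_series_sums:
  assumes "fps_conv_radius (complex_fps F) \<ge> 1" "t \<in> uhp"
  shows "(\<lambda>n. of_int (fps_nth F n) * nome t ^ n) sums nome_series F t"
proof -
  have "ereal (norm (nome t)) < fps_conv_radius (complex_fps F)"
    by (rule less_le_trans[OF _ assms(1)]) (use norm_nome_less_1[OF assms(2)] in simp)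
  from sums_eval_fps[OF this] show ?thesis by (simp add: nome_series_def)
qed

lemma nome_series_mult:
  assumes "fps_conv_radius (complex_fps F) \<ge> 1" "fps_conv_radius (complex_fps G) \<ge> 1" "t \<in> uhp"
  shows "nome_series (F * G) t = nome_series F t * nome_series G t"
  unfolding nome_series_def complex_fps_mult
  by (rule eval_fps_mult; rule less_le_trans[of _ 1]) (use assms norm_nome_less_1[OF assms(3)] in simp_all)

lemma conv_radius_complex_fps_mult:
  assumes "fps_conv_radius (complex_fps F) \<ge> 1" "fps_conv_radius (complex_fps G) \<ge> 1"
  shows "fps_conv_radius (complex_fps (F * G)) \<ge> 1"
  unfolding complex_fps_mult by (rule order_trans[OF _ fps_conv_radius_mult]) (use assms in simp)

lemma conv_radius_complex_fps_power:
  assumes "fps_conv_radius (complex_fps F) \<ge> 1"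
  shows "fps_conv_radius (complex_fps (F ^ n)) \<ge> 1"
  unfolding complex_fps_power by (rule order_trans[OF assms fps_conv_radius_power])

lemma nome_series_power:
  assumes "fps_conv_radius (complex_fps F) \<ge> 1" "t \<in> uhp"
  shows "nome_series (F ^ n) t = nome_series F t ^ n"
proof (induction n)
  case 0
  have "complex_fps 1 = 1" by (rule fps_ext) simp
  then show ?case by (simp add: nome_series_def)
next
  case (Suc n)
  then show ?case
    using nome_series_mult[OF assms(1) conv_radius_complex_fps_power[OF assms(1), of n] assms(2)] by simp
qed

lemma holomorphic_nome_series:
  assumes "fps_conv_radius (complex_fps F) \<ge> 1"
  shows "nome_series F holomorphic_on uhp"
proof -
  have 1: "eval_fps (complex_fps F) holomorphic_on ball 0 1"
  proof (rule holomorphic_on_eval_fps, rule subsetI)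
    fix z :: complex assume "z \<in> ball 0 1"
    then show "z \<in> eball 0 (fps_conv_radius (complex_fps F))"
      by (simp add: less_le_trans[OF _ assms])
  qed
  have "(eval_fps (complex_fps F) \<circ> nome) holomorphic_on uhp"
    by (rule holomorphic_on_compose_gen[OF _ 1])
       (auto intro!: holomorphic_intros norm_nome_less_1)
  then show ?thesis by (simp add: o_def nome_series_def[abs_def])
qed

lemma moderate_nome_series:
  assumes "\<And>n. \<bar>fps_nth F n\<bar> \<le> 2"
  shows "moderate (nome_series F)"
proof (rule moderateI[of _ 4 1])
  fix t assume t: "t \<in> uhp"
  define y where "y = pi * Im t"
  have y: "y > 0" using t by (simp add: y_def uhp_def)
  have q: "cmod (nome t) = exp (- y)" by (simp add: norm_nome y_def)
  have "1 + y \<le> exp y" by (rule exp_ge_add_one_self)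
  then have "exp (- y) \<le> 1 / (1 + y)" using y by (simp add: exp_minus field_simps)
  then have "1 - exp (- y) \<ge> 1 - 1 / (1 + y)" by simp
  also have "1 - 1 / (1 + y) = y / (1 + y)" using y by (simp add: field_simps)
  finally have le: "y / (1 + y) \<le> 1 - exp (- y)" .
  have "cmod (nome_series F t) \<le> 2 / (1 - cmod (nome t))"
    unfolding nome_series_def eval_fps_def by (rule bounded_fps_norm_sums(2)[OF assms norm_nome_less_1[OF t]])
  also have "\<dots> \<le> 2 / (y / (1 + y))"
    unfolding q using y le by (intro divide_left_mono mult_pos_pos) auto
  also have "\<dots> = 2 + 2 * (1 / y)" using y by (simp add: field_simps)
  also have "1 / y \<le> 1 / Im t"
    using t pi_gt3 by (intro divide_left_mono) (auto simp: y_def uhp_def)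
  also have "1 / Im t \<le> mu t" using mu_bounds[OF t] by simp
  also have "2 + 2 * mu t \<le> 4 * mu t ^ 1" using mu_bounds(1)[OF t] by simp
  finally show "cmod (nome_series F t) \<le> 4 * mu t ^ 1" by simp
qed

subsection \<open>Theta functions\<close>

definition theta4 :: "complex \<Rightarrow> complex" where
  "theta4 = nome_series (theta4_fps 1)"

text \<open>The classical theta constant of index 2, the sum of q^((r + 1/2)^2) over all integers r,
  without its factor q^(1/4). The indices r and -r - 1 give the same exponent, hence the coefficient
  2.\<close>

definition theta2_fps :: "int fps" where
  "theta2_fps = Abs_fps (\<lambda>n. if \<exists>k. n = k * (k + 1) then 2 else 0)"

definition theta2 :: "complex \<Rightarrow> complex" where
  "theta2 t = nome (t / 4) * nome_series theta2_fps t"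

lemma abs_theta4_coeff_le: "\<bar>theta4_coeff n\<bar> \<le> 2"
  by (simp add: theta4_coeff_def abs_mult)

lemma theta4_fps_bound: "\<bar>fps_nth (theta4_fps j) n\<bar> \<le> 2"
  using abs_theta4_coeff_le by (simp add: theta4_fps_def)

lemma theta2_fps_bound: "\<bar>fps_nth theta2_fps n\<bar> \<le> 2"
  by (simp add: theta2_fps_def)

lemmas theta_conv_radius = bounded_fps_conv_radius[of "theta4_fps j" for j, OF theta4_fps_bound]
  bounded_fps_conv_radius[of theta2_fps, OF theta2_fps_bound]

lemma theta4_sums:
  assumes "t \<in> uhp"
  shows "(\<lambda>k. (if k = 0 then 1 else 2 * (-1) ^ k) * nome t ^ k\<^sup>2) sums theta4 t"
proof -
  have sm: "strict_mono (\<lambda>k::nat. k\<^sup>2)" by (auto simp: strict_mono_def power_strict_mono)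
  have z: "of_int (fps_nth (theta4_fps 1) n) * nome t ^ n = 0" if "n \<notin> range (\<lambda>k. k\<^sup>2)" for n
  proof -
    have "n \<noteq> 0" "\<not> (\<exists>r. n = r\<^sup>2)" using that by (auto intro: range_eqI[of _ _ 0])
    then show ?thesis by (simp add: theta4_fps_def theta4_coeff_def)
  qed
  have "(\<lambda>k. of_int (fps_nth (theta4_fps 1) (k\<^sup>2)) * nome t ^ k\<^sup>2) sums theta4 t"
    using sums_mono_reindex[OF sm, of "\<lambda>n. of_int (fps_nth (theta4_fps 1) n) * nome t ^ n"] z
      nome_series_sums[OF theta_conv_radius(1) assms] by (simp add: theta4_def)
  moreover have "of_int (fps_nth (theta4_fps 1) (k\<^sup>2)) = (if k = 0 then 1 else 2 * (-1) ^ k :: complex)" for k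
    by (auto simp: theta4_fps_def theta4_coeff_def power2_eq_square power_mult minus_one_power_iff)
  ultimately show ?thesis by simp
qed

lemma theta2_sums:
  assumes "t \<in> uhp"
  shows "(\<lambda>k. 2 * nome ((of_nat k + 1/2)\<^sup>2 * t)) sums theta2 t"
proof -
  have sm: "strict_mono (\<lambda>k::nat. k * (k + 1))"
    unfolding strict_mono_Suc_iff by simp
  have z: "of_int (fps_nth theta2_fps n) * nome t ^ n = 0" if "n \<notin> range (\<lambda>k. k * (k + 1))" for n
    using that by (auto simp: theta2_fps_def)
  have "(\<lambda>k. of_int (fps_nth theta2_fps (k * (k + 1))) * nome t ^ (k * (k + 1))) sums nome_series theta2_fps t"
    using sums_mono_reindex[OF sm, of "\<lambda>n. of_int (fps_nth theta2_fps n) * nome t ^ n"] z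
      nome_series_sums[OF theta_conv_radius(2) assms] by blast
  then have "(\<lambda>k. nome (t / 4) * (of_int (fps_nth theta2_fps (k * (k + 1))) * nome t ^ (k * (k + 1)))) sums theta2 t"
    unfolding theta2_def by (rule sums_mult)
  moreover have "nome (t / 4) * (of_int (fps_nth theta2_fps (k * (k + 1))) * nome t ^ (k * (k + 1))) =
      2 * nome ((of_nat k + 1/2)\<^sup>2 * t)" for k
  proof -
    have "nome ((of_nat k + 1/2)\<^sup>2 * t) = nome (t / 4 + of_nat (k * (k + 1)) * t)"
      by (rule arg_cong[of _ _ nome]) (simp add: power2_eq_square field_simps)
    then have "nome ((of_nat k + 1/2)\<^sup>2 * t) = nome (t / 4) * nome t ^ (k * (k + 1))"
      by (simp only: nome_add nome_of_nat_mult)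
    moreover have "fps_nth theta2_fps (k * (k + 1)) = 2" by (auto simp: theta2_fps_def)
    ultimately show ?thesis by (simp only: of_int_numeral mult_ac)
  qed
  ultimately show ?thesis by simp
qed

text \<open>(k + 1/2)^2 = k(k + 1) + 1/4 with k(k + 1) even, so all terms pick up the same eighth
  root of unity.\<close>

lemma theta2_shift:
  assumes "t \<in> uhp"
  shows "theta2 (t + 1) = cis (pi / 4) * theta2 t"
proof -
  have t1: "t + 1 \<in> uhp" using assms by (simp add: uhp_def)
  have "(\<lambda>k. cis (pi / 4) * (2 * nome ((of_nat k + 1/2)\<^sup>2 * t))) sums (cis (pi / 4) * theta2 t)"
    by (intro sums_mult theta2_sums assms)
  moreover have "cis (pi / 4) * (2 * nome ((of_nat k + 1/2)\<^sup>2 * t)) = 2 * nome ((of_nat k + 1/2)\<^sup>2 * (t + 1))" for k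
  proof -
    obtain j where j: "k * (k + 1) = 2 * j" by (rule evenE[of "k * (k + 1)"]) auto
    have "(of_nat k + 1/2)\<^sup>2 * (t + 1) = (of_nat k + 1/2)\<^sup>2 * t + (of_nat (k * (k + 1)) + 1/4 :: complex)"
      by (simp add: power2_eq_square field_simps)
    then have "nome ((of_nat k + 1/2)\<^sup>2 * (t + 1)) = nome ((of_nat k + 1/2)\<^sup>2 * t) * (nome (of_nat j * 2) * nome (1/4))"
      unfolding j by (simp add: nome_add mult.commute)
    also have "nome (of_nat j * 2) = 1" by (simp add: nome_of_nat_mult nome_2)
    also have "nome (1/4) = cis (pi / 4)" by (simp add: nome_def cis_conv_exp mult.commute)
    finally show ?thesis by simp
  qed
  ultimately have "(\<lambda>k. 2 * nome ((of_nat k + 1/2)\<^sup>2 * (t + 1))) sums (cis (pi / 4) * theta2 t)" by simp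
  then show ?thesis using theta2_sums[OF t1] by (rule sums_unique2[symmetric])
qed

lemma nome_imaginary: "nome (of_real x * (\<i> * of_real y)) = of_real (exp (- pi * x * y))"
proof -
  have "complex_of_real pi * \<i> * (of_real x * (\<i> * of_real y)) = of_real (- pi * x * y)"
    by (simp add: complex_eq_iff)
  then show ?thesis by (simp only: nome_def exp_of_real)
qed

text \<open>Poisson summation at t = \<i> y. The value of \<open>theta2\<close> there is real, so
  the real limit A in \<open>poisson_half\<close> determines it.\<close>

lemma theta4_imaginary:
  assumes y: "y > 0"
  shows "theta4 (- 1 / (\<i> * of_real y)) = of_real (sqrt y) * theta2 (\<i> * of_real y)"
proof -
  have iy: "\<i> * of_real y \<in> uhp" "\<i> * of_real (1 / y) \<in> uhp" using y by (simp_all add: uhp_def)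
  have e: "- 1 / (\<i> * of_real y) = \<i> * of_real (1 / y)"
    using y by (simp add: field_simps)
  have n2: "2 * nome ((of_nat k + 1/2)\<^sup>2 * (\<i> * of_real y)) = of_real (2 * exp (- pi * y * (real k + 1/2)\<^sup>2))" for k
    using nome_imaginary[of "(real k + 1/2)\<^sup>2" y] by (simp add: mult_ac)
  define A where "A = Re (theta2 (\<i> * of_real y))"
  have s2: "(\<lambda>k. of_real (2 * exp (- pi * y * (real k + 1/2)\<^sup>2))) sums theta2 (\<i> * of_real y)"
    using theta2_sums[OF iy(1)] unfolding n2 .
  have sA: "(\<lambda>k. 2 * exp (- pi * y * (real k + 1/2)\<^sup>2)) sums A"
    using sums_Re[OF s2] by (simp only: A_def Re_complex_of_real)
  then have "(\<lambda>k. complex_of_real (2 * exp (- pi * y * (real k + 1/2)\<^sup>2))) sums of_real A" by (rule sums_of_real)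
  then have A: "theta2 (\<i> * of_real y) = of_real A" using s2 sums_unique2 by blast
  have n4: "(if k = 0 then 1 else 2 * (-1) ^ k) * nome (\<i> * of_real (1 / y)) ^ k\<^sup>2 =
      of_real (if k = 0 then 1 else 2 * ((-1) ^ k * exp (- pi * (real k)\<^sup>2 / y)))" for k
    using nome_imaginary[of "(real k)\<^sup>2" "1 / y"] by (simp flip: nome_of_nat_mult)
  have "(\<lambda>k. of_real (if k = 0 then 1 else 2 * ((-1) ^ k * exp (- pi * (real k)\<^sup>2 / y)))) sums theta4 (- 1 / (\<i> * of_real y))"
    unfolding e using theta4_sums[OF iy(2)] unfolding n4 .
  then have "(\<lambda>M. \<Sum>k\<le>M. complex_of_real (if k = 0 then 1 else 2 * ((-1) ^ k * exp (- pi * (real k)\<^sup>2 / y)))) \<longlonglongrightarrow> theta4 (- 1 / (\<i> * of_real y))"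
    by (simp only: sums_def_le)
  moreover have "(\<Sum>k\<le>M. complex_of_real (if k = 0 then 1 else 2 * ((-1) ^ k * exp (- pi * (real k)\<^sup>2 / y)))) =
      of_real (sqrt y) * of_real ((1 + 2 * (\<Sum>k=1..M. (-1) ^ k * exp (- pi * (real k)\<^sup>2 / y))) / sqrt y)" for M
  proof -
    have "{..M} = insert 0 {1..M}" by auto
    then have "(\<Sum>k\<le>M. if k = 0 then 1 else 2 * ((-1) ^ k * exp (- pi * (real k)\<^sup>2 / y))) =
       1 + (\<Sum>k=1..M. if k = 0 then 1 else 2 * ((-1) ^ k * exp (- pi * (real k)\<^sup>2 / y)))" by simp
    also have "(\<Sum>k=1..M. if k = 0 then 1 else 2 * ((-1) ^ k * exp (- pi * (real k)\<^sup>2 / y))) =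
       2 * (\<Sum>k=1..M. (-1) ^ k * exp (- pi * (real k)\<^sup>2 / y))"
      unfolding sum_distrib_left by (rule sum.cong) auto
    finally have "(\<Sum>k\<le>M. if k = 0 then 1 else 2 * ((-1) ^ k * exp (- pi * (real k)\<^sup>2 / y))) =
       sqrt y * ((1 + 2 * (\<Sum>k=1..M. (-1) ^ k * exp (- pi * (real k)\<^sup>2 / y))) / sqrt y)"
      using y by simp
    from arg_cong[OF this, of complex_of_real] show ?thesis unfolding of_real_sum of_real_mult .
  qed
  moreover have "(\<lambda>M. of_real (sqrt y) * complex_of_real ((1 + 2 * (\<Sum>k=1..M. (-1) ^ k * exp (- pi * (real k)\<^sup>2 / y))) / sqrt y)) \<longlonglongrightarrow>
      of_real (sqrt y) * of_real A"
    by (intro tendsto_mult tendsto_const tendsto_of_real poisson_half[OF y sA])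
  ultimately show ?thesis unfolding A using LIMSEQ_unique by fastforce
qed

lemma neg_inverse_uhp: "t \<in> uhp \<Longrightarrow> - 1 / t \<in> uhp"
  using mob_in_uhp[of t "(0, -1, 1, 0)"] by simp

lemma uhp_nonzero: "t \<in> uhp \<Longrightarrow> t \<noteq> 0"
  by (auto simp: uhp_def)

lemma uhp_rotate: "t \<in> uhp \<Longrightarrow> Re (- \<i> * t) > 0"
  by (simp add: uhp_def)

text \<open>Both sides are holomorphic on the upper half plane and agree on the imaginary axis,
  where - \<i> t is positive and the root is the real one.\<close>

lemma theta4_transform:
  assumes t: "t \<in> uhp"
  shows "theta4 (- 1 / t) = csqrt (- \<i> * t) * theta2 t"
proof -
  define F where "F t = theta4 (- 1 / t) - csqrt (- \<i> * t) * theta2 t" for t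
  have t4: "theta4 holomorphic_on uhp" unfolding theta4_def by (rule holomorphic_nome_series[OF theta_conv_radius(1)])
  have "(theta4 \<circ> (\<lambda>t. - 1 / t)) holomorphic_on uhp"
    by (rule holomorphic_on_compose_gen[OF _ t4]) (auto intro!: holomorphic_intros dest: uhp_nonzero neg_inverse_uhp)
  moreover have "nome_series theta2_fps holomorphic_on uhp" by (rule holomorphic_nome_series[OF theta_conv_radius(2)])
  moreover have "- \<i> * t \<notin> \<real>\<^sub>\<le>\<^sub>0" if "t \<in> uhp" for t
    using uhp_rotate[OF that] by (auto simp: complex_nonpos_Reals_iff)
  ultimately have hol: "F holomorphic_on uhp"
    unfolding F_def theta2_def o_def by (intro holomorphic_intros) auto
  have ii: "\<i> islimpt {t \<in> uhp. Re t = 0}"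
    unfolding islimpt_approachable
  proof (intro allI impI)
    fix e :: real assume e: "e > 0"
    have "\<i> * of_real (1 + e / 2) \<in> {t \<in> uhp. Re t = 0}" using e by (simp add: uhp_def)
    moreover have "\<i> * of_real (1 + e / 2) \<noteq> \<i>" using e by (simp add: complex_eq_iff)
    moreover have "dist (\<i> * of_real (1 + e / 2)) \<i> < e"
    proof -
      have "\<i> * of_real (1 + e / 2) - \<i> = \<i> * of_real (e / 2)" by (simp add: algebra_simps)
      then show ?thesis unfolding dist_norm by (simp only: norm_mult) (use e in simp)
    qed
    ultimately show "\<exists>x'\<in>{t \<in> uhp. Re t = 0}. x' \<noteq> \<i> \<and> dist x' \<i> < e" by blast
  qed
  have "F t = 0"
  proof (rule analytic_continuation[OF hol open_uhp convex_connected[OF convex_uhp] _ _ ii _ t])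
    show "{t \<in> uhp. Re t = 0} \<subseteq> uhp" by auto
    show "\<i> \<in> uhp" by (simp add: uhp_def)
    fix z assume z: "z \<in> {t \<in> uhp. Re t = 0}"
    define y where "y = Im z"
    have y: "y > 0" and zy: "z = \<i> * of_real y" using z by (auto simp: y_def uhp_def complex_eq_iff)
    have "- \<i> * z = of_real y" by (simp add: zy)
    then have "csqrt (- \<i> * z) = of_real (sqrt y)" using y by (simp add: csqrt_of_real_nonneg)
    then show "F z = 0" using theta4_imaginary[OF y] by (simp add: F_def zy)
  qed
  then show ?thesis by (simp add: F_def)
qed

subsection \<open>The weight one form\<close>

definition psi :: "complex \<Rightarrow> complex" where
  "psi = nome_series psi_fps"

lemma uhp_scale: "t \<in> uhp \<Longrightarrow> r > 0 \<Longrightarrow> of_real r * t \<in> uhp"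
  by (simp add: uhp_def)

lemma theta4_double:
  assumes t: "t \<in> uhp"
  shows "nome_series (theta4_fps 2) t = theta4 (2 * t)"
proof -
  have t2: "2 * t \<in> uhp" using uhp_scale[OF t, of 2] by simp
  have sm: "strict_mono (\<lambda>k::nat. 2 * k)" by (auto simp: strict_mono_def)
  have z: "of_int (fps_nth (theta4_fps 2) n) * nome t ^ n = 0" if "n \<notin> range (\<lambda>k. 2 * k)" for n
    using that by (auto simp: theta4_fps_def)
  have "(\<lambda>k. of_int (fps_nth (theta4_fps 2) (2 * k)) * nome t ^ (2 * k)) sums nome_series (theta4_fps 2) t"
    using sums_mono_reindex[OF sm, of "\<lambda>n. of_int (fps_nth (theta4_fps 2) n) * nome t ^ n"] z
      nome_series_sums[OF theta_conv_radius(1) t] by blast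
  moreover have "of_int (fps_nth (theta4_fps 2) (2 * k)) * nome t ^ (2 * k) = of_int (fps_nth (theta4_fps 1) k) * nome (2 * t) ^ k" for k
    using nome_of_nat_mult[of 2 t] by (simp add: theta4_fps_def power_mult)
  ultimately have "(\<lambda>k. of_int (fps_nth (theta4_fps 1) k) * nome (2 * t) ^ k) sums nome_series (theta4_fps 2) t" by simp
  then show ?thesis
    using nome_series_sums[OF theta_conv_radius(1) t2, of 1] unfolding theta4_def by (rule sums_unique2)
qed

lemma psi_conv_radius: "fps_conv_radius (complex_fps psi_fps) \<ge> 1"
  unfolding psi_fps_def by (intro conv_radius_complex_fps_mult theta_conv_radius)

lemma psi_eq: "t \<in> uhp \<Longrightarrow> psi t = theta4 t * theta4 (2 * t)"
  unfolding psi_def psi_fps_def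
  by (subst nome_series_mult) (auto intro: theta_conv_radius simp: theta4_double theta4_def)

lemma holomorphic_psi: "psi holomorphic_on uhp"
  unfolding psi_def by (rule holomorphic_nome_series[OF psi_conv_radius])

lemma moderate_cong: "(\<And>t. t \<in> uhp \<Longrightarrow> f t = g t) \<Longrightarrow> moderate f = moderate g"
  by (simp add: moderate_def)

lemma moderate_psi: "moderate psi"
proof -
  have "moderate (\<lambda>t. nome_series (theta4_fps 1) t * nome_series (theta4_fps 2) t)"
    by (intro moderate_mult moderate_nome_series theta4_fps_bound)
  moreover have "psi t = nome_series (theta4_fps 1) t * nome_series (theta4_fps 2) t" if "t \<in> uhp" for t
    unfolding psi_def psi_fps_def by (intro nome_series_mult theta_conv_radius that)
  ultimately show ?thesis using moderate_cong[of psi] by simp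
qed

lemma psi_shift: "psi (t + 2) = psi t"
  by (simp add: psi_def nome_series_def nome_add nome_2)

lemma csqrt_mult_half:
  assumes "Re z > 0"
  shows "csqrt z * csqrt (z / 2) = z / of_real (sqrt 2)"
proof -
  have "csqrt (of_real (1 / 2) * z) = csqrt (of_real (1 / 2)) * csqrt z"
    by (rule csqrt_mult) (use Arg_bounded[of z] in \<open>simp only: Arg_of_real\<close>, simp)
  moreover have "csqrt (of_real (1 / 2)) = of_real (1 / sqrt 2)"
    by (subst csqrt_of_real_nonneg) (simp_all add: real_sqrt_divide)
  ultimately have "csqrt (z / 2) = of_real (1 / sqrt 2) * csqrt z" by simp
  then have "csqrt z * csqrt (z / 2) = of_real (1 / sqrt 2) * (csqrt z)\<^sup>2" by (simp add: power2_eq_square)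
  then show ?thesis by simp
qed

lemma psi_neg_inverse:
  assumes s: "s \<in> uhp"
  shows "psi (- 1 / s) = - \<i> * s / of_real (sqrt 2) * (theta2 s * theta2 (s / 2))"
proof -
  have s2: "s / 2 \<in> uhp" using uhp_scale[OF s, of "1/2"] by simp
  have "2 * (- 1 / s) = - 1 / (s / 2)" by simp
  then have "psi (- 1 / s) = csqrt (- \<i> * s) * theta2 s * (csqrt (- \<i> * (s / 2)) * theta2 (s / 2))"
    unfolding psi_eq[OF neg_inverse_uhp[OF s]] theta4_transform[OF s] by (simp only: theta4_transform[OF s2])
  also have "\<dots> = csqrt (- \<i> * s) * csqrt (- \<i> * s / 2) * (theta2 s * theta2 (s / 2))" by simp
  also have "csqrt (- \<i> * s) * csqrt (- \<i> * s / 2) = - \<i> * s / of_real (sqrt 2)"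
    by (rule csqrt_mult_half[OF uhp_rotate[OF s]])
  finally show ?thesis .
qed

text \<open>In the coordinate s = -1/t the map is s -> s + 2. There \<psi> becomes a product of
  \<open>theta2\<close> at s and at s/2; the first factor contributes two eighth roots of unity, the
  second one.\<close>

lemma psi_transform_lower:
  assumes t: "t \<in> uhp"
  shows "psi (mob (1, 0, -2, 1) t) = cis (3 * pi / 4) * jfac (1, 0, -2, 1) t * psi t"
proof -
  define s where "s = - 1 / t"
  have s: "s \<in> uhp" unfolding s_def by (rule neg_inverse_uhp[OF t])
  have s1: "s + 1 \<in> uhp" "s + 2 \<in> uhp" "s / 2 \<in> uhp" using s by (simp_all add: uhp_def)
  have t0: "t \<noteq> 0" by (rule uhp_nonzero[OF t])
  have ts: "t = - 1 / s" using t0 by (simp add: s_def)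
  have j: "1 - 2 * t \<noteq> 0" using jfac_nonzero[OF t, of "(1, 0, -2, 1)"] by simp
  have m: "mob (1, 0, -2, 1) t = - 1 / (s + 2)"
  proof -
    have "s + 2 = - (1 - 2 * t) / t" using t0 by (simp add: s_def field_simps)
    then show ?thesis by (simp only:) (use t0 j in \<open>simp add: field_simps\<close>)
  qed
  have "theta2 (s + 2) = cis (pi / 4) * (cis (pi / 4) * theta2 s)"
    using theta2_shift[OF s1(1)] theta2_shift[OF s] by (simp add: add.assoc)
  moreover have "theta2 ((s + 2) / 2) = cis (pi / 4) * theta2 (s / 2)"
    using theta2_shift[OF s1(3)] by (simp add: add_divide_distrib)
  ultimately have "psi (mob (1, 0, -2, 1) t) = - \<i> * (s + 2) / of_real (sqrt 2) *
     (cis (pi / 4) * cis (pi / 4) * cis (pi / 4)) * (theta2 s * theta2 (s / 2))"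
    unfolding m psi_neg_inverse[OF s1(2)] by (simp add: mult_ac)
  also have "cis (pi / 4) * cis (pi / 4) * cis (pi / 4) = cis (3 * pi / 4)"
    by (simp only: cis_mult) (rule arg_cong[of _ _ cis], simp)
  also have "- \<i> * (s + 2) = (1 - 2 * t) * (- \<i> * s)" using t0 by (simp add: s_def field_simps)
  also have "(1 - 2 * t) * (- \<i> * s) / of_real (sqrt 2) * cis (3 * pi / 4) * (theta2 s * theta2 (s / 2)) =
     cis (3 * pi / 4) * (1 - 2 * t) * (- \<i> * s / of_real (sqrt 2) * (theta2 s * theta2 (s / 2)))" by simp
  also have "- \<i> * s / of_real (sqrt 2) * (theta2 s * theta2 (s / 2)) = psi t"
    using psi_neg_inverse[OF s] by (simp only: ts)
  finally show ?thesis by simp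
qed

subsection \<open>The multiplier system\<close>

text \<open>
  \<open>chi8\<close> is the Kronecker symbol of discriminant \<open>-8\<close>. The second factor of \<open>omega\<close> is a 16th root of unity
  that disappears when 16 divides \<open>c\<close>.
\<close>

definition chi8 :: "int \<Rightarrow> int" where
  "chi8 d = (if d mod 8 = 1 \<or> d mod 8 = 3 then 1 else if odd d then -1 else 0)"

fun omega :: "mat2 \<Rightarrow> complex" where
  "omega (a, b, c, d) = of_int (chi8 d) * cis (- (3 * pi * of_int (c * d) / 8))"

lemma chi8_neg: "odd d \<Longrightarrow> chi8 (- d) = - chi8 d"
proof -
  assume "odd d"
  then have "d mod 8 = 1 \<or> d mod 8 = 3 \<or> d mod 8 = 5 \<or> d mod 8 = 7" by presburger
  then show ?thesis
  proof (elim disjE)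
    assume "d mod 8 = 1" then have "(- d) mod 8 = 7" by presburger
    then show ?thesis using \<open>d mod 8 = 1\<close> \<open>odd d\<close> by (simp add: chi8_def)
  next
    assume "d mod 8 = 3" then have "(- d) mod 8 = 5" by presburger
    then show ?thesis using \<open>d mod 8 = 3\<close> \<open>odd d\<close> by (simp add: chi8_def)
  next
    assume "d mod 8 = 5" then have "(- d) mod 8 = 3" by presburger
    then show ?thesis using \<open>d mod 8 = 5\<close> \<open>odd d\<close> by (simp add: chi8_def)
  next
    assume "d mod 8 = 7" then have "(- d) mod 8 = 1" by presburger
    then show ?thesis using \<open>d mod 8 = 7\<close> \<open>odd d\<close> by (simp add: chi8_def)
  qed
qed

lemma chi8_cong: "d mod 8 = e mod 8 \<Longrightarrow> chi8 d = chi8 e"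
proof -
  assume *: "d mod 8 = e mod 8"
  then have "odd d = odd e" by presburger
  then show ?thesis using * by (simp add: chi8_def)
qed

lemma chi8_add_4:
  assumes "odd d"
  shows "chi8 (d + 4 * x) = (if even x then chi8 d else - chi8 d)"
proof (cases "even x")
  case True
  then have "(d + 4 * x) mod 8 = d mod 8" by presburger
  then have "chi8 (d + 4 * x) = chi8 d" by (rule chi8_cong)
  then show ?thesis using True by simp
next
  case False
  then have "(d + 4 * x) mod 8 = (d + 4) mod 8" by presburger
  then have "chi8 (d + 4 * x) = chi8 (d + 4)" by (rule chi8_cong)
  moreover have "d mod 8 = 1 \<or> d mod 8 = 3 \<or> d mod 8 = 5 \<or> d mod 8 = 7" using assms by presburger
  then have "chi8 (d + 4) = - chi8 d"
  proof (elim disjE)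
    assume "d mod 8 = 1" moreover from this have "(d + 4) mod 8 = 5" by presburger
    ultimately show ?thesis using assms by (simp add: chi8_def)
  next
    assume "d mod 8 = 3" moreover from this have "(d + 4) mod 8 = 7" by presburger
    ultimately show ?thesis using assms by (simp add: chi8_def)
  next
    assume "d mod 8 = 5" moreover from this have "(d + 4) mod 8 = 1" by presburger
    ultimately show ?thesis using assms by (simp add: chi8_def)
  next
    assume "d mod 8 = 7" moreover from this have "(d + 4) mod 8 = 3" by presburger
    ultimately show ?thesis using assms by (simp add: chi8_def)
  qed
  ultimately show ?thesis using False by simp
qed

lemma cis_3_pi_8_cong:
  assumes "[m = n] (mod 16)"
  shows "cis (- (3 * pi * of_int m / 8)) = cis (- (3 * pi * of_int n / 8))"
proof -
  obtain k where k: "n = m + 16 * k" using assms by (auto simp: cong_iff_lin)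
  have "- (3 * pi * of_int n / 8) = - (3 * pi * of_int m / 8) + 2 * pi * of_int (- 3 * k)"
    by (simp add: k field_simps)
  then have "cis (- (3 * pi * of_int n / 8)) = cis (- (3 * pi * of_int m / 8)) * cis (2 * pi * of_int (- 3 * k))"
    by (simp only: cis_mult)
  also have "cis (2 * pi * of_int (- 3 * k)) = 1" by (rule cis_multiple_2pi) auto
  finally show ?thesis by simp
qed

text \<open>With b = 2b', the product c d grows by 2e + 8b' modulo 16. The part 8b' gives the sign
  (-1)^b', which cancels against the change of \<open>chi8\<close> from d to d + 4eb'.\<close>

lemma omega_lower_mult:
  assumes M: "M \<in> Delta2 1" and e: "e = 1 \<or> e = -1"
  shows "omega (mmul (1, 0, 2 * e, 1) M) = cis (- (3 * pi * of_int e / 4)) * omega M"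
proof -
  obtain a b c d where Mf: "M = (a, b, c, d)" by (cases M)
  have par: "odd a" "even b" "even c" "odd d" and det: "a * d - b * c = 1"
    using M by (auto simp: Mf Delta2_def)
  obtain b' where b: "b = 2 * b'" using par by (elim evenE)
  obtain c' where c: "c = 2 * c'" using par by (elim evenE)
  obtain a' where a: "a = 2 * a' + 1" using par by (elim oddE)
  have "(2 * e * a + c) * (2 * e * b + d) = 4 * (e * e) * a * b + 2 * e * (a * d - b * c) + 4 * e * b * c + c * d"
    by (simp add: algebra_simps)
  also have "\<dots> = c * d + 2 * e + 8 * b' + 16 * (a' * b' + e * b' * c')"
    unfolding det using e by (auto simp: a b c algebra_simps)
  finally have "[(2 * e * a + c) * (2 * e * b + d) = c * d + 2 * e + 8 * b'] (mod 16)"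
    by (simp add: cong_iff_dvd_diff)
  from cis_3_pi_8_cong[OF this]
  have "cis (- (3 * pi * of_int ((2 * e * a + c) * (2 * e * b + d)) / 8)) =
      cis (- (3 * pi * of_int (c * d) / 8) + (- (3 * pi * of_int e / 4)) + - (3 * pi * of_int b'))"
    by (simp only:) (rule arg_cong[of _ _ cis], simp add: field_simps)
  also have "\<dots> = cis (- (3 * pi * of_int (c * d) / 8)) * cis (- (3 * pi * of_int e / 4)) * cis (- (3 * pi * of_int b'))"
    by (simp only: cis_mult)
  also have "cis (- (3 * pi * of_int b')) = (if even b' then 1 else -1)"
  proof -
    have "cis (- (3 * pi * of_int b')) = cis (of_int (- 3 * b') * pi)" by (rule arg_cong[of _ _ cis]) simp
    also have "\<dots> = (if even b' then 1 else -1)"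
      by (simp only: complex_eq_iff cis.sel sin_npi_int mult.commute[of _ pi] cos_npi_int) auto
    finally show ?thesis .
  qed
  finally have 1: "cis (- (3 * pi * of_int ((2 * e * a + c) * (2 * e * b + d)) / 8)) =
    cis (- (3 * pi * of_int (c * d) / 8)) * cis (- (3 * pi * of_int e / 4)) * (if even b' then 1 else -1)" .
  have "2 * e * b + d = d + 4 * (e * b')" by (simp add: b)
  moreover have "even (e * b') = even b'" using e by auto
  ultimately have 2: "chi8 (2 * e * b + d) = (if even b' then chi8 d else - chi8 d)"
    by (simp only: chi8_add_4[OF par(4)])
  have "omega (mmul (1, 0, 2 * e, 1) M) = of_int (chi8 (2 * e * b + d)) * cis (- (3 * pi * of_int ((2 * e * a + c) * (2 * e * b + d)) / 8))"
    by (simp only: Mf mmul.simps omega.simps mult_1 mult_zero_left add_0)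
  also have "\<dots> = cis (- (3 * pi * of_int e / 4)) * (of_int (chi8 d) * cis (- (3 * pi * of_int (c * d) / 8)))"
    unfolding 1 2 by simp
  finally show ?thesis by (simp only: Mf omega.simps)
qed

lemma omega_upper_mult: "omega (mmul (1, x, 0, 1) M) = omega M"
  by (cases M) simp

lemma omega_neg_mult:
  assumes "M \<in> Delta2 1"
  shows "omega (mmul (-1, 0, 0, -1) M) = - omega M"
  using assms by (cases M) (simp add: Delta2_def chi8_neg)

lemma mob_mmul_Delta2:
  assumes "M \<in> Delta2 1" "N \<in> Delta2 1" "t \<in> uhp"
  shows "mob (mmul M N) t = mob M (mob N t)" "jfac (mmul M N) t = jfac M (mob N t) * jfac N t" "mob N t \<in> uhp"
  using assms by (auto simp: Delta2_def intro!: mob_mmul jfac_mmul mob_in_uhp)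

text \<open>By induction over the generators it suffices that \<open>omega\<close> changes under
  left multiplication by each generator, or its inverse, in the way that \<psi> does.\<close>

lemma psi_transform:
  assumes "M \<in> Delta2 1"
  shows "\<forall>t\<in>uhp. psi (mob M t) = omega M * jfac M t * psi t"
  using assms
proof (induction rule: Gamma2_induct)
  case one
  show ?case by (simp add: chi8_def)
next
  have U: "(1, 0, -2, 1) \<in> Delta2 1" "(1, 0, 2, 1) \<in> Delta2 1" "(1, 2, 0, 1) \<in> Delta2 1" "(1, -2, 0, 1) \<in> Delta2 1" "(-1, 0, 0, -1) \<in> Delta2 1"
    by (simp_all add: Delta2_def)
  have step: "\<forall>t\<in>uhp. psi (mob (mmul G M) t) = omega (mmul G M) * jfac (mmul G M) t * psi t"
    if M: "M \<in> Delta2 1" "\<forall>t\<in>uhp. psi (mob M t) = omega M * jfac M t * psi t"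
      and G: "G \<in> Delta2 1" "\<And>t. t \<in> uhp \<Longrightarrow> psi (mob G t) = c * jfac G t * psi t"
      and om: "omega (mmul G M) = c * omega M" for G M c
  proof
    fix t assume t: "t \<in> uhp"
    note mm = mob_mmul_Delta2[OF G(1) M(1) t]
    show "psi (mob (mmul G M) t) = omega (mmul G M) * jfac (mmul G M) t * psi t"
      unfolding mm(1,2) om G(2)[OF mm(3)] using M(2) t by simp
  qed
  \<comment> \<open>The law for the inverse generator follows from the law for the generator, taken
    at the image point.\<close>
  have low_pos: "psi (mob (1, 0, 2, 1) t) = cis (- (3 * pi / 4)) * jfac (1, 0, 2, 1) t * psi t" if t: "t \<in> uhp" for t
  proof -
    note mm = mob_mmul_Delta2[OF U(1) U(2) t]
    have one: "mmul (1, 0, -2, 1) (1, 0, 2, 1) = (1, 0, 0, 1)" by simp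
    have j: "1 = jfac (1, 0, -2, 1) (mob (1, 0, 2, 1) t) * jfac (1, 0, 2, 1) t"
      using mm(2) unfolding one by simp
    have "psi t = cis (3 * pi / 4) * jfac (1, 0, -2, 1) (mob (1, 0, 2, 1) t) * psi (mob (1, 0, 2, 1) t)"
      using psi_transform_lower[OF mm(3)] mm(1) unfolding one by simp
    then have "cis (- (3 * pi / 4)) * jfac (1, 0, 2, 1) t * psi t =
      (cis (- (3 * pi / 4)) * cis (3 * pi / 4)) * (jfac (1, 0, -2, 1) (mob (1, 0, 2, 1) t) * jfac (1, 0, 2, 1) t) * psi (mob (1, 0, 2, 1) t)"
      by (simp only: mult_ac)
    then show ?thesis unfolding j[symmetric] cis_mult by simp
  qed
  have up: "psi (mob (1, 2, 0, 1) t) = 1 * jfac (1, 2, 0, 1) t * psi t"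
    "psi (mob (1, -2, 0, 1) t) = 1 * jfac (1, -2, 0, 1) t * psi t" for t
    using psi_shift[of t] psi_shift[of "t - 2"] by simp_all
  have neg: "psi (mob (-1, 0, 0, -1) t) = -1 * jfac (-1, 0, 0, -1) t * psi t" for t by simp
  note omega_low = omega_lower_mult[of _ "-1"] omega_lower_mult[of _ 1]
  case (gen G M)
  then consider "G = (1, 2, 0, 1)" | "G = (1, 0, -2, 1)" | "G = (-1, 0, 0, -1)" by (auto simp: Gamma2_gens_def)
  then show ?case
  proof cases
    case 1
    show ?thesis unfolding 1 by (rule step[OF gen(2,3) U(3) up(1)]) (simp only: omega_upper_mult mult_1)
  next
    case 2
    show ?thesis unfolding 2
      by (rule step[OF gen(2,3) U(1) psi_transform_lower]) (use omega_low(1)[OF gen(2)] in simp_all)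
  next
    case 3
    show ?thesis unfolding 3 by (rule step[OF gen(2,3) U(5) neg]) (simp only: omega_neg_mult[OF gen(2)], simp)
  qed
  case (inv G M)
  then consider "G = (1, 2, 0, 1)" | "G = (1, 0, -2, 1)" | "G = (-1, 0, 0, -1)" by (auto simp: Gamma2_gens_def)
  then show ?case
  proof cases
    case 1
    have "madj G = (1, -2, 0, 1)" by (simp add: 1)
    then show ?thesis by (simp only:) (rule step[OF inv(2,3) U(4) up(2)], simp only: omega_upper_mult mult_1)
  next
    case 2
    have "madj G = (1, 0, 2, 1)" by (simp add: 2)
    then show ?thesis
      by (simp only:) (rule step[OF inv(2,3) U(2) low_pos], use omega_low(2)[OF inv(2)] in simp_all)
  next
    case 3
    have "madj G = (-1, 0, 0, -1)" by (simp add: 3)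
    then show ?thesis by (simp only:) (rule step[OF inv(2,3) U(5) neg], simp only: omega_neg_mult[OF inv(2)], simp)
  qed
qed

lemma psi_power_transform:
  assumes "(a, b, c, d) \<in> Delta2 1" "16 dvd c" "t \<in> uhp"
  shows "psi (mob (a, b, c, d) t) ^ w = of_int (chi8 d) ^ w * jfac (a, b, c, d) t ^ w * psi t ^ w"
proof -
  have "[c * d = 0] (mod 16)" using assms(2) by (simp add: cong_0_iff)
  from cis_3_pi_8_cong[OF this] have "omega (a, b, c, d) = of_int (chi8 d)" by simp
  then show ?thesis using psi_transform[OF assms(1)] assms(3) by (simp only: power_mult_distrib)
qed

text \<open>Component v is the translate of \<psi>^w by a matrix of \<Gamma>(2) with bottom row v
  modulo 16. Two such matrices differ on the left by one with bottom row (0, 1) modulo 16, which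
  fixes \<psi>^w, so the choice does not matter (\<open>psi_slash_cong\<close>). Rows reached by no
  matrix of \<Gamma>(2) get 0.\<close>

definition psi_family :: "nat \<Rightarrow> int \<times> int \<Rightarrow> complex \<Rightarrow> complex" where
  "psi_family w v t =
     (if \<exists>M\<in>Delta2 1. vmod 4 (vact (0, 1) M) = vmod 4 v
      then let M = SOME M. M \<in> Delta2 1 \<and> vmod 4 (vact (0, 1) M) = vmod 4 v
           in psi (mob M t) ^ w / jfac M t ^ w
      else 0)"

lemma jfac_Delta2_nonzero: "M \<in> Delta2 1 \<Longrightarrow> t \<in> uhp \<Longrightarrow> jfac M t \<noteq> 0"
  by (rule jfac_nonzero) (auto simp: Delta2_def)

lemma Delta2_1_mmul: "M \<in> Delta2 1 \<Longrightarrow> N \<in> Delta2 1 \<Longrightarrow> mmul M N \<in> Delta2 1"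
  using Delta2_mmul[of M 1 N 1] by simp

lemma psi_slash_mmul:
  assumes N: "(a, b, c, d) \<in> Delta2 1" "16 dvd c" and M: "M \<in> Delta2 1" and t: "t \<in> uhp"
  shows "psi (mob (mmul (a, b, c, d) M) t) ^ w / jfac (mmul (a, b, c, d) M) t ^ w =
    of_int (chi8 d) ^ w * (psi (mob M t) ^ w / jfac M t ^ w)"
proof -
  note mm = mob_mmul_Delta2[OF N(1) M t]
  have "jfac (a, b, c, d) (mob M t) \<noteq> 0" by (rule jfac_Delta2_nonzero[OF N(1) mm(3)])
  then show ?thesis
    unfolding mm(1,2) psi_power_transform[OF N mm(3)] power_mult_distrib by simp
qed

lemma psi_slash_cong:
  assumes M: "M \<in> Delta2 1" "M' \<in> Delta2 1" "vmod 4 (vact (0, 1) M) = vmod 4 (vact (0, 1) M')" and t: "t \<in> uhp"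
  shows "psi (mob M t) ^ w / jfac M t ^ w = psi (mob M' t) ^ w / jfac M' t ^ w"
proof -
  define N where "N = mmul M' (madj M)"
  have N: "N \<in> Delta2 1" unfolding N_def by (intro Delta2_1_mmul M Delta2_madj)
  have det: "mdet M = 1" using M by (simp add: Delta2_def)
  have NM: "mmul N M = M'" by (simp add: N_def mmul_assoc mmul_madj[OF det])
  have "vmod 4 (vact (0, 1) N) = vmod 4 (vact (vact (0, 1) M) (madj M))"
    unfolding N_def vact_mmul by (rule vmod_vact_cong[OF M(3)[symmetric]])
  also have "vact (vact (0, 1) M) (madj M) = (0, 1)"
    by (simp only: vact_mmul[symmetric] mmul_madj[OF det] vact_1)
  finally have v: "vmod 4 (vact (0, 1) N) = vmod 4 (0, 1)" .
  obtain a b c d where Nf: "N = (a, b, c, d)" by (cases N)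
  have c: "16 dvd c" and d: "d mod 16 = 1" using v by (simp_all add: Nf vmod_def mod_eq_0_iff_dvd)
  have "d mod 8 = 1" using d by presburger
  then have "chi8 d = 1" by (simp add: chi8_def)
  then show ?thesis using psi_slash_mmul[OF N[unfolded Nf] c M(1) t, of w] NM by (simp only: Nf) simp
qed

lemma psi_family_eq:
  assumes M: "M \<in> Delta2 1" "vmod 4 (vact (0, 1) M) = vmod 4 v" and t: "t \<in> uhp"
  shows "psi_family w v t = psi (mob M t) ^ w / jfac M t ^ w"
proof -
  define L where "L = (SOME M. M \<in> Delta2 1 \<and> vmod 4 (vact (0, 1) M) = vmod 4 v)"
  have "M \<in> Delta2 1 \<and> vmod 4 (vact (0, 1) M) = vmod 4 v" using M by simp
  then have L: "L \<in> Delta2 1 \<and> vmod 4 (vact (0, 1) L) = vmod 4 v" unfolding L_def by (rule someI)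
  have "psi_family w v t = psi (mob L t) ^ w / jfac L t ^ w"
    using M unfolding psi_family_def L_def[symmetric] Let_def by auto
  also have "\<dots> = psi (mob M t) ^ w / jfac M t ^ w"
    by (rule psi_slash_cong) (use L M t in auto)
  finally show ?thesis .
qed

lemma psi_family_eq_0:
  assumes "\<not> (\<exists>M\<in>Delta2 1. vmod 4 (vact (0, 1) M) = vmod 4 v)"
  shows "psi_family w v t = 0"
  unfolding psi_family_def by (simp only: assms if_False)

lemma vmod_scale: "vmod s v = vmod s v' \<Longrightarrow> vmod s (u * fst v, u * snd v) = vmod s (u * fst v', u * snd v')"
  by (simp add: vmod_def) (metis mod_mult_right_eq)

text \<open>A matrix with bottom row (16, u) multiplies bottom rows by u modulo 16. Inverting u
  modulo 32 rather than 16 makes the upper right entry even.\<close>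

lemma ex_diamond:
  assumes u: "odd u"
  obtains a b where "(a, b, 16, u) \<in> Delta2 1"
proof -
  have "coprime u 2" using u by simp
  then have "coprime u (2 ^ 5)" by (simp only: coprime_power_right_iff simp_thms)
  then obtain a where "[u * a = 1] (mod 2 ^ 5)" using coprime_iff_invertible_int by blast
  then have "32 dvd a * u - 1" by (simp add: cong_iff_dvd_diff mult.commute)
  then obtain b where b: "a * u - 1 = 32 * b" by (elim dvdE)
  have "a * u = 32 * b + 1" using b by simp
  moreover from this have "odd (a * u)" by presburger
  then have "odd a" by simp
  ultimately have "(a, 2 * b, 16, u) \<in> Delta2 1" using u by (simp add: Delta2_def)
  then show ?thesis by (rule that)
qed

lemma psi_family_reachable_scale:
  assumes u: "odd u" and M: "M \<in> Delta2 1" "vmod 4 (vact (0, 1) M) = vmod 4 v"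
    and N: "(a, b, 16, u) \<in> Delta2 1"
  shows "vmod 4 (vact (0, 1) (mmul (a, b, 16, u) M)) = vmod 4 (u * fst v, u * snd v)"
proof -
  obtain a' b' c d where Mf: "M = (a', b', c, d)" by (cases M)
  have "vmod 4 (vact (0, 1) (mmul (a, b, 16, u) M)) = vmod 4 (u * fst (c, d), u * snd (c, d))"
    by (simp add: Mf vmod_def)
  also have "\<dots> = vmod 4 (u * fst v, u * snd v)"
    by (rule vmod_scale) (use M(2) in \<open>simp add: Mf\<close>)
  finally show ?thesis .
qed

lemma psi_family_scale:
  assumes u: "odd u" and t: "t \<in> uhp"
  shows "psi_family w (u * fst v, u * snd v) t = of_int (chi8 u) ^ w * psi_family w v t"
proof (cases "\<exists>M\<in>Delta2 1. vmod 4 (vact (0, 1) M) = vmod 4 v")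
  case True
  then obtain M where M: "M \<in> Delta2 1" "vmod 4 (vact (0, 1) M) = vmod 4 v" by (elim bexE)
  obtain a b where N: "(a, b, 16, u) \<in> Delta2 1" using ex_diamond[OF u] .
  have "psi_family w (u * fst v, u * snd v) t =
      psi (mob (mmul (a, b, 16, u) M) t) ^ w / jfac (mmul (a, b, 16, u) M) t ^ w"
    by (rule psi_family_eq[OF Delta2_1_mmul[OF N M(1)] psi_family_reachable_scale[OF u M N] t])
  also have "\<dots> = of_int (chi8 u) ^ w * (psi (mob M t) ^ w / jfac M t ^ w)"
    by (rule psi_slash_mmul[OF N _ M(1) t]) simp
  finally show ?thesis by (simp only: psi_family_eq[OF M t])
next
  case False
  \<comment> \<open>If the scaled row were reached, scaling it back by an inverse a of u modulo 16
    would reach v.\<close>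
  have *: "\<not> (\<exists>M\<in>Delta2 1. vmod 4 (vact (0, 1) M) = vmod 4 (u * fst v, u * snd v))"
  proof
    assume "\<exists>M\<in>Delta2 1. vmod 4 (vact (0, 1) M) = vmod 4 (u * fst v, u * snd v)"
    then obtain M where M: "M \<in> Delta2 1" "vmod 4 (vact (0, 1) M) = vmod 4 (u * fst v, u * snd v)" by (elim bexE)
    obtain a b where N: "(a, b, 16, u) \<in> Delta2 1" using ex_diamond[OF u] .
    have au: "a * u - b * 16 = 1" and a: "odd a" using N by (auto simp: Delta2_def)
    obtain x y where N': "(x, y, 16, a) \<in> Delta2 1" using ex_diamond[OF a] .
    have au1: "(a * u) mod 16 = 1"
    proof -
      have "a * u = 1 + 16 * b" using au by simp
      then show ?thesis by simp
    qed
    have m: "(a * (u * z)) mod 16 = z mod 16" for z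
    proof -
      have "(a * (u * z)) mod 16 = ((a * u) mod 16 * z) mod 16" by (simp only: mod_mult_left_eq mult.assoc)
      then show ?thesis by (simp add: au1)
    qed
    have "vmod 4 (vact (0, 1) (mmul (x, y, 16, a) M)) = vmod 4 (a * (u * fst v), a * (u * snd v))"
      using psi_family_reachable_scale[OF a M N'] by simp
    also have "\<dots> = vmod 4 v" by (simp add: vmod_def m)
    finally show False using False Delta2_1_mmul[OF N' M(1)] by blast
  qed
  show ?thesis unfolding psi_family_eq_0[OF False] psi_family_eq_0[OF *] by simp
qed

lemma modular_family_psi_family: "modular_family 4 w (\<lambda>u. of_int (chi8 u) ^ w) (psi_family w)"
  unfolding modular_family_def
proof (intro conjI allI ballI impI)
  show "periodic 4 (psi_family w)"
    unfolding periodic_def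
  proof (intro allI impI)
    fix v v' assume eq: "vmod 4 v = vmod 4 v'"
    show "psi_family w v = psi_family w v'"
      by (rule ext) (simp only: psi_family_def eq)
  qed
next
  fix v
  have "psi_family w v holomorphic_on uhp \<and> moderate (psi_family w v)"
  proof (cases "\<exists>M\<in>Delta2 1. vmod 4 (vact (0, 1) M) = vmod 4 v")
    case True
    then obtain M where M: "M \<in> Delta2 1" "vmod 4 (vact (0, 1) M) = vmod 4 v" by (elim bexE)
    have det: "mdet M = 1" using M by (simp add: Delta2_def)
    define F where "F t = psi (mob M t) ^ w * inverse (jfac M t) ^ w" for t
    have eq: "psi_family w v t = F t" if "t \<in> uhp" for t
      unfolding F_def psi_family_eq[OF M that] by (simp add: divide_inverse power_inverse)
    have mobh: "mob M holomorphic_on uhp"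
      using has_field_derivative_mob[of _ M] det
      by (intro holomorphic_onI) (auto simp: field_differentiable_def intro: has_field_derivative_at_within)
    have "(psi \<circ> mob M) holomorphic_on uhp"
      by (rule holomorphic_on_compose_gen[OF mobh holomorphic_psi]) (use det in \<open>auto intro!: mob_in_uhp\<close>)
    moreover have "jfac M holomorphic_on uhp"
    proof (cases M)
      case (fields a b c d)
      then have "jfac M = (\<lambda>t. of_int c * t + of_int d)" by (simp add: fun_eq_iff)
      then show ?thesis by (auto intro!: holomorphic_intros)
    qed
    ultimately have "F holomorphic_on uhp"
      unfolding F_def o_def using jfac_Delta2_nonzero[OF M(1)] by (intro holomorphic_intros) auto
    then have "psi_family w v holomorphic_on uhp"
      by (rule holomorphic_transform) (simp only: eq)
    moreover have "moderate F"
      unfolding F_def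
      by (intro moderate_mult moderate_power moderate_mob moderate_psi moderate_inverse_jfac) (use det in auto)
    then have "moderate (psi_family w v)" using moderate_cong[OF eq] by simp
    ultimately show ?thesis by simp
  next
    case False
    then have "psi_family w v = (\<lambda>t. 0)" by (intro ext psi_family_eq_0)
    then show ?thesis by (auto intro: moderate_const)
  qed
  then show "psi_family w v holomorphic_on uhp" "moderate (psi_family w v)" by simp_all
next
  fix M v t assume M: "M \<in> Delta2 1" and t: "t \<in> uhp"
  show "psi_family w v (mob M t) = jfac M t ^ w * psi_family w (vact v M) t"
  proof (cases "\<exists>L\<in>Delta2 1. vmod 4 (vact (0, 1) L) = vmod 4 v")
    case True
    then obtain L where L: "L \<in> Delta2 1" "vmod 4 (vact (0, 1) L) = vmod 4 v" by (elim bexE)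
    note mm = mob_mmul_Delta2[OF L(1) M t]
    have LM: "vmod 4 (vact (0, 1) (mmul L M)) = vmod 4 (vact v M)"
      unfolding vact_mmul by (rule vmod_vact_cong[OF L(2)])
    show ?thesis
      unfolding psi_family_eq[OF L mm(3)] psi_family_eq[OF Delta2_1_mmul[OF L(1) M] LM t] mm(1,2) power_mult_distrib
      using jfac_Delta2_nonzero[OF M t] by simp
  next
    case False
    have *: "\<not> (\<exists>L\<in>Delta2 1. vmod 4 (vact (0, 1) L) = vmod 4 (vact v M))"
    proof
      assume "\<exists>L\<in>Delta2 1. vmod 4 (vact (0, 1) L) = vmod 4 (vact v M)"
      then obtain L where L: "L \<in> Delta2 1" "vmod 4 (vact (0, 1) L) = vmod 4 (vact v M)" by (elim bexE)
      have det: "mdet M = 1" using M by (simp add: Delta2_def)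
      have "vmod 4 (vact (0, 1) (mmul L (madj M))) = vmod 4 (vact (vact v M) (madj M))"
        unfolding vact_mmul by (rule vmod_vact_cong[OF L(2)])
      also have "vact (vact v M) (madj M) = v"
        by (simp only: vact_mmul[symmetric] mmul_madj[OF det] vact_1)
      finally show False using False Delta2_1_mmul[OF L(1) Delta2_madj[OF M]] by blast
    qed
    show ?thesis unfolding psi_family_eq_0[OF False] psi_family_eq_0[OF *] by simp
  qed
next
  fix u :: int and v t assume "t \<in> uhp" "odd u"
  then show "psi_family w (u * fst v, u * snd v) t = of_int (chi8 u) ^ w * psi_family w v t"
    by (intro psi_family_scale)
qed

lemma psi_family_0_1: "t \<in> uhp \<Longrightarrow> psi_family w (0, 1) t = psi t ^ w"
  using psi_family_eq[of "(1, 0, 0, 1)" "(0, 1)" t w] by (simp add: Delta2_def)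

subsection \<open>Hecke operators on coefficient sequences\<close>

text \<open>The classical action of T_p on q-expansions of weight w and character X; it visibly
  preserves integrality.\<close>

definition coeff_hecke :: "nat \<Rightarrow> (int \<Rightarrow> int) \<Rightarrow> nat \<Rightarrow> (nat \<Rightarrow> int) \<Rightarrow> nat \<Rightarrow> int" where
  "coeff_hecke w X p a n = a (p * n) + X (int p) * int p ^ (w - 1) * (if p dvd n then a (n div p) else 0)"

lemma nome_surj:
  assumes "z \<noteq> 0" "cmod z < 1"
  obtains t where "t \<in> uhp" "nome t = z"
proof
  define t where "t = - \<i> * Ln z / of_real pi"
  have "of_real pi * \<i> * t = Ln z" by (simp add: t_def)
  then show "nome t = z" using assms by (simp add: nome_def)
  have "Im t = - ln (cmod z) / pi" using assms by (simp add: t_def)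
  then show "t \<in> uhp" using assms by (simp add: uhp_def divide_neg_pos)
qed

text \<open>The nome takes every nonzero value in the unit disc, so this is uniqueness of power
  series.\<close>

lemma nome_series_eq_0:
  fixes c :: "nat \<Rightarrow> complex"
  assumes c: "\<And>t. t \<in> uhp \<Longrightarrow> (\<lambda>n. c n * nome t ^ n) sums 0"
  shows "c n = 0"
proof -
  have s: "(\<lambda>n. c n * z ^ n) sums 0" if "z \<noteq> 0" "norm z < 1" for z
    using nome_surj[OF that] c by metis
  have "((\<lambda>z::complex. 0) \<longlongrightarrow> c 0) (at 0)"
    by (rule powser_limit_0_strong[of 1]) (use s in auto)
  then have c0: "c 0 = 0" using tendsto_const tendsto_unique[OF trivial_limit_at] by metis
  have s': "(\<lambda>n. c n * (z - 0) ^ n) sums 0" if "norm (z - 0) < 1" for z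
  proof (cases "z = 0")
    case True
    have "(\<lambda>n. c n * 0 ^ n) sums c 0" by (rule powser_sums_zero)
    then show ?thesis using c0 True by simp
  qed (use s that in auto)
  show ?thesis
  proof (rule ccontr)
    assume nz: "c n \<noteq> 0"
    then have "n > 0" using c0 by (cases n) auto
    obtain r where r: "r > 0" "\<And>z. z \<in> cball 0 r - {0::complex} \<Longrightarrow> (0::complex) \<noteq> 0"
      by (rule powser_0_nonzero[of 1 0 c "\<lambda>z. 0" n]) (use s' nz \<open>n > 0\<close> in auto)
    have "of_real r \<in> cball 0 r - {0::complex}" using r(1) by simp
    from r(2)[OF this] show False by simp
  qed
qed

lemma sum_nome_roots:
  assumes p: "p > 0"
  shows "(\<Sum>k<p. nome (of_nat (2 * k) / of_nat p) ^ n) = (if p dvd n then of_nat p else 0)"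
proof -
  define z where "z = nome (of_nat (2 * n) / of_nat p)"
  have zk: "nome (of_nat (2 * k) / of_nat p) ^ n = z ^ k" for k
    unfolding z_def by (simp flip: nome_of_nat_mult add: mult_ac)
  have zp: "z ^ p = 1"
  proof -
    have "z ^ p = nome (of_nat n * 2)" using p unfolding z_def by (simp flip: nome_of_nat_mult add: mult_ac)
    then show ?thesis by (simp add: nome_of_nat_mult nome_2)
  qed
  have z1: "z = 1 \<longleftrightarrow> p dvd n"
  proof
    assume "z = 1"
    then have "exp (of_real pi * \<i> * (of_nat (2 * n) / of_nat p)) = (1::complex)" by (simp add: z_def nome_def)
    then obtain j :: int where "pi * (2 * real n / real p) = of_int (2 * j) * pi" unfolding exp_eq_1 by auto
    then have "real n = of_int j * real p" using p by (simp add: field_simps)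
    then have "int n = j * int p" by (metis of_int_eq_iff of_int_mult of_int_of_nat_eq)
    then show "p dvd n" by (metis dvd_triv_right int_dvd_int_iff)
  next
    assume "p dvd n"
    then obtain j where "n = p * j" by (elim dvdE)
    then have "of_nat (2 * n) / of_nat p = of_nat j * (2::complex)" using p by simp
    then show "z = 1" by (simp add: z_def nome_of_nat_mult nome_2)
  qed
  have "(\<Sum>k<p. z ^ k) = (if p dvd n then of_nat p else 0)"
  proof (cases "z = 1")
    case True
    then show ?thesis using z1 by simp
  next
    case False
    then have "(\<Sum>k<p. z ^ k) = (z ^ p - 1) / (z - 1)" by (rule geometric_sum)
    then show ?thesis using False z1 zp by simp
  qed
  then show ?thesis by (simp only: zk)
qed

text \<open>The adjugates of the representatives with first column (1, 0) fix the row (0, 1), while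
  that of diag(p, 1) sends it to (0, p), where the scalar p contributes the character.\<close>

lemma hecke_0_1:
  assumes p: "prime p" "odd p" and t: "t \<in> uhp" and w: "w > 0"
    and g: "modular_family s w (\<lambda>u. of_int (X u)) g"
  shows "hecke w p g (0, 1) t = of_nat p ^ (w - 1) * of_int (X (int p)) * g (0, 1) (of_nat p * t) +
    (\<Sum>k<p. g (0, 1) (t / of_nat p + of_nat (2 * k) / of_nat p)) / of_nat p"
proof -
  have p0: "p > 0" using p(1) by (rule prime_gt_0_nat)
  define F :: "nat \<Rightarrow> mat2" where "F = (\<lambda>k. (1, 2 * int k, 0, int p))"
  define H where "H h = g (vact (0, 1) (madj h)) (mob h t) / jfac h t ^ w" for h
  have inj: "inj_on F {..<p}" by (auto simp: F_def inj_on_def)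
  have notin: "(int p, 0, 0, 1) \<notin> F ` {..<p}" using prime_gt_1_nat[OF p(1)] by (auto simp: F_def)
  have "hreps p = insert (int p, 0, 0, 1) (F ` {..<p})" by (simp only: hreps_def F_def)
  then have "(\<Sum>h\<in>hreps p. H h) = H (int p, 0, 0, 1) + (\<Sum>k<p. H (F k))"
    using notin by (simp add: sum.reindex[OF inj])
  also have "H (int p, 0, 0, 1) = of_int (X (int p)) * g (0, 1) (of_nat p * t)"
  proof -
    have pt: "of_nat p * t \<in> uhp" using uhp_scale[OF t, of "real p"] p0 by simp
    have odd: "odd (int p)" using p(2) by simp
    show ?thesis using modular_familyD(5)[OF g odd pt, of "(0, 1)"] by (simp add: H_def)
  qed
  also have "(\<Sum>k<p. H (F k)) = (\<Sum>k<p. g (0, 1) (t / of_nat p + of_nat (2 * k) / of_nat p)) / of_nat p ^ w"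
    by (simp add: H_def F_def sum_divide_distrib add_divide_distrib)
  finally have "hecke w p g (0, 1) t = of_nat p ^ (w - 1) * (of_int (X (int p)) * g (0, 1) (of_nat p * t) +
     (\<Sum>k<p. g (0, 1) (t / of_nat p + of_nat (2 * k) / of_nat p)) / of_nat p ^ w)"
    unfolding hecke_def H_def by simp
  moreover have "of_nat p ^ (w - 1) * (x / of_nat p ^ w) = x / of_nat p" for x :: complex
    using w p0 by (cases w) auto
  ultimately show ?thesis by (simp only: distrib_left mult.assoc)
qed

lemma hecke_sums:
  assumes p: "prime p" "odd p" and w: "w > 0" and g: "modular_family s w (\<lambda>u. of_int (X u)) g"
    and a: "\<And>t. t \<in> uhp \<Longrightarrow> (\<lambda>n. of_int (a n) * nome t ^ n) sums g (0, 1) t" and t: "t \<in> uhp"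
  shows "(\<lambda>n. of_int (coeff_hecke w X p a n) * nome t ^ n) sums hecke w p g (0, 1) t"
proof -
  have p0: "p > 0" using p(1) by (rule prime_gt_0_nat)
  have sm: "strict_mono (\<lambda>n::nat. p * n)" using p0 by (auto simp: strict_mono_def)
  have pt: "of_nat p * t \<in> uhp" using uhp_scale[OF t, of "real p"] p0 by simp
  have 1: "(\<lambda>n. of_int (if p dvd n then a (n div p) else 0) * nome t ^ n) sums g (0, 1) (of_nat p * t)"
  proof -
    define f where "f n = of_int (if p dvd n then a (n div p) else 0) * nome t ^ n" for n
    have "f (p * n) = of_int (a n) * nome (of_nat p * t) ^ n" for n
      using p0 by (simp add: f_def power_mult nome_of_nat_mult)
    then have "(\<lambda>n. f (p * n)) sums g (0, 1) (of_nat p * t)" using a[OF pt] by simp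
    moreover have "f n = 0" if "n \<notin> range (\<lambda>n. p * n)" for n using that by (auto simp: f_def)
    ultimately have "f sums g (0, 1) (of_nat p * t)" using sums_mono_reindex[OF sm, of f] by blast
    then show ?thesis by (simp add: f_def[abs_def])
  qed
  have 2: "(\<lambda>n. of_int (a (p * n)) * nome t ^ n) sums
     ((\<Sum>k<p. g (0, 1) (t / of_nat p + of_nat (2 * k) / of_nat p)) / of_nat p)"
  proof -
    define f where "f n = (if p dvd n then of_int (a n) * nome (t / of_nat p) ^ n else 0)" for n
    have "t / of_nat p + of_nat (2 * k) / of_nat p \<in> uhp" for k
      using t p0 by (simp add: uhp_def)
    then have "(\<lambda>n. \<Sum>k<p. of_int (a n) * nome (t / of_nat p + of_nat (2 * k) / of_nat p) ^ n) sums
       (\<Sum>k<p. g (0, 1) (t / of_nat p + of_nat (2 * k) / of_nat p))"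
      by (intro sums_sum a)
    moreover have "(\<Sum>k<p. of_int (a n) * nome (t / of_nat p + of_nat (2 * k) / of_nat p) ^ n) = of_nat p * f n" for n
    proof -
      have "(\<Sum>k<p. of_int (a n) * nome (t / of_nat p + of_nat (2 * k) / of_nat p) ^ n) =
          of_int (a n) * nome (t / of_nat p) ^ n * (\<Sum>k<p. nome (of_nat (2 * k) / of_nat p) ^ n)"
        unfolding sum_distrib_left by (intro sum.cong refl) (simp only: nome_add power_mult_distrib mult.assoc)
      then show ?thesis unfolding sum_nome_roots[OF p0] by (simp add: f_def)
    qed
    ultimately have "(\<lambda>n. of_nat p * f n) sums (\<Sum>k<p. g (0, 1) (t / of_nat p + of_nat (2 * k) / of_nat p))"
      by (simp only:)
    from sums_divide[OF this, of "of_nat p"]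
    have "f sums ((\<Sum>k<p. g (0, 1) (t / of_nat p + of_nat (2 * k) / of_nat p)) / of_nat p)"
      using p0 by simp
    moreover have "f n = 0" if "n \<notin> range (\<lambda>n. p * n)" for n using that by (auto simp: f_def)
    ultimately have "(\<lambda>n. f (p * n)) sums ((\<Sum>k<p. g (0, 1) (t / of_nat p + of_nat (2 * k) / of_nat p)) / of_nat p)"
      using sums_mono_reindex[OF sm, of f] by blast
    moreover have "f (p * n) = of_int (a (p * n)) * nome t ^ n" for n
    proof -
      have "nome (t / of_nat p) ^ (p * n) = nome (of_nat p * (t / of_nat p)) ^ n"
        by (simp only: nome_of_nat_mult power_mult)
      then show ?thesis using p0 by (simp add: f_def)
    qed
    ultimately show ?thesis by simp
  qed
  have "(\<lambda>n. of_nat p ^ (w - 1) * of_int (X (int p)) * (of_int (if p dvd n then a (n div p) else 0) * nome t ^ n) +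
     of_int (a (p * n)) * nome t ^ n) sums hecke w p g (0, 1) t"
    unfolding hecke_0_1[OF p t w g] by (intro sums_add sums_mult 1 2)
  moreover have "of_nat p ^ (w - 1) * of_int (X (int p)) * (of_int (if p dvd n then a (n div p) else 0) * nome t ^ n) +
     of_int (a (p * n)) * nome t ^ n = of_int (coeff_hecke w X p a n) * nome t ^ n" for n
    by (simp add: coeff_hecke_def algebra_simps)
  ultimately show ?thesis by (simp only:)
qed

lemma coeff_hecke_comm:
  assumes "prime p" "prime q"
  shows "coeff_hecke w X p (coeff_hecke w X q a) = coeff_hecke w X q (coeff_hecke w X p a)"
proof (cases "p = q")
  case False
  have p0: "p > 0" "q > 0" using assms by (simp_all add: prime_gt_0_nat)
  have cop: "coprime p q" using primes_coprime[OF assms False] .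
  show ?thesis
  proof
    fix n
    have d: "q dvd p * n \<longleftrightarrow> q dvd n" "p dvd q * n \<longleftrightarrow> p dvd n"
      using cop by (simp_all add: coprime_dvd_mult_right_iff coprime_commute)
    have e: "q dvd n div p \<longleftrightarrow> q dvd n" if pn: "p dvd n"
    proof -
      obtain r where r: "n = p * r" using pn by (elim dvdE)
      show ?thesis using p0 cop unfolding r by (simp add: coprime_dvd_mult_right_iff coprime_commute)
    qed
    have e': "p dvd n div q \<longleftrightarrow> p dvd n" if pn: "q dvd n"
    proof -
      obtain r where r: "n = q * r" using pn by (elim dvdE)
      show ?thesis using p0 cop unfolding r by (simp add: coprime_dvd_mult_right_iff)
    qed
    have dd: "n div p div q = n div q div p" by (simp add: div_mult2_eq[symmetric] mult.commute)
    have m: "p * n div q = p * (n div q)" if "q dvd n" using that by (simp add: div_mult_swap)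
    have m': "q * n div p = q * (n div p)" if "p dvd n" using that by (simp add: div_mult_swap)
    show "coeff_hecke w X p (coeff_hecke w X q a) n = coeff_hecke w X q (coeff_hecke w X p a) n"
      by (cases "p dvd n"; cases "q dvd n")
         (simp_all add: coeff_hecke_def d e e' dd m m' d[unfolded mult.commute[of _ n]]
           m[unfolded mult.commute[of _ n]] m'[unfolded mult.commute[of _ n]] algebra_simps)
  qed
qed simp

lemma coeff_hecke_exact:
  assumes "\<not> p dvd n"
  shows "coeff_hecke w X p a n = a (p * n)"
  using assms by (simp add: coeff_hecke_def)

lemma prime_dvd_prod_listE:
  assumes "prime p" "p dvd prod_list xs"
  shows "\<exists>x\<in>set xs. p dvd (x :: nat)"
  using assms(2)
proof (induction xs)
  case Nil
  then show ?case using assms(1) by simp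
next
  case (Cons x xs)
  then show ?case using assms(1) by (auto simp: prime_dvd_mult_iff)
qed

lemma prod_dvd_of_primes:
  fixes n :: nat
  assumes "finite S" "\<And>p. p \<in> S \<Longrightarrow> prime p" "\<And>p. p \<in> S \<Longrightarrow> p dvd n"
  shows "\<Prod>S dvd n"
  using assms
proof (induction S rule: finite_induct)
  case (insert p S)
  have "coprime p (\<Prod>S)"
  proof (rule prod_coprime_right)
    fix q assume "q \<in> S"
    then show "coprime p q" using insert by (intro primes_coprime) auto
  qed
  moreover have "p dvd n" "\<Prod>S dvd n" using insert by simp_all
  ultimately have "p * \<Prod>S dvd n" by (simp add: divides_mult)
  then show ?case using insert by simp
qed simp

text \<open>Each p of the list divides neither n nor the other primes of the list, so at every step
  T_p only replaces the index by its p-fold.\<close>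

lemma fold_coeff_hecke:
  assumes "distinct ps" "\<And>p. p \<in> set ps \<Longrightarrow> prime p" "\<And>p. p \<in> set ps \<Longrightarrow> \<not> p dvd n"
  shows "fold (coeff_hecke w X) ps a n = a (prod_list ps * n)"
  using assms
proof (induction ps arbitrary: a)
  case (Cons p ps)
  have "fold (coeff_hecke w X) (p # ps) a n = coeff_hecke w X p a (prod_list ps * n)"
    using Cons by simp
  also have "\<not> p dvd prod_list ps * n"
  proof
    assume "p dvd prod_list ps * n"
    moreover have p: "prime p" using Cons.prems by simp
    ultimately have "p dvd prod_list ps" using Cons.prems(3)[of p] by (simp add: prime_dvd_mult_iff)
    then obtain q where q: "q \<in> set ps" "p dvd q" using prime_dvd_prod_listE[OF p] by blast
    then have "p = q" using p Cons.prems(2)[of q] by (simp add: primes_dvd_imp_eq)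
    then show False using q Cons.prems(1) by simp
  qed
  then have "coeff_hecke w X p a (prod_list ps * n) = a (p * (prod_list ps * n))" by (rule coeff_hecke_exact)
  finally show ?case by (simp add: mult.assoc)
qed simp

subsection \<open>Divisibility of the coefficients\<close>

text \<open>Integrality is demanded of the component (0, 1) only; the remaining components are
  carried along for the periods.\<close>

definition qexp_space :: "nat \<Rightarrow> nat \<Rightarrow> (int \<Rightarrow> int) \<Rightarrow> (nat \<Rightarrow> int) set" where
  "qexp_space s w X = {a. \<exists>g. modular_family s w (\<lambda>u. of_int (X u)) g \<and>
     (\<forall>t\<in>uhp. (\<lambda>n. of_int (a n) * nome t ^ n) sums g (0, 1) t)}"

lemma qexp_spaceE:
  assumes "a \<in> qexp_space s w X"
  obtains g where "modular_family s w (\<lambda>u. of_int (X u)) g"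
    "\<forall>t\<in>uhp. (\<lambda>n. of_int (a n) * nome t ^ n) sums g (0, 1) t"
  using assms unfolding qexp_space_def mem_Collect_eq by (elim exE conjE)

lemma qexp_spaceI:
  assumes "modular_family s w (\<lambda>u. of_int (X u)) g"
    "\<And>t. t \<in> uhp \<Longrightarrow> (\<lambda>n. of_int (a n) * nome t ^ n) sums g (0, 1) t"
  shows "a \<in> qexp_space s w X"
  unfolding qexp_space_def by (rule CollectI, rule exI[of _ g]) (intro conjI ballI assms)

lemma qexp_space_choice:
  assumes "\<And>i. i \<in> I \<Longrightarrow> a i \<in> qexp_space s w X"
  obtains g where "\<forall>i\<in>I. modular_family s w (\<lambda>u. of_int (X u)) (g i)"
    "\<forall>i\<in>I. \<forall>t\<in>uhp. (\<lambda>n. of_int (a i n) * nome t ^ n) sums g i (0, 1) t"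
proof -
  have "\<forall>i\<in>I. \<exists>g. modular_family s w (\<lambda>u. of_int (X u)) g \<and>
     (\<forall>t\<in>uhp. (\<lambda>n. of_int (a i n) * nome t ^ n) sums g (0, 1) t)"
  proof
    fix i assume "i \<in> I"
    then show "\<exists>g. modular_family s w (\<lambda>u. of_int (X u)) g \<and>
      (\<forall>t\<in>uhp. (\<lambda>n. of_int (a i n) * nome t ^ n) sums g (0, 1) t)"
      using assms[of i] unfolding qexp_space_def mem_Collect_eq by simp
  qed
  from bchoice[OF this] obtain g where "\<forall>i\<in>I. modular_family s w (\<lambda>u. of_int (X u)) (g i) \<and>
     (\<forall>t\<in>uhp. (\<lambda>n. of_int (a i n) * nome t ^ n) sums g i (0, 1) t)" by (elim exE)
  then show ?thesis by (intro that) auto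
qed

lemma qexp_space_sum:
  fixes c :: "'i \<Rightarrow> int"
  assumes "\<And>i. i \<in> I \<Longrightarrow> a i \<in> qexp_space s w X"
  shows "(\<lambda>n. \<Sum>i\<in>I. c i * a i n) \<in> qexp_space s w X"
proof -
  obtain g where g: "\<forall>i\<in>I. modular_family s w (\<lambda>u. of_int (X u)) (g i)"
    "\<forall>i\<in>I. \<forall>t\<in>uhp. (\<lambda>n. of_int (a i n) * nome t ^ n) sums g i (0, 1) t"
    using qexp_space_choice[where a = a, OF assms] .
  show ?thesis
  proof (rule qexp_spaceI)
    show "modular_family s w (\<lambda>u. of_int (X u)) (\<lambda>v t. \<Sum>i\<in>I. of_int (c i) * g i v t)"
      by (rule modular_family_sum[OF bspec[OF g(1)]])
    fix t assume t: "t \<in> uhp"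
    have "(\<lambda>n. \<Sum>i\<in>I. of_int (c i) * (of_int (a i n) * nome t ^ n)) sums (\<Sum>i\<in>I. of_int (c i) * g i (0, 1) t)"
      by (intro sums_sum sums_mult bspec[OF bspec[OF g(2)] t])
    moreover have "(\<Sum>i\<in>I. of_int (c i) * (of_int (a i n) * nome t ^ n)) = of_int (\<Sum>i\<in>I. c i * a i n) * nome t ^ n" for n
      by (simp add: sum_distrib_right mult.assoc)
    ultimately show "(\<lambda>n. of_int (\<Sum>i\<in>I. c i * a i n) * nome t ^ n) sums (\<Sum>i\<in>I. of_int (c i) * g i (0, 1) t)"
      by (simp only:)
  qed
qed

lemma qexp_space_hecke:
  assumes p: "prime p" "odd p" and w: "w > 0" and a: "a \<in> qexp_space s w X"
  shows "coeff_hecke w X p a \<in> qexp_space s w X"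
proof -
  obtain g where g: "modular_family s w (\<lambda>u. of_int (X u)) g"
    "\<forall>t\<in>uhp. (\<lambda>n. of_int (a n) * nome t ^ n) sums g (0, 1) t"
    using qexp_spaceE[OF a] .
  show ?thesis
    by (rule qexp_spaceI[OF modular_family_hecke[OF p g(1) w] hecke_sums[OF p w g(1) bspec[OF g(2)]]])
qed

lemma hecke_power_sums:
  assumes p: "prime p" "odd p" and w: "w > 0" and g: "modular_family s w (\<lambda>u. of_int (X u)) g"
    "\<forall>t\<in>uhp. (\<lambda>n. of_int (a n) * nome t ^ n) sums g (0, 1) t"
  shows "modular_family s w (\<lambda>u. of_int (X u)) ((hecke w p ^^ j) g) \<and>
    (\<forall>t\<in>uhp. (\<lambda>n. of_int ((coeff_hecke w X p ^^ j) a n) * nome t ^ n) sums (hecke w p ^^ j) g (0, 1) t)"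
proof (induction j)
  case 0
  then show ?case unfolding funpow.simps id_apply by (rule conjI[OF g])
next
  case (Suc j)
  note m = conjunct1[OF Suc] and s = conjunct2[OF Suc]
  show ?case
    unfolding funpow.simps o_apply
    by (intro conjI ballI modular_family_hecke[OF p m w] hecke_sums[OF p w m bspec[OF s]])
qed

text \<open>The relation between forms, read at (0, 1) and compared coefficient by coefficient. The
  quotient by 2 is an integer combination of images of a under powers of T_p, so it stays in the
  lattice.\<close>

lemma coeff_hecke_nilpotent_mod_2:
  assumes p: "prime p" "odd p" and m: "m > 0" and a: "a \<in> qexp_space s (m + 2) X"
  shows "\<exists>e. \<exists>b\<in>qexp_space s (m + 2) X. (coeff_hecke (m + 2) X p ^^ e) a = b + b"
proof -
  define w where "w = m + 2"
  have w: "w > 0" by (simp add: w_def)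
  have aw: "a \<in> qexp_space s w X" using a by (simp only: w_def)
  obtain g where g: "modular_family s w (\<lambda>u. of_int (X u)) g"
    "\<forall>t\<in>uhp. (\<lambda>n. of_int (a n) * nome t ^ n) sums g (0, 1) t"
    using qexp_spaceE[OF aw] .
  obtain D L :: nat and c :: "nat \<Rightarrow> int" where c: "\<forall>v. \<forall>t\<in>uhp. ((hecke w p ^^ (D * L)) g) v t =
      2 * (\<Sum>l<D. of_int (c l) * ((hecke w p ^^ (l * L)) g) v t)"
    using hecke_nilpotent_mod_2[OF p g(1)[unfolded w_def] m] unfolding w_def by (elim exE)
  define x where "x j = (coeff_hecke w X p ^^ j) a" for j
  have xs: "(\<lambda>n. of_int (x j n) * nome t ^ n) sums (hecke w p ^^ j) g (0, 1) t" if "t \<in> uhp" for j t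
    unfolding x_def by (rule bspec[OF conjunct2[OF hecke_power_sums[OF p w g]] that])
  have xA: "x j \<in> qexp_space s w X" for j
    unfolding x_def by (induction j) (simp_all add: aw qexp_space_hecke[OF p w])
  define b where "b n = (\<Sum>l<D. c l * x (l * L) n)" for n
  have bA: "b \<in> qexp_space s w X" unfolding b_def[abs_def] by (rule qexp_space_sum[OF xA])
  have "complex_of_int (x (D * L) n - 2 * b n) = 0" for n
  proof (rule nome_series_eq_0)
    fix t assume t: "t \<in> uhp"
    have "(\<lambda>n. of_int (x (D * L) n) * nome t ^ n - 2 * (\<Sum>l<D. of_int (c l) * (of_int (x (l * L) n) * nome t ^ n))) sums
      ((hecke w p ^^ (D * L)) g (0, 1) t - 2 * (\<Sum>l<D. of_int (c l) * (hecke w p ^^ (l * L)) g (0, 1) t))"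
      by (intro sums_diff sums_mult sums_sum xs t)
    moreover have "(hecke w p ^^ (D * L)) g (0, 1) t - 2 * (\<Sum>l<D. of_int (c l) * (hecke w p ^^ (l * L)) g (0, 1) t) = 0"
      using c t by (simp only: diff_self)
    moreover have "of_int (x (D * L) n) * nome t ^ n - 2 * (\<Sum>l<D. of_int (c l) * (of_int (x (l * L) n) * nome t ^ n)) =
       of_int (x (D * L) n - 2 * b n) * nome t ^ n" for n
      by (simp add: b_def left_diff_distrib sum_distrib_right sum_distrib_left mult.assoc)
    ultimately show "(\<lambda>n. of_int (x (D * L) n - 2 * b n) * nome t ^ n) sums 0" by (simp only:)
  qed
  then have "x (D * L) n - 2 * b n = 0" for n by (simp only: of_int_eq_0_iff)
  then have "x (D * L) = b + b" by (simp add: fun_eq_iff eq_diff_eq)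
  then show ?thesis using bA unfolding x_def w_def by blast
qed

text \<open>A linear relation between families gives a complex relation between integer sequences,
  which \<open>ex_even_integer_relation\<close> turns into one modulo 2. D is fixed before the
  sequences are given.\<close>

lemma qexp_space_rank:
  assumes m: "m > 0"
  shows "\<exists>D::nat. \<forall>x. (\<forall>k\<le>D. x k \<in> qexp_space s (m + 2) X) \<longrightarrow>
    (\<exists>J. J \<noteq> {} \<and> J \<subseteq> {..D} \<and> (\<exists>b\<in>qexp_space s (m + 2) X. (\<Sum>k\<in>J. x k) = b + b))"
proof -
  obtain D :: nat where D: "\<forall>g. (\<forall>k\<le>D. modular_family s (m + 2) (\<lambda>u. of_int (X u)) (g k)) \<longrightarrow>
    (\<exists>c::nat \<Rightarrow> complex. (\<exists>k\<le>D. c k \<noteq> 0) \<and> (\<forall>v. \<forall>t\<in>uhp. (\<Sum>k\<le>D. c k * g k v t) = 0))"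
    using modular_family_finite_rank[OF m, of s "\<lambda>u. of_int (X u)"] by (elim exE)
  define w where "w = m + 2"
  show ?thesis unfolding w_def[symmetric]
  proof (intro exI[of _ D] allI impI)
    fix x :: "nat \<Rightarrow> nat \<Rightarrow> int" assume x: "\<forall>k\<le>D. x k \<in> qexp_space s w X"
    then have xk: "x k \<in> qexp_space s w X" if "k \<in> {..D}" for k using that by simp
    obtain g where g: "\<forall>k\<in>{..D}. modular_family s w (\<lambda>u. of_int (X u)) (g k)"
      "\<forall>k\<in>{..D}. \<forall>t\<in>uhp. (\<lambda>n. of_int (x k n) * nome t ^ n) sums g k (0, 1) t"
      using qexp_space_choice[where a = x, OF xk] .
    have "\<forall>k\<le>D. modular_family s (m + 2) (\<lambda>u. of_int (X u)) (g k)"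
      using g(1) unfolding w_def by simp
    then have "\<exists>c::nat \<Rightarrow> complex. (\<exists>k\<le>D. c k \<noteq> 0) \<and> (\<forall>v. \<forall>t\<in>uhp. (\<Sum>k\<le>D. c k * g k v t) = 0)"
      using D by blast
    then obtain c :: "nat \<Rightarrow> complex" and k0 where k0: "k0 \<le> D" "c k0 \<noteq> 0"
      and c: "\<forall>v. \<forall>t\<in>uhp. (\<Sum>k\<le>D. c k * g k v t) = 0" by (elim exE conjE)
    have rel: "(\<Sum>k\<le>D. c k * of_int (x k n)) = 0" for n
    proof (rule nome_series_eq_0[where c = "\<lambda>n. \<Sum>k\<le>D. c k * of_int (x k n)"])
      fix t assume t: "t \<in> uhp"
      have "(\<lambda>n. \<Sum>k\<le>D. c k * (of_int (x k n) * nome t ^ n)) sums (\<Sum>k\<le>D. c k * g k (0, 1) t)"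
        by (intro sums_sum sums_mult bspec[OF bspec[OF g(2)] t])
      moreover have "(\<Sum>k\<le>D. c k * g k (0, 1) t) = 0" using c t by blast
      ultimately show "(\<lambda>n. (\<Sum>k\<le>D. c k * of_int (x k n)) * nome t ^ n) sums 0"
        by (simp only: sum_distrib_right mult.assoc)
    qed
    obtain J d where J: "J \<noteq> {}" "J \<subseteq> {..D}" and d: "\<forall>n. (\<Sum>k\<in>J. x k n) = 2 * (\<Sum>k\<le>D. d k * x k n)"
      using ex_even_integer_relation[where a = x, OF rel k0] by (elim exE conjE)
    define b where "b n = (\<Sum>k\<le>D. d k * x k n)" for n
    have bA: "b \<in> qexp_space s w X"
      unfolding b_def[abs_def] by (rule qexp_space_sum) (use x in simp)
    have "(\<Sum>k\<in>J. x k) n = (\<Sum>k\<in>J. x k n)" for n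
      by (induction J rule: infinite_finite_induct) auto
    then have "(\<Sum>k\<in>J. x k) = b + b" using d by (simp add: fun_eq_iff b_def)
    then show "\<exists>J. J \<noteq> {} \<and> J \<subseteq> {..D} \<and> (\<exists>b\<in>qexp_space s w X. (\<Sum>k\<in>J. x k) = b + b)"
      using J bA by blast
  qed
qed

lemma double_power_apply: "((\<lambda>x. x + x) ^^ k) (b :: nat \<Rightarrow> int) n = 2 ^ k * b n"
  by (induction k) auto

text \<open>The primes give D k operators, whose product sends a to 2^k b. Write n as the product of
  these primes times r; exactness means that none of them divides r, so the r-th coefficient of the
  image is the n-th coefficient of a.\<close>

theorem qexp_divisible_by_power_of_2:
  assumes m: "m > 0" and a: "a \<in> qexp_space s (m + 2) X"
  shows "\<exists>N. \<forall>n. (\<exists>S. finite S \<and> card S = N \<and> (\<forall>p\<in>S. prime p \<and> p > 2 \<and> exact_prime p n)) \<longrightarrow> 2 ^ k dvd a n"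
proof -
  define w where "w = m + 2"
  define A where "A = qexp_space s w X"
  have w: "w > 0" by (simp add: w_def)
  obtain D :: nat where D: "\<forall>x. (\<forall>k\<le>D. x k \<in> A) \<longrightarrow>
    (\<exists>J. J \<noteq> {} \<and> J \<subseteq> {..D} \<and> (\<exists>b\<in>A. (\<Sum>k\<in>J. x k) = b + b))"
    using qexp_space_rank[OF m, of s X] unfolding A_def w_def by (elim exE)
  interpret commuting_operators "coeff_hecke w X" "{p. prime p \<and> odd p}" A D
  proof
    fix p x y assume p: "p \<in> {p::nat. prime p \<and> odd p}"
    show "coeff_hecke w X p (x + y) = coeff_hecke w X p x + coeff_hecke w X p y"
      by (rule ext) (simp add: coeff_hecke_def algebra_simps)
    show "coeff_hecke w X p x \<in> A" if "x \<in> A"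
      using p that unfolding A_def by (intro qexp_space_hecke[OF _ _ w]) auto
    show "\<exists>e. \<exists>b\<in>A. (coeff_hecke w X p ^^ e) x = b + b" if "x \<in> A"
      using coeff_hecke_nilpotent_mod_2[of p m x s X] p m that unfolding A_def w_def by blast
    show "coeff_hecke w X p (coeff_hecke w X q x) = coeff_hecke w X q (coeff_hecke w X p x)"
      if "q \<in> {p. prime p \<and> odd p}" for q
      using p that by (intro coeff_hecke_comm) auto
  next
    have "(\<lambda>n. \<Sum>i\<in>{}. (0 :: int) * undefined i n) \<in> A"
      unfolding A_def by (rule qexp_space_sum) simp
    then show "0 \<in> A" by (simp add: zero_fun_def)
  next
    fix x y assume xy: "x \<in> A" "y \<in> A"
    have "(\<lambda>n. \<Sum>i\<in>{True, False}. (if i then 1 else -1) * (if i then x else y) n) \<in> A"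
      unfolding A_def by (rule qexp_space_sum) (use xy in \<open>auto simp: A_def\<close>)
    then show "x - y \<in> A" by (simp add: fun_diff_def)
  next
    fix x :: "nat \<Rightarrow> nat \<Rightarrow> int" assume "\<And>k. k \<le> D \<Longrightarrow> x k \<in> A"
    then show "\<exists>J. J \<noteq> {} \<and> J \<subseteq> {..D} \<and> (\<exists>b\<in>A. (\<Sum>k\<in>J. x k) = b + b)" using D by blast
  qed
  show ?thesis
  proof (intro exI[of _ "D * k"] allI impI)
    fix n assume "\<exists>S. finite S \<and> card S = D * k \<and> (\<forall>p\<in>S. prime p \<and> p > 2 \<and> exact_prime p n)"
    then obtain S where S: "finite S" "card S = D * k" and Sp: "\<forall>p\<in>S. prime p \<and> p > 2 \<and> exact_prime p n"
      by (elim exE conjE)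
    obtain ps where ps: "set ps = S" "distinct ps" using finite_distinct_list[OF S(1)] by blast
    have len: "length ps = D * k" using ps S distinct_card by metis
    have pr: "prime p" if "p \<in> set ps" for p using Sp ps that by blast
    have sub: "set ps \<subseteq> {p. prime p \<and> odd p}"
      using Sp ps prime_odd_nat by auto
    have "prod_list ps = \<Prod>(set ps)" using prod.distinct_set_conv_list[OF ps(2), of "\<lambda>x. x"] by simp
    also have "\<dots> dvd n"
      by (rule prod_dvd_of_primes) (use Sp ps in \<open>auto simp: exact_prime_def\<close>)
    finally obtain r where r: "n = prod_list ps * r" by (elim dvdE)
    have nd: "\<not> p dvd r" if "p \<in> set ps" for p
    proof
      assume "p dvd r"
      moreover have "p dvd prod_list ps" using that by (rule prod_list_dvd)
      ultimately have "p\<^sup>2 dvd n" unfolding r power2_eq_square by (rule mult_dvd_mono[rotated])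
      then show False using Sp ps that by (auto simp: exact_prime_def)
    qed
    obtain b where "fold (coeff_hecke w X) ps a = ((\<lambda>x. x + x) ^^ k) b"
      using fold_T_double_power[OF sub len, of a] a unfolding A_def w_def by blast
    then have "a n = 2 ^ k * b r"
      using fold_coeff_hecke[OF ps(2) pr nd, of w X a] double_power_apply[of k b r] by (simp add: r)
    then show "2 ^ k dvd a n" by simp
  qed
qed

lemma psi_power_in_qexp_space: "fps_nth (psi_fps ^ w) \<in> qexp_space 4 w (\<lambda>u. chi8 u ^ w)"
proof (rule qexp_spaceI)
  show "modular_family 4 w (\<lambda>u. of_int (chi8 u ^ w)) (psi_family w)"
    using modular_family_psi_family[of w] by simp
  fix t assume t: "t \<in> uhp"
  have "psi_family w (0, 1) t = nome_series (psi_fps ^ w) t"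
    unfolding psi_family_0_1[OF t] nome_series_power[OF psi_conv_radius t] by (simp only: psi_def)
  then show "(\<lambda>n. of_int (fps_nth (psi_fps ^ w) n) * nome t ^ n) sums psi_family w (0, 1) t"
    using nome_series_sums[OF conv_radius_complex_fps_power[OF psi_conv_radius] t] by simp
qed

theorem theorem1p4:
  fixes k :: nat
  assumes "k > 0"
  shows "((\<lambda>X::real. real (card {n::nat. real n \<le> X \<and> [overcubic n = 0] (mod 2 ^ k)}) / X)
           \<longlongrightarrow> 1) at_top"
proof -
  \<comment> \<open>The weight is 2^(k+1) - 1 = m + 2. The exponent k + 1 makes m positive even for
    k = 1; the congruence with the power of \<psi> then holds modulo 2^(k+2), more than is
    asked.\<close>
  define m where "m = (2::nat) ^ Suc k - 3"
  have "(2::nat) ^ Suc k \<ge> 2 ^ 2" using assms by (intro power_increasing) auto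
  then have m: "m > 0" "2 ^ Suc k - 1 = m + 2" by (auto simp: m_def)
  obtain N where N: "\<forall>n. (\<exists>S. finite S \<and> card S = N \<and> (\<forall>p\<in>S. prime p \<and> p > 2 \<and> exact_prime p n)) \<longrightarrow>
      2 ^ k dvd fps_nth (psi_fps ^ (m + 2)) n"
    using qexp_divisible_by_power_of_2[OF m(1) psi_power_in_qexp_space, of k] by (elim exE)
  have "((\<lambda>X. real (card {n. real n \<le> X \<and> n \<in> {n. [overcubic n = 0] (mod 2 ^ k)}}) / X) \<longlongrightarrow> 1) at_top"
  proof (rule density_one_if_many_exact_primes[of N 2])
    fix n assume "\<exists>S. finite S \<and> card S = N \<and> (\<forall>p\<in>S. prime p \<and> p > 2 \<and> exact_prime p n)"
    then have 1: "2 ^ k dvd fps_nth (psi_fps ^ (m + 2)) n" using N by blast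
    have "2 ^ Suc (Suc k) dvd overcubic n - fps_nth (psi_fps ^ (m + 2)) n"
      using overcubic_cong_psi_power[of "Suc k" n] unfolding m(2) .
    then have "2 ^ k dvd overcubic n - fps_nth (psi_fps ^ (m + 2)) n"
      by (rule dvd_trans[rotated]) (intro le_imp_power_dvd, simp)
    then have "2 ^ k dvd overcubic n" using 1 by (metis dvd_add diff_add_cancel)
    then show "n \<in> {n. [overcubic n = 0] (mod 2 ^ k)}" by (simp add: cong_0_iff)
  qed
  then show ?thesis by simp
qed

end
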